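(* Let $T>0$, let $b:[0,T]\times\mathbb{R}^d\to\mathbb{R}^d$ be measurable, and suppose there are nonnegative $C_0,C_1\in L^1([0,T])$ such that for all $t\in[0,T]$ and $x,y\in\mathbb{R}^d$, $|b(t,x)|\le C_0(t)(1+|x|)$ and $(b(t,x)-b(t,y))\cdot(x-y)\ge -C_1(t)|x-y|^2$. Let $1\le p\le\infty$ and suppose that $f\in C([0,T],L^p_{\mathrm{loc}}(\mathbb{R}^d))$ is a distributional solution of $$\partial_tf+\operatorname{div}(b(t,x)f)=0\ \text{ in }(0,T)\times\mathbb{R}^d$$ and $f\ge0$. Then $f(t,x)=f(0,\phi_{0,t}(x))\,J_{0,t}(x)$ for all $t\in[0,T]$ and a.e. $x\in\mathbb{R}^d$.
   Context: Backward Filippov flow: let $\hat b(t,x)$ be the convex hull of all limit points of $b(t,y)$ as $y\to x$. For every $(s,x)$ there is a unique absolutely continuous $[0,s]\ni t\mapsto\phi_{t,s}(x)$ with $\partial_t\phi_{t,s}(x)\in\hat b(t,\phi_{t,s}(x))$ for a.e. $t$ and $\phi_{s,s}(x)=x$; it is Lipschitz in $x$. $J_{t,s}(x)=\det(\nabla_x\phi_{t,s}(x))$ for a.e. $x$, $t\le s$. The right-hand side of the formula is understood to vanish where $J_{0,t}=0$. *)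

theory Defs
  imports "HOL-Analysis.Analysis" "HOL-Probability.Essential_Supremum"
begin

section \<open>The backward Filippov flow\<close>

definition filippov_hull ::
    "(real \<Rightarrow> real^'n \<Rightarrow> real^'n) \<Rightarrow> real \<Rightarrow> real^'n \<Rightarrow> (real^'n) set" where
  "filippov_hull b t x =
     convex hull {v. \<exists>y :: nat \<Rightarrow> real^'n.
       filterlim y (at x) sequentially \<and> (\<lambda>n. b t (y n)) \<longlonglongrightarrow> v}"

text \<open>The finite families of non-overlapping subintervals of \<open>{a..b}\<close> in the usual
  \<open>\<epsilon>\<close>-\<open>\<delta>\<close> definition are given as divisions of arbitrary subsets \<open>S\<close> of \<open>{a..b}\<close>.\<close>

definition abs_continuous_on :: "real \<Rightarrow> real \<Rightarrow> (real \<Rightarrow> 'a::real_normed_vector) \<Rightarrow> bool" where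
  "abs_continuous_on a b g \<longleftrightarrow>
     (\<forall>\<epsilon>>0. \<exists>\<delta>>0. \<forall>D S. D division_of S \<and> S \<subseteq> {a..b} \<and> (\<Sum>k\<in>D. Sup k - Inf k) < \<delta>
        \<longrightarrow> (\<Sum>k\<in>D. norm (g (Sup k) - g (Inf k))) < \<epsilon>)"

text \<open>\<open>\<phi> t s x\<close> stands for \<open>\<phi>\<^sub>t\<^sub>,\<^sub>s(x)\<close>, relevant for \<open>0 \<le> t \<le> s \<le> T\<close>. Under the one-sided Lipschitz
  condition on \<open>b\<close> these requirements determine \<open>\<phi>\<close> uniquely in that range.\<close>

definition backward_filippov_flow ::
    "real \<Rightarrow> (real \<Rightarrow> real^'n \<Rightarrow> real^'n) \<Rightarrow> (real \<Rightarrow> real \<Rightarrow> real^'n \<Rightarrow> real^'n) \<Rightarrow> bool" where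
  "backward_filippov_flow T b \<phi> \<longleftrightarrow>
     (\<forall>s\<in>{0..T}. \<forall>x.
        abs_continuous_on 0 s (\<lambda>t. \<phi> t s x) \<and>
        (AE t in lebesgue_on {0..s}. \<exists>v\<in>filippov_hull b t (\<phi> t s x).
           ((\<lambda>r. \<phi> r s x) has_vector_derivative v) (at t within {0..s})) \<and>
        \<phi> s s x = x)"

text \<open>At the points where \<open>\<phi> t s\<close> is not differentiable (a null set, as the flow is Lipschitz
  in space) the value is irrelevant.\<close>

definition flow_jacobian ::
    "(real \<Rightarrow> real \<Rightarrow> real^'n \<Rightarrow> real^'n) \<Rightarrow> real \<Rightarrow> real \<Rightarrow> real^'n \<Rightarrow> real" where
  "flow_jacobian \<phi> t s x = det (jacobian (\<phi> t s) (at x))"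

section \<open>The space \<open>C([0,T], L\<^sup>p\<^sub>l\<^sub>o\<^sub>c)\<close>\<close>

text \<open>The case distinction on \<open>I\<close> is needed because \<open>enn2real \<infinity> = 0\<close>.\<close>

definition Lp_norm_on :: "ennreal \<Rightarrow> 'a::euclidean_space set \<Rightarrow> ('a \<Rightarrow> real) \<Rightarrow> ennreal" where
  "Lp_norm_on p K g =
     (if p = \<infinity> then esssup (lebesgue_on K) (\<lambda>x. ennreal \<bar>g x\<bar>)
      else let I = (\<integral>\<^sup>+ x. ennreal (\<bar>g x\<bar> powr enn2real p) \<partial>lebesgue_on K)
           in if I = \<infinity> then \<infinity> else ennreal (enn2real I powr (1 / enn2real p)))"

definition Lp_loc :: "ennreal \<Rightarrow> ('a::euclidean_space \<Rightarrow> real) set" where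
  "Lp_loc p = {g. g \<in> borel_measurable lebesgue \<and> (\<forall>K. compact K \<longrightarrow> Lp_norm_on p K g < \<infinity>)}"

definition continuous_into_Lp_loc ::
    "real \<Rightarrow> ennreal \<Rightarrow> (real \<Rightarrow> 'a::euclidean_space \<Rightarrow> real) \<Rightarrow> bool" where
  "continuous_into_Lp_loc T p f \<longleftrightarrow>
     (\<forall>t\<in>{0..T}. f t \<in> Lp_loc p) \<and>
     (\<forall>t\<in>{0..T}. \<forall>K. compact K \<longrightarrow>
        ((\<lambda>s. Lp_norm_on p K (\<lambda>x. f s x - f t x)) \<longlongrightarrow> 0) (at t within {0..T}))"

section \<open>Distributional solutions of the continuity equation\<close>

text \<open>\<open>C_class k g\<close> says that \<open>g\<close> is \<open>k\<close> times continuously differentiable on the whole space.\<close>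

fun C_class :: "nat \<Rightarrow> ('a::euclidean_space \<Rightarrow> real) \<Rightarrow> bool" where
  "C_class 0 g \<longleftrightarrow> continuous_on UNIV g"
| "C_class (Suc k) g \<longleftrightarrow>
     (\<forall>z. g differentiable (at z)) \<and> (\<forall>v. C_class k (\<lambda>z. frechet_derivative g (at z) v))"

definition test_function :: "'a::euclidean_space set \<Rightarrow> ('a \<Rightarrow> real) \<Rightarrow> bool" where
  "test_function U \<psi> \<longleftrightarrow>
     (\<forall>k. C_class k \<psi>) \<and> compact (closure {z. \<psi> z \<noteq> 0}) \<and> closure {z. \<psi> z \<noteq> 0} \<subseteq> U"

text \<open>The two derivatives below are \<open>\<partial>\<^sub>t \<psi>\<close> and \<open>b(t,x) \<bullet> \<nabla>\<^sub>x \<psi>\<close>. The integral is iterated since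
  a family \<open>f\<close> of representatives, chosen separately for each \<open>t\<close>, need not be jointly measurable;
  for a jointly measurable \<open>f\<close> it is the integral over \<open>(0,T)\<close> times the whole space. For \<open>f\<close>
  in \<open>C([0,T], L\<^sup>p\<^sub>l\<^sub>o\<^sub>c)\<close> and \<open>b\<close> measurable with linear growth, both integrals converge absolutely
  (the inner one for almost every \<open>t\<close>), so that the convention giving the value 0 to
  non-integrable functions plays no role.\<close>

definition distributional_solution ::
    "real \<Rightarrow> (real \<Rightarrow> real^'n \<Rightarrow> real^'n) \<Rightarrow> (real \<Rightarrow> real^'n \<Rightarrow> real) \<Rightarrow> bool" where
  "distributional_solution T b f \<longleftrightarrow>
     (\<forall>\<psi> :: real \<times> (real^'n) \<Rightarrow> real. test_function ({0<..<T} \<times> UNIV) \<psi> \<longrightarrow>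
        (LINT t:{0<..<T}|lebesgue. (LINT x|lebesgue.
           f t x * (frechet_derivative \<psi> (at (t, x)) (1, 0)
                    + frechet_derivative \<psi> (at (t, x)) (0, b t x)))) = 0)"

end

theory Submission
  imports Defs "HOL-Probability.Probability" "HOL-Homology.Homology"
begin

text \<open>The main point is that \<open>\<integral> g (\<phi> 0 t x) f t x dx\<close> does not depend on \<open>t\<close> for Lipschitz \<open>g\<close> of bounded
  support. The function \<open>u r = g \<circ> \<phi> 0 r\<close> is transported by the flow, and mollifying it in space gives an
  admissible test function. Over a short time step the error is bounded by differences of \<open>b\<close> at points
  \<open>x\<close> and \<open>x \<plusminus> \<tau> e\<close>: the one-sided Lipschitz condition makes these differences nonnegative up to a small
  error, so that moving the shift onto a cutoff function shows that their integral is \<open>O(\<tau>)\<close>.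
  Uniform integrability of \<open>f\<close> takes care of the missing bound on \<open>f\<close>. Hence the flow pushes \<open>f t\<close> forward
  to \<open>f 0\<close>. Where \<open>J = 0\<close>, the image under the flow is a null set, so \<open>f t\<close> vanishes there. Where
  \<open>J \<noteq> 0\<close>, trajectories cannot merge: a topological degree argument shows that fibres are singletons
  and \<open>J > 0\<close>, and the change of variables formula applies.\<close>

section \<open>Absolutely continuous functions\<close>

text \<open>What survives is a sign: a quantity that is almost nonnegative has an L^1 norm as small
  as its integral, and pairing it with \<open>f\<close> costs a truncation level plus a small
  excess. To exploit this, trajectories starting near \<open>x\<close> must be compared with the
  field at a distance \<open>\<tau>\<close> much larger than both the mollification radius, taken as
  \<open>\<tau>\<^sup>2\<close>, and the displacement during one step; the ratio of these scales
  enters the error. Every error of a step is a small factor times the mass of \<open>C0 + C1\<close>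
  on that step, so the errors add up over the steps. The formula has no absolute value around the
  Jacobian, so the sign of the determinant must be found too; for a flow that is only Lipschitz,
  homotopy is the means to do so.\<close>

lemma AE_lebesgue_iff_negligible: "(AE x in lebesgue. P x) \<longleftrightarrow> negligible {x. \<not> P x}"
 by (simp add: completion.AE_iff_null_sets negligible_iff_null_sets)

lemma abs_continuous_onE:
 assumes "abs_continuous_on a b g" "\<epsilon> > 0"
 obtains \<delta> where "\<delta> > 0"
  "\<And>D S. D division_of S \<and> S \<subseteq> {a..b} \<and> (\<Sum>k\<in>D. Sup k - Inf k) < \<delta>
    ==> (\<Sum>k\<in>D. norm (g (Sup k) - g (Inf k))) < \<epsilon>"
 using assms unfolding abs_continuous_on_def by meson

lemma abs_continuous_on_imp_dist:
 assumes "abs_continuous_on a b g" "\<epsilon> > 0"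
 obtains \<delta> where "\<delta> > 0"
  "\<And>u v. a <= u ==> u <= v ==> v <= b ==> v - u < \<delta> ==> norm (g v - g u) < \<epsilon>"
proof -
 obtain \<delta> where \<delta>: "\<delta> > 0" "\<And>D S. D division_of S \<and> S \<subseteq> {a..b} \<and> (\<Sum>k\<in>D. Sup k - Inf k) < \<delta>
    ==> (\<Sum>k\<in>D. norm (g (Sup k) - g (Inf k))) < \<epsilon>"
  by (rule abs_continuous_onE[OF assms]) blast
 show ?thesis
 proof (rule that[OF \<delta>(1)])
  fix u v assume uv: "a <= u" "u <= v" "v <= b" "v - u < \<delta>"
  have "{{u..v}} division_of {u..v}"
   using uv division_of_self[of u v] by (simp add: cbox_interval)
  then show "norm (g v - g u) < \<epsilon>"
   using \<delta>(2)[of "{{u..v}}" "{u..v}"] uv by simp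
 qed
qed

lemma abs_continuous_on_imp_continuous_on:
 assumes "abs_continuous_on a b g"
 shows "continuous_on {a..b} g"
 unfolding continuous_on_iff
proof (intro ballI allI impI)
 fix x and e::real assume x: "x \<in> {a..b}" and "0 < e"
 then obtain \<delta> where \<delta>: "\<delta> > 0"
  "\<And>u v. a <= u ==> u <= v ==> v <= b ==> v - u < \<delta> ==> norm (g v - g u) < e"
  using abs_continuous_on_imp_dist[OF assms] by metis
 show "\<exists>d>0. \<forall>x'\<in>{a..b}. dist x' x < d --> dist (g x') (g x) < e"
 proof (intro exI[of _ \<delta>] conjI ballI impI \<delta>(1))
  fix x' assume x': "x' \<in> {a..b}" "dist x' x < \<delta>"
  show "dist (g x') (g x) < e"
  proof (cases "x <= x'")
   case True
   then show ?thesis using \<delta>(2)[of x x'] x x' by (auto simp: dist_norm)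
  next
   case False
   then show ?thesis using \<delta>(2)[of x' x] x x' by (auto simp: dist_norm norm_minus_commute)
  qed
 qed
qed

lemma abs_continuous_on_subinterval:
 assumes "abs_continuous_on a b g" "a <= c" "d <= b"
 shows "abs_continuous_on c d g"
 unfolding abs_continuous_on_def
proof (intro allI impI)
 fix \<epsilon>::real assume "\<epsilon> > 0"
 then obtain \<delta> where "\<delta> > 0" and \<delta>: "\<And>D S. D division_of S \<and> S \<subseteq> {a..b} \<and> (\<Sum>k\<in>D. Sup k - Inf k) < \<delta>
    ==> (\<Sum>k\<in>D. norm (g (Sup k) - g (Inf k))) < \<epsilon>"
  using abs_continuous_onE[OF assms(1)] by blast
 moreover have "S \<subseteq> {a..b}" if "S \<subseteq> {c..d}" for S
  using that assms by auto
 ultimately show "\<exists>\<delta>>0. \<forall>D S. D division_of S \<and> S \<subseteq> {c..d} \<and> (\<Sum>k\<in>D. Sup k - Inf k) < \<delta> --> (\<Sum>k\<in>D. norm (g (Sup k) - g (Inf k))) < \<epsilon>"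
  by blast
qed

lemma division_of_endpoints:
 fixes D :: "real set set"
 assumes "D division_of S" "S \<subseteq> {a..b}" "k \<in> D"
 shows "Inf k \<in> {a..b}" "Sup k \<in> {a..b}" "Inf k <= Sup k"
proof -
 obtain u v where k: "k = {u..v}" using assms(1,3) by (metis division_ofD(4) cbox_interval)
 have ne: "k ~= {}" using assms(1,3) by (rule division_ofD(3))
 have "k \<subseteq> {a..b}" using assms division_ofD(2) by blast
 then show "Inf k \<in> {a..b}" "Sup k \<in> {a..b}" "Inf k <= Sup k" using k ne by auto
qed

lemma abs_continuous_on_dominated:
 assumes g: "abs_continuous_on a b g"
  and h: "\<And>u v. u \<in> {a..b} ==> v \<in> {a..b} ==> norm (h v - h u) <= M * norm (g v - g u)"
 shows "abs_continuous_on a b h"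
 unfolding abs_continuous_on_def
proof (intro allI impI)
 fix \<epsilon>::real assume "\<epsilon> > 0"
 define M' where "M' = max M 1"
 have M': "M' > 0" "M <= M'" by (auto simp: M'_def)
 have "\<epsilon> / M' > 0" using \<open>\<epsilon> > 0\<close> M' by simp
 then obtain \<delta> where "\<delta> > 0" and \<delta>: "\<And>D S. D division_of S \<and> S \<subseteq> {a..b} \<and> (\<Sum>k\<in>D. Sup k - Inf k) < \<delta>
    ==> (\<Sum>k\<in>D. norm (g (Sup k) - g (Inf k))) < \<epsilon> / M'"
  using abs_continuous_onE[OF g] by blast
 have "(\<Sum>k\<in>D. norm (h (Sup k) - h (Inf k))) < \<epsilon>"
  if D: "D division_of S \<and> S \<subseteq> {a..b} \<and> (\<Sum>k\<in>D. Sup k - Inf k) < \<delta>" for D S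
 proof -
  have "(\<Sum>k\<in>D. norm (h (Sup k) - h (Inf k))) <= (\<Sum>k\<in>D. M' * norm (g (Sup k) - g (Inf k)))"
  proof (rule sum_mono)
   fix k assume "k \<in> D"
   then have "norm (h (Sup k) - h (Inf k)) <= M * norm (g (Sup k) - g (Inf k))"
    using D \<open>k \<in> D\<close> by (intro h) (blast intro: division_of_endpoints)+
   also have "\<dots> <= M' * norm (g (Sup k) - g (Inf k))"
    using M' by (intro mult_right_mono) auto
   finally show "norm (h (Sup k) - h (Inf k)) <= M' * norm (g (Sup k) - g (Inf k))" .
  qed
  also have "\<dots> = M' * (\<Sum>k\<in>D. norm (g (Sup k) - g (Inf k)))" by (simp add: sum_distrib_left)
  also have "\<dots> < M' * (\<epsilon> / M')" using \<delta>[OF D] M' by (intro mult_strict_left_mono) auto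
  finally show ?thesis using M' by simp
 qed
 with \<open>\<delta> > 0\<close> show "\<exists>\<delta>>0. \<forall>D S. D division_of S \<and> S \<subseteq> {a..b} \<and> (\<Sum>k\<in>D. Sup k - Inf k) < \<delta> --> (\<Sum>k\<in>D. norm (h (Sup k) - h (Inf k))) < \<epsilon>"
  by blast
qed

lemma abs_continuous_on_diff:
 assumes f: "abs_continuous_on a b f" and g: "abs_continuous_on a b g"
 shows "abs_continuous_on a b (%t. f t - g t)"
 unfolding abs_continuous_on_def
proof (intro allI impI)
 fix \<epsilon>::real assume "\<epsilon> > 0"
 then have e2: "\<epsilon> / 2 > 0" by simp
 obtain \<delta> where "\<delta> > 0" and \<delta>: "\<And>D S. D division_of S \<and> S \<subseteq> {a..b} \<and> (\<Sum>k\<in>D. Sup k - Inf k) < \<delta>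
    ==> (\<Sum>k\<in>D. norm (f (Sup k) - f (Inf k))) < \<epsilon> / 2"
  by (rule abs_continuous_onE[OF f e2]) blast
 obtain \<delta>' where "\<delta>' > 0" and \<delta>': "\<And>D S. D division_of S \<and> S \<subseteq> {a..b} \<and> (\<Sum>k\<in>D. Sup k - Inf k) < \<delta>'
    ==> (\<Sum>k\<in>D. norm (g (Sup k) - g (Inf k))) < \<epsilon> / 2"
  by (rule abs_continuous_onE[OF g e2]) blast
 have "(\<Sum>k\<in>D. norm (f (Sup k) - g (Sup k) - (f (Inf k) - g (Inf k)))) < \<epsilon>"
  if D: "D division_of S \<and> S \<subseteq> {a..b} \<and> (\<Sum>k\<in>D. Sup k - Inf k) < min \<delta> \<delta>'" for D S
 proof -
  have "(\<Sum>k\<in>D. norm (f (Sup k) - g (Sup k) - (f (Inf k) - g (Inf k))))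
    <= (\<Sum>k\<in>D. norm (f (Sup k) - f (Inf k)) + norm (g (Sup k) - g (Inf k)))"
  proof (rule sum_mono)
   fix k
   have "f (Sup k) - g (Sup k) - (f (Inf k) - g (Inf k)) = (f (Sup k) - f (Inf k)) - (g (Sup k) - g (Inf k))"
    by simp
   then show "norm (f (Sup k) - g (Sup k) - (f (Inf k) - g (Inf k))) <= norm (f (Sup k) - f (Inf k)) + norm (g (Sup k) - g (Inf k))"
    using norm_triangle_ineq4 by metis
  qed
  also have "\<dots> < \<epsilon>" using \<delta>[of D S] \<delta>'[of D S] D by (simp add: sum.distrib)
  finally show ?thesis .
 qed
 then show "\<exists>\<delta>>0. \<forall>D S. D division_of S \<and> S \<subseteq> {a..b} \<and> (\<Sum>k\<in>D. Sup k - Inf k) < \<delta> --> (\<Sum>k\<in>D. norm (f (Sup k) - g (Sup k) - (f (Inf k) - g (Inf k)))) < \<epsilon>"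
  using \<open>\<delta> > 0\<close> \<open>\<delta>' > 0\<close> by (intro exI[of _ "min \<delta> \<delta>'"]) (simp, blast)
qed

lemma abs_continuous_on_power2_norm:
 fixes g :: "real => 'a::real_inner"
 assumes g: "abs_continuous_on a b g"
 shows "abs_continuous_on a b (%t. (norm (g t))\<^sup>2)"
proof -
 have "bounded (g ` {a..b})"
  using abs_continuous_on_imp_continuous_on[OF g] compact_continuous_image compact_imp_bounded by blast
 then obtain M where M: "\<And>t. t \<in> {a..b} ==> norm (g t) <= M" unfolding bounded_iff by blast
 show ?thesis
 proof (rule abs_continuous_on_dominated[OF g, where M = "2 * M"])
  fix u v assume uv: "u \<in> {a..b}" "v \<in> {a..b}"
  have "norm ((norm (g v))\<^sup>2 - (norm (g u))\<^sup>2) = \<bar>norm (g v) - norm (g u)\<bar> * (norm (g v) + norm (g u))"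
   by (simp add: power2_eq_square square_diff_square_factored abs_mult)
  also have "\<dots> <= norm (g v - g u) * (2 * M)"
   using M[OF uv(1)] M[OF uv(2)] by (intro mult_mono norm_triangle_ineq3) auto
  finally show "norm ((norm (g v))\<^sup>2 - (norm (g u))\<^sup>2) <= 2 * M * norm (g v - g u)" by (simp add: mult.commute)
 qed
qed

text \<open>Tags in the exceptional null set get cells inside an open set of small measure, where absolute
 continuity makes the total increment small.\<close>

lemma abs_continuous_on_has_integral:
 fixes g :: "real => 'a::euclidean_space"
 assumes ab: "a <= b" and ac: "abs_continuous_on a b g"
  and N: "negligible N"
  and der: "\<And>t. t \<in> {a..b} - N ==> (g has_vector_derivative g' t) (at t within {a..b})"
  and g'0: "\<And>t. t \<in> N ==> g' t = 0"
 shows "(g' has_integral (g b - g a)) {a..b}"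
 unfolding has_integral_real
proof (intro allI impI)
 fix e::real assume e: "e > 0"
 \<comment> \<open>Tags outside \<open>N\<close> contribute at most \<open>\<epsilon>\<close> times
   the total length; the 1 covers \<open>a = b\<close>.\<close>
 define \<epsilon> where "\<epsilon> = e / (2 * (b - a + 1))"
 have ba: "b - a + 1 > 0" using ab by simp
 have \<epsilon>: "\<epsilon> > 0" using e ba by (simp add: \<epsilon>_def)
 have "e / 2 > 0" using e by simp
 then obtain \<delta> where \<delta>0: "\<delta> > 0" and \<delta>: "\<And>D S. D division_of S \<and> S \<subseteq> {a..b} \<and> (\<Sum>k\<in>D. Sup k - Inf k) < \<delta>
    ==> (\<Sum>k\<in>D. norm (g (Sup k) - g (Inf k))) < e / 2"
  using abs_continuous_onE[OF ac] by blast
 have "N \<in> sets lebesgue" using N by (simp add: negligible_imp_sets)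
 then obtain U where U: "open U" "N \<subseteq> U" "U - N \<in> lmeasurable" "emeasure lebesgue (U - N) < ennreal \<delta>"
  using sets_lebesgue_outer_open[OF _ \<delta>0] by blast
 have UN: "U - N \<union> N = U" using U by blast
 have Um: "U \<in> lmeasurable" using fmeasurable.Un[OF U(3) negligible_imp_measurable[OF N]] UN by simp
 have "measure lebesgue U = measure lebesgue (U - N)"
  using N Um by (intro measure_Diff_null_set[symmetric]) (auto simp: negligible_iff_null_sets fmeasurableD)
 also have "\<dots> < \<delta>" using U(3,4) \<delta>0 by (simp add: emeasure_eq_measure2 ennreal_less_iff)
 finally have mU: "measure lebesgue U < \<delta>" .
 have *: "\<exists>d>0. (t \<in> N --> ball t d \<subseteq> U) \<and>
   (t \<in> {a..b} - N --> (\<forall>y\<in>{a..b}. \<bar>y - t\<bar> < d --> norm (g y - g t - (y - t) *\<^sub>R g' t) <= \<epsilon> * \<bar>y - t\<bar>))" for t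
 proof (cases "t \<in> {a..b} - N")
  case True
  from der[OF this] \<epsilon> obtain d where "d > 0"
   "\<And>y. y \<in> {a..b} ==> norm (y - t) < d ==> norm (g y - g t - (y - t) *\<^sub>R g' t) <= \<epsilon> * norm (y - t)"
   unfolding has_vector_derivative_def has_derivative_within_alt by blast
  then show ?thesis using True by (intro exI[of _ d]) (simp add: real_norm_def)
 next
  case False
  show ?thesis
  proof (cases "t \<in> N")
   case True
   then obtain d where "d > 0" "ball t d \<subseteq> U" using U open_contains_ball by blast
   then show ?thesis using True by auto
  qed (use False in \<open>auto intro: exI[of _ 1]\<close>)
 qed
 have "\<exists>d. \<forall>t. d t > 0 \<and> (t \<in> N --> ball t (d t) \<subseteq> U) \<and>
   (t \<in> {a..b} - N --> (\<forall>y\<in>{a..b}. \<bar>y - t\<bar> < d t --> norm (g y - g t - (y - t) *\<^sub>R g' t) <= \<epsilon> * \<bar>y - t\<bar>))"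
  by (rule choice) (intro allI *)
 then obtain d where d0: "\<And>t. d t > 0" and dN: "\<And>t. t \<in> N ==> ball t (d t) \<subseteq> U"
  and dd: "\<And>t y. t \<in> {a..b} - N ==> y \<in> {a..b} ==> \<bar>y - t\<bar> < d t ==> norm (g y - g t - (y - t) *\<^sub>R g' t) <= \<epsilon> * \<bar>y - t\<bar>"
  by blast
 show "\<exists>\<gamma>. gauge \<gamma> \<and> (\<forall>\<D>. \<D> tagged_division_of {a..b} \<and> \<gamma> fine \<D> -->
    norm ((\<Sum>(x, k)\<in>\<D>. measure lborel k *\<^sub>R g' x) - (g b - g a)) < e)"
 proof (intro exI[of _ "%t. ball t (d t)"] conjI allI impI)
  show "gauge (%t. ball t (d t))" using d0 by (simp add: gauge_def)
  fix p assume "p tagged_division_of {a..b} \<and> (%t. ball t (d t)) fine p"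
  then have p: "p tagged_division_of {a..b}" and fine: "(%t. ball t (d t)) fine p" by blast+
  have fin: "finite p" by (rule tagged_division_of_finite[OF p])
  have cell: "\<exists>u v. k = {u..v} \<and> u <= x \<and> x <= v \<and> a <= u \<and> v <= b \<and> k \<subseteq> ball x (d x)" if xk: "(x, k) \<in> p" for x k
  proof -
   obtain u v where k: "k = {u..v}" using tagged_division_ofD(4)[OF p xk] by (auto simp: cbox_interval)
   have "x \<in> k" "k \<subseteq> {a..b}" using tagged_division_ofD(2,3)[OF p xk] by blast+
   moreover have "k \<subseteq> ball x (d x)" using fineD[OF fine xk] .
   ultimately show ?thesis using k by auto
  qed
  define pN where "pN = {(x, k) \<in> p. x \<in> N}"
  have pN: "pN \<subseteq> p" by (auto simp: pN_def)
  have tel: "g b - g a = (\<Sum>(x, k)\<in>p. g (Sup k) - g (Inf k))"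
   using additive_tagged_division_1[OF ab p, of g] by simp
  have "norm ((\<Sum>(x, k)\<in>p. measure lborel k *\<^sub>R g' x) - (g b - g a))
    = norm (\<Sum>(x, k)\<in>p. measure lborel k *\<^sub>R g' x - (g (Sup k) - g (Inf k)))"
   unfolding tel by (simp add: sum_subtractf case_prod_unfold)
  also have "\<dots> <= (\<Sum>(x, k)\<in>p. norm (measure lborel k *\<^sub>R g' x - (g (Sup k) - g (Inf k))))"
   by (simp add: case_prod_unfold sum_norm_le)
  also have "\<dots> = (\<Sum>(x, k)\<in>p - pN. norm (measure lborel k *\<^sub>R g' x - (g (Sup k) - g (Inf k))))
     + (\<Sum>(x, k)\<in>pN. norm (measure lborel k *\<^sub>R g' x - (g (Sup k) - g (Inf k))))"
   using sum.subset_diff[OF pN fin] by simp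
  also have "\<dots> < e / 2 + e / 2"
  proof (rule add_le_less_mono)
   have "(\<Sum>(x, k)\<in>p - pN. norm (measure lborel k *\<^sub>R g' x - (g (Sup k) - g (Inf k)))) <= (\<Sum>(x, k)\<in>p - pN. \<epsilon> * measure lborel k)"
   proof (rule sum_mono, clarify)
    fix x k assume xk: "(x, k) \<in> p" "(x, k) \<notin> pN"
    then obtain u v where k: "k = {u..v}" "u <= x" "x <= v" "a <= u" "v <= b" "k \<subseteq> ball x (d x)" using cell by blast
    have xN: "x \<in> {a..b} - N" using xk k by (auto simp: pN_def)
    have "u \<in> {u..v}" "v \<in> {u..v}" using k by auto
    then have uv: "u \<in> ball x (d x)" "v \<in> ball x (d x)" using k by blast+
    have 1: "norm (g u - g x - (u - x) *\<^sub>R g' x) <= \<epsilon> * \<bar>u - x\<bar>"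
     using uv k by (intro dd xN) (auto simp: dist_real_def)
    have 2: "norm (g v - g x - (v - x) *\<^sub>R g' x) <= \<epsilon> * \<bar>v - x\<bar>"
     using uv k by (intro dd xN) (auto simp: dist_real_def)
    have eq: "measure lborel k *\<^sub>R g' x - (g (Sup k) - g (Inf k)) = (g u - g x - (u - x) *\<^sub>R g' x) - (g v - g x - (v - x) *\<^sub>R g' x)"
     using k by (simp add: algebra_simps)
    have "norm (measure lborel k *\<^sub>R g' x - (g (Sup k) - g (Inf k))) <= \<epsilon> * \<bar>u - x\<bar> + \<epsilon> * \<bar>v - x\<bar>"
     unfolding eq by (rule order_trans[OF norm_triangle_ineq4 add_mono[OF 1 2]])
    also have "\<dots> = \<epsilon> * measure lborel k" using k by (simp add: algebra_simps)
    finally show "norm (measure lborel k *\<^sub>R g' x - (g (Sup k) - g (Inf k))) <= \<epsilon> * measure lborel k" .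
   qed
   also have "\<dots> <= (\<Sum>(x, k)\<in>p. \<epsilon> * measure lborel k)"
    using fin \<epsilon> by (intro sum_mono2) auto
   also have "\<dots> = \<epsilon> * (b - a)"
    using additive_content_tagged_division[of p a b] p ab by (simp add: case_prod_unfold flip: sum_distrib_left)
   also have "\<dots> <= \<epsilon> * (b - a + 1)" using \<epsilon> by (intro mult_left_mono) auto
   also have "\<dots> = e / 2" using ba by (simp add: \<epsilon>_def field_simps)
   finally show "(\<Sum>(x, k)\<in>p - pN. norm (measure lborel k *\<^sub>R g' x - (g (Sup k) - g (Inf k)))) <= e / 2" .
  next
   have tp: "pN tagged_partial_division_of {a..b}"
    by (rule tagged_partial_division_subset[OF _ pN]) (use p in \<open>simp add: tagged_division_of_def\<close>)
   define S where "S = \<Union>(snd ` pN)"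
   have td: "pN tagged_division_of S"
    using tagged_partial_division_of_Union_self[OF tp] by (simp add: S_def)
   have div: "snd ` pN division_of S" using division_of_tagged_division[OF td] .
   have SU: "S \<subseteq> U"
   proof
    fix y assume "y \<in> S"
    then obtain x k where xk: "(x, k) \<in> pN" "y \<in> k" by (auto simp: S_def)
    then have "x \<in> N" "k \<subseteq> ball x (d x)" using cell pN by (auto simp: pN_def)
    then show "y \<in> U" using dN xk by blast
   qed
   have Sab: "S \<subseteq> {a..b}" using cell pN by (fastforce simp: S_def)
   have len: "Sup k - Inf k = measure lebesgue k" if "k \<in> snd ` pN" for k
    using that cell pN by (fastforce)
   have "(\<Sum>k\<in>snd ` pN. Sup k - Inf k) = (\<Sum>k\<in>snd ` pN. measure lebesgue k)"
    using len by (intro sum.cong) auto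
   also have "\<dots> = measure lebesgue S"
    by (rule content_division[OF div])
   also have "\<dots> <= measure lebesgue U"
    using SU Um lmeasurable_division[OF div] by (intro measure_mono_fmeasurable) (auto simp: fmeasurableD)
   also have "\<dots> < \<delta>" by (rule mU)
   finally have small: "(\<Sum>k\<in>snd ` pN. norm (g (Sup k) - g (Inf k))) < e / 2"
    using \<delta> div Sab by blast
   have "(\<Sum>(x, k)\<in>pN. norm (measure lborel k *\<^sub>R g' x - (g (Sup k) - g (Inf k)))) = (\<Sum>(x, k)\<in>pN. norm (g (Sup k) - g (Inf k)))"
    by (intro sum.cong) (auto simp: pN_def g'0 norm_minus_commute)
   \<comment> \<open>\<open>sum.over_tagged_division_lemma\<close> wants a function that vanishes on
     all boxes with empty interior. The empty box is treated separately because its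
     \<open>Inf\<close> and \<open>Sup\<close> are arbitrary.\<close>
   also have "\<dots> = (\<Sum>(x, k)\<in>pN. if k = {} then 0 else norm (g (Sup k) - g (Inf k)))"
    by (intro sum.cong) (auto dest: tagged_division_ofD(2)[OF td])
   also have "\<dots> = (\<Sum>k\<in>snd ` pN. if k = {} then 0 else norm (g (Sup k) - g (Inf k)))"
   proof (rule sum.over_tagged_division_lemma[OF td])
    fix u v :: real assume "box u v = {}"
    then have "v <= u" by (simp add: box_real)
    then show "(if cbox u v = {} then 0 else norm (g (Sup (cbox u v)) - g (Inf (cbox u v)))) = 0"
     by (cases "u = v") (auto simp: cbox_interval)
   qed
   also have "\<dots> = (\<Sum>k\<in>snd ` pN. norm (g (Sup k) - g (Inf k)))"
    using division_ofD(3)[OF div] by (intro sum.cong) auto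
   finally show "(\<Sum>(x, k)\<in>pN. norm (measure lborel k *\<^sub>R g' x - (g (Sup k) - g (Inf k)))) < e / 2"
    using small by simp
  qed
  finally show "norm ((\<Sum>(x, k)\<in>p. measure lborel k *\<^sub>R g' x) - (g b - g a)) < e" by simp
 qed
qed

text \<open>The fundamental theorem above delivers the integrability of the derivative together with
  its integral, so an almost everywhere bound by an integrable \<open>h\<close> can be integrated.
  All differential inequalities along trajectories enter in this form.\<close>

lemma abs_continuous_on_increment_le:
 fixes g h :: "real => real"
 assumes ab: "a <= b" and ac: "abs_continuous_on a b g"
  and der: "AE t in lebesgue_on {a..b}. \<exists>v. (g has_vector_derivative v) (at t within {a..b}) \<and> v <= h t"
  and h: "h integrable_on {a..b}"
 shows "g b - g a <= integral {a..b} h"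
proof -
 define N where "N = {t. \<not> (t \<in> {a..b} --> (\<exists>v. (g has_vector_derivative v) (at t within {a..b}) \<and> v <= h t))}"
 have "AE t in lebesgue. t \<in> {a..b} --> (\<exists>v. (g has_vector_derivative v) (at t within {a..b}) \<and> v <= h t)"
  using der by (subst (asm) AE_restrict_space_iff) auto
 then have N: "negligible N" unfolding N_def by (simp only: AE_lebesgue_iff_negligible)
 have N2: "\<exists>v. (g has_vector_derivative v) (at t within {a..b}) \<and> v <= h t" if "t \<in> {a..b} - N" for t
  using that by (auto simp: N_def)
 define g0 where "g0 = (%t. SOME v. (g has_vector_derivative v) (at t within {a..b}) \<and> v <= h t)"
 have "(g has_vector_derivative g0 t) (at t within {a..b}) \<and> g0 t <= h t" if "t \<in> {a..b} - N" for t
  unfolding g0_def by (rule someI_ex[OF N2[OF that]])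
 then have g0: "\<And>t. t \<in> {a..b} - N ==> (g has_vector_derivative g0 t) (at t within {a..b})"
   "\<And>t. t \<in> {a..b} - N ==> g0 t <= h t" by blast+
 define g' where "g' = (%t. if t \<in> N then 0 else g0 t)"
 have i: "(g' has_integral (g b - g a)) {a..b}"
  by (rule abs_continuous_on_has_integral[OF ab ac N]) (use g0 in \<open>auto simp: g'_def\<close>)
 have "((%t. if t \<in> N then 0 else h t) has_integral integral {a..b} h) {a..b}"
  by (rule has_integral_spike[OF N _ integrable_integral[OF h]]) auto
 then show ?thesis
  by (rule has_integral_le[OF i]) (use g0 in \<open>auto simp: g'_def\<close>)
qed

section \<open>The backward flow\<close>

lemma absolutely_integrable_mult_continuous:
 fixes c E :: "real => real"
 assumes c: "c absolutely_integrable_on {a..b}" and E: "continuous_on {a..b} E"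
 shows "(%x. c x * E x) absolutely_integrable_on {a..b}"
proof -
 have "(%x. E x * c x) absolutely_integrable_on {a..b}"
 proof (rule absolutely_integrable_bounded_measurable_product_real[OF _ _ _ c])
  show "E \<in> borel_measurable (lebesgue_on {a..b})"
   by (intro continuous_imp_measurable_on_sets_lebesgue E) simp
  show "{a..b} \<in> sets lebesgue" by simp
  show "bounded (E ` {a..b})"
   using E compact_continuous_image compact_imp_bounded by blast
 qed
 then show ?thesis by (simp add: mult.commute)
qed

text \<open>The interval is cut into pieces on which \<open>c\<close> has mass at most 1/2. On such
  a piece the integral is at most half the maximum of \<open>E\<close>, so \<open>E\<close> at most
  doubles; \<open>N\<close> counts the pieces, and \<open>2 ^ N\<close> takes the place of an
  exponential.\<close>

lemma gronwall_backward:
 fixes E c :: "real => real"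
 assumes E: "continuous_on {a..b} E" and E0: "\<And>r. r \<in> {a..b} ==> 0 <= E r"
  and c: "c absolutely_integrable_on {a..b}" and c0: "\<And>r. r \<in> {a..b} ==> 0 <= c r"
  and le: "\<And>r q. a <= r ==> r <= q ==> q <= b ==> E r <= E q + integral {r..q} (%x. c x * E x)"
 shows "a <= s ==> s <= t ==> t <= b ==> integral {s..t} c <= real N / 2 ==> E s <= 2 ^ N * E t"
proof (induction N arbitrary: s t)
 have small: "E s <= 2 * E t" if st: "a <= s" "s <= t" "t <= b" and i: "integral {s..t} c <= 1 / 2" for s t
 proof -
  have sub: "{s..t} \<subseteq> {a..b}" using st by auto
  obtain m where m: "m \<in> {s..t}" "\<And>r. r \<in> {s..t} ==> E r <= E m"
   using continuous_attains_sup[OF compact_Icc _ continuous_on_subset[OF E sub]] st by auto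
  have mt: "{m..t} \<subseteq> {s..t}" "{m..t} \<subseteq> {a..b}" using m sub by auto
  have Em: "0 <= E m" using m sub E0 by blast
  have ci: "c integrable_on {m..t}" "c integrable_on {s..t}"
   using absolutely_integrable_on_subinterval[OF c] mt sub
   by (auto simp: set_lebesgue_integral_eq_integral(1) box_real)
  have cEi: "(%x. c x * E x) integrable_on {m..t}"
   by (intro set_lebesgue_integral_eq_integral(1) absolutely_integrable_mult_continuous
     absolutely_integrable_on_subinterval[OF c] mt continuous_on_subset[OF E])
  have "integral {m..t} (%x. c x * E x) <= integral {m..t} (%x. E m * c x)"
  proof (rule integral_le[OF cEi])
   show "(%x. E m * c x) integrable_on {m..t}" by (rule integrable_on_mult_right[OF ci(1)])
   fix x assume "x \<in> {m..t}"
   then show "c x * E x <= E m * c x"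
    using m(2)[of x] c0[of x] mt by (subst mult.commute, intro mult_right_mono) auto
  qed
  also have "\<dots> = E m * integral {m..t} c" by simp
  also have "\<dots> <= E m * (1 / 2)"
  proof (rule mult_left_mono[OF _ Em])
   have "integral {m..t} c <= integral {s..t} c"
    by (rule integral_subset_le[OF mt(1) ci]) (use c0 sub in auto)
   then show "integral {m..t} c <= 1 / 2" using i by simp
  qed
  finally have "E m <= E t + E m * (1 / 2)"
   using le[of m t] m st by auto
  then have "E m <= 2 * E t" by simp
  then show ?thesis using m(2)[of s] st by auto
 qed
 {
  \<comment> \<open>Here the integral of \<open>c\<close> is at most 0, and a bound on
    \<open>E\<close> makes the integral of \<open>c * E\<close> nonpositive as well.\<close>
  case 0
  have "integral {s..t} c <= 0" using 0 by simp
  define F where "F = E s"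
  have sub: "{s..t} \<subseteq> {a..b}" using 0 by auto
  obtain M where M: "M \<ge> 0" "\<And>r. r \<in> {s..t} ==> E r <= M"
  proof -
   have "bounded (E ` {s..t})"
    using continuous_on_subset[OF E sub] compact_continuous_image compact_imp_bounded by blast
   then obtain M where "\<And>r. r \<in> {s..t} ==> norm (E r) <= M" unfolding bounded_iff by blast
   then have "\<And>r. r \<in> {s..t} ==> E r <= \<bar>M\<bar>" by fastforce
   then show ?thesis using that[of "\<bar>M\<bar>"] by simp
  qed
  have ci: "c integrable_on {s..t}"
   using absolutely_integrable_on_subinterval[OF c sub] by (auto simp: set_lebesgue_integral_eq_integral(1) box_real)
  have "integral {s..t} (%x. c x * E x) <= integral {s..t} (%x. M * c x)"
  proof (rule integral_le)
   show "(%x. c x * E x) integrable_on {s..t}"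
    by (intro set_lebesgue_integral_eq_integral(1) absolutely_integrable_mult_continuous
     absolutely_integrable_on_subinterval[OF c] sub continuous_on_subset[OF E])
   show "(%x. M * c x) integrable_on {s..t}" by (rule integrable_on_mult_right[OF ci])
   fix x assume "x \<in> {s..t}"
   then show "c x * E x <= M * c x"
    using M(2)[of x] c0[of x] sub by (subst mult.commute, intro mult_right_mono) auto
  qed
  also have "\<dots> = M * integral {s..t} c" by simp
  also have "\<dots> <= 0" using M 0 by (simp add: mult_nonneg_nonpos)
  finally show ?case using le[of s t] 0 by simp
 next
  case (Suc N)
  show ?case
  proof (cases "integral {s..t} c <= 1 / 2")
   case True
   have "0 <= E t" using E0 Suc.prems by auto
   have "E s <= 2 * E t" using small[OF Suc.prems(1-3) True] .
   also have "\<dots> <= 2 ^ Suc N * E t"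
    using \<open>0 <= E t\<close> by (intro mult_right_mono) auto
   finally show ?thesis .
  next
   case False
   have sub: "{s..t} \<subseteq> {a..b}" using Suc.prems by auto
   have ci: "c integrable_on {s..t}"
    using absolutely_integrable_on_subinterval[OF c sub] by (auto simp: set_lebesgue_integral_eq_integral(1) box_real)
   have cont: "continuous_on {s..t} (%r. integral {r..t} c)"
    by (rule indefinite_integral_continuous_1'[OF ci])
   \<comment> \<open>A piece of mass exactly 1/2 is cut off at the right end; the rest has mass at
     most \<open>N / 2\<close>.\<close>
   have "\<exists>r\<ge>s. r <= t \<and> integral {r..t} c = 1 / 2"
    by (rule IVT2'[of "%r. integral {r..t} c", OF _ _ _ cont]) (use False Suc.prems in auto)
   then obtain r where r: "s <= r" "r <= t" "integral {r..t} c = 1 / 2" by blast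
   have "integral {s..r} c + integral {r..t} c = integral {s..t} c"
    by (rule Henstock_Kurzweil_Integration.integral_combine[OF r(1,2) ci])
   then have "integral {s..r} c <= real N / 2" using Suc.prems r by (simp add: field_simps)
   then have "E s <= 2 ^ N * E r" using Suc.IH[of s r] Suc.prems r by simp
   also have "\<dots> <= 2 ^ N * (2 * E t)"
    using small[of r t] Suc.prems r by (intro mult_left_mono) auto
   finally show ?thesis by simp
  qed
 }
qed

text \<open>The derivative is bounded from below only, so the estimate runs backward in time, from
  \<open>b\<close> to \<open>a\<close>; the increment bound is applied to
  \<open>- E\<close>.\<close>

lemma gronwall_backward_AE:
 fixes E c :: "real => real"
 assumes ac: "abs_continuous_on a b E" and E0: "\<And>r. r \<in> {a..b} ==> 0 <= E r"
  and c: "c absolutely_integrable_on {a..b}" and c0: "\<And>r. r \<in> {a..b} ==> 0 <= c r"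
  and der: "AE t in lebesgue_on {a..b}. \<exists>v. (E has_vector_derivative v) (at t within {a..b}) \<and> - v <= c t * E t"
  and ab: "a <= b" and N: "integral {a..b} c <= real N / 2"
 shows "E a <= 2 ^ N * E b"
proof (rule gronwall_backward[OF _ E0 c c0 _ order_refl ab order_refl N])
 show cont: "continuous_on {a..b} E" by (rule abs_continuous_on_imp_continuous_on[OF ac])
 fix r q assume rq: "a <= r" "r <= q" "q <= b"
 have sub: "{r..q} \<subseteq> {a..b}" using rq by auto
 have "- E q - (- E r) <= integral {r..q} (%x. c x * E x)"
 proof (rule abs_continuous_on_increment_le[OF rq(2)])
  show "abs_continuous_on r q (%x. - E x)"
   by (rule abs_continuous_on_dominated[OF abs_continuous_on_subinterval[OF ac rq(1,3)], where M = 1]) auto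
  show "(%x. c x * E x) integrable_on {r..q}"
   by (intro set_lebesgue_integral_eq_integral(1) absolutely_integrable_mult_continuous
     absolutely_integrable_on_subinterval[OF c] sub continuous_on_subset[OF cont])
  have "AE t in lebesgue. t \<in> {a..b} --> (\<exists>v. (E has_vector_derivative v) (at t within {a..b}) \<and> - v <= c t * E t)"
   using der by (subst (asm) AE_restrict_space_iff) auto
  then have "AE t in lebesgue. t \<in> {r..q} --> (\<exists>v. ((%x. - E x) has_vector_derivative v) (at t within {r..q}) \<and> v <= c t * E t)"
  proof (rule AE_mp, intro AE_I2 impI)
   fix t assume H: "t \<in> {a..b} --> (\<exists>v. (E has_vector_derivative v) (at t within {a..b}) \<and> - v <= c t * E t)"
    and "t \<in> {r..q}"
   then obtain v where "(E has_vector_derivative v) (at t within {a..b})" "- v <= c t * E t" using sub by blast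
   then show "\<exists>v. ((%x. - E x) has_vector_derivative v) (at t within {r..q}) \<and> v <= c t * E t"
    by (intro exI[of _ "- v"] conjI has_vector_derivative_minus has_vector_derivative_within_subset[OF _ sub])
  qed
  then show "AE t in lebesgue_on {r..q}. \<exists>v. ((%x. - E x) has_vector_derivative v) (at t within {r..q}) \<and> v <= c t * E t"
   by (subst AE_restrict_space_iff) auto
 qed
 then show "E r <= E q + integral {r..q} (%x. c x * E x)" by simp
qed

text \<open>Makes \<open>1 / (1 + |y|^2)\<close> absolutely continuous along a trajectory, for the
  second bound in \<open>flow_growth\<close>.\<close>

lemma abs_inverse_diff_le:
 fixes x y :: real
 assumes "1 <= x" "1 <= y"
 shows "\<bar>1 / x - 1 / y\<bar> <= \<bar>x - y\<bar>"
proof -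
 have "x * y \<ge> 1" using mult_mono[OF assms] assms by simp
 have "1 / x - 1 / y = (y - x) / (x * y)"
  using assms by (simp add: field_simps)
 then have "\<bar>1 / x - 1 / y\<bar> = \<bar>x - y\<bar> / (x * y)" using assms by (simp add: abs_mult abs_minus_commute)
 also have "\<dots> <= \<bar>x - y\<bar> / 1" using \<open>x * y \<ge> 1\<close> by (intro divide_left_mono) auto
 finally show ?thesis by simp
qed

locale one_sided_field =
 fixes T :: real
  and b :: "real => real^'n => real^'n"
  and C0 C1 :: "real => real"
 assumes T_pos: "T > 0"
  and b_meas: "(%(t, x). b t x) \<in> borel_measurable (lebesgue_on ({0..T} \<times> UNIV))"
  and C0_int: "C0 absolutely_integrable_on {0..T}" and C0_nonneg: "\<And>t. t \<in> {0..T} ==> C0 t \<ge> 0"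
  and C1_int: "C1 absolutely_integrable_on {0..T}" and C1_nonneg: "\<And>t. t \<in> {0..T} ==> C1 t \<ge> 0"
  and growth: "\<And>t x. t \<in> {0..T} ==> norm (b t x) <= C0 t * (1 + norm x)"
  and one_sided: "\<And>t x y. t \<in> {0..T} ==>
      (b t x - b t y) \<bullet> (x - y) \<ge> - C1 t * (norm (x - y))\<^sup>2"
begin

text \<open>For fixed \<open>z\<close> the inequality describes a half-space of vectors
  \<open>v\<close>. Limit points of \<open>b\<close> lie in it by continuity, and by convexity so
  does their hull.\<close>

lemma filippov_hull_one_sided:
 assumes t: "t \<in> {0..T}" and v: "v \<in> filippov_hull b t x"
 shows "(b t z - v) \<bullet> (z - x) \<ge> - C1 t * (norm (z - x))\<^sup>2"
proof -
 let ?H = "{v. (z - x) \<bullet> v <= (z - x) \<bullet> b t z + C1 t * (norm (z - x))\<^sup>2}"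
 have "filippov_hull b t x \<subseteq> ?H"
  unfolding filippov_hull_def
 proof (rule hull_minimal[of _ _ convex])
  show "convex ?H" by (rule convex_halfspace_le)
  show "{v. \<exists>y. filterlim y (at x) sequentially \<and> (%n. b t (y n)) \<longlonglongrightarrow> v} \<subseteq> ?H"
  proof clarify
   fix v and y :: "nat => real^'n"
   assume y: "filterlim y (at x) sequentially" and bv: "(%n. b t (y n)) \<longlonglongrightarrow> v"
   have y': "y \<longlonglongrightarrow> x" using y by (simp add: filterlim_at)
   have "(%n. (b t z - b t (y n)) \<bullet> (z - y n) + C1 t * (norm (z - y n))\<^sup>2) \<longlonglongrightarrow> (b t z - v) \<bullet> (z - x) + C1 t * (norm (z - x))\<^sup>2"
    by (intro tendsto_intros bv y')
   then have "0 <= (b t z - v) \<bullet> (z - x) + C1 t * (norm (z - x))\<^sup>2"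
   proof (rule LIMSEQ_le_const)
    have "0 <= (b t z - b t (y n)) \<bullet> (z - y n) + C1 t * (norm (z - y n))\<^sup>2" for n
     using one_sided[OF t, of z "y n"] by simp
    then show "\<exists>N. \<forall>n\<ge>N. 0 <= (b t z - b t (y n)) \<bullet> (z - y n) + C1 t * (norm (z - y n))\<^sup>2" by blast
   qed
   then show "(z - x) \<bullet> v <= (z - x) \<bullet> b t z + C1 t * (norm (z - x))\<^sup>2"
    by (simp add: inner_diff_left inner_diff_right inner_commute)
  qed
 qed
 then show ?thesis using v by (auto simp: inner_diff_left inner_diff_right inner_commute)
qed

lemma filippov_hull_growth:
 assumes t: "t \<in> {0..T}" and v: "v \<in> filippov_hull b t x"
 shows "norm v <= C0 t * (1 + norm x)"
proof -
 have "filippov_hull b t x \<subseteq> cball 0 (C0 t * (1 + norm x))"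
  unfolding filippov_hull_def
 proof (rule hull_minimal[of _ _ convex])
  show "{v. \<exists>y. filterlim y (at x) sequentially \<and> (%n. b t (y n)) \<longlonglongrightarrow> v} \<subseteq> cball 0 (C0 t * (1 + norm x))"
  proof clarify
   fix v and y :: "nat => real^'n"
   assume y: "filterlim y (at x) sequentially" and bv: "(%n. b t (y n)) \<longlonglongrightarrow> v"
   have y': "y \<longlonglongrightarrow> x" using y by (simp add: filterlim_at)
   have "norm v <= C0 t * (1 + norm x)"
    by (rule LIMSEQ_le[of "%n. norm (b t (y n))" _ "%n. C0 t * (1 + norm (y n))"])
      (intro tendsto_intros bv y', intro tendsto_intros bv y', use growth[OF t] in auto)
   then show "v \<in> cball 0 (C0 t * (1 + norm x))" by simp
  qed
 qed simp
 then show ?thesis using v by auto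
qed

text \<open>The half-space argument once more: now \<open>w\<close> is fixed, and
  \<open>filippov_hull_one_sided\<close> takes the role of the pointwise condition along points that
  tend to \<open>x\<close>.\<close>

lemma filippov_hull_one_sided2:
 assumes t: "t \<in> {0..T}" and v: "v \<in> filippov_hull b t x" and w: "w \<in> filippov_hull b t y"
 shows "(v - w) \<bullet> (x - y) \<ge> - C1 t * (norm (x - y))\<^sup>2"
proof -
 let ?H = "{v. (x - y) \<bullet> v \<ge> (x - y) \<bullet> w - C1 t * (norm (x - y))\<^sup>2}"
 have "filippov_hull b t x \<subseteq> ?H"
  unfolding filippov_hull_def[of b t x]
 proof (rule hull_minimal[of _ _ convex])
  show "convex ?H" by (rule convex_halfspace_ge)
  show "{v. \<exists>y. filterlim y (at x) sequentially \<and> (%n. b t (y n)) \<longlonglongrightarrow> v} \<subseteq> ?H"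
  proof clarify
   fix v and z :: "nat => real^'n"
   assume z: "filterlim z (at x) sequentially" and bv: "(%n. b t (z n)) \<longlonglongrightarrow> v"
   have z': "z \<longlonglongrightarrow> x" using z by (simp add: filterlim_at)
   have "(%n. (b t (z n) - w) \<bullet> (z n - y) + C1 t * (norm (z n - y))\<^sup>2) \<longlonglongrightarrow> (v - w) \<bullet> (x - y) + C1 t * (norm (x - y))\<^sup>2"
    by (intro tendsto_intros bv z')
   then have "0 <= (v - w) \<bullet> (x - y) + C1 t * (norm (x - y))\<^sup>2"
   proof (rule LIMSEQ_le_const)
    have "0 <= (b t (z n) - w) \<bullet> (z n - y) + C1 t * (norm (z n - y))\<^sup>2" for n
     using filippov_hull_one_sided[OF t w, of "z n"] by simp
    then show "\<exists>N. \<forall>n\<ge>N. 0 <= (b t (z n) - w) \<bullet> (z n - y) + C1 t * (norm (z n - y))\<^sup>2" by blast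
   qed
   then show "(x - y) \<bullet> v \<ge> (x - y) \<bullet> w - C1 t * (norm (x - y))\<^sup>2"
    by (simp add: inner_diff_left inner_diff_right inner_commute)
  qed
 qed
 then show ?thesis using v by (auto simp: inner_diff_left inner_diff_right inner_commute)
qed

end

locale backward_flow = one_sided_field T b C0 C1
 for T and b :: "real => real^'n => real^'n" and C0 C1 +
 fixes \<phi> :: "real => real => real^'n => real^'n"
 assumes flow: "backward_filippov_flow T b \<phi>"
begin

definition is_traj :: "real => real => (real => real^'n) => bool" where
 "is_traj s t y \<longleftrightarrow> abs_continuous_on s t y \<and>
   (AE r in lebesgue_on {s..t}. \<exists>v\<in>filippov_hull b r (y r). (y has_vector_derivative v) (at r within {s..t}))"

lemma is_traj_subinterval:
 assumes "is_traj s t y" "s <= r" "q <= t"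
 shows "is_traj r q y"
proof -
 have sub: "{r..q} \<subseteq> {s..t}" using assms by auto
 have "AE x in lebesgue. x \<in> {s..t} --> (\<exists>v\<in>filippov_hull b x (y x). (y has_vector_derivative v) (at x within {s..t}))"
  using assms(1) unfolding is_traj_def by (subst (asm) AE_restrict_space_iff) auto
 then have "AE x in lebesgue. x \<in> {r..q} --> (\<exists>v\<in>filippov_hull b x (y x). (y has_vector_derivative v) (at x within {r..q}))"
 proof (rule AE_mp, intro AE_I2 impI)
  fix x assume "x \<in> {s..t} --> (\<exists>v\<in>filippov_hull b x (y x). (y has_vector_derivative v) (at x within {s..t}))" "x \<in> {r..q}"
  then obtain v where "v\<in>filippov_hull b x (y x)" "(y has_vector_derivative v) (at x within {s..t})" using sub by blast
  then show "\<exists>v\<in>filippov_hull b x (y x). (y has_vector_derivative v) (at x within {r..q})"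
   by (intro bexI[of _ v] has_vector_derivative_within_subset[OF _ sub])
 qed
 then have "AE x in lebesgue_on {r..q}. \<exists>v\<in>filippov_hull b x (y x). (y has_vector_derivative v) (at x within {r..q})"
  by (subst AE_restrict_space_iff) auto
 then show ?thesis
  using assms abs_continuous_on_subinterval unfolding is_traj_def by blast
qed

lemma is_traj_flow:
 assumes "0 <= s" "s <= t" "t <= T"
 shows "is_traj s t (%r. \<phi> r t x)"
proof (rule is_traj_subinterval[OF _ assms(1) order_refl])
 show "is_traj 0 t (%r. \<phi> r t x)"
  using flow assms unfolding backward_filippov_flow_def is_traj_def by auto
qed

lemma flow_self: "0 <= t ==> t <= T ==> \<phi> t t x = x"
 using flow unfolding backward_filippov_flow_def by auto

lemma AE_interval_mp:
 assumes "AE r in lebesgue_on {s..t::real}. P r" "\<And>r. r \<in> {s..t} ==> P r ==> Q r"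
 shows "AE r in lebesgue_on {s..t}. Q r"
 using assms(1) by (rule AE_mp) (use assms(2) in \<open>auto simp: space_restrict_space\<close>)

lemma integral_C_subinterval:
 assumes c: "c absolutely_integrable_on {0..T}" "\<And>t. t \<in> {0..T} ==> c t \<ge> (0::real)" and st: "0 <= s" "t <= T"
 shows "c absolutely_integrable_on {s..t}" "integral {s..t} c <= integral {0..T} c" "c integrable_on {s..t}" "0 <= integral {s..t} c"
proof -
 have sub: "{s..t} \<subseteq> {0..T}" using st by auto
 show 1: "c absolutely_integrable_on {s..t}" by (rule absolutely_integrable_on_subinterval[OF c(1) sub])
 then show 2: "c integrable_on {s..t}" by (rule set_lebesgue_integral_eq_integral(1))
 show "integral {s..t} c <= integral {0..T} c"
  by (rule integral_subset_le[OF sub 2 set_lebesgue_integral_eq_integral(1)[OF c(1)]]) (use c in auto)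
 show "0 <= integral {s..t} c" by (rule integral_nonneg[OF 2]) (use c sub in auto)
qed

text \<open>The factor from \<open>gronwall_backward\<close>. The exponent is the number of pieces
  of mass 1/2 for the whole interval, rounded up, so one constant serves all subintervals.\<close>

definition Kc :: "(real => real) => real" where
 "Kc c = 2 ^ nat \<lceil>2 * integral {0..T} c\<rceil>"

lemma gronwall_traj:
 assumes c: "c absolutely_integrable_on {0..T}" "\<And>t. t \<in> {0..T} ==> c t \<ge> (0::real)" and st: "0 <= s" "s <= t" "t <= T"
  and ac: "abs_continuous_on s t E" and E0: "\<And>r. 0 <= E r"
  and der: "AE r in lebesgue_on {s..t}. \<exists>v. (E has_vector_derivative v) (at r within {s..t}) \<and> - v <= c r * E r"
 shows "E s <= Kc c * E t"
 unfolding Kc_def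
proof (rule gronwall_backward_AE[OF ac E0 _ _ der st(2)])
 show "c absolutely_integrable_on {s..t}" by (rule integral_C_subinterval[OF c st(1,3)])
 show "0 <= c r" if "r \<in> {s..t}" for r using that c(2) st by auto
 have "integral {s..t} c <= integral {0..T} c" by (rule integral_C_subinterval[OF c st(1,3)])
 also have "\<dots> <= real (nat \<lceil>2 * integral {0..T} c\<rceil>) / 2" by linarith
 finally show "integral {s..t} c <= real (nat \<lceil>2 * integral {0..T} c\<rceil>) / 2" .
qed

lemma norm_le_1_plus_power2: "norm x <= 1 + (norm x)\<^sup>2"
proof -
 have "0 <= (norm x - 1)\<^sup>2" by simp
 then show ?thesis unfolding power2_diff using norm_ge_zero[of x] by (simp, linarith)
qed

lemma norm_plus_power2_le: "norm x + (norm x)\<^sup>2 <= 2 * (1 + (norm x)\<^sup>2)"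
 using norm_le_1_plus_power2[of x] zero_le_power2[of "norm x"] by argo

lemma has_vector_derivative_norm_power2:
 assumes "(w has_vector_derivative (v::real^'n)) (at r within S)"
 shows "((%r. (norm (w r))\<^sup>2) has_vector_derivative 2 * (v \<bullet> w r)) (at r within S)"
proof -
 have "((%r. w r \<bullet> w r) has_derivative (%h. w r \<bullet> (h *\<^sub>R v) + (h *\<^sub>R v) \<bullet> w r)) (at r within S)"
  using assms unfolding has_vector_derivative_def by (intro has_derivative_inner)
 then show ?thesis
  unfolding has_vector_derivative_def power2_norm_eq_inner
  by (rule has_derivative_eq_rhs) (auto simp: inner_commute algebra_simps)
qed

text \<open>The squared distance has derivative at least \<open>- 2 * C1\<close> times itself, so
  its value at the earlier time is controlled by the one at the later time. Uniqueness and the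
  Lipschitz bound of the flow both come from here. The opposite control is not to be had, since
  distinct points may be carried into one as time decreases.\<close>

lemma traj_dist:
 assumes st: "0 <= s" "s <= t" "t <= T" and y: "is_traj s t y" and z: "is_traj s t z"
 shows "(norm (y s - z s))\<^sup>2 <= Kc (%r. 2 * C1 r) * (norm (y t - z t))\<^sup>2"
proof (rule gronwall_traj[where c = "%r. 2 * C1 r" and E = "%r. (norm (y r - z r))\<^sup>2", OF _ _ st])
 show "0 <= (norm (y r - z r))\<^sup>2" for r by simp
 show "(%r. 2 * C1 r) absolutely_integrable_on {0..T}" by (rule set_integrable_mult_right) (rule C1_int)
 show "0 <= 2 * C1 t" if "t \<in> {0..T}" for t using C1_nonneg[OF that] by simp
 show "abs_continuous_on s t (%r. (norm (y r - z r))\<^sup>2)"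
  using y z unfolding is_traj_def by (intro abs_continuous_on_power2_norm abs_continuous_on_diff) auto
 define P where "P r \<longleftrightarrow> (\<exists>v\<in>filippov_hull b r (y r). (y has_vector_derivative v) (at r within {s..t})) \<and>
   (\<exists>v\<in>filippov_hull b r (z r). (z has_vector_derivative v) (at r within {s..t}))" for r
 define Q where "Q r \<longleftrightarrow> (\<exists>v. ((%r. (norm (y r - z r))\<^sup>2) has_vector_derivative v) (at r within {s..t})
    \<and> - v <= 2 * C1 r * (norm (y r - z r))\<^sup>2)" for r
 have "AE r in lebesgue_on {s..t}. P r"
  using y z unfolding is_traj_def P_def by auto
 moreover have "Q r" if r: "r \<in> {s..t}" and H: "P r" for r
 proof -
  from H obtain v w where v: "v\<in>filippov_hull b r (y r)" "(y has_vector_derivative v) (at r within {s..t})"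
   and w: "w\<in>filippov_hull b r (z r)" "(z has_vector_derivative w) (at r within {s..t})" unfolding P_def by blast
  have rT: "r \<in> {0..T}" using r st by auto
  have d: "((%r. (norm (y r - z r))\<^sup>2) has_vector_derivative 2 * ((v - w) \<bullet> (y r - z r))) (at r within {s..t})"
   by (rule has_vector_derivative_norm_power2[OF has_vector_derivative_diff[OF v(2) w(2)]])
  have e: "- (2 * ((v - w) \<bullet> (y r - z r))) <= 2 * C1 r * (norm (y r - z r))\<^sup>2"
   using filippov_hull_one_sided2[OF rT v(1) w(1)] by simp
  show ?thesis unfolding Q_def by (rule exI, rule conjI, rule d, rule e)
 qed
 ultimately have "AE r in lebesgue_on {s..t}. Q r"
  by (rule AE_interval_mp)
 then show "AE r in lebesgue_on {s..t}. \<exists>v. ((%r. (norm (y r - z r))\<^sup>2) has_vector_derivative v) (at r within {s..t})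
    \<and> - v <= 2 * C1 r * (norm (y r - z r))\<^sup>2" unfolding Q_def .
qed

text \<open>As functions of the earliest time both sides are trajectories, and they agree at time
  \<open>r\<close>.\<close>

lemma flow_compose:
 assumes st: "0 <= s" "s <= r" "r <= t" "t <= T"
 shows "\<phi> s t x = \<phi> s r (\<phi> r t x)"
proof -
 have "(norm (\<phi> s t x - \<phi> s r (\<phi> r t x)))\<^sup>2 <= Kc (%r. 2 * C1 r) * (norm (\<phi> r t x - \<phi> r r (\<phi> r t x)))\<^sup>2"
 proof (rule traj_dist[where y = "%q. \<phi> q t x" and z = "%q. \<phi> q r (\<phi> r t x)"])
  show "is_traj s r (%q. \<phi> q t x)"
   by (rule is_traj_subinterval[OF is_traj_flow order_refl st(3)]) (use st in auto)
  show "is_traj s r (%q. \<phi> q r (\<phi> r t x))" by (rule is_traj_flow) (use st in auto)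
 qed (use st in auto)
 then show ?thesis using flow_self[of r] st by simp
qed

definition KL :: real where "KL = sqrt (Kc (%r. 2 * C1 r))"

lemma Kc_ge_1: "Kc c \<ge> 1" unfolding Kc_def by simp

lemma KL_ge_1: "KL \<ge> 1" using Kc_ge_1 unfolding KL_def by simp

lemma flow_lipschitz:
 assumes st: "0 <= s" "s <= t" "t <= T"
 shows "norm (\<phi> s t x - \<phi> s t y) <= KL * norm (x - y)"
proof -
 have "(norm (\<phi> s t x - \<phi> s t y))\<^sup>2 <= Kc (%r. 2 * C1 r) * (norm (\<phi> t t x - \<phi> t t y))\<^sup>2"
  by (rule traj_dist[where y = "%q. \<phi> q t x" and z = "%q. \<phi> q t y", OF st is_traj_flow is_traj_flow]) (use st in auto)
 also have "\<dots> = (KL * norm (x - y))\<^sup>2"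
  using flow_self[of t] st Kc_ge_1[of "%r. 2 * C1 r"] by (simp add: KL_def power_mult_distrib)
 finally show ?thesis
  by (rule power2_le_imp_le) (use KL_ge_1 in auto)
qed

definition KR :: real where "KR = Kc (%r. 4 * C0 r)"

text \<open>\<open>1 + |y|^2\<close> satisfies a two-sided differential inequality, but the Gronwall
  lemma runs only backward in time; the second bound is therefore obtained by applying it to the
  reciprocal. It confines preimages of bounded sets to bounded sets.\<close>

lemma flow_growth:
 assumes st: "0 <= s" "s <= t" "t <= T"
 shows "1 + (norm (\<phi> s t x))\<^sup>2 <= KR * (1 + (norm x)\<^sup>2)" (is ?A)
  and "1 + (norm x)\<^sup>2 <= KR * (1 + (norm (\<phi> s t x))\<^sup>2)" (is ?B)
proof -
 let ?y = "%r. \<phi> r t x"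
 let ?N = "%r. 1 + (norm (?y r))\<^sup>2"
 have i: "(%r. 4 * C0 r) absolutely_integrable_on {0..T}" by (rule set_integrable_mult_right) (rule C0_int)
 have p: "0 <= 4 * C0 t" if "t \<in> {0..T}" for t using C0_nonneg[OF that] by simp
 have tr: "is_traj s t ?y" by (rule is_traj_flow[OF st])
 have acN: "abs_continuous_on s t ?N"
  by (rule abs_continuous_on_dominated[where M = 1, OF abs_continuous_on_power2_norm[of s t ?y]])
    (use tr in \<open>auto simp: is_traj_def\<close>)
 have N1: "?N r \<ge> 1" for r by simp
 have inv_le: "norm (1 / ?N v - 1 / ?N u) <= 1 * norm (?N v - ?N u)" for u v
  using abs_inverse_diff_le[OF N1 N1] by simp
 \<comment> \<open>The factor 4 arises from
   \<open>2 |v| |y| <= 2 C0 (|y| + |y|^2) <= 4 C0 (1 + |y|^2)\<close>.\<close>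
 have bound: "\<bar>2 * (v \<bullet> ?y r)\<bar> <= 4 * C0 r * ?N r" if "v \<in> filippov_hull b r (?y r)" "r \<in> {0..T}" for v r
 proof -
  have C: "0 <= C0 r" using C0_nonneg that by simp
  have "\<bar>v \<bullet> ?y r\<bar> <= norm v * norm (?y r)" by (rule Cauchy_Schwarz_ineq2)
  also have "\<dots> <= C0 r * (1 + norm (?y r)) * norm (?y r)"
   using filippov_hull_growth[OF that(2,1)] by (intro mult_right_mono) auto
  also have "\<dots> = C0 r * (norm (?y r) + (norm (?y r))\<^sup>2)" by (simp add: power2_eq_square algebra_simps)
  also have "\<dots> <= C0 r * (2 * ?N r)"
   by (rule mult_left_mono[OF norm_plus_power2_le C])
  finally show ?thesis by (simp add: abs_mult algebra_simps)
 qed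
 define P where "P r \<longleftrightarrow> (\<exists>v\<in>filippov_hull b r (?y r). (?y has_vector_derivative v) (at r within {s..t}))" for r
 have der: "AE r in lebesgue_on {s..t}. P r"
  using tr unfolding is_traj_def P_def by auto
 have derN: "(?N has_vector_derivative 2 * (v \<bullet> ?y r)) (at r within {s..t})"
  if "(?y has_vector_derivative v) (at r within {s..t})" for v r
  using has_vector_derivative_add[OF has_vector_derivative_const[of 1] has_vector_derivative_norm_power2[OF that]] by simp
 have "?N s <= KR * ?N t" unfolding KR_def
 proof (rule gronwall_traj[OF i p st acN])
  define Q where "Q r \<longleftrightarrow> (\<exists>v. (?N has_vector_derivative v) (at r within {s..t}) \<and> - v <= 4 * C0 r * ?N r)" for r
  have "Q r" if r: "r \<in> {s..t}" and H: "P r" for r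
  proof -
   from H obtain v where v: "v \<in> filippov_hull b r (?y r)" "(?y has_vector_derivative v) (at r within {s..t})"
    unfolding P_def by blast
   have rT: "r \<in> {0..T}" using r st by auto
   have le: "- (2 * (v \<bullet> ?y r)) <= 4 * C0 r * ?N r" using bound[OF v(1) rT] by linarith
   show ?thesis unfolding Q_def by (rule exI, rule conjI, rule derN[OF v(2)], rule le)
  qed
  with der have "AE r in lebesgue_on {s..t}. Q r" by (rule AE_interval_mp)
  then show "AE r in lebesgue_on {s..t}. \<exists>v. (?N has_vector_derivative v) (at r within {s..t}) \<and> - v <= 4 * C0 r * ?N r"
   unfolding Q_def .
 qed auto
 then show ?A using flow_self[of t x] st by simp
 have "1 / ?N s <= KR * (1 / ?N t)" unfolding KR_def
 proof (rule gronwall_traj[where E = "%r. 1 / ?N r", OF i p st])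
  show "abs_continuous_on s t (%r. 1 / ?N r)"
   by (rule abs_continuous_on_dominated[where M = 1, OF acN inv_le])
  define Q where "Q r \<longleftrightarrow> (\<exists>v. ((%r. 1 / ?N r) has_vector_derivative v) (at r within {s..t}) \<and> - v <= 4 * C0 r * (1 / ?N r))" for r
  have "Q r" if r: "r \<in> {s..t}" and H: "P r" for r
  proof -
   from H obtain v where v: "v \<in> filippov_hull b r (?y r)" "(?y has_vector_derivative v) (at r within {s..t})"
    unfolding P_def by blast
   have rT: "r \<in> {0..T}" using r st by auto
   have N0: "?N r > 0" by (simp add: add_pos_nonneg)
   have "((%r. 1 / ?N r) has_real_derivative (0 * ?N r - 1 * (2 * (v \<bullet> ?y r))) / (?N r * ?N r)) (at r within {s..t})"
    using derN[OF v(2)] N0 unfolding has_real_derivative_iff_has_vector_derivative[symmetric]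
    by (intro DERIV_divide DERIV_const) auto
   then have d: "((%r. 1 / ?N r) has_vector_derivative - (2 * (v \<bullet> ?y r)) / (?N r)\<^sup>2) (at r within {s..t})"
    unfolding has_real_derivative_iff_has_vector_derivative[symmetric] by (simp add: power2_eq_square)
   have "2 * (v \<bullet> ?y r) / (?N r)\<^sup>2 <= 4 * C0 r * ?N r / (?N r)\<^sup>2"
    using bound[OF v(1) rT] by (intro divide_right_mono) auto
   also have "4 * C0 r * ?N r / (?N r)\<^sup>2 = 4 * C0 r * (1 / ?N r)"
    using N0 by (simp add: power2_eq_square)
   finally have le: "- (- (2 * (v \<bullet> ?y r)) / (?N r)\<^sup>2) <= 4 * C0 r * (1 / ?N r)" by simp
   show ?thesis unfolding Q_def by (rule exI, rule conjI, rule d, rule le)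
  qed
  with der have "AE r in lebesgue_on {s..t}. Q r" by (rule AE_interval_mp)
  then show "AE r in lebesgue_on {s..t}. \<exists>v. ((%r. 1 / ?N r) has_vector_derivative v) (at r within {s..t}) \<and> - v <= 4 * C0 r * (1 / ?N r)"
   unfolding Q_def .
 qed (auto simp: add_pos_nonneg)
 moreover have "?N s > 0" "?N t > 0" by (auto simp: add_pos_nonneg)
 ultimately have "?N t <= KR * ?N s" by (simp add: field_simps)
 then show ?B using flow_self[of t x] st by simp
qed

lemma KR_ge_1: "KR \<ge> 1" unfolding KR_def by (rule Kc_ge_1)

lemma one_plus_norm_le: "1 + norm x <= 2 * (1 + (norm x)\<^sup>2)"
 using norm_le_1_plus_power2[of x] zero_le_power2[of "norm x"] by argo

text \<open>Measures the continuity in time by the mass of \<open>C0\<close> on the step, uniformly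
  on bounded sets. The increment bound is scalar, so it is applied in the directions
  \<open>e\<close> and \<open>- e\<close>; \<open>CARD('n)\<close> comes from summing over the
  coordinates.\<close>

lemma flow_displacement:
 assumes st: "0 <= s" "s <= t" "t <= T"
 shows "norm (\<phi> s t x - x) <= CARD('n) * ((2 * KR * (1 + (norm x)\<^sup>2)) * integral {s..t} C0)"
proof -
 let ?y = "%r. \<phi> r t x"
 let ?c = "2 * KR * (1 + (norm x)\<^sup>2)"
 have tr: "is_traj s t ?y" by (rule is_traj_flow[OF st])
 have "\<bar>(\<phi> s t x - x) \<bullet> e\<bar> <= ?c * integral {s..t} C0" if e: "norm e = 1" for e
 proof -
  have *: "?y t \<bullet> e - ?y s \<bullet> e <= integral {s..t} (%r. ?c * C0 r)" if e: "norm e = 1" for e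
  proof (rule abs_continuous_on_increment_le[OF st(2)])
   show "abs_continuous_on s t (%r. ?y r \<bullet> e)"
    by (rule abs_continuous_on_dominated[where M = 1 and g = ?y])
     (use tr Cauchy_Schwarz_ineq2[of _ e] e in \<open>auto simp: is_traj_def inner_diff_left[symmetric]\<close>)
   show "(%r. ?c * C0 r) integrable_on {s..t}"
    using integral_C_subinterval(3)[OF C0_int C0_nonneg st(1,3)] by (intro integrable_on_mult_right) auto
   define P where "P r \<longleftrightarrow> (\<exists>v\<in>filippov_hull b r (?y r). (?y has_vector_derivative v) (at r within {s..t}))" for r
   define Q where "Q r \<longleftrightarrow> (\<exists>v. ((%r. ?y r \<bullet> e) has_vector_derivative v) (at r within {s..t}) \<and> v <= ?c * C0 r)" for r
   have "AE r in lebesgue_on {s..t}. P r"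
    using tr unfolding is_traj_def P_def by auto
   moreover have "Q r" if r: "r \<in> {s..t}" and H: "P r" for r
   proof -
    from H obtain v where v: "v \<in> filippov_hull b r (?y r)" "(?y has_vector_derivative v) (at r within {s..t})"
     unfolding P_def by blast
    have rT: "r \<in> {0..T}" using r st by auto
    have d: "((%r. ?y r \<bullet> e) has_vector_derivative (v \<bullet> e)) (at r within {s..t})"
     using bounded_linear.has_vector_derivative[OF bounded_linear_inner_left v(2)] .
    have le: "v \<bullet> e <= ?c * C0 r"
    proof -
     have "v \<bullet> e <= norm v" using Cauchy_Schwarz_ineq2[of v e] e by simp
     also have "\<dots> <= C0 r * (1 + norm (?y r))" by (rule filippov_hull_growth[OF rT v(1)])
     also have "\<dots> <= C0 r * ?c"
     proof (rule mult_left_mono[OF _ C0_nonneg[OF rT]])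
      have "1 + norm (?y r) <= 2 * (1 + (norm (?y r))\<^sup>2)"
       by (rule one_plus_norm_le)
      also have "\<dots> <= ?c" using flow_growth(1)[of r t x] r st by auto
      finally show "1 + norm (?y r) <= ?c" .
     qed
     finally show ?thesis by (simp add: mult.commute)
    qed
    show ?thesis unfolding Q_def by (rule exI, rule conjI, rule d, rule le)
   qed
   ultimately have "AE r in lebesgue_on {s..t}. Q r" by (rule AE_interval_mp)
   then show "AE r in lebesgue_on {s..t}. \<exists>v. ((%r. ?y r \<bullet> e) has_vector_derivative v) (at r within {s..t}) \<and> v <= ?c * C0 r"
    unfolding Q_def .
  qed
  have int: "integral {s..t} (%r. ?c * C0 r) = ?c * integral {s..t} C0" by (rule integral_mult_right)
  have tt: "?y t = x" using flow_self[of t x] st by simp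
  have e': "norm (- e) = 1" using e by simp
  show ?thesis using *[OF e] *[OF e'] unfolding int tt
   by (simp add: abs_le_iff inner_diff_left)
 qed
 then have "(\<Sum>i\<in>Basis. \<bar>(\<phi> s t x - x) \<bullet> i\<bar>) <= (\<Sum>i\<in>(Basis::(real^'n) set). ?c * integral {s..t} C0)"
  by (intro sum_mono) auto
 then show ?thesis using norm_le_l1[of "\<phi> s t x - x"] by simp
qed

text \<open>Continuity in time at each point, combined with a Lipschitz bound in space that is
  uniform in time. This allows time to serve as a homotopy parameter.\<close>

lemma flow_continuous_joint:
 assumes "0 <= t" "t <= T"
 shows "continuous_on ({0..t} \<times> UNIV) (%(r, x). \<phi> r t x)"
proof -
 have "continuous_on ({0..t} \<times> (UNIV :: (real^'n) set)) (%z. \<phi> (fst z) t (snd z))"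
  unfolding continuous_on_iff
 proof (intro ballI allI impI)
  fix z :: "real \<times> (real^'n)" and e::real assume z: "z \<in> {0..t} \<times> UNIV" and e: "e > 0"
  have "continuous_on {0..t} (%r. \<phi> r t (snd z))"
   using is_traj_flow[of 0 t] assms unfolding is_traj_def by (intro abs_continuous_on_imp_continuous_on) auto
  then obtain d where d: "d > 0" "\<And>r. r \<in> {0..t} ==> dist r (fst z) < d ==> dist (\<phi> r t (snd z)) (\<phi> (fst z) t (snd z)) < e / 2"
  proof -
   have "fst z \<in> {0..t}" "e / 2 > 0" using z e by auto
   with \<open>continuous_on {0..t} (%r. \<phi> r t (snd z))\<close> show ?thesis
    unfolding continuous_on_iff using that by blast
  qed
  define d' where "d' = min d (e / (2 * KL))"
  have d': "d' > 0" using d e KL_ge_1 by (auto simp: d'_def)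
  show "\<exists>d>0. \<forall>x'\<in>{0..t} \<times> UNIV. dist x' z < d --> dist (\<phi> (fst x') t (snd x')) (\<phi> (fst z) t (snd z)) < e"
  proof (intro exI[of _ d'] conjI d' ballI impI)
   fix w :: "real \<times> (real^'n)" assume w: "w \<in> {0..t} \<times> UNIV" "dist w z < d'"
   have 1: "dist (fst w) (fst z) < d" "dist (snd w) (snd z) < e / (2 * KL)"
    using w(2) dist_fst_le[of w z] dist_snd_le[of w z] by (auto simp: d'_def)
   have "dist (\<phi> (fst w) t (snd w)) (\<phi> (fst w) t (snd z)) <= KL * dist (snd w) (snd z)"
    unfolding dist_norm using w assms by (intro flow_lipschitz) auto
   also have "\<dots> < KL * (e / (2 * KL))" using 1 KL_ge_1 by (intro mult_strict_left_mono) auto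
   also have "\<dots> = e / 2" using KL_ge_1 by (simp add: field_simps)
   finally have "dist (\<phi> (fst w) t (snd w)) (\<phi> (fst w) t (snd z)) < e / 2" .
   moreover have "dist (\<phi> (fst w) t (snd z)) (\<phi> (fst z) t (snd z)) < e / 2" using d(2)[of "fst w"] w 1 by auto
   ultimately show "dist (\<phi> (fst w) t (snd w)) (\<phi> (fst z) t (snd z)) < e"
    using dist_triangle[of "\<phi> (fst w) t (snd w)" "\<phi> (fst z) t (snd z)" "\<phi> (fst w) t (snd z)"] by linarith
  qed
 qed
 then show ?thesis by (simp add: case_prod_unfold)
qed

end

section \<open>Homotopy classes of linear isomorphisms\<close>

abbreviation homotopic_nz :: "(real^'n => real^'n) => (real^'n => real^'n) => bool" where
 "homotopic_nz f g \<equiv> homotopic_with_canon (%_. True) (- {0}) (- {0}) f g"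

lemma homotopic_canonI:
 assumes "continuous_on ({0..1::real} \<times> S) h" "\<And>t x. t \<in> {0..1} ==> x \<in> S ==> h (t, x) \<in> Y"
  "\<And>x. x \<in> S ==> h (0, x) = f x" "\<And>x. x \<in> S ==> h (1, x) = g x"
 shows "homotopic_with_canon (%_. True) S Y f g"
proof -
 have "continuous_map (prod_topology (top_of_set {0..1}) (top_of_set S)) (top_of_set Y) h"
  using assms(1,2) by (auto simp: continuous_map_in_subtopology image_subset_iff Pi_iff)
 then have "\<exists>h :: real \<times> _ => _. continuous_map (prod_topology (top_of_set {0..1}) (top_of_set S)) (top_of_set Y) h \<and>
    (\<forall>x \<in> topspace (top_of_set S). h (0, x) = f x) \<and> (\<forall>x \<in> topspace (top_of_set S). h (1, x) = g x) \<and> (\<forall>t \<in> {0..1::real}. True)"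
  using assms(3,4) by (intro exI) (auto simp only: topspace_euclidean_subtopology)
 then show ?thesis
  using homotopic_with[where P = "%_. True" and X = "top_of_set S" and Y = "top_of_set Y" and p = f and q = g] by blast
qed

definition flip_coords :: "'n set => real^'n => real^'n" where
 "flip_coords S x = (\<chi> i. if i \<in> S then - x $ i else x $ i)"

lemma linear_flip_coords: "linear (flip_coords S)"
 by (rule linearI) (auto simp: flip_coords_def vec_eq_iff)

lemma flip_coords_nz [simp]: "flip_coords S x = 0 \<longleftrightarrow> x = 0"
 by (auto simp: flip_coords_def vec_eq_iff)

lemma homotopic_nz_refl_linear: "linear f ==> (\<And>x. f x = 0 ==> x = 0) ==> homotopic_nz f f"
 by (rule homotopic_with_equal) (auto simp: continuous_map_in_subtopology linear_continuous_on linear_conv_bounded_linear)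

definition rot_coords :: "'n => 'n => real => real^'n => real^'n" where
 "rot_coords m n \<theta> x = (\<chi> i. if i = m then cos \<theta> * x $ m - sin \<theta> * x $ n
   else if i = n then sin \<theta> * x $ m + cos \<theta> * x $ n else x $ i)"

lemma rotation_sum_squares:
 "(c * u - s * v)\<^sup>2 + (s * u + c * v)\<^sup>2 = (s\<^sup>2 + c\<^sup>2) * (u\<^sup>2 + v\<^sup>2)" for c s u v :: real
 by (simp add: power2_eq_square algebra_simps)

lemma rot_coords_homotopic:
 assumes "m ~= n"
 shows "homotopic_nz (rot_coords m n \<theta>) id"
proof (rule homotopic_canonI[where h = "%z. rot_coords m n ((1 - fst z) * \<theta>) (snd z)"])
 show "continuous_on ({0..1} \<times> - {0}) (%z. rot_coords m n ((1 - fst z) * \<theta>) (snd z))"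
  unfolding rot_coords_def
 proof (rule continuous_on_vec_lambda)
  fix i
  show "continuous_on ({0..1} \<times> - {0})
     (%z. if i = m then cos ((1 - fst z) * \<theta>) * snd z $ m - sin ((1 - fst z) * \<theta>) * snd z $ n
       else if i = n then sin ((1 - fst z) * \<theta>) * snd z $ m + cos ((1 - fst z) * \<theta>) * snd z $ n
         else snd z $ i)"
   by (cases "i = m"; cases "i = n") (auto intro!: continuous_intros)
 qed
next
 fix t :: real and x :: "real^'a" assume "x \<in> - {0}"
 let ?c = "cos ((1 - t) * \<theta>)" and ?s = "sin ((1 - t) * \<theta>)"
 have False if z: "rot_coords m n ((1 - t) * \<theta>) x = 0"
 proof -
  have comp: "rot_coords m n ((1 - t) * \<theta>) x $ i = 0" for i using z by simp
  have 1: "?c * x $ m - ?s * x $ n = 0" using comp[of m] by (simp add: rot_coords_def)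
  have 2: "?s * x $ m + ?c * x $ n = 0" using comp[of n] assms by (simp add: rot_coords_def)
  have 3: "x $ i = 0" if "i ~= m" "i ~= n" for i
   using comp[of i] that by (simp add: rot_coords_def)
  have "(?c * x $ m - ?s * x $ n)\<^sup>2 + (?s * x $ m + ?c * x $ n)\<^sup>2 = (?s\<^sup>2 + ?c\<^sup>2) * ((x $ m)\<^sup>2 + (x $ n)\<^sup>2)"
   by (rule rotation_sum_squares)
  then have "(x $ m)\<^sup>2 + (x $ n)\<^sup>2 = 0" using 1 2 by simp
  then have "x $ m = 0" "x $ n = 0" by (auto simp: sum_power2_eq_zero_iff)
  with 3 have "x $ i = 0" for i by (cases "i = m \<or> i = n") auto
  then have "x = 0" by (simp add: vec_eq_iff)
  with \<open>x \<in> - {0}\<close> show False by simp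
 qed
 then show "rot_coords m n ((1 - fst (t, x)) * \<theta>) (snd (t, x)) \<in> - {0}" by auto
qed (use assms in \<open>auto simp: rot_coords_def vec_eq_iff\<close>)

text \<open>Two coordinate reflections differ by the half turn in the plane of the two coordinates,
  and a rotation can be unwound.\<close>

lemma homotopic_nz_flip_single:
 "homotopic_nz (flip_coords {j}) (flip_coords {k :: 'n::finite})"
proof (cases "j = k")
 case False
 have 1: "rot_coords j k pi x = flip_coords {j} (flip_coords {k} x)" for x
  using False by (simp add: rot_coords_def flip_coords_def vec_eq_iff)
 have "homotopic_nz (rot_coords j k pi \<circ> flip_coords {k}) (id \<circ> flip_coords {k})"
  by (rule homotopic_compose[OF homotopic_nz_refl_linear rot_coords_homotopic[OF False]])
    (auto simp: linear_flip_coords)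
 moreover have "rot_coords j k pi \<circ> flip_coords {k} = flip_coords {j}"
 proof
  fix x
  have "flip_coords {k} (flip_coords {k} x) = x" by (simp add: flip_coords_def vec_eq_iff)
  then show "(rot_coords j k pi \<circ> flip_coords {k}) x = flip_coords {j} x" by (simp add: 1)
 qed
 ultimately show ?thesis by simp
next
 case True
 show ?thesis unfolding True by (rule homotopic_nz_refl_linear[OF linear_flip_coords]) simp
qed

text \<open>Chosen representatives of the two components of the general linear group.\<close>

definition orient :: "'n => real => real^'n => real^'n" where
 "orient k d = (if d > 0 then id else flip_coords {k})"

lemma orient_compose: "d ~= 0 ==> e ~= 0 ==> orient k d \<circ> orient k e = orient k (d * e)"
 by (auto simp: orient_def fun_eq_iff flip_coords_def vec_eq_iff zero_less_mult_iff)

lemma flip_coords_homotopic: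
 "finite S ==> homotopic_nz (flip_coords S) (orient k ((-1) ^ card S))"
proof (induction S rule: finite_induct)
 case empty
 have "flip_coords {} = (id :: real^'a => _)" by (auto simp: flip_coords_def fun_eq_iff vec_eq_iff)
 then show ?case by (auto simp: orient_def intro!: homotopic_nz_refl_linear linear_id)
next
 case (insert j S)
 have "homotopic_nz (flip_coords {j} \<circ> flip_coords S) (flip_coords {k} \<circ> orient k ((-1) ^ card S))"
  by (rule homotopic_compose[OF insert.IH homotopic_nz_flip_single])
 moreover have "flip_coords {j} \<circ> flip_coords S = flip_coords (insert j S)"
  using insert.hyps by (auto simp: fun_eq_iff flip_coords_def vec_eq_iff)
 moreover have "flip_coords {k} \<circ> orient k ((-1) ^ card S) = orient k ((-1) ^ card (insert j S))"
  using orient_compose[of "-1" "(-1) ^ card S" k] insert.hyps by (simp add: orient_def)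
 ultimately show ?case by simp
qed

text \<open>Induction over elementary maps. A diagonal map is joined to a diagonal matrix of signs
  by segments, a swap is a quarter turn followed by a reflection, and a shear is joined to the
  identity by segments. Under composition the representatives multiply like the signs of the
  determinants.\<close>

lemma linear_homotopic_orient:
 fixes f :: "real^'n => real^'n"
 assumes "linear f" "det (matrix f) ~= 0"
 shows "homotopic_nz f (orient k (det (matrix f)))"
proof -
 have "linear f \<and> (det (matrix f) ~= 0 --> homotopic_nz f (orient k (det (matrix f))))"
 proof (rule induct_linear_elementary[OF assms(1)])
  fix f g :: "real^'n => real^'n"
  assume "linear f" "linear g"
   and f: "linear f \<and> (det (matrix f) ~= 0 --> homotopic_nz f (orient k (det (matrix f))))"
   and g: "linear g \<and> (det (matrix g) ~= 0 --> homotopic_nz g (orient k (det (matrix g))))"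
  have m: "det (matrix (f \<circ> g)) = det (matrix f) * det (matrix g)"
   using matrix_compose[OF \<open>linear g\<close> \<open>linear f\<close>] by (simp add: det_mul)
  show "linear (f \<circ> g) \<and> (det (matrix (f \<circ> g)) ~= 0 --> homotopic_nz (f \<circ> g) (orient k (det (matrix (f \<circ> g)))))"
  proof (intro conjI impI linear_compose \<open>linear f\<close> \<open>linear g\<close>)
   assume "det (matrix (f \<circ> g)) ~= 0"
   then have nz: "det (matrix f) ~= 0" "det (matrix g) ~= 0" using m by auto
   then have "homotopic_nz (f \<circ> g) (orient k (det (matrix f)) \<circ> orient k (det (matrix g)))"
    using f g by (intro homotopic_compose) auto
   then show "homotopic_nz (f \<circ> g) (orient k (det (matrix (f \<circ> g))))"
    using orient_compose[OF nz, of k] m by simp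
  qed
 next
  fix f :: "real^'n => real^'n" and i
  assume f: "linear f" and 0: "\<And>x. f x $ i = 0"
  then have "\<not> inj f"
   by (metis (full_types) linear_injective_imp_surjective one_neq_zero surjE vec_component)
  then have "det (matrix f) = 0" using det_nz_iff_inj[OF f] by blast
  then show "linear f \<and> (det (matrix f) ~= 0 --> homotopic_nz f (orient k (det (matrix f))))" using f by simp
 next
  fix c :: "'n => real"
  let ?h = "%x::real^'n. \<chi> i. c i * x $ i"
  have lin: "linear ?h" by (rule linearI) (auto simp: vec_eq_iff algebra_simps)
  have det: "det (matrix ?h) = (\<Prod>i\<in>UNIV. c i)"
   by (simp add: axis_def matrix_def det_diagonal)
  show "linear ?h \<and> (det (matrix ?h) ~= 0 --> homotopic_nz ?h (orient k (det (matrix ?h))))"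
  proof (intro conjI impI lin)
   assume "det (matrix ?h) ~= 0"
   then have c: "c i ~= 0" for i using det by auto
   define S where "S = {i. c i < 0}"
   have h1: "homotopic_nz ?h (flip_coords S)"
   proof (rule homotopic_with_linear)
    show "continuous_on (- {0}) ?h" "continuous_on (- {0}) (flip_coords S)"
     using lin linear_flip_coords by (auto intro!: linear_continuous_on simp: linear_conv_bounded_linear)
    fix x :: "real^'n" assume x: "x \<in> - {0}"
    show "closed_segment (?h x) (flip_coords S x) \<subseteq> - {0}"
    proof
     fix y assume "y \<in> closed_segment (?h x) (flip_coords S x)"
     then obtain u where u: "0 <= u" "u <= 1" "y = (1 - u) *\<^sub>R ?h x + u *\<^sub>R flip_coords S x"
      unfolding closed_segment_def by blast
     obtain i where i: "x $ i ~= 0" using x by (auto simp: vec_eq_iff)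
     have "(1 - u) * \<bar>c i\<bar> + u > 0"
     proof (cases "u = 1")
      case False
      then have "(1 - u) * \<bar>c i\<bar> > 0" using u c[of i] by (intro mult_pos_pos) auto
      then show ?thesis using u by simp
     qed simp
     moreover have "y $ i = (if i \<in> S then -1 else 1) * ((1 - u) * \<bar>c i\<bar> + u) * x $ i"
      unfolding u(3) by (auto simp: flip_coords_def S_def algebra_simps)
     ultimately have "y $ i ~= 0" using i by auto
     then show "y \<in> - {0}" by auto
    qed
   qed
   have h2: "homotopic_nz (flip_coords S) (orient k ((-1) ^ card S))"
    by (rule flip_coords_homotopic) simp
   have h3: "orient k ((-1) ^ card S) = orient k (det (matrix ?h))"
   proof -
    have "(\<Prod>i\<in>UNIV. c i) = (\<Prod>i\<in>UNIV. (if i \<in> S then -1 else 1) * \<bar>c i\<bar>)"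
     by (intro prod.cong) (auto simp: S_def)
    also have "\<dots> = (-1) ^ card S * (\<Prod>i\<in>UNIV. \<bar>c i\<bar>)"
     by (simp add: prod.distrib prod.If_cases)
    finally have "det (matrix ?h) = (-1) ^ card S * (\<Prod>i\<in>UNIV. \<bar>c i\<bar>)" using det by simp
    moreover have "(\<Prod>i\<in>UNIV. \<bar>c i\<bar>) > 0" using c by (intro prod_pos) auto
    ultimately have "det (matrix ?h) > 0 \<longleftrightarrow> (-1::real) ^ card S > 0" by (simp add: zero_less_mult_iff)
    then show ?thesis by (simp add: orient_def)
   qed
   show "homotopic_nz ?h (orient k (det (matrix ?h)))" using homotopic_with_trans[OF h1 h2] unfolding h3 .
  qed
 next
  fix m n :: 'n assume mn: "m ~= n"
  let ?h = "%x::real^'n. \<chi> i. x $ Transposition.transpose m n i"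
  have lin: "linear ?h" by (rule linearI) (auto simp: vec_eq_iff)
  have "(\<chi> i j. if Transposition.transpose m n i = j then 1 else 0) = (\<chi> i j. if j = Transposition.transpose m n i then 1 else (0::real))"
   by (auto intro!: Cart_lambda_cong)
  then have "matrix ?h = Finite_Cartesian_Product.transpose (\<chi> i j. mat 1 $ i $ Transposition.transpose m n j)"
   by (auto simp: matrix_eq transpose_def axis_def mat_def matrix_def)
  then have det: "det (matrix ?h) = -1"
   using mn by (simp add: det_permute_columns permutes_swap_id sign_swap_id)
  have "homotopic_nz (flip_coords {m} \<circ> rot_coords m n (pi / 2)) (flip_coords {k} \<circ> id)"
   by (rule homotopic_compose[OF rot_coords_homotopic[OF mn] homotopic_nz_flip_single])
  moreover have "flip_coords {m} \<circ> rot_coords m n (pi / 2) = ?h"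
   using mn by (auto simp: fun_eq_iff flip_coords_def rot_coords_def vec_eq_iff Transposition.transpose_def)
  ultimately show "linear ?h \<and> (det (matrix ?h) ~= 0 --> homotopic_nz ?h (orient k (det (matrix ?h))))"
   using lin det by (simp add: orient_def)
 next
  fix m n :: 'n assume mn: "m ~= n"
  let ?h = "%x::real^'n. \<chi> i. if i = m then x $ m + x $ n else x $ i"
  have lin: "linear ?h" by (rule linearI) (auto simp: vec_eq_iff algebra_simps)
  have "matrix ?h = (\<chi> i. if i = m then row m (mat 1) + 1 *s row n (mat 1) else row i (mat 1))"
   by (auto simp: matrix_def axis_def mat_def row_def vec_eq_iff)
  then have det: "det (matrix ?h) = 1"
   using det_row_operation[OF mn, of "mat 1" "1::real"] by simp
  have "homotopic_nz ?h id"
  proof (rule homotopic_with_linear)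
   show "continuous_on (- {0}) ?h" using lin by (auto intro!: linear_continuous_on simp: linear_conv_bounded_linear)
   fix x :: "real^'n" assume x: "x \<in> - {0}"
   show "closed_segment (?h x) (id x) \<subseteq> - {0}"
   proof
    fix y assume "y \<in> closed_segment (?h x) (id x)"
    then obtain u where u: "y = (1 - u) *\<^sub>R ?h x + u *\<^sub>R x"
     unfolding closed_segment_def by auto
    have "y ~= 0"
    proof
     assume "y = 0"
     have ym: "y $ i = x $ i" if "i ~= m" for i unfolding u using that by (simp add: algebra_simps)
     then have x0: "x $ i = 0" if "i ~= m" for i using that \<open>y = 0\<close> by simp
     have "y $ m = x $ m + (1 - u) * x $ n" unfolding u by (simp add: algebra_simps)
     then have "x $ m = 0" using x0[of n] mn \<open>y = 0\<close> by simp
     then have "x = 0" using x0 by (metis vec_eq_iff zero_index)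
     then show False using x by simp
    qed
    then show "y \<in> - {0}" by simp
   qed
  qed simp
  then show "linear ?h \<and> (det (matrix ?h) ~= 0 --> homotopic_nz ?h (orient k (det (matrix ?h))))"
   using lin det by (simp add: orient_def)
 qed
 then show ?thesis using assms(2) by blast
qed

text \<open>The two maps have different Brouwer degrees. Since \<open>nsphere p\<close> consists of
  real sequences supported on \<open>{..p}\<close>, the maps \<open>F\<close> and \<open>G\<close>
  translate between it and the unit sphere along an enumeration \<open>e\<close> of the
  coordinates.\<close>

lemma flip_not_homotopic_id: "\<not> homotopic_with_canon (%_. True) (sphere 0 1) (sphere 0 1) id (flip_coords {k :: 'n::finite})"
proof
 assume hom: "homotopic_with_canon (%_. True) (sphere 0 1) (sphere 0 1) id (flip_coords {k})"
 define p where "p = CARD('n) - 1"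
 have p: "CARD('n) = Suc p" using zero_less_card_finite[where 'a='n] by (simp add: p_def)
 obtain e0 where e0: "bij_betw e0 {..<CARD('n)} (UNIV :: 'n set)"
  using ex_bij_betw_nat_finite[of "UNIV :: 'n set"] by (auto simp: atLeast0LessThan)
 obtain j where j: "j < CARD('n)" "e0 j = k" using e0 by (metis UNIV_I bij_betw_iff_bijections lessThan_iff)
 \<comment> \<open>The transposition brings \<open>k\<close> to index 0, the coordinate that
   \<open>Brouwer_degree2_reflection\<close> reverses.\<close>
 define e where "e = e0 \<circ> Transposition.transpose 0 j"
 have e: "bij_betw e {..p} (UNIV :: 'n set)"
 proof -
  have "bij_betw (Transposition.transpose 0 j) {..<CARD('n)} {..<CARD('n)}"
   using j permutes_imp_bij[OF permutes_swap_id[of 0 "{..<CARD('n)}" j]] by simp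
  then show ?thesis unfolding e_def using bij_betw_trans[OF _ e0] by (simp add: p lessThan_Suc_atMost)
 qed
 have ek: "e 0 = k" using j by (simp add: e_def)
 have inj: "i = i'" if "e i = e i'" "i <= p" "i' <= p" for i i'
  using e that by (auto simp: bij_betw_def inj_on_def)
 define F :: "(nat => real) => real^'n" where "F = (%x. \<Sum>i\<le>p. x i *\<^sub>R axis (e i) 1)"
 define G :: "real^'n => nat => real" where "G = (%y i. if i <= p then y $ e i else 0)"
 have Fe: "F x $ e i = x i" if "i <= p" for x i
 proof -
  have "F x $ e i = (\<Sum>i'\<le>p. if i' = i then x i' else 0)"
   unfolding F_def sum_component
  proof (rule sum.cong[OF refl])
   fix i' assume "i' \<in> {..p}"
   then have "e i = e i' \<longleftrightarrow> i' = i" using inj[of i i'] that by auto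
   then show "(x i' *\<^sub>R axis (e i') 1) $ e i = (if i' = i then x i' else 0)" by (simp add: axis_def)
  qed
  then show ?thesis using that by simp
 qed
 have sq: "(norm y)\<^sup>2 = (\<Sum>i\<le>p. (y $ e i)\<^sup>2)" for y :: "real^'n"
 proof -
  have "(norm y)\<^sup>2 = (\<Sum>i\<in>UNIV. (y $ i)\<^sup>2)" unfolding power2_norm_eq_inner by (simp add: inner_vec_def power2_eq_square)
  also have "\<dots> = (\<Sum>i\<le>p. (y $ e i)\<^sup>2)" by (rule sum.reindex_bij_betw[OF e, symmetric])
  finally show ?thesis .
 qed
 have ts: "x \<in> topspace (nsphere p) \<longleftrightarrow> (\<forall>i>p. x i = 0) \<and> (\<Sum>i\<le>p. (x i)\<^sup>2) = 1" for x
  by (auto simp: nsphere_def Euclidean_space_def)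
 have norm1: "norm y = 1 \<longleftrightarrow> (\<Sum>i\<le>p. (y $ e i)\<^sup>2) = 1" for y :: "real^'n"
  unfolding sq[symmetric] using norm_ge_zero[of y] by (simp only: power2_eq_1_iff) linarith
 have F: "continuous_map (nsphere p) (top_of_set (sphere 0 1)) F"
  unfolding continuous_map_in_subtopology
 proof
  show "continuous_map (nsphere p) euclidean F"
   unfolding F_def
  proof (intro continuous_map_sum)
   fix i
   have "continuous_map euclideanreal (euclidean :: (real^'n) topology) (%r. r *\<^sub>R axis (e i) 1)"
    by (simp add: continuous_intros)
   then have "continuous_map (nsphere p) euclidean ((%r. r *\<^sub>R axis (e i) (1::real)) \<circ> (%x. x i))"
    by (rule continuous_map_compose[OF continuous_map_nsphere_projection])
   then show "continuous_map (nsphere p) euclidean (%x. x i *\<^sub>R axis (e i) (1::real))" by (simp only: o_def)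
  qed simp
  show "F \<in> topspace (nsphere p) \<rightarrow> sphere 0 1" using Fe by (auto simp: ts norm1)
 qed
 have G: "continuous_map (top_of_set (sphere 0 1)) (nsphere p) G"
  unfolding nsphere continuous_map_in_subtopology
 proof
  show "continuous_map (top_of_set (sphere 0 1)) (powertop_real UNIV) G"
   unfolding continuous_map_componentwise_UNIV G_def
   by (auto intro!: continuous_intros)
  show "G \<in> topspace (top_of_set (sphere 0 1)) \<rightarrow> {x. (\<Sum>i\<le>p. (x i)\<^sup>2) = 1 \<and> (\<forall>i>p. x i = 0)}"
   by (auto simp: G_def norm1)
 qed
 have "homotopic_with (%_. True) (nsphere p) (nsphere p) (G \<circ> id \<circ> F) (G \<circ> flip_coords {k} \<circ> F)"
  using hom F G by (intro homotopic_with_compose_continuous_map_left[where p = "%_. True"] homotopic_with_compose_continuous_map_right[where p = "%_. True"]) auto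
 then have "Brouwer_degree2 p (G \<circ> id \<circ> F) = Brouwer_degree2 p (G \<circ> flip_coords {k} \<circ> F)"
  by (rule Brouwer_degree2_homotopic)
 moreover have "Brouwer_degree2 p (G \<circ> id \<circ> F) = Brouwer_degree2 p id"
  by (rule Brouwer_degree2_eq) (auto simp: G_def Fe ts fun_eq_iff)
 moreover have "Brouwer_degree2 p (G \<circ> flip_coords {k} \<circ> F) = Brouwer_degree2 p (%x i. if i = 0 then - x i else x i)"
 proof (rule Brouwer_degree2_eq)
  fix x assume "x \<in> topspace (nsphere p)"
  show "(G \<circ> flip_coords {k} \<circ> F) x = (%i. if i = 0 then - x i else x i)"
  proof
   fix i
   show "(G \<circ> flip_coords {k} \<circ> F) x i = (if i = 0 then - x i else x i)"
   proof (cases "i <= p")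
    case True
    have "e i = k \<longleftrightarrow> i = 0" using inj[of i 0] ek True by auto
    then show ?thesis using True by (auto simp: G_def Fe flip_coords_def)
   next
    case False
    then show ?thesis using \<open>x \<in> topspace (nsphere p)\<close> by (auto simp: G_def ts)
   qed
  qed
 qed
 ultimately show False by (simp add: Brouwer_degree2_reflection)
qed

lemma continuous_on_normalize: "continuous_on (- {0}) (%x::'a::real_normed_vector. x /\<^sub>R norm x)"
 by (auto intro!: continuous_intros)

text \<open>Otherwise \<open>f\<close>, and with it the identity, would be homotopic to a
  reflection; normalising vectors turns this into a homotopy within the sphere.\<close>

lemma det_pos_if_homotopic_id:
 fixes f :: "real^'n => real^'n"
 assumes f: "linear f" and det: "det (matrix f) ~= 0"
  and hom: "homotopic_with_canon (%_. True) (sphere 0 1) (- {0}) (%x. x) f"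
 shows "det (matrix f) > 0"
proof (rule ccontr)
 assume "\<not> det (matrix f) > 0"
 fix k :: 'n
 have "homotopic_with_canon (%_. True) (- {0}) (- {0}) f (flip_coords {k})"
  using linear_homotopic_orient[OF f det, of k] \<open>\<not> det (matrix f) > 0\<close> by (simp add: orient_def)
 then have "homotopic_with_canon (%_. True) (sphere 0 1) (- {0}) f (flip_coords {k})"
  by (rule homotopic_with_subset_left) auto
 with hom have "homotopic_with_canon (%_. True) (sphere 0 1) (- {0}) (%x. x) (flip_coords {k})"
  by (rule homotopic_with_trans)
 then have "homotopic_with_canon (%_. True) (sphere 0 1) (sphere 0 1)
   ((%x. x /\<^sub>R norm x) \<circ> (%x. x)) ((%x. x /\<^sub>R norm x) \<circ> flip_coords {k})"
  by (rule homotopic_with_compose_continuous_map_left[where p = "%_. True"])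
    (auto simp: continuous_map_in_subtopology continuous_on_normalize)
 then have "homotopic_with_canon (%_. True) (sphere 0 1) (sphere 0 1) id (flip_coords {k})"
 proof (rule homotopic_with_eq)
  fix x :: "real^'n" assume "x \<in> topspace (top_of_set (sphere 0 1))"
  then have x: "norm x = 1" by simp
  then show "id x = ((%x. x /\<^sub>R norm x) \<circ> (%x. x)) x" by simp
  have "(norm (flip_coords {k} x))\<^sup>2 = (norm x)\<^sup>2"
   unfolding power2_norm_eq_inner by (auto simp: inner_vec_def flip_coords_def intro!: sum.cong)
  then have "norm (flip_coords {k} x) = norm x" by (rule power2_eq_imp_eq) auto
  then have "norm (flip_coords {k} x) = 1" using x by simp
  then show "flip_coords {k} x = ((%x. x /\<^sub>R norm x) \<circ> flip_coords {k}) x" by simp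
 qed simp
 then show False using flip_not_homotopic_id by blast
qed

text \<open>Rescaling vectors to length \<open>r\<close> pushes the homotopy into the sphere, which
  would then be contractible.\<close>

lemma not_nullhomotopic_sphere:
 fixes a :: "'a::euclidean_space"
 assumes r: "r > 0" and hom: "homotopic_with_canon (%_. True) (sphere a r) (- {0}) (%x. x - a) (%x. c)"
 shows False
proof -
 define q where "q = (%x. a + r *\<^sub>R (x /\<^sub>R norm x))"
 have q: "continuous_map (top_of_set (- {0})) (top_of_set (sphere a r)) q"
  unfolding continuous_map_in_subtopology
 proof
  show "continuous_map (top_of_set (- {0})) euclidean q"
   unfolding q_def by (auto intro!: continuous_intros)
  show "q \<in> topspace (top_of_set (- {0})) \<rightarrow> sphere a r"
   using r by (auto simp: q_def dist_norm)
 qed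
 have "homotopic_with_canon (%_. True) (sphere a r) (sphere a r) (q \<circ> (%x. x - a)) (q \<circ> (%x. c))"
  by (rule homotopic_with_compose_continuous_map_left[OF hom q]) simp
 then have "homotopic_with_canon (%_. True) (sphere a r) (sphere a r) id (%x. q c)"
 proof (rule homotopic_with_eq)
  fix x assume "x \<in> topspace (top_of_set (sphere a r))"
  then have "norm (x - a) = r" by (simp add: dist_norm norm_minus_commute)
  then show "id x = (q \<circ> (%x. x - a)) x" using r by (simp add: q_def)
 qed simp_all
 then have "contractible (sphere a r)" unfolding contractible_def by blast
 then show False using r by (simp add: contractible_sphere)
qed

section \<open>Differentiability of Lipschitz functions\<close>

lemma emeasure_le_disjoint_UN:
 fixes I :: "'i => 'a set"
 assumes C: "countable C" and d: "disjoint_family_on I C" and m: "\<And>i. i \<in> C ==> I i \<in> sets M"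
  and sN: "sets N = sets M" and le: "\<And>i. i \<in> C ==> emeasure M (I i) <= c * emeasure N (I i)"
 shows "emeasure M (\<Union>i\<in>C. I i) <= c * emeasure N (\<Union>i\<in>C. I i)"
proof -
 have "emeasure M (\<Union>i\<in>C. I i) = (\<integral>\<^sup>+i. emeasure M (I i) \<partial>count_space C)"
  by (rule emeasure_UN_countable[OF m C d])
 also have "\<dots> <= (\<integral>\<^sup>+i. c * emeasure N (I i) \<partial>count_space C)"
  by (intro nn_integral_mono) (use le in auto)
 also have "\<dots> = c * (\<integral>\<^sup>+i. emeasure N (I i) \<partial>count_space C)"
  by (rule nn_integral_cmult) auto
 also have "(\<integral>\<^sup>+i. emeasure N (I i) \<partial>count_space C) = emeasure N (\<Union>i\<in>C. I i)"
  by (rule emeasure_UN_countable[symmetric, OF _ C d]) (use m sN in auto)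
 finally show ?thesis .
qed

text \<open>Intervals that contain \<open>x\<close>, possibly off centre, in the centre and radius
  form of the Vitali covering theorem; \<open>P\<close> restricts the slope of the chord over the
  interval.\<close>

definition slope_set :: "(real => real) => real set => real => (real \<times> real) set" where
 "slope_set g P x = {(a, r). 0 < r \<and> x \<in> cball a r \<and> (g (a + r) - g (a - r)) / (2 * r) \<in> P}"

text \<open>Short enough intervals around a point of \<open>E\<close> stay inside \<open>U\<close>,
  so the fine cover can be restricted to \<open>U\<close> before the covering theorem is
  applied.\<close>

lemma Vitali_slopes:
 fixes g :: "real => real"
 assumes U: "open U" and EU: "E \<subseteq> U"
  and E: "\<And>x d. x \<in> E ==> 0 < d ==> \<exists>(a, r) \<in> slope_set g P x. r < d"
 obtains C where "countable C" "disjoint_family_on (%(a, r). cball a r) C"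
  "negligible (E - (\<Union>(a, r)\<in>C. cball a r))" "(\<Union>(a, r)\<in>C. cball a r) \<subseteq> U"
  "\<And>a r. (a, r) \<in> C ==> 0 < r \<and> (g (a + r) - g (a - r)) / (2 * r) \<in> P"
proof -
 define K where "K = {(a, r). 0 < r \<and> cball a r \<subseteq> U \<and> (g (a + r) - g (a - r)) / (2 * r) \<in> P}"
 have r: "0 < snd i" if "i \<in> K" for i using that by (auto simp: K_def)
 have cov: "\<exists>i. i \<in> K \<and> x \<in> cball (fst i) (snd i) \<and> snd i < d" if x: "x \<in> E" and d: "0 < d" for x d
 proof -
  obtain e where e: "e > 0" "ball x e \<subseteq> U" using U EU x open_contains_ball by blast
  have "0 < min d (e / 2)" using d e by simp
  from E[OF x this] obtain a r where ar: "(a, r) \<in> slope_set g P x" "r < min d (e / 2)" by blast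
  have "cball a r \<subseteq> ball x e"
  proof
   fix y assume "y \<in> cball a r"
   then show "y \<in> ball x e" using ar by (auto simp: slope_set_def dist_real_def)
  qed
  then have "(a, r) \<in> K" using ar e by (auto simp: K_def slope_set_def)
  then show ?thesis using ar by (intro exI[of _ "(a, r)"]) (auto simp: slope_set_def)
 qed
 obtain C where C: "countable C" "C \<subseteq> K"
   "pairwise (%i j. disjnt (cball (fst i) (snd i)) (cball (fst j) (snd j))) C"
   "negligible (E - (\<Union>i \<in> C. cball (fst i) (snd i)))"
  using Vitali_covering_theorem_cballs[of K snd E fst, OF r cov] by blast
 show ?thesis
 proof (rule that[OF C(1)])
  show "disjoint_family_on (%(a, r). cball a r) C"
   using C(3) by (auto simp: disjoint_family_on_def pairwise_def disjnt_def case_prod_unfold)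
 qed (use C in \<open>auto simp: case_prod_unfold K_def\<close>)
qed

text \<open>Lebesgue's argument with the Stieltjes measure \<open>M\<close> of \<open>g\<close> and
  the outer measure \<open>m\<close> of \<open>E\<close>. Disjoint intervals of slope at most
  \<open>p\<close> cover almost all of \<open>E\<close> inside a nearly optimal open set; inside
  these, disjoint intervals of slope at least \<open>q\<close> cover almost all of \<open>E\<close>
  again. Comparing the two Stieltjes measures gives \<open>q * m <= p * m\<close>, hence
  \<open>m = 0\<close>.\<close>

lemma lipschitz_mono_slopes_negligible:
 fixes g :: "real => real"
 assumes mono: "\<And>x y. x <= y ==> g x <= g y" and cont: "continuous_on UNIV g"
  and pq: "0 <= p" "p < q"
  and bd: "bounded E"
  and lo: "\<And>x d. x \<in> E ==> 0 < d ==> \<exists>(a, r) \<in> slope_set g {..p} x. r < d"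
  and hi: "\<And>x d. x \<in> E ==> 0 < d ==> \<exists>(a, r) \<in> slope_set g {q..} x. r < d"
 shows "negligible E"
proof -
 define M where "M = interval_measure g"
 have sM: "sets M = sets lborel" by (simp add: M_def)
 have eM: "emeasure M (cball a r) = ennreal (g (a + r) - g (a - r))" if "0 < r" for a r :: real
  unfolding M_def cball_eq_atLeastAtMost using that by (intro emeasure_interval_measure_Icc mono cont) auto
 have eL: "emeasure lborel (cball a r) = ennreal (2 * r)" if "0 < r" for a r :: real
  unfolding cball_eq_atLeastAtMost using that by simp
 \<comment> \<open>Outer measure by open sets, as \<open>E\<close> is not known to be
   measurable.\<close>
 define m where "m = (INF U\<in>{U. open U \<and> E \<subseteq> U}. emeasure lborel U)"
 obtain R where R: "E \<subseteq> ball 0 R" using bd bounded_subset_ballD by blast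
 have mfin: "m < \<infinity>"
 proof -
  have "m <= emeasure lborel (ball (0::real) R)" unfolding m_def by (rule INF_lower) (use R in auto)
  also have "\<dots> < \<infinity>" using emeasure_lborel_ball_finite by simp
  finally show ?thesis .
 qed
 have mle: "m <= emeasure lborel G" if G: "G \<in> sets borel" "negligible (E - G)" for G
 proof (rule ennreal_le_epsilon)
  fix e :: real assume "0 < e"
  obtain B where B: "open B" "E - G \<subseteq> B" "emeasure lebesgue (B - (E - G)) < ennreal (e / 2)"
   by (rule sets_lebesgue_outer_open[OF negligible_imp_sets[OF G(2)] half_gt_zero[OF \<open>0 < e\<close>]])
  obtain A where A: "open A" "G \<subseteq> A" "emeasure lebesgue (A - G) < ennreal (e / 2)"
   by (rule sets_lebesgue_outer_open[of G, OF _ half_gt_zero[OF \<open>0 < e\<close>]]) (use G(1) in auto)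
  have eB: "emeasure lborel B <= ennreal (e / 2)"
  proof -
   have "emeasure lborel B = emeasure lebesgue B" using B(1) by simp
   also have "\<dots> = emeasure lebesgue (B - (E - G))"
    using G(2) B(1) by (intro emeasure_Diff_null_set[symmetric]) (auto simp: negligible_iff_null_sets)
   finally show ?thesis using B(3) by simp
  qed
  have eA: "emeasure lborel A <= emeasure lborel G + ennreal (e / 2)"
  proof -
   have "emeasure lborel A = emeasure lborel (G \<union> (A - G))" using A(2) by (simp add: Un_absorb1)
   also have "\<dots> <= emeasure lborel G + emeasure lborel (A - G)"
    using A(1) G(1) by (intro emeasure_subadditive) auto
   also have "emeasure lborel (A - G) = emeasure lebesgue (A - G)" using A(1) G(1) by simp
   finally show ?thesis using A(3) by (meson add_left_mono less_imp_le order_trans)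
  qed
  have "m <= emeasure lborel (A \<union> B)" unfolding m_def using A B by (intro INF_lower) auto
  also have "\<dots> <= emeasure lborel A + emeasure lborel B" using A B by (intro emeasure_subadditive) auto
  also have "\<dots> <= (emeasure lborel G + ennreal (e / 2)) + ennreal (e / 2)" using eA eB by (intro add_mono)
  also have "\<dots> = emeasure lborel G + ennreal e"
   using \<open>0 < e\<close> by (simp add: add.assoc flip: ennreal_plus)
  finally show "m <= emeasure lborel G + ennreal e" .
 qed
 have key: "ennreal q * m <= ennreal p * emeasure lborel U" if U: "open U" "E \<subseteq> U" for U
 proof -
  obtain C where C: "countable C" "disjoint_family_on (%(a, r). cball a r) C"
   "negligible (E - (\<Union>(a, r)\<in>C. cball a r))" "(\<Union>(a, r)\<in>C. cball a r) \<subseteq> U"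
   "\<And>a r. (a, r) \<in> C ==> 0 < r \<and> (g (a + r) - g (a - r)) / (2 * r) \<in> {..p}"
   using Vitali_slopes[OF U lo] by blast
  define G where "G = (\<Union>(a, r)\<in>C. cball a r)"
  \<comment> \<open>The second cover has to lie inside the first, so the intervals are opened; this
    loses only countably many end points.\<close>
  define V where "V = (\<Union>(a, r)\<in>C. ball a r)"
  have VG: "V \<subseteq> G" by (auto simp: V_def G_def)
  have Gb: "G \<in> sets borel" unfolding G_def using C(1) by (intro sets.countable_UN') auto
  have Vo: "open V" by (auto simp: V_def)
  have ends: "negligible (G - V)"
  proof (rule negligible_subset)
   show "negligible ((%(a, r). a + r) ` C \<union> (%(a, r). a - r) ` C)"
    unfolding negligible_iff_null_sets using C(1)
    by (intro null_sets_completionI countable_imp_null_set_lborel) auto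
   show "G - V \<subseteq> (%(a, r). a + r) ` C \<union> (%(a, r). a - r) ` C"
   proof
    fix x assume x: "x \<in> G - V"
    then obtain a r where ar: "(a, r) \<in> C" "x \<in> cball a r" by (auto simp: G_def)
    have "x \<notin> ball a r" using x ar by (auto simp: V_def)
    then have "x = a + r \<or> x = a - r" using ar by (auto simp: dist_real_def)
    then show "x \<in> (%(a, r). a + r) ` C \<union> (%(a, r). a - r) ` C" using ar by force
   qed
  qed
  have hi': "\<exists>(a, r) \<in> slope_set g {q..} x. r < d" if "x \<in> E \<inter> V" "0 < d" for x d
   by (rule hi) (use that in auto)
  obtain C' where C': "countable C'" "disjoint_family_on (%(a, r). cball a r) C'"
   "negligible (E \<inter> V - (\<Union>(a, r)\<in>C'. cball a r))" "(\<Union>(a, r)\<in>C'. cball a r) \<subseteq> V"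
   "\<And>a r. (a, r) \<in> C' ==> 0 < r \<and> (g (a + r) - g (a - r)) / (2 * r) \<in> {q..}"
   using Vitali_slopes[OF Vo Int_lower2 hi'] by blast
  define G' where "G' = (\<Union>(a, r)\<in>C'. cball a r)"
  have G'b: "G' \<in> sets borel" unfolding G'_def using C'(1) by (intro sets.countable_UN') auto
  have "negligible (E - G')"
  proof (rule negligible_subset)
   show "negligible ((E - G) \<union> (G - V) \<union> (E \<inter> V - G'))"
    using C(3) ends C'(3) by (auto simp: G_def G'_def)
   show "E - G' \<subseteq> (E - G) \<union> (G - V) \<union> (E \<inter> V - G')" by blast
  qed
  then have "ennreal q * m <= ennreal q * emeasure lborel G'" by (intro mult_left_mono mle G'b) auto
  also have "\<dots> <= ennreal 1 * emeasure M G'"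
  proof -
   have "emeasure (scale_measure (ennreal q) lborel) G' <= ennreal 1 * emeasure M G'"
    unfolding G'_def
   proof (rule emeasure_le_disjoint_UN[OF C'(1,2)])
    show "(case i of (a, r) => cball a r) \<in> sets (scale_measure (ennreal q) lborel)" for i :: "real \<times> real" by (cases i) auto
    show "sets M = sets (scale_measure (ennreal q) lborel)" using sM by simp
    fix i assume i: "i \<in> C'"
    obtain a r where [simp]: "i = (a, r)" by (cases i)
    have r: "0 < r" "q <= (g (a + r) - g (a - r)) / (2 * r)" using C'(5) i by auto
    then have "q * (2 * r) <= g (a + r) - g (a - r)" by (simp add: field_simps)
    then show "emeasure (scale_measure (ennreal q) lborel) (case i of (a, r) => cball a r) <= ennreal 1 * emeasure M (case i of (a, r) => cball a r)"
     using r pq by (simp add: eM eL ennreal_mult[symmetric] ennreal_leI)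
   qed
   then show ?thesis by simp
  qed
  also have "\<dots> <= emeasure M G"
   using C'(4) VG Gb sM by (auto simp: G'_def intro!: emeasure_mono)
  also have "\<dots> <= ennreal p * emeasure lborel G"
   unfolding G_def
  proof (rule emeasure_le_disjoint_UN[OF C(1,2)])
   show "(case i of (a, r) => cball a r) \<in> sets M" for i :: "real \<times> real" using sM by (cases i) auto
   show "sets lborel = sets M" using sM by simp
   fix i assume i: "i \<in> C"
   obtain a r where [simp]: "i = (a, r)" by (cases i)
   have r: "0 < r" "(g (a + r) - g (a - r)) / (2 * r) <= p" using C(5) i by auto
   then have "g (a + r) - g (a - r) <= p * (2 * r)" by (simp add: field_simps)
   then show "emeasure M (case i of (a, r) => cball a r) <= ennreal p * emeasure lborel (case i of (a, r) => cball a r)"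
    using r pq by (simp add: eM eL ennreal_mult[symmetric] ennreal_leI)
  qed
  also have "\<dots> <= ennreal p * emeasure lborel U"
   using C(4) U Gb by (intro mult_left_mono emeasure_mono) (auto simp: G_def)
  finally show ?thesis .
 qed
 have "m = 0"
 proof (rule ccontr)
  assume "m ~= 0"
  define m' where "m' = enn2real m"
  have mm: "m = ennreal m'" "0 <= m'" using mfin by (simp_all add: m'_def)
  have "q * m' <= p * m'"
  proof (rule field_le_epsilon)
   fix e :: real assume e: "0 < e"
   define \<epsilon> where "\<epsilon> = e / (p + 1)"
   have \<epsilon>: "0 < \<epsilon>" "p * \<epsilon> <= e" using e pq by (auto simp: \<epsilon>_def field_simps)
   have "m < ennreal (m' + \<epsilon>)" unfolding mm(1) using mm(2) \<epsilon> by (simp add: ennreal_less_iff)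
   then obtain U where U: "open U" "E \<subseteq> U" "emeasure lborel U < ennreal (m' + \<epsilon>)"
    unfolding m_def INF_less_iff by blast
   have "ennreal q * ennreal m' <= ennreal p * emeasure lborel U" using key[OF U(1,2)] mm by simp
   also have "\<dots> <= ennreal p * ennreal (m' + \<epsilon>)" using U(3) by (intro mult_left_mono) auto
   finally have "ennreal (q * m') <= ennreal (p * (m' + \<epsilon>))"
    using pq mm(2) \<epsilon> by (simp add: ennreal_mult)
   then have "q * m' <= p * (m' + \<epsilon>)" using pq mm(2) \<epsilon> by (simp add: ennreal_le_iff)
   then show "q * m' <= p * m' + e" using \<epsilon> by (simp add: algebra_simps)
  qed
  moreover have "m' > 0" using \<open>m ~= 0\<close> mm by (cases "m' = 0") auto
  ultimately show False using pq by simp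
 qed
 show ?thesis
  unfolding negligible_outer
 proof (intro allI impI)
  fix e :: real assume "e > 0"
  then have "m < ennreal e" using \<open>m = 0\<close> by simp
  then obtain U where U: "open U" "E \<subseteq> U" "emeasure lborel U < ennreal e"
   unfolding m_def INF_less_iff by blast
  then have "U \<in> lmeasurable" unfolding fmeasurable_def by (auto simp: less_top intro: order_less_trans)
  moreover have "measure lebesgue U < e"
  proof -
   have "emeasure lborel U = ennreal (measure lborel U)"
    using U(3) by (intro emeasure_eq_ennreal_measure) (auto simp: top_unique)
   then have "measure lborel U < e" using U(3) by (simp add: ennreal_less_iff)
   then show ?thesis using U(1) by (simp add: measure_completion)
  qed
  ultimately show "\<exists>T. E \<subseteq> T \<and> T \<in> lmeasurable \<and> measure lebesgue T < e" using U by blast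
 qed
qed

text \<open>Adding \<open>L * x\<close> gives an increasing function with slopes in
  \<open>[0, 2 L]\<close>. Where it is not differentiable, the lower and upper limits of its slopes
  are separated by rationals \<open>p < q\<close>, so the point lies in one of countably many null
  sets.\<close>

lemma lipschitz_real_differentiable_AE:
 fixes f :: "real => real"
 assumes L: "\<And>x y. \<bar>f x - f y\<bar> <= L * \<bar>x - y\<bar>"
 shows "negligible {x. \<not> f differentiable (at x)}"
proof -
 define g where "g x = f x + L * x" for x
 have L0: "L \<ge> 0" using L[of 1 0] by simp
 have inc: "0 <= g y - g x" "g y - g x <= 2 * L * (y - x)" if "x <= y" for x y
  using L[of y x] that by (auto simp: g_def abs_le_iff algebra_simps)
 have mono: "g x <= g y" if "x <= y" for x y using inc[OF that] by simp
 have lipg: "\<bar>g y - g x\<bar> <= 2 * L * \<bar>y - x\<bar>" for x y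
  using inc[of x y] inc[of y x] by (cases "x <= y") auto
 have cont: "continuous_on UNIV g"
 proof -
  have "(2 * L)-lipschitz_on UNIV g" using lipg L0 by (intro lipschitz_onI) (auto simp: dist_real_def)
  then show ?thesis by (rule lipschitz_on_continuous_on)
 qed
 define E where "E = (%(p, q, n). {x. \<bar>x\<bar> <= real n \<and> (\<forall>d>0. \<exists>(a, r) \<in> slope_set g {..of_rat p} x. r < d)
    \<and> (\<forall>d>0. \<exists>(a, r) \<in> slope_set g {of_rat q..} x. r < d)})"
 have sub: "{x. \<not> f differentiable (at x)} \<subseteq> (\<Union>(p, q, n)\<in>{(p, q, n). (0::rat) <= p \<and> p < q}. E (p, q, n))"
 proof
  fix x assume "x \<in> {x. \<not> f differentiable (at x)}"
  then have nd: "\<not> f differentiable (at x)" by simp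
  define s where "s y = (g y - g x) / (y - x)" for y
  have s0: "0 <= s y" "s y <= 2 * L" for y
  proof -
   consider "y = x" | "x < y" | "y < x" by linarith
   then show "0 <= s y" using inc[of x y] inc[of y x]
    by cases (auto simp: s_def zero_le_divide_iff)
   show "s y <= 2 * L"
    by (cases "x <= y"; cases "x = y") (use inc[of x y] inc[of y x] L0 in \<open>auto simp: s_def divide_simps algebra_simps\<close>)
  qed
  let ?l = "Liminf (at x) (%y. ereal (s y))" and ?u = "Limsup (at x) (%y. ereal (s y))"
  have nt: "at x ~= bot" by simp
  have "?l ~= ?u"
  proof
   assume eq: "?l = ?u"
   have lim: "((%y. ereal (s y)) \<longlongrightarrow> ?l) (at x)"
    using tendsto_iff_Liminf_eq_Limsup[OF nt, of "%y. ereal (s y)" ?l] eq by simp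
   have "0 <= ?l" by (rule Liminf_bounded) (use s0 in auto)
   moreover have "?l <= ereal (2 * L)" unfolding eq by (rule Limsup_bounded) (use s0 in auto)
   ultimately obtain D where "?l = ereal D" by (cases ?l) auto
   with lim have "(s \<longlongrightarrow> D) (at x)" by simp
   then have "(g has_field_derivative D) (at x)"
    unfolding s_def has_field_derivative_iff .
   then have "((%y. g y - L * y) has_field_derivative (D - L)) (at x)"
    by (auto intro!: derivative_eq_intros)
   moreover have "(%y. g y - L * y) = f" by (auto simp: g_def)
   ultimately have "f differentiable (at x)"
    unfolding differentiable_def has_field_derivative_def by auto
   then show False using nd by simp
  qed
  moreover have "?l <= ?u" by (rule Liminf_le_Limsup[OF nt])
  ultimately have lu: "?l < ?u" by simp
  have l0: "0 <= ?l" by (rule Liminf_bounded) (use s0 in auto)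
  \<comment> \<open>Three reals strictly between the two limits leave room for \<open>p\<close>
    below and \<open>q\<close> above the middle one.\<close>
  obtain z where z: "?l < ereal z" "ereal z < ?u" using ereal_dense2[OF lu] by blast
  obtain w where w: "ereal z < ereal w" "ereal w < ?u" using ereal_dense2[OF z(2)] by blast
  obtain w' where w': "ereal w < ereal w'" "ereal w' < ?u" using ereal_dense2[OF w(2)] by blast
  obtain p where p: "z < of_rat p" "of_rat p < w" using of_rat_dense[of z w] w by auto
  obtain q where q: "w < of_rat q" "of_rat q < w'" using of_rat_dense[of w w'] w' by auto
  have "0 <= ereal z" using l0 z by (meson less_imp_le order_trans)
  then have "0 <= z" by simp
  then have "0 <= (of_rat p :: real)" using p by linarith
  then have p0: "0 <= p" by simp
  have "(of_rat p::real) < of_rat q" using p q by linarith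
  then have pq: "p < q" by (simp add: of_rat_less)
  have lo: "\<exists>\<^sub>F y in at x. s y <= of_rat p"
  proof (rule ccontr)
   assume "\<not> (\<exists>\<^sub>F y in at x. s y <= of_rat p)"
   then have "\<forall>\<^sub>F y in at x. ereal (of_rat p) <= ereal (s y)"
    unfolding not_frequently by (rule eventually_mono) auto
   then have "ereal (of_rat p) <= ?l" by (rule Liminf_bounded)
   then have "ereal (of_rat p) < ereal z" using z(1) by (rule le_less_trans)
   then show False using p(1) by simp
  qed
  have hi: "\<exists>\<^sub>F y in at x. of_rat q <= s y"
  proof (rule ccontr)
   assume "\<not> (\<exists>\<^sub>F y in at x. of_rat q <= s y)"
   then have "\<forall>\<^sub>F y in at x. ereal (s y) <= ereal (of_rat q)"
    unfolding not_frequently by (rule eventually_mono) auto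
   then have "?u <= ereal (of_rat q)" by (rule Limsup_bounded)
   with w'(2) have "ereal w' < ereal (of_rat q)" by (rule less_le_trans)
   then show False using q(2) by simp
  qed
  have slope: "\<exists>(a, r) \<in> slope_set g P x. r < d" if fr: "\<exists>\<^sub>F y in at x. s y \<in> P" and d: "d > 0" for P d
  proof -
   obtain y where y: "s y \<in> P" "y ~= x" "dist y x < d"
    using fr d unfolding frequently_at by blast
   \<comment> \<open>The interval with end points \<open>x\<close> and \<open>y\<close>, as a ball
     around its midpoint.\<close>
   define a where "a = (x + y) / 2"
   define r where "r = \<bar>y - x\<bar> / 2"
   have k: "(g (a + r) - g (a - r)) / (2 * r) = s y"
   proof (cases "x < y")
    case True
    then have "a + r = y" "a - r = x" "2 * r = y - x" unfolding a_def r_def by (auto simp: field_simps)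
    then show ?thesis unfolding s_def by (simp only:)
   next
    case False
    then have "a + r = x" "a - r = y" "2 * r = x - y" by (auto simp: a_def r_def field_simps)
    then have "(g (a + r) - g (a - r)) / (2 * r) = (g x - g y) / (x - y)" by (simp only:)
    also have "\<dots> = s y" unfolding s_def by (subst minus_divide_divide[symmetric]) simp
    finally show ?thesis .
   qed
   have "0 < r" using y(2) by (simp add: r_def)
   moreover have "x \<in> cball a r" by (simp add: a_def r_def dist_real_def field_simps)
   ultimately have "(a, r) \<in> slope_set g P x" using y(1) by (simp add: slope_set_def k)
   moreover have "r < d" using y by (auto simp: r_def dist_real_def)
   ultimately show ?thesis by blast
  qed
  obtain n where n: "\<bar>x\<bar> <= real n" using real_arch_simple by blast
  have "x \<in> E (p, q, n)"
   unfolding E_def using n slope[of "{..of_rat p}"] slope[of "{of_rat q..}"] lo hi by simp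
  then show "x \<in> (\<Union>(p, q, n)\<in>{(p, q, n). (0::rat) <= p \<and> p < q}. E (p, q, n))"
   using p0 pq by blast
 qed
 have "negligible (\<Union>(p, q, n)\<in>{(p, q, n). (0::rat) <= p \<and> p < q}. E (p, q, n))"
 proof (rule negligible_countable_Union)
  show "countable ((%(p, q, n). E (p, q, n)) ` {(p, q, n). (0::rat) <= p \<and> p < q})" by (rule countable_image) simp
  fix X assume "X \<in> (%(p, q, n). E (p, q, n)) ` {(p, q, n). (0::rat) <= p \<and> p < q}"
  then obtain p q n where X: "X = E (p, q, n)" and pq: "0 <= p" "p < q" by auto
  show "negligible X" unfolding X
  proof (rule lipschitz_mono_slopes_negligible[OF mono cont, where p = "of_rat p" and q = "of_rat q"])
   show "bounded (E (p, q, n))" by (rule boundedI[of _ "real n"]) (auto simp: E_def)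
  qed (use pq in \<open>auto simp: E_def of_rat_less\<close>)
 qed
 then show ?thesis using negligible_subset sub by blast
qed

section \<open>Fibres of the flow\<close>

context backward_flow
begin

text \<open>Time is the homotopy parameter, running from \<open>t\<close>, where the flow is the
  identity, down to 0. A zero at an intermediate time would persist down to time 0.\<close>

lemma flow_difference_homotopic:
 assumes t: "0 <= t" "t <= T" and ne: "\<And>x. x \<in> S ==> \<phi> 0 t x ~= \<phi> 0 t z"
 shows "homotopic_with_canon (%_. True) S (- {0}) (%x. x - z) (%x. \<phi> 0 t x - \<phi> 0 t z)"
proof (rule homotopic_canonI[where h = "%q. \<phi> ((1 - fst q) * t) t (snd q) - \<phi> ((1 - fst q) * t) t z"])
 have time: "0 <= (1 - a) * t" "(1 - a) * t <= t" if "a \<in> {0..1}" for a :: real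
  using that t by (auto simp: mult_left_le_one_le)
 note c = flow_continuous_joint[OF t]
 have "continuous_on ({0..1} \<times> S) (%q. (%(r, x). \<phi> r t x) ((1 - fst q) * t, snd q))"
  by (rule continuous_on_compose2[OF c]) (use time in \<open>auto intro!: continuous_intros\<close>)
 moreover have "continuous_on ({0..1} \<times> S) (%q. (%(r, x). \<phi> r t x) ((1 - fst q) * t, z))"
  by (rule continuous_on_compose2[OF c]) (use time in \<open>auto intro!: continuous_intros\<close>)
 ultimately show "continuous_on ({0..1} \<times> S) (%q. \<phi> ((1 - fst q) * t) t (snd q) - \<phi> ((1 - fst q) * t) t z)"
  by (intro continuous_on_diff) simp_all
 fix a :: real and x assume a: "a \<in> {0..1}" and x: "x \<in> S"
 let ?s = "(1 - a) * t"
 have "\<phi> ?s t x ~= \<phi> ?s t z"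
 proof
  assume eq: "\<phi> ?s t x = \<phi> ?s t z"
  have "\<phi> 0 t x = \<phi> 0 ?s (\<phi> ?s t x)" by (rule flow_compose) (use time[OF a] t in auto)
  also have "\<dots> = \<phi> 0 ?s (\<phi> ?s t z)" by (simp only: eq)
  also have "\<dots> = \<phi> 0 t z" by (rule flow_compose[symmetric]) (use time[OF a] t in auto)
  finally show False using ne[OF x] by simp
 qed
 then show "\<phi> ((1 - fst (a, x)) * t) t (snd (a, x)) - \<phi> ((1 - fst (a, x)) * t) t z \<in> - {0}" by simp
qed (use t flow_self in auto)

text \<open>Trajectories that merge stay merged, so over a sphere around \<open>x\<close> that avoids the fibre of
 \<open>\<phi> 0 t x\<close> the flow is a homotopy of nowhere vanishing maps. A second point of the fibre would lie
 outside the sphere and make the identity of the sphere null-homotopic.\<close>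

lemma regular_fibre:
 assumes t: "0 <= t" "t <= T" and der: "(\<phi> 0 t has_derivative A) (at x0)" and det: "det (matrix A) ~= 0"
 shows "\<phi> 0 t x = \<phi> 0 t x0 ==> x = x0" and "det (matrix A) > 0"
proof -
 have lin: "linear A" using der has_derivative_linear by blast
 have "inj A" using det det_nz_iff_inj[OF lin] by blast
 then obtain c where c: "c > 0" "\<And>v. c * norm v <= norm (A v)"
  using linear_inj_bounded_below_pos[OF lin] by blast
 have "c / 2 > 0" using c by simp
 then obtain r0 where r0: "r0 > 0" "\<And>y. norm (y - x0) < r0 ==> norm (\<phi> 0 t y - \<phi> 0 t x0 - A (y - x0)) <= c / 2 * norm (y - x0)"
  using der unfolding has_derivative_at_alt by blast
 \<comment> \<open>Half of \<open>r0\<close>: a further point of the fibre has distance at least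
   \<open>r0\<close> from \<open>x0\<close> and thus lies strictly outside the sphere.\<close>
 define r where "r = r0 / 2"
 have r: "0 < r" "r < r0" using r0 by (auto simp: r_def)
 have close: "norm (\<phi> 0 t y - \<phi> 0 t x0 - A (y - x0)) < norm (A (y - x0))" if "norm (y - x0) < r0" "y ~= x0" for y
 proof -
  have "norm (\<phi> 0 t y - \<phi> 0 t x0 - A (y - x0)) <= c / 2 * norm (y - x0)" using r0(2) that by blast
  also have "\<dots> < c * norm (y - x0)" using c that by simp
  also have "\<dots> <= norm (A (y - x0))" by (rule c(2))
  finally show ?thesis .
 qed
 have ne: "\<phi> 0 t y ~= \<phi> 0 t x0" if "norm (y - x0) < r0" "y ~= x0" for y
  using close[OF that] by auto
 have sph: "norm (y - x0) = r" if "y \<in> sphere x0 r" for y using that by (simp add: dist_norm norm_minus_commute)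
 have neS: "\<phi> 0 t y ~= \<phi> 0 t x0" if "y \<in> sphere x0 r" for y
  by (rule ne) (use sph[OF that] r in auto)
 have h0: "homotopic_with_canon (%_. True) (sphere x0 r) (- {0}) (%x. x - x0) (%x. \<phi> 0 t x - \<phi> 0 t x0)"
  by (rule flow_difference_homotopic[OF t neS])
 show "x = x0" if eq: "\<phi> 0 t x = \<phi> 0 t x0"
 proof (rule ccontr)
  assume "x ~= x0"
  then have far: "norm (x - x0) \<ge> r0" using ne[of x] eq by (meson not_le)
  have "homotopic_with_canon (%_. True) (sphere x0 r) (- {0}) (%y. y - x) (%y. \<phi> 0 t y - \<phi> 0 t x)"
   by (rule flow_difference_homotopic[OF t]) (use neS eq in auto)
  then have h1: "homotopic_with_canon (%_. True) (sphere x0 r) (- {0}) (%y. \<phi> 0 t y - \<phi> 0 t x0) (%y. y - x)"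
   unfolding eq by (rule homotopic_with_symD)
  \<comment> \<open>As \<open>x\<close> lies outside the ball, \<open>y - x\<close> stays nonzero
    while \<open>y\<close> is moved to the centre.\<close>
  have h2: "homotopic_with_canon (%_. True) (sphere x0 r) (- {0}) (%y. y - x) (%y. x0 - x)"
  proof (rule homotopic_with_linear)
   fix y assume y: "y \<in> sphere x0 r"
   show "closed_segment (y - x) (x0 - x) \<subseteq> - {0}"
   proof
    fix w assume "w \<in> closed_segment (y - x) (x0 - x)"
    then obtain u where u: "0 <= u" "u <= 1" "w = (1 - u) *\<^sub>R (y - x) + u *\<^sub>R (x0 - x)"
     unfolding closed_segment_def by blast
    have "w = (x0 - x) + (1 - u) *\<^sub>R (y - x0)" unfolding u(3) by (simp add: algebra_simps)
    moreover have "norm ((1 - u) *\<^sub>R (y - x0)) <= r"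
     using u sph[OF y] r by (simp add: mult_left_le_one_le)
    ultimately have "w ~= 0" using far r
     by (metis add.commute eq_neg_iff_add_eq_0 leD norm_minus_cancel norm_minus_commute order.trans)
    then show "w \<in> - {0}" by simp
   qed
  qed (auto intro!: continuous_intros)
  have "homotopic_with_canon (%_. True) (sphere x0 r) (- {0}) (%x. x - x0) (%y. x0 - x)"
   by (rule homotopic_with_trans[OF h0 homotopic_with_trans[OF h1 h2]])
  then show False by (rule not_nullhomotopic_sphere[OF r(1)])
 qed
 \<comment> \<open>On the sphere the linearisation error is smaller than
   \<open>|A (y - x0)|\<close>, so the segment to the linear part avoids 0.\<close>
 have h3: "homotopic_with_canon (%_. True) (sphere x0 r) (- {0}) (%x. \<phi> 0 t x - \<phi> 0 t x0) (%x. A (x - x0))"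
 proof (rule homotopic_with_linear)
  show "continuous_on (sphere x0 r) (%x. \<phi> 0 t x - \<phi> 0 t x0)"
   using homotopic_with_imp_continuous[OF h0] by blast
  show "continuous_on (sphere x0 r) (%x. A (x - x0))"
   by (rule linear_continuous_on_compose[OF _ lin]) (auto intro!: continuous_intros)
  fix y assume y: "y \<in> sphere x0 r"
  have cl: "norm (\<phi> 0 t y - \<phi> 0 t x0 - A (y - x0)) < norm (A (y - x0))"
   by (rule close) (use sph[OF y] r in auto)
  show "closed_segment (\<phi> 0 t y - \<phi> 0 t x0) (A (y - x0)) \<subseteq> - {0}"
  proof
   fix w assume "w \<in> closed_segment (\<phi> 0 t y - \<phi> 0 t x0) (A (y - x0))"
   then obtain u where u: "0 <= u" "u <= 1" "w = (1 - u) *\<^sub>R (\<phi> 0 t y - \<phi> 0 t x0) + u *\<^sub>R A (y - x0)"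
    unfolding closed_segment_def by blast
   have w: "w = A (y - x0) + (1 - u) *\<^sub>R (\<phi> 0 t y - \<phi> 0 t x0 - A (y - x0))" unfolding u(3) by (simp add: algebra_simps)
   have "norm ((1 - u) *\<^sub>R (\<phi> 0 t y - \<phi> 0 t x0 - A (y - x0))) <= norm (\<phi> 0 t y - \<phi> 0 t x0 - A (y - x0))"
    using u by (simp add: mult_left_le_one_le)
   then have "norm ((1 - u) *\<^sub>R (\<phi> 0 t y - \<phi> 0 t x0 - A (y - x0))) < norm (A (y - x0))" using cl by linarith
   moreover have "norm (A (y - x0)) <= norm w + norm ((1 - u) *\<^sub>R (\<phi> 0 t y - \<phi> 0 t x0 - A (y - x0)))"
    unfolding w by (metis add_diff_cancel norm_triangle_ineq4)
   ultimately have "norm w > 0" by linarith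
   then show "w \<in> - {0}" by auto
  qed
 qed
 have h4: "homotopic_with_canon (%_. True) (sphere x0 r) (- {0}) (%x. x - x0) (%x. A (x - x0))"
  by (rule homotopic_with_trans[OF h0 h3])
 have map: "continuous_map (top_of_set (sphere 0 1)) (top_of_set (sphere x0 r)) (%x. x0 + r *\<^sub>R x)"
  using r by (auto simp: continuous_map_in_subtopology dist_norm intro!: continuous_intros)
 have "homotopic_with_canon (%_. True) (sphere 0 1) (- {0}) ((%x. x - x0) \<circ> (%x. x0 + r *\<^sub>R x)) ((%x. A (x - x0)) \<circ> (%x. x0 + r *\<^sub>R x))"
  by (rule homotopic_with_compose_continuous_map_right[OF h4 map]) simp
 then have h5: "homotopic_with_canon (%_. True) (sphere 0 1) (- {0}) (%x. r *\<^sub>R x) (%x. r *\<^sub>R A x)"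
  by (rule homotopic_with_eq) (auto simp: linear_scale[OF lin])
 \<comment> \<open>Passing to the unit sphere leaves a factor \<open>r\<close>, which is removed
   through the positive factors \<open>1 - u + u * r\<close>.\<close>
 have scale: "homotopic_with_canon (%_. True) (sphere 0 1) (- {0}) B (%x. r *\<^sub>R B x)"
  if "linear B" "inj B" for B :: "real^'n => real^'n"
 proof (rule homotopic_with_linear)
  have "bounded_linear B" using that by (simp add: linear_conv_bounded_linear)
  then show cB: "continuous_on (sphere 0 1) B" by (rule linear_continuous_on)
  then show "continuous_on (sphere 0 1) (%x. r *\<^sub>R B x)" by (intro continuous_intros)
  fix x :: "real^'n" assume x: "x \<in> sphere 0 1"
  then have "x ~= 0" by auto
  then have "B x ~= 0" using that by (metis injD linear_0)
  show "closed_segment (B x) (r *\<^sub>R B x) \<subseteq> - {0}"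
  proof
   fix w assume "w \<in> closed_segment (B x) (r *\<^sub>R B x)"
   then obtain u where u: "0 <= u" "u <= 1" "w = (1 - u) *\<^sub>R B x + u *\<^sub>R (r *\<^sub>R B x)"
    unfolding closed_segment_def by blast
   have "w = (1 - u + u * r) *\<^sub>R B x" unfolding u(3) by (simp add: algebra_simps)
   moreover have "1 - u + u * r > 0"
   proof (cases "u = 1")
    case False
    then have "1 - u > 0" "u * r \<ge> 0" using u r by auto
    then show ?thesis by linarith
   qed (use r in simp)
   ultimately show "w \<in> - {0}" using \<open>B x ~= 0\<close> by simp
  qed
 qed
 have s1: "homotopic_with_canon (%_. True) (sphere (0::real^'n) 1) (- {0}) (%x. x) (%x. r *\<^sub>R x)"
  using scale[of "%x. x", OF linear_ident inj_on_id2] by simp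
 have s2: "homotopic_with_canon (%_. True) (sphere 0 1) (- {0}) (%x. r *\<^sub>R A x) A"
  by (rule homotopic_with_symD[OF scale[OF lin \<open>inj A\<close>]])
 show "det (matrix A) > 0"
  by (rule det_pos_if_homotopic_id[OF lin det homotopic_with_trans[OF s1 homotopic_with_trans[OF h5 s2]]])
qed

end

section \<open>Measures tested with Lipschitz functions, and null sets along lines\<close>

lemma measure_eqI_lipschitz:
 fixes M N :: "'a::euclidean_space measure"
 assumes sM: "sets M = sets borel" and sN: "sets N = sets borel"
  and fin: "\<And>R. emeasure M (ball 0 R) < \<infinity>"
  and eq: "\<And>g L R. (\<And>x. 0 <= g x \<and> g x <= 1) ==> L-lipschitz_on UNIV g ==> (\<And>x. g x ~= 0 ==> norm x <= R)
    ==> (\<integral>\<^sup>+x. ennreal (g x) \<partial>M) = (\<integral>\<^sup>+x. ennreal (g x) \<partial>N)"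
 shows "M = N"
proof -
 have op: "emeasure M U = emeasure N U" if U: "open U" "bounded U" for U
 proof -
  have ne: "- U ~= {}" using U(2) not_bounded_UNIV by (metis double_complement Compl_empty_eq)
  \<comment> \<open>Truncated multiples of the distance to the complement increase to the indicator
    of \<open>U\<close>. Open boxes then form a generator closed under intersections.\<close>
  define g where "g k x = min 1 (real k * infdist x (- U))" for k :: nat and x
  have g01: "0 <= g k x \<and> g k x <= 1" for k x by (auto simp: g_def infdist_nonneg)
  have gl: "(real k)-lipschitz_on UNIV (g k)" for k
  proof (rule lipschitz_onI)
   fix x y :: 'a
   have "\<bar>infdist x (- U) - infdist y (- U)\<bar> <= dist x y" by (rule infdist_triangle_abs)
   then have "\<bar>real k * infdist x (- U) - real k * infdist y (- U)\<bar> <= real k * dist x y"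
    unfolding right_diff_distrib[symmetric] abs_mult by (intro mult_mono) auto
   then show "dist (g k x) (g k y) <= real k * dist x y"
    unfolding g_def dist_real_def by linarith
  qed simp
  obtain R where R: "\<And>x. x \<in> U ==> norm x <= R" using U(2) unfolding bounded_iff by blast
  have g0: "g k x = 0" if "x \<notin> U" for k x using that by (simp add: g_def infdist_zero)
  have gR: "norm x <= R" if "g k x ~= 0" for k x using that g0 R by blast
  have meas: "(%x. ennreal (g k x)) \<in> borel_measurable borel" for k
   using borel_measurable_continuous_onI[OF lipschitz_on_continuous_on[OF gl]] by simp
  have inc: "incseq (%k x. ennreal (g k x))"
   by (auto simp: incseq_def le_fun_def g_def intro!: ennreal_leI min.mono mult_right_mono infdist_nonneg)
  have sup: "(SUP k. ennreal (g k x)) = indicator U x" for x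
  proof (cases "x \<in> U")
   case True
   have "infdist x (- U) > 0"
    using True ne U(1) by (metis ComplD closed_Compl infdist_pos_not_in_closed)
   then obtain k where "1 <= real k * infdist x (- U)"
    using ex_less_of_nat_mult[of "infdist x (- U)" 1] by (auto intro: less_imp_le)
   then have "ennreal (g k x) = 1" by (simp add: g_def)
   moreover have "ennreal (g j x) <= 1" for j using g01[of j x] by (simp add: ennreal_le_1)
   ultimately have "(SUP k. ennreal (g k x)) = 1"
    by (intro antisym SUP_least) (auto intro: SUP_upper2[of k])
   then show ?thesis using True by simp
  next
   case False
   then show ?thesis by (simp add: g0)
  qed
  have *: "emeasure K U = (SUP k. \<integral>\<^sup>+x. ennreal (g k x) \<partial>K)" if sK: "sets K = sets borel" for K
  proof -
   have "emeasure K U = (\<integral>\<^sup>+x. indicator U x \<partial>K)" using U(1) sK by simp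
   also have "\<dots> = (\<integral>\<^sup>+x. (SUP k. ennreal (g k x)) \<partial>K)" by (simp add: sup)
   also have "\<dots> = (SUP k. \<integral>\<^sup>+x. ennreal (g k x) \<partial>K)"
    using meas sK by (intro nn_integral_monotone_convergence_SUP inc) (simp cong: measurable_cong_sets)
   finally show ?thesis .
  qed
  show ?thesis
   unfolding *[OF sM] *[OF sN] using eq[OF g01 gl gR] by simp
 qed
 show ?thesis
 proof (rule measure_eqI_generator_eq)
  let ?E = "range (%(a, b). box a b :: 'a set)"
  show "Int_stable ?E" by (auto simp: Int_stable_def box_Int_box)
  show "?E \<subseteq> Pow UNIV" by simp
  show "sets M = sigma_sets UNIV ?E" "sets N = sigma_sets UNIV ?E"
   using sM sN by (simp_all add: borel_eq_box)
  show "emeasure M X = emeasure N X" if "X \<in> ?E" for X using that by (auto intro!: op)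
  let ?A = "%n::nat. box (- (real n *\<^sub>R One)) (real n *\<^sub>R One) :: 'a set"
  show "range ?A \<subseteq> ?E" by auto
  show "(\<Union>i. ?A i) = UNIV" by (rule UN_box_eq_UNIV)
  fix i
  obtain R where R: "?A i \<subseteq> ball 0 R" using bounded_subset_ballD[OF bounded_box] by metis
  have "emeasure M (?A i) <= emeasure M (ball 0 R)" using R sM by (intro emeasure_mono) auto
  then show "emeasure M (?A i) ~= \<infinity>" using fin[of R] by (auto simp: top_unique)
 qed
qed

lemma nn_integral_lborel_shift:
 fixes f :: "'a::euclidean_space => ennreal"
 assumes [measurable]: "f \<in> borel_measurable borel"
 shows "(\<integral>\<^sup>+x. f (x + c) \<partial>lborel) = (\<integral>\<^sup>+x. f x \<partial>lborel)"
proof -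
 have "(\<integral>\<^sup>+x. f x \<partial>lborel) = (\<integral>\<^sup>+x. f x \<partial>distr lborel borel ((+) c))" by (simp add: lborel_distr_plus)
 also have "\<dots> = (\<integral>\<^sup>+x. f (c + x) \<partial>lborel)" by (rule nn_integral_distr) auto
 finally show ?thesis by (simp add: add.commute)
qed

lemma integral_lborel_shift:
 fixes f :: "'a::euclidean_space => real"
 assumes [measurable]: "f \<in> borel_measurable borel"
 shows "(\<integral>x. f (x + c) \<partial>lborel) = (\<integral>x. f x \<partial>lborel)"
proof -
 have "(\<integral>x. f x \<partial>lborel) = (\<integral>x. f x \<partial>distr lborel borel ((+) c))" by (simp add: lborel_distr_plus)
 also have "\<dots> = (\<integral>x. f (c + x) \<partial>lborel)" by (rule integral_distr) auto
 finally show ?thesis by (simp add: add.commute)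
qed

text \<open>By translation invariance the measure of \<open>N\<close> is the average over
  \<open>t\<close> in \<open>{0..1}\<close> of the measures of its translates by
  \<open>- t v\<close>. Exchanging the integrals leaves sections along \<open>v\<close>, and no
  coordinates adapted to \<open>v\<close> have to be set up.\<close>

lemma null_set_if_null_on_lines:
 fixes N :: "'a::euclidean_space set"
 assumes N[measurable]: "N \<in> sets borel" and v: "\<And>x. negligible {t::real. x + t *\<^sub>R v \<in> N}"
 shows "N \<in> null_sets lborel"
proof -
 let ?f = "%(t::real) (x::'a). indicator {0..1} t * indicator N (x + t *\<^sub>R v) :: ennreal"
 have "emeasure lborel N = (\<integral>\<^sup>+t. indicator {0..1} (t::real) * emeasure lborel N \<partial>lborel)"
  by (simp add: nn_integral_multc)
 also have "\<dots> = (\<integral>\<^sup>+t. \<integral>\<^sup>+x. ?f t x \<partial>lborel \<partial>lborel)"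
 proof (rule nn_integral_cong)
  fix t :: real
  have "(\<integral>\<^sup>+x. ?f t x \<partial>lborel) = indicator {0..1} t * (\<integral>\<^sup>+x. indicator N (x + t *\<^sub>R v) \<partial>lborel)"
   by (rule nn_integral_cmult) measurable
  also have "(\<integral>\<^sup>+x. indicator N (x + t *\<^sub>R v) \<partial>lborel) = (\<integral>\<^sup>+x. indicator N x \<partial>lborel)"
   by (rule nn_integral_lborel_shift) measurable
  finally show "indicator {0..1} t * emeasure lborel N = (\<integral>\<^sup>+x. ?f t x \<partial>lborel)" by simp
 qed
 also have "\<dots> = (\<integral>\<^sup>+x. \<integral>\<^sup>+t. ?f t x \<partial>lborel \<partial>lborel)"
  by (rule lborel_pair.Fubini'[symmetric]) measurable
 also have "\<dots> = (\<integral>\<^sup>+(x::'a). 0 \<partial>lborel)"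
 proof (rule nn_integral_cong)
  fix x :: 'a
  have m: "{t::real. x + t *\<^sub>R v \<in> N} \<in> sets lborel" by measurable
  have "{t::real. x + t *\<^sub>R v \<in> N} \<in> null_sets lebesgue" using v[of x] by (simp add: negligible_iff_null_sets)
  then have "{t::real. x + t *\<^sub>R v \<in> N} \<in> null_sets lborel" using m null_sets_completion_iff[of _ lborel] by blast
  then have "AE t in lborel. t \<notin> {t::real. x + t *\<^sub>R v \<in> N}" by (rule AE_not_in)
  then have "AE t in lborel. ?f t x = 0" by eventually_elim auto
  then show "(\<integral>\<^sup>+t. ?f t x \<partial>lborel) = 0" by (subst nn_integral_0_iff_AE) auto
 qed
 finally show ?thesis by (intro null_setsI) auto
qed

section \<open>Rademacher's theorem\<close>

locale lipschitz_fun =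
 fixes f :: "'a::euclidean_space => real" and L :: real
 assumes lip: "\<And>x y. \<bar>f x - f y\<bar> <= L * norm (x - y)"
begin

definition dq :: "'a => real => 'a => real" where
 "dq v h x = (f (x + h *\<^sub>R v) - f x) / h"

definition has_dd :: "'a => 'a => real => bool" where
 "has_dd v x D \<longleftrightarrow> ((%h. dq v h x) \<longlongrightarrow> D) (at 0)"

text \<open>A limit along a single sequence is Borel measurable in \<open>x\<close>; it is the
  directional derivative wherever that exists.\<close>

definition dd :: "'a => 'a => real" where
 "dd v x = lim (%n. dq v (1 / real (Suc n)) x)"

text \<open>The Cauchy criterion for difference quotients over rational increments: countable
  quantifiers make the set Borel, and continuity of the quotient in the increment recovers the real
  ones.\<close>

definition ddset :: "'a => 'a set" where
 "ddset v = {x. \<forall>k::nat. \<exists>m::nat. \<forall>r r'::rat. r ~= 0 \<and> r' ~= 0 \<and> \<bar>real_of_rat r\<bar> < 1 / real (Suc m) \<and> \<bar>real_of_rat r'\<bar> < 1 / real (Suc m)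
   --> \<bar>dq v (real_of_rat r) x - dq v (real_of_rat r') x\<bar> <= 1 / real (Suc k)}"

lemma L_nonneg: "L \<ge> 0"
proof -
 obtain e :: 'a where e: "e \<in> Basis" using nonempty_Basis by blast
 have "0 <= L * norm (e - 0)" using lip[of e 0] by linarith
 then show ?thesis using e by simp
qed

lemma cont: "continuous_on UNIV f"
proof -
 have "L-lipschitz_on UNIV f" using lip L_nonneg by (intro lipschitz_onI) (auto simp: dist_norm)
 then show ?thesis by (rule lipschitz_on_continuous_on)
qed

lemma f_meas[measurable]: "f \<in> borel_measurable borel"
 by (rule borel_measurable_continuous_onI[OF cont])

lemma dq_meas[measurable]: "dq v h \<in> borel_measurable borel"
 unfolding dq_def[abs_def] by measurable

lemma dd_meas[measurable]: "dd v \<in> borel_measurable borel"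
 unfolding dd_def[abs_def] by measurable

lemma ddset_meas[measurable]: "ddset v \<in> sets borel"
proof -
 have "Measurable.pred borel (%x. \<forall>k::nat. \<exists>m::nat. \<forall>r r'::rat. r ~= 0 \<and> r' ~= 0 \<and> \<bar>real_of_rat r\<bar> < 1 / real (Suc m) \<and> \<bar>real_of_rat r'\<bar> < 1 / real (Suc m)
   --> \<bar>dq v (real_of_rat r) x - dq v (real_of_rat r') x\<bar> <= 1 / real (Suc k))"
  by measurable
 then show ?thesis unfolding ddset_def pred_def by simp
qed

lemma dq_bound: "\<bar>dq v h x\<bar> <= L * norm v"
proof (cases "h = 0")
 case False
 have "\<bar>f (x + h *\<^sub>R v) - f x\<bar> <= L * (\<bar>h\<bar> * norm v)" using lip[of "x + h *\<^sub>R v" x] by simp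
 then show ?thesis using False unfolding dq_def abs_divide by (simp add: divide_le_eq mult.assoc mult.commute mult.left_commute)
qed (use L_nonneg in \<open>simp add: dq_def\<close>)

lemma has_dd_dd: "has_dd v x D ==> dd v x = D"
 unfolding dd_def
proof (rule limI)
 assume "has_dd v x D"
 moreover have "filterlim (%n. 1 / real (Suc n)) (at 0) sequentially"
  unfolding filterlim_at using LIMSEQ_inverse_real_of_nat by (auto simp: inverse_eq_divide)
 ultimately show "(%n. dq v (1 / real (Suc n)) x) \<longlonglongrightarrow> D"
  unfolding has_dd_def by (rule filterlim_compose)
qed

text \<open>A nonzero real increment is approximated by rational ones, where the quotient is
  continuous, so the Cauchy bound extends to it; the limit is then identified along
  \<open>1 / Suc n\<close>.\<close>

lemma ddset_imp_has_dd:
 assumes x: "x \<in> ddset v"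
 shows "has_dd v x (dd v x)"
proof -
 define q where "q h = dq v h x" for h
 have C: "\<exists>m::nat. \<forall>r r'::rat. r ~= 0 \<and> r' ~= 0 \<and> \<bar>real_of_rat r\<bar> < 1 / real (Suc m) \<and> \<bar>real_of_rat r'\<bar> < 1 / real (Suc m)
   --> \<bar>q (real_of_rat r) - q (real_of_rat r')\<bar> <= 1 / real (Suc k)" for k
  using x unfolding ddset_def q_def by blast
 have contq: "isCont q h" if "h ~= 0" for h
 proof -
  have "continuous_on UNIV (%h. f (x + h *\<^sub>R v))"
   by (intro continuous_on_compose2[OF cont] continuous_intros) auto
  then have "isCont (%h. f (x + h *\<^sub>R v)) h" by (simp add: continuous_on_eq_continuous_at)
  then show ?thesis unfolding q_def dq_def using that by (intro continuous_intros) auto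
 qed
 have real_h: "\<bar>q h - q (real_of_rat r')\<bar> <= 1 / real (Suc k)"
  if m: "\<And>r r'::rat. r ~= 0 \<and> r' ~= 0 \<and> \<bar>real_of_rat r\<bar> < 1 / real (Suc m) \<and> \<bar>real_of_rat r'\<bar> < 1 / real (Suc m)
   ==> \<bar>q (real_of_rat r) - q (real_of_rat r')\<bar> <= 1 / real (Suc k)"
   and h: "h ~= 0" "\<bar>h\<bar> < 1 / real (Suc m)" and r': "r' ~= 0" "\<bar>real_of_rat r'\<bar> < 1 / real (Suc m)" for h r' k m
 proof (rule field_le_epsilon)
  fix e :: real assume "0 < e"
  then obtain d where d: "d > 0" "\<And>y. dist y h < d ==> dist (q y) (q h) < e"
   using contq[OF h(1)] unfolding continuous_at_eps_delta by blast
  define d' where "d' = min d (min \<bar>h\<bar> (1 / real (Suc m) - \<bar>h\<bar>))"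
  have "0 < d'" using d h by (auto simp: d'_def)
  then obtain r where r: "h < real_of_rat r" "real_of_rat r < h + d'" using of_rat_dense[of h "h + d'"] by auto
  have dr: "dist (real_of_rat r) h < d'" using r by (auto simp: dist_real_def)
  then have dr': "\<bar>real_of_rat r - h\<bar> < \<bar>h\<bar>" "\<bar>real_of_rat r - h\<bar> < 1 / real (Suc m) - \<bar>h\<bar>"
   by (auto simp: d'_def dist_real_def)
  have "r ~= 0" using dr'(1) by auto
  moreover have "\<bar>real_of_rat r\<bar> < 1 / real (Suc m)" using dr'(2) by linarith
  ultimately have "\<bar>q (real_of_rat r) - q (real_of_rat r')\<bar> <= 1 / real (Suc k)" using m r' by auto
  moreover have "\<bar>q (real_of_rat r) - q h\<bar> < e" using d(2)[of "real_of_rat r"] dr by (auto simp: d'_def dist_real_def)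
  ultimately show "\<bar>q h - q (real_of_rat r')\<bar> <= 1 / real (Suc k) + e" by linarith
 qed
 have rat1: "1 / real (Suc n) = real_of_rat (1 / of_nat (Suc n))" for n
  by (simp add: of_rat_divide of_rat_add)
 have Cq: "Cauchy (%n. q (1 / real (Suc n)))"
 proof (rule metric_CauchyI)
  fix e :: real assume "0 < e"
  then obtain k where k: "1 / real (Suc k) < e" using nat_approx_posE by blast
  obtain m where m: "\<And>r r'::rat. r ~= 0 \<and> r' ~= 0 \<and> \<bar>real_of_rat r\<bar> < 1 / real (Suc m) \<and> \<bar>real_of_rat r'\<bar> < 1 / real (Suc m)
   ==> \<bar>q (real_of_rat r) - q (real_of_rat r')\<bar> <= 1 / real (Suc k)" using C[of k] by blast
  have "dist (q (1 / real (Suc i))) (q (1 / real (Suc j))) < e" if "i \<ge> Suc m" "j \<ge> Suc m" for i j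
  proof -
   have 1: "\<bar>real_of_rat (1 / of_nat (Suc n))\<bar> < 1 / real (Suc m)" if "n \<ge> Suc m" for n
    unfolding rat1[symmetric] using that by (simp add: field_simps)
   have "\<bar>q (real_of_rat (1 / of_nat (Suc i))) - q (real_of_rat (1 / of_nat (Suc j)))\<bar> <= 1 / real (Suc k)"
    by (rule m) (use 1[OF that(1)] 1[OF that(2)] in auto)
   then show ?thesis using k unfolding rat1 dist_real_def by linarith
  qed
  then show "\<exists>M. \<forall>m\<ge>M. \<forall>n\<ge>M. dist (q (1 / real (Suc m))) (q (1 / real (Suc n))) < e" by blast
 qed
 then obtain D where D: "(%n. q (1 / real (Suc n))) \<longlonglongrightarrow> D"
  using real_Cauchy_convergent[OF Cq] unfolding convergent_def by blast
 have "(q \<longlongrightarrow> D) (at 0)"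
  unfolding LIM_def
 proof (intro allI impI)
  fix e :: real assume "0 < e"
  then obtain k where k: "1 / real (Suc k) < e" using nat_approx_posE by blast
  obtain m where m: "\<And>r r'::rat. r ~= 0 \<and> r' ~= 0 \<and> \<bar>real_of_rat r\<bar> < 1 / real (Suc m) \<and> \<bar>real_of_rat r'\<bar> < 1 / real (Suc m)
   ==> \<bar>q (real_of_rat r) - q (real_of_rat r')\<bar> <= 1 / real (Suc k)" using C[of k] by blast
  have "dist (q h) D < e" if h: "h ~= 0" "\<bar>h\<bar> < 1 / real (Suc m)" for h
  proof -
   have "\<bar>q h - D\<bar> <= 1 / real (Suc k)"
   proof (rule LIMSEQ_le_const2)
    show "(%n. \<bar>q h - q (1 / real (Suc n))\<bar>) \<longlonglongrightarrow> \<bar>q h - D\<bar>" by (intro tendsto_intros D)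
    have "\<bar>q h - q (1 / real (Suc n))\<bar> <= 1 / real (Suc k)" if "n \<ge> Suc m" for n
     unfolding rat1[of n]
    proof (rule real_h[OF m h])
     show "(1 / of_nat (Suc n) :: rat) ~= 0" by simp
     show "\<bar>real_of_rat (1 / of_nat (Suc n))\<bar> < 1 / real (Suc m)"
      unfolding rat1[symmetric] using that by (simp add: field_simps)
    qed
    then show "\<exists>N. \<forall>n\<ge>N. \<bar>q h - q (1 / real (Suc n))\<bar> <= 1 / real (Suc k)" by blast
   qed
   then show ?thesis using k by (simp add: dist_real_def)
  qed
  then show "\<exists>s>0. \<forall>x. x ~= 0 \<and> dist x 0 < s --> dist (q x) D < e"
   by (intro exI[of _ "1 / real (Suc m)"]) auto
 qed
 then have "has_dd v x D" unfolding has_dd_def q_def .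
 then show ?thesis using has_dd_dd by simp
qed

lemma has_dd_imp_ddset:
 assumes "has_dd v x D"
 shows "x \<in> ddset v"
 unfolding ddset_def
proof (rule CollectI, rule allI)
 fix k :: nat
 have "0 < 1 / (2 * real (Suc k))" by simp
 then obtain s where s: "s > 0" "\<And>h. h ~= 0 ==> \<bar>h\<bar> < s ==> \<bar>dq v h x - D\<bar> < 1 / (2 * real (Suc k))"
  using assms unfolding has_dd_def LIM_def dist_real_def by (metis diff_zero)
 obtain m where m: "1 / real (Suc m) < s" using nat_approx_posE[OF s(1)] by blast
 show "\<exists>m::nat. \<forall>r r'::rat. r ~= 0 \<and> r' ~= 0 \<and> \<bar>real_of_rat r\<bar> < 1 / real (Suc m) \<and> \<bar>real_of_rat r'\<bar> < 1 / real (Suc m)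
   --> \<bar>dq v (real_of_rat r) x - dq v (real_of_rat r') x\<bar> <= 1 / real (Suc k)"
 proof (intro exI[of _ m] allI impI)
  fix r r' :: rat assume H: "r ~= 0 \<and> r' ~= 0 \<and> \<bar>real_of_rat r\<bar> < 1 / real (Suc m) \<and> \<bar>real_of_rat r'\<bar> < 1 / real (Suc m)"
  then have "\<bar>real_of_rat r\<bar> < s" "\<bar>real_of_rat r'\<bar> < s" using m by linarith+
  then have 1: "\<bar>dq v (real_of_rat r) x - D\<bar> < 1 / (2 * real (Suc k))" "\<bar>dq v (real_of_rat r') x - D\<bar> < 1 / (2 * real (Suc k))"
   using H s(2) by auto
  have 2: "1 / (2 * real (Suc k)) + 1 / (2 * real (Suc k)) = 1 / real (Suc k)" by (simp add: field_simps)
  show "\<bar>dq v (real_of_rat r) x - dq v (real_of_rat r') x\<bar> <= 1 / real (Suc k)"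
   using 1 unfolding 2[symmetric] by argo
 qed
qed

text \<open>On every line in direction \<open>v\<close> the restriction is a Lipschitz function of
  one variable, so the exceptional set has null sections.\<close>

lemma AE_ddset: "AE x in lborel. x \<in> ddset v"
proof -
 have "UNIV - ddset v \<in> null_sets lborel"
 proof (rule null_set_if_null_on_lines)
  fix x
  define F where "F t = f (x + t *\<^sub>R v)" for t :: real
  have FL: "\<bar>F s - F t\<bar> <= (L * norm v) * \<bar>s - t\<bar>" for s t
  proof -
   have "\<bar>F s - F t\<bar> <= L * norm ((x + s *\<^sub>R v) - (x + t *\<^sub>R v))" unfolding F_def by (rule lip)
   also have "(x + s *\<^sub>R v) - (x + t *\<^sub>R v) = (s - t) *\<^sub>R v" by (simp add: algebra_simps)
   finally show ?thesis by (simp add: mult.commute mult.left_commute)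
  qed
  show "negligible {t. x + t *\<^sub>R v \<in> UNIV - ddset v}"
  proof (rule negligible_subset[OF lipschitz_real_differentiable_AE[OF FL]], rule subsetI, rule ccontr)
   fix t assume t: "t \<in> {t. x + t *\<^sub>R v \<in> UNIV - ddset v}" and "t \<notin> {x. \<not> F differentiable at x}"
   then obtain D where "(F has_field_derivative D) (at t)"
    by (auto simp: real_differentiable_def)
   then have "((%h. (F (t + h) - F t) / h) \<longlongrightarrow> D) (at 0)" by (simp add: DERIV_def)
   moreover have "(F (t + h) - F t) / h = dq v h (x + t *\<^sub>R v)" for h
    by (simp add: F_def dq_def algebra_simps)
   ultimately have "has_dd v (x + t *\<^sub>R v) D" unfolding has_dd_def by simp
   then show False using t has_dd_imp_ddset by blast
  qed
 qed measurable
 then have "AE x in lborel. x \<notin> UNIV - ddset v" by (rule AE_not_in)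
 then show ?thesis by simp
qed

lemma dd_bound: "x \<in> ddset v ==> \<bar>dd v x\<bar> <= L * norm v"
proof -
 assume "x \<in> ddset v"
 then have "((%h. \<bar>dq v h x\<bar>) \<longlongrightarrow> \<bar>dd v x\<bar>) (at 0)"
  using ddset_imp_has_dd unfolding has_dd_def by (intro tendsto_rabs) blast
 then show ?thesis
  by (rule tendsto_upperbound) (auto simp: dq_bound)
qed

lemma dq_lim: "x \<in> ddset v ==> (%n. dq v (1 / real (Suc n)) x) \<longlonglongrightarrow> dd v x"
proof -
 assume "x \<in> ddset v"
 then have "((%h. dq v h x) \<longlongrightarrow> dd v x) (at 0)" using ddset_imp_has_dd unfolding has_dd_def by blast
 moreover have "filterlim (%n. 1 / real (Suc n)) (at 0) sequentially"
  unfolding filterlim_at using LIMSEQ_inverse_real_of_nat by (auto simp: inverse_eq_divide)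
 ultimately show ?thesis by (rule filterlim_compose)
qed

text \<open>The quotient for \<open>v + w\<close> at \<open>x\<close> is the quotient for
  \<open>v\<close> at \<open>x\<close> plus the one for \<open>w\<close> at \<open>x + h v\<close>.
  A translation moves this shift to the continuous function \<open>g\<close>, where it disappears as
  \<open>h\<close> tends to 0.\<close>

lemma integral_dd_additive:
 assumes g01: "\<And>x. 0 <= g x \<and> g x <= 1" and gl: "K-lipschitz_on UNIV g" and gR: "\<And>x. g x ~= 0 ==> norm x <= R"
 shows "(\<integral>x. g x * dd (v + w) x \<partial>lborel) = (\<integral>x. g x * dd v x \<partial>lborel) + (\<integral>x. g x * dd w x \<partial>lborel)"
proof -
 have gc: "continuous_on UNIV g" by (rule lipschitz_on_continuous_on[OF gl])
 have gm[measurable]: "g \<in> borel_measurable borel" by (rule borel_measurable_continuous_onI[OF gc])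
 define h where "h n = 1 / real (Suc n)" for n
 have h0: "h n > 0" "h n <= 1" for n by (auto simp: h_def)
 have hlim: "h \<longlonglongrightarrow> 0" unfolding h_def using LIMSEQ_inverse_real_of_nat by (simp add: inverse_eq_divide)
 have ind: "integrable lborel (%x. c * indicator (cball 0 S) x :: real)" for c S
  by (intro integrable_mult_right integrable_real_indicator) (auto simp: emeasure_lborel_cball_finite[unfolded infinity_ennreal_def])
 have gb: "\<bar>g x * q\<bar> <= c * indicator (cball 0 R) x" if "\<bar>q\<bar> <= c" for x q c
 proof (cases "g x = 0")
  case True
  then show ?thesis using that by (auto simp: indicator_def)
 next
  case False
  have "\<bar>g x * q\<bar> <= 1 * c" unfolding abs_mult using g01[of x] that by (intro mult_mono) auto
  then show ?thesis using gR[OF False] by simp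
 qed
 have lim1: "(%n. \<integral>x. g x * dq v (h n) x \<partial>lborel) \<longlonglongrightarrow> (\<integral>x. g x * dd v x \<partial>lborel)" for v
 proof (rule integral_dominated_convergence[where w = "%x. (L * norm v) * indicator (cball 0 R) x"])
  show "AE x in lborel. (%n. g x * dq v (h n) x) \<longlonglongrightarrow> g x * dd v x"
   using AE_ddset[of v] by eventually_elim (auto simp: h_def simp del: of_nat_Suc intro!: tendsto_mult dq_lim)
  show "AE x in lborel. norm (g x * dq v (h n) x) <= (L * norm v) * indicator (cball 0 R) x" for n
   using gb[OF dq_bound] by simp
 qed (use ind in auto)
 have lim2: "(%n. \<integral>x. g (x - h n *\<^sub>R v) * dq w (h n) x \<partial>lborel) \<longlonglongrightarrow> (\<integral>x. g x * dd w x \<partial>lborel)"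
 proof (rule integral_dominated_convergence[where w = "%x. (L * norm w) * indicator (cball 0 (R + norm v)) x"])
  show "AE x in lborel. (%n. g (x - h n *\<^sub>R v) * dq w (h n) x) \<longlonglongrightarrow> g x * dd w x"
   using AE_ddset[of w]
  proof eventually_elim
   fix x assume x: "x \<in> ddset w"
   have "(%n. x - h n *\<^sub>R v) \<longlonglongrightarrow> x - 0 *\<^sub>R v" by (intro tendsto_intros hlim)
   then have "(%n. g (x - h n *\<^sub>R v)) \<longlonglongrightarrow> g x"
    using gc by (intro continuous_on_tendsto_compose[OF gc]) auto
   then show "(%n. g (x - h n *\<^sub>R v) * dq w (h n) x) \<longlonglongrightarrow> g x * dd w x"
    using dq_lim[OF x] by (intro tendsto_mult) (auto simp: h_def simp del: of_nat_Suc)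
  qed
  show "AE x in lborel. norm (g (x - h n *\<^sub>R v) * dq w (h n) x) <= (L * norm w) * indicator (cball 0 (R + norm v)) x" for n
  proof (rule AE_I2)
   fix x
   have "\<bar>g (x - h n *\<^sub>R v) * dq w (h n) x\<bar> <= (L * norm w) * indicator (cball 0 R) (x - h n *\<^sub>R v)"
    using gb[OF dq_bound] .
   also have "\<dots> <= (L * norm w) * indicator (cball 0 (R + norm v)) x"
   proof (rule mult_left_mono)
    have "norm x <= norm (x - h n *\<^sub>R v) + norm (h n *\<^sub>R v)" by (metis norm_triangle_sub add.commute)
    moreover have "norm (h n *\<^sub>R v) <= norm v" using h0[of n] by (simp add: mult_left_le_one_le)
    ultimately show "indicator (cball 0 R) (x - h n *\<^sub>R v) <= (indicator (cball 0 (R + norm v)) x :: real)"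
     by (auto simp: indicator_def)
   qed (use L_nonneg in auto)
   finally show "norm (g (x - h n *\<^sub>R v) * dq w (h n) x) <= (L * norm w) * indicator (cball 0 (R + norm v)) x" by simp
  qed
 qed (use ind in auto)
 have split: "(\<integral>x. g x * dq (v + w) (h n) x \<partial>lborel)
   = (\<integral>x. g x * dq v (h n) x \<partial>lborel) + (\<integral>x. g (x - h n *\<^sub>R v) * dq w (h n) x \<partial>lborel)" for n
 proof -
  have i: "integrable lborel (%x. g x * q x)" if [measurable]: "q \<in> borel_measurable borel" and q: "\<And>x. \<bar>q x\<bar> <= c" for q c
  proof (rule Bochner_Integration.integrable_bound[OF ind[of c R]])
   show "AE x in lborel. norm (g x * q x) <= norm (c * indicator (cball 0 R) x)"
    using gb[OF q] by (intro AE_I2) (metis abs_ge_self order_trans real_norm_def)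
  qed simp
  have "(\<integral>x. g x * dq (v + w) (h n) x \<partial>lborel) = (\<integral>x. g x * dq v (h n) x + g x * dq w (h n) (x + h n *\<^sub>R v) \<partial>lborel)"
   by (intro Bochner_Integration.integral_cong) (auto simp: dq_def algebra_simps diff_divide_distrib)
  also have "\<dots> = (\<integral>x. g x * dq v (h n) x \<partial>lborel) + (\<integral>x. g x * dq w (h n) (x + h n *\<^sub>R v) \<partial>lborel)"
  proof (rule Bochner_Integration.integral_add)
   show "integrable lborel (%x. g x * dq v (h n) x)" by (rule i[OF _ dq_bound]) measurable
   show "integrable lborel (%x. g x * dq w (h n) (x + h n *\<^sub>R v))" by (rule i[OF _ dq_bound]) measurable
  qed
  also have "(\<integral>x. g x * dq w (h n) (x + h n *\<^sub>R v) \<partial>lborel) = (\<integral>x. g (x - h n *\<^sub>R v) * dq w (h n) x \<partial>lborel)"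
   using integral_lborel_shift[of "%x. g (x - h n *\<^sub>R v) * dq w (h n) x" "h n *\<^sub>R v"] by simp
  finally show ?thesis .
 qed
 have "(%n. \<integral>x. g x * dq (v + w) (h n) x \<partial>lborel) \<longlonglongrightarrow> (\<integral>x. g x * dd v x \<partial>lborel) + (\<integral>x. g x * dd w x \<partial>lborel)"
  unfolding split by (intro tendsto_add lim1 lim2)
 then show ?thesis using lim1[of "v + w"] LIMSEQ_unique by blast
qed

text \<open>Additivity against all Lipschitz test functions identifies two densities. To obtain
  genuine measures the defect is clamped to \<open>[- C, C]\<close> and raised by \<open>C\<close>,
  where \<open>C\<close> is so large that clamping changes only a null set.\<close>

lemma AE_dd_additive: "AE x in lborel. dd (v + w) x = dd v x + dd w x"
proof -
 define C where "C = L * norm (v + w) + L * norm v + L * norm w"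
 have C0: "C \<ge> 0" using L_nonneg by (simp add: C_def)
 define G where "G x = max (- C) (min C (dd (v + w) x - dd v x - dd w x))" for x
 have Gm[measurable]: "G \<in> borel_measurable borel" unfolding G_def[abs_def] by measurable
 have GC: "\<bar>G x\<bar> <= C" for x using C0 by (auto simp: G_def)
 have Gae: "AE x in lborel. G x = dd (v + w) x - dd v x - dd w x"
  using AE_ddset[of "v + w"] AE_ddset[of v] AE_ddset[of w]
 proof eventually_elim
  case (elim x)
  then have "\<bar>dd (v + w) x\<bar> <= L * norm (v + w)" "\<bar>dd v x\<bar> <= L * norm v" "\<bar>dd w x\<bar> <= L * norm w" by (auto simp: dd_bound)
  then show ?case by (auto simp: G_def C_def)
 qed
 let ?M = "density lborel (%x. ennreal (C + G x))" and ?N = "density lborel (%x. ennreal C)"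
 have "?M = ?N"
 proof (rule measure_eqI_lipschitz)
  fix R
  have "emeasure ?M (ball 0 R) = (\<integral>\<^sup>+x. ennreal (C + G x) * indicator (ball 0 R) x \<partial>lborel)"
   by (subst emeasure_density) auto
  also have "\<dots> <= (\<integral>\<^sup>+(x::'a). ennreal (2 * C) * indicator (ball 0 R) x \<partial>lborel)"
  proof (rule nn_integral_mono)
   fix x :: 'a
   have "C + G x <= 2 * C" using GC[of x] by linarith
   then show "ennreal (C + G x) * indicator (ball 0 R) x <= ennreal (2 * C) * indicator (ball 0 R) x"
    by (intro mult_right_mono ennreal_leI) auto
  qed
  also have "\<dots> = ennreal (2 * C) * emeasure lborel (ball (0::'a) R)" by (simp add: nn_integral_cmult_indicator)
  also have "\<dots> < \<infinity>" using emeasure_lborel_ball_finite[of "0::'a" R] by (simp add: ennreal_mult_less_top)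
  finally show "emeasure ?M (ball 0 R) < \<infinity>" .
 next
  fix g :: "'a => real" and K R
  assume g01: "\<And>x. 0 <= g x \<and> g x <= 1" and gl: "K-lipschitz_on UNIV g" and gR: "\<And>x. g x ~= 0 ==> norm x <= R"
  have gm[measurable]: "g \<in> borel_measurable borel"
   by (rule borel_measurable_continuous_onI[OF lipschitz_on_continuous_on[OF gl]])
  have ind: "integrable lborel (%x. c * indicator (cball 0 R) x :: real)" for c and R
   by (intro integrable_mult_right integrable_real_indicator) (auto simp: emeasure_lborel_cball_finite[unfolded infinity_ennreal_def])
  have i: "integrable lborel (%x. g x * q x)" if [measurable]: "q \<in> borel_measurable borel" and q: "AE x in lborel. \<bar>q x\<bar> <= c" for q c
  proof (rule Bochner_Integration.integrable_bound[OF ind[of c R]])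
   show "AE x in lborel. norm (g x * q x) <= norm (c * indicator (cball 0 R) x)"
    using q
   proof eventually_elim
    fix x assume q: "\<bar>q x\<bar> <= c"
    have "\<bar>g x * q x\<bar> <= 1 * c" unfolding abs_mult using g01[of x] q by (intro mult_mono) auto
    then show "norm (g x * q x) <= norm (c * indicator (cball 0 R) x)"
     using gR[of x] q by (cases "g x = 0") auto
   qed
  qed simp
  have i_dd: "integrable lborel (%x. g x * dd u x)" for u
  proof (rule i)
   show "AE x in lborel. \<bar>dd u x\<bar> <= L * norm u"
    using AE_ddset[of u] by eventually_elim (rule dd_bound)
  qed measurable
  have "(\<integral>x. g x * G x \<partial>lborel) = (\<integral>x. g x * dd (v + w) x - g x * dd v x - g x * dd w x \<partial>lborel)"
  proof (rule integral_cong_AE)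
   show "AE x in lborel. g x * G x = g x * dd (v + w) x - g x * dd v x - g x * dd w x"
    using Gae by eventually_elim (simp add: right_diff_distrib)
  qed measurable
  also have "\<dots> = (\<integral>x. g x * dd (v + w) x \<partial>lborel) - (\<integral>x. g x * dd v x \<partial>lborel) - (\<integral>x. g x * dd w x \<partial>lborel)"
   using i_dd by simp
  also have "\<dots> = 0" using integral_dd_additive[OF g01 gl gR, of v w] by simp
  finally have zero: "(\<integral>x. g x * G x \<partial>lborel) = 0" .
  have iG: "integrable lborel (%x. g x * G x)" by (rule i[OF Gm AE_I2[OF GC]])
  have iC: "integrable lborel (%x. g x * C)" by (rule i[OF _ AE_I2, of _ C]) (use C0 in auto)
  have "(\<integral>\<^sup>+x. ennreal (g x) \<partial>?M) = (\<integral>\<^sup>+x. ennreal (C + G x) * ennreal (g x) \<partial>lborel)"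
   by (subst nn_integral_density) auto
  also have "\<dots> = (\<integral>\<^sup>+x. ennreal (g x * C + g x * G x) \<partial>lborel)"
  proof (rule nn_integral_cong)
   fix x
   have "0 <= C + G x" using GC[of x] by linarith
   then show "ennreal (C + G x) * ennreal (g x) = ennreal (g x * C + g x * G x)"
    using g01[of x] by (simp add: ennreal_mult[symmetric] algebra_simps)
  qed
  also have "\<dots> = ennreal (\<integral>x. g x * C + g x * G x \<partial>lborel)"
  proof (rule nn_integral_eq_integral)
   show "integrable lborel (%x. g x * C + g x * G x)" using iC iG by simp
   have "0 <= g x * C + g x * G x" for x
   proof -
    have "0 <= C + G x" using GC[of x] by linarith
    then have "0 <= g x * (C + G x)" using g01[of x] by simp
    then show ?thesis by (simp add: algebra_simps)
   qed
   then show "AE x in lborel. 0 <= g x * C + g x * G x" by simp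
  qed
  also have "(\<integral>x. g x * C + g x * G x \<partial>lborel) = (\<integral>x. g x * C \<partial>lborel)"
   using iC iG zero by (subst Bochner_Integration.integral_add) simp_all
  also have "ennreal (\<integral>x. g x * C \<partial>lborel) = (\<integral>\<^sup>+x. ennreal (g x * C) \<partial>lborel)"
   using g01 C0 by (intro nn_integral_eq_integral[symmetric] iC) auto
  also have "\<dots> = (\<integral>\<^sup>+x. ennreal (g x) \<partial>?N)"
   using g01 C0 by (subst nn_integral_density) (auto simp: ennreal_mult mult.commute)
  finally show "(\<integral>\<^sup>+x. ennreal (g x) \<partial>?M) = (\<integral>\<^sup>+x. ennreal (g x) \<partial>?N)" .
 qed auto
 then have "AE x in lborel. ennreal (C + G x) = ennreal C"
  by (intro sigma_finite_measure.density_unique[OF lborel.sigma_finite_measure_axioms]) auto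
 then show ?thesis using Gae
 proof eventually_elim
  case (elim x)
  have "0 <= C + G x" using GC[of x] by linarith
  then have "G x = 0" using elim(1) C0 by (simp add: ennreal_inj)
  then show ?case using elim(2) by simp
 qed
qed

definition ratvec :: "'a set" where "ratvec = {x. \<forall>i\<in>Basis. x \<bullet> i \<in> \<rat>}"

lemma countable_ratvec: "countable ratvec"
proof -
 have "ratvec \<subseteq> (%c. \<Sum>i\<in>Basis. c i *\<^sub>R i) ` (PiE Basis (%_. \<rat>))"
 proof
  fix x :: 'a assume x: "x \<in> ratvec"
  have "x = (\<Sum>i\<in>Basis. restrict (%i. x \<bullet> i) Basis i *\<^sub>R i)"
   by (simp add: euclidean_representation)
  moreover have "restrict (%i. x \<bullet> i) Basis \<in> PiE Basis (%_. \<rat>)" using x by (auto simp: ratvec_def)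
  ultimately show "x \<in> (%c. \<Sum>i\<in>Basis. c i *\<^sub>R i) ` (PiE Basis (%_. \<rat>))" by blast
 qed
 moreover have "countable (PiE (Basis :: 'a set) (%_. \<rat> :: real set))"
  by (intro countable_PiE) (auto simp: countable_rat)
 ultimately show ?thesis by (meson countable_image countable_subset)
qed

lemma ratvec_dense:
 assumes "e > 0"
 shows "\<exists>w\<in>ratvec. norm (v - w) < e"
proof -
 define \<delta> where "\<delta> = e / (2 * real DIM('a))"
 have \<delta>: "\<delta> > 0" using assms by (simp add: \<delta>_def)
 have "\<exists>r. r \<in> \<rat> \<and> \<bar>v \<bullet> i - r\<bar> < \<delta>" for i
 proof -
  obtain r where "v \<bullet> i < of_rat r" "of_rat r < v \<bullet> i + \<delta>" using of_rat_dense[of "v \<bullet> i" "v \<bullet> i + \<delta>"] \<delta> by auto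
  then show ?thesis by (intro exI[of _ "of_rat r"]) auto
 qed
 then obtain r where r: "\<And>i. r i \<in> \<rat>" "\<And>i. \<bar>v \<bullet> i - r i\<bar> < \<delta>" by metis
 define w where "w = (\<Sum>i\<in>Basis. r i *\<^sub>R i)"
 have wi: "w \<bullet> i = r i" if "i \<in> Basis" for i using that by (simp add: w_def inner_sum_left inner_Basis if_distrib cong: if_cong)
 have "norm (v - w) <= (\<Sum>i\<in>Basis. \<bar>(v - w) \<bullet> i\<bar>)" by (rule norm_le_l1)
 also have "\<dots> <= (\<Sum>i\<in>(Basis::'a set). \<delta>)" by (intro sum_mono) (use r wi in \<open>auto simp: inner_diff_left less_imp_le\<close>)
 also have "\<dots> < e" using assms by (simp add: \<delta>_def)
 finally show ?thesis using r wi by (intro bexI[of _ w]) (auto simp: ratvec_def)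
qed

lemma has_dd_scale:
 assumes "has_dd v x D"
 shows "has_dd (c *\<^sub>R v) x (c * D)"
proof (cases "c = 0")
 case False
 have "filterlim (%h. c * h) (at 0) (at 0)"
  unfolding filterlim_at
 proof
  show "((%h. c * h) \<longlongrightarrow> 0) (at 0)" by (auto intro!: tendsto_eq_intros)
  show "\<forall>\<^sub>F h in at 0. c * h \<in> UNIV \<and> c * h ~= 0" using False by (auto simp: eventually_at_filter)
 qed
 then have "((%h. dq v (c * h) x) \<longlongrightarrow> D) (at 0)"
  using assms unfolding has_dd_def by (rule filterlim_compose[rotated])
 then have "((%h. c * dq v (c * h) x) \<longlongrightarrow> c * D) (at 0)" by (intro tendsto_intros)
 moreover have "c * dq v (c * h) x = dq (c *\<^sub>R v) h x" for h
  using False by (simp add: dq_def mult.commute)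
 ultimately show ?thesis unfolding has_dd_def by simp
qed (auto simp: has_dd_def dq_def)

text \<open>Off a null set the derivative exists in all directions with rational coordinates and is
  additive there, so it agrees with a linear map. A finite net of such directions covering the unit
  ball and the Lipschitz bound turn this into differentiability.\<close>

theorem differentiable_AE: "AE x in lborel. f differentiable (at x)"
proof -
 have "AE x in lborel. \<forall>v\<in>ratvec. x \<in> ddset v"
  by (subst AE_ball_countable[OF countable_ratvec]) (use AE_ddset in blast)
 moreover have "AE x in lborel. \<forall>v\<in>ratvec. \<forall>w\<in>ratvec. dd (v + w) x = dd v x + dd w x"
  by (subst AE_ball_countable[OF countable_ratvec], intro ballI, subst AE_ball_countable[OF countable_ratvec]) (use AE_dd_additive in blast)
 ultimately show ?thesis
 proof eventually_elim
  case (elim x)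
  have has: "has_dd v x (dd v x)" if "v \<in> ratvec" for v using elim(1) that ddset_imp_has_dd by blast
  have add: "dd (v + w) x = dd v x + dd w x" if "v \<in> ratvec" "w \<in> ratvec" for v w using elim(2) that by blast
  define A where "A v = (\<Sum>i\<in>Basis. (v \<bullet> i) * dd i x)" for v
  have basis_rat: "i \<in> ratvec" if "i \<in> Basis" for i using that by (auto simp: ratvec_def inner_Basis)
  have Aeq: "dd v x = A v" if v: "v \<in> ratvec" for v
  proof -
   have "S \<subseteq> Basis ==> (\<Sum>i\<in>S. (v \<bullet> i) *\<^sub>R i) \<in> ratvec \<and> dd (\<Sum>i\<in>S. (v \<bullet> i) *\<^sub>R i) x = (\<Sum>i\<in>S. (v \<bullet> i) * dd i x)"
    if "finite S" for S
    using that
   proof (induction S rule: finite_induct)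
    case empty
    have "has_dd 0 x 0" by (simp add: has_dd_def dq_def)
    then show ?case using has_dd_dd by (auto simp: ratvec_def)
   next
    case (insert j S)
    have j: "j \<in> Basis" using insert by auto
    have jr: "(v \<bullet> j) *\<^sub>R j \<in> ratvec" using v j by (auto simp: ratvec_def inner_Basis)
    have "dd ((v \<bullet> j) *\<^sub>R j) x = (v \<bullet> j) * dd j x"
     by (rule has_dd_dd[OF has_dd_scale[OF has[OF basis_rat[OF j]]]])
    moreover have IH: "(\<Sum>i\<in>S. (v \<bullet> i) *\<^sub>R i) \<in> ratvec" "dd (\<Sum>i\<in>S. (v \<bullet> i) *\<^sub>R i) x = (\<Sum>i\<in>S. (v \<bullet> i) * dd i x)"
     using insert by auto
    ultimately have "dd ((v \<bullet> j) *\<^sub>R j + (\<Sum>i\<in>S. (v \<bullet> i) *\<^sub>R i)) x = (v \<bullet> j) * dd j x + (\<Sum>i\<in>S. (v \<bullet> i) * dd i x)"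
     using add[OF jr IH(1)] by simp
    moreover have "(v \<bullet> j) *\<^sub>R j + (\<Sum>i\<in>S. (v \<bullet> i) *\<^sub>R i) \<in> ratvec"
     using jr IH(1) by (auto simp: ratvec_def inner_add_left)
    ultimately show ?case using insert.hyps by simp
   qed
   from this[OF finite_Basis order_refl] show ?thesis by (simp add: A_def euclidean_representation)
  qed
  define \<Lambda> where "\<Lambda> = (\<Sum>i\<in>(Basis::'a set). \<bar>dd i x\<bar>)"
  have A_bound: "\<bar>A v\<bar> <= norm v * \<Lambda>" for v
  proof -
   have "\<bar>A v\<bar> <= (\<Sum>i\<in>Basis. \<bar>v \<bullet> i\<bar> * \<bar>dd i x\<bar>)" unfolding A_def by (rule order_trans[OF sum_abs]) (simp add: abs_mult)
   also have "\<dots> <= (\<Sum>i\<in>Basis. norm v * \<bar>dd i x\<bar>)" by (intro sum_mono mult_right_mono) (auto simp: Basis_le_norm)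
   finally show ?thesis by (simp add: \<Lambda>_def sum_distrib_left)
  qed
  have \<Lambda>0: "\<Lambda> \<ge> 0" by (auto simp: \<Lambda>_def intro: sum_nonneg)
  have Alin: "linear A"
   by (rule linearI) (auto simp: A_def inner_add_left algebra_simps sum.distrib sum_distrib_left)
  then have Abl: "bounded_linear A" by (simp add: linear_conv_bounded_linear)
  have "(f has_derivative A) (at x)"
   unfolding has_derivative_at_alt
  proof (intro conjI Abl allI impI)
   fix e :: real assume e: "0 < e"
   \<comment> \<open>Three errors are balanced: moving to a net direction in \<open>f\<close>
     (factor \<open>L\<close>), the difference quotient in that direction (factor 1), and moving
     back in \<open>A\<close> (factor \<open>\<Lambda>\<close>).\<close>
   define \<epsilon> where "\<epsilon> = e / (L + 1 + \<Lambda> + 1)"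
   have \<epsilon>: "\<epsilon> > 0" using e L_nonneg \<Lambda>0 by (simp add: \<epsilon>_def)
   have cov: "cball (0::'a) 1 \<subseteq> (\<Union>w\<in>ratvec. ball w \<epsilon>)"
   proof
    fix v :: 'a
    obtain w where "w \<in> ratvec" "norm (v - w) < \<epsilon>" using ratvec_dense[OF \<epsilon>] by blast
    then show "v \<in> (\<Union>w\<in>ratvec. ball w \<epsilon>)" by (auto simp: dist_norm norm_minus_commute)
   qed
   obtain W where W: "W \<subseteq> ratvec" "finite W" "cball (0::'a) 1 \<subseteq> (\<Union>w\<in>W. ball w \<epsilon>)"
    by (rule compactE_image[OF compact_cball _ cov]) auto
   have "\<forall>w\<in>W. \<forall>\<^sub>F h in at 0. \<bar>dq w h x - A w\<bar> < \<epsilon>"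
   proof
    fix w assume "w \<in> W"
    then have "w \<in> ratvec" using W by blast
    then have "((%h. dq w h x) \<longlongrightarrow> A w) (at 0)" using has[of w] Aeq[of w] by (simp add: has_dd_def)
    then show "\<forall>\<^sub>F h in at 0. \<bar>dq w h x - A w\<bar> < \<epsilon>" using \<epsilon> by (auto simp: tendsto_iff dist_real_def)
   qed
   then have "\<forall>\<^sub>F h in at 0. \<forall>w\<in>W. \<bar>dq w h x - A w\<bar> < \<epsilon>" using W(2) by (simp add: eventually_ball_finite)
   then obtain d where d: "d > 0" "\<And>h w. h ~= 0 ==> dist h 0 < d ==> w \<in> W ==> \<bar>dq w h x - A w\<bar> < \<epsilon>"
    unfolding eventually_at by blast
   show "\<exists>d>0. \<forall>y. norm (y - x) < d --> norm (f y - f x - A (y - x)) <= e * norm (y - x)"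
   proof (intro exI[of _ d] conjI d(1) allI impI)
    fix y assume y: "norm (y - x) < d"
    show "norm (f y - f x - A (y - x)) <= e * norm (y - x)"
    proof (cases "y = x")
     case True
     then show ?thesis using linear_0[OF Alin] by simp
    next
     case False
     define h where "h = norm (y - x)"
     define v where "v = (1 / h) *\<^sub>R (y - x)"
     have h: "h > 0" using False by (simp add: h_def)
     have yv: "y - x = h *\<^sub>R v" "y = x + h *\<^sub>R v" using h by (auto simp: v_def)
     have "norm v = 1" using h by (simp add: v_def h_def)
     then obtain w where w: "w \<in> W" "norm (v - w) < \<epsilon>" using W(3) by (force simp: dist_norm norm_minus_commute)
     have 1: "\<bar>f y - f (x + h *\<^sub>R w)\<bar> <= L * (h * \<epsilon>)"
     proof -
      have "\<bar>f y - f (x + h *\<^sub>R w)\<bar> <= L * norm (y - (x + h *\<^sub>R w))" by (rule lip)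
      also have "y - (x + h *\<^sub>R w) = h *\<^sub>R (v - w)" unfolding yv(2) by (simp add: algebra_simps)
      also have "norm (h *\<^sub>R (v - w)) = h * norm (v - w)" using h by simp
      also have "L * (h * norm (v - w)) <= L * (h * \<epsilon>)"
       using L_nonneg h w by (intro mult_left_mono) auto
      finally show ?thesis .
     qed
     have "\<bar>dq w h x - A w\<bar> < \<epsilon>" using d(2)[of h w] h w y by (simp add: h_def)
     then have "\<bar>h * (dq w h x - A w)\<bar> <= h * \<epsilon>" using h by (simp add: abs_mult)
     then have 2: "\<bar>f (x + h *\<^sub>R w) - f x - h * A w\<bar> <= h * \<epsilon>"
      using h by (simp add: dq_def right_diff_distrib diff_divide_distrib)
     have 3: "\<bar>h * A w - A (y - x)\<bar> <= h * (\<epsilon> * \<Lambda>)"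
     proof -
      have "h * A w - A (y - x) = h * A (w - v)"
       unfolding yv(1) by (simp add: linear_diff[OF Alin] linear_scale[OF Alin] algebra_simps)
      then have "\<bar>h * A w - A (y - x)\<bar> = h * \<bar>A (w - v)\<bar>" using h by (simp add: abs_mult)
      also have "\<dots> <= h * (norm (w - v) * \<Lambda>)" using h A_bound by (intro mult_left_mono) auto
      also have "\<dots> <= h * (\<epsilon> * \<Lambda>)"
       using h w \<Lambda>0 by (intro mult_left_mono mult_right_mono) (auto simp: norm_minus_commute)
      finally show ?thesis .
     qed
     have "\<bar>f y - f x - A (y - x)\<bar> <= L * (h * \<epsilon>) + h * \<epsilon> + h * (\<epsilon> * \<Lambda>)" using 1 2 3 by linarith
     also have "\<dots> = h * (\<epsilon> * (L + 1 + \<Lambda>))" by (simp add: algebra_simps)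
     also have "\<dots> <= h * e"
     proof (rule mult_left_mono)
      have "\<epsilon> * (L + 1 + \<Lambda>) <= \<epsilon> * (L + 1 + \<Lambda> + 1)" using \<epsilon> by (intro mult_left_mono) auto
      also have "\<dots> = e" using L_nonneg \<Lambda>0 by (simp add: \<epsilon>_def)
      finally show "\<epsilon> * (L + 1 + \<Lambda>) <= e" .
     qed (use h in auto)
     finally show ?thesis unfolding h_def by (simp add: mult.commute)
    qed
   qed
  qed
  then show ?case by (auto simp: differentiable_def)
 qed
qed

end

theorem rademacher:
 fixes f :: "'a::euclidean_space => 'b::euclidean_space"
 assumes "\<And>x y. norm (f x - f y) <= L * norm (x - y)"
 shows "negligible {x. \<not> f differentiable (at x)}"
proof -
 have comp: "AE x in lborel. (%y. f y \<bullet> i) differentiable (at x)" if i: "i \<in> Basis" for i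
 proof -
  interpret lipschitz_fun "%y. f y \<bullet> i" L
  proof
   fix x y
   have "\<bar>f x \<bullet> i - f y \<bullet> i\<bar> <= norm (f x - f y)" unfolding inner_diff_left[symmetric] by (rule Basis_le_norm[OF i])
   then show "\<bar>f x \<bullet> i - f y \<bullet> i\<bar> <= L * norm (x - y)" using assms order_trans by blast
  qed
  show ?thesis by (rule differentiable_AE)
 qed
 have "AE x in lborel. \<forall>i\<in>Basis. (%y. f y \<bullet> i) differentiable (at x)"
  unfolding AE_ball_countable[OF countable_finite[OF finite_Basis]] using comp by blast
 then have "AE x in lborel. f differentiable (at x)"
 proof (rule AE_mp, intro AE_I2 impI)
  fix x assume "\<forall>i\<in>Basis. (%y. f y \<bullet> i) differentiable (at x)"
  then show "f differentiable (at x)" by (subst differentiable_componentwise_within) simp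
 qed
 then have "AE x in completion lborel. f differentiable (at x)"
  unfolding AE_completion_iff .
 then show ?thesis by (simp add: completion.AE_iff_null_sets negligible_iff_null_sets)
qed

section \<open>Change of variables\<close>

text \<open>\<open>baby_Sard\<close> and \<open>has_absolute_integral_change_of_variables\<close>
  concern well-ordered index types. This copy of a finite type takes its order from an injection
  into the naturals, and results are carried over along the relabelling
  \<open>to_wo\<close>.\<close>

typedef 'a wo = "UNIV :: 'a set" by simp

lemma bij_Rep_wo: "bij Rep_wo"
 by (metis Abs_wo_inverse Rep_wo_inverse UNIV_I bijI')

instance wo :: (finite) finite
proof
 have "range (Abs_wo :: 'a => 'a wo) = UNIV" by (metis Rep_wo_inverse surjI)
 then show "finite (UNIV :: 'a wo set)" using finite_imageI[OF finite[of "UNIV :: 'a set"]] by metis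
qed

definition wo_index :: "'a::finite wo => nat" where
 "wo_index = (SOME f. inj f)"

lemma inj_wo_index: "inj (wo_index :: 'a::finite wo => nat)"
proof -
 have "\<exists>f :: 'a wo => nat. inj f"
  using finite_imp_inj_to_nat_seg[OF finite[of "UNIV :: 'a wo set"]] by blast
 then show ?thesis unfolding wo_index_def by (rule someI_ex)
qed

instantiation wo :: (finite) wellorder
begin

definition "x <= y \<longleftrightarrow> wo_index x <= wo_index y"
definition "x < y \<longleftrightarrow> wo_index x < wo_index y"

instance
proof
 fix x y z :: "'a wo"
 show "x < y \<longleftrightarrow> x <= y \<and> \<not> y <= x" "x <= x" "x <= y \<or> y <= x"
  by (auto simp: less_eq_wo_def less_wo_def)
 show "x <= y ==> y <= z ==> x <= z" by (simp add: less_eq_wo_def)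
 show "x <= y ==> y <= x ==> x = y"
  by (auto simp: less_eq_wo_def intro: injD[OF inj_wo_index])
 fix P :: "'a wo => bool" and a
 assume H: "\<And>x. (\<And>y. y < x ==> P y) ==> P x"
 show "P a" by (induction a rule: measure_induct_rule[of wo_index]) (use H in \<open>auto simp: less_wo_def\<close>)
qed

end

definition to_wo :: "real^'n => real^('n wo)" where "to_wo x = (\<chi> i. x $ Rep_wo i)"
definition of_wo :: "real^('n::finite wo) => real^'n" where "of_wo y = (\<chi> i. y $ Abs_wo i)"

lemma of_to_wo[simp]: "of_wo (to_wo x) = x" by (simp add: to_wo_def of_wo_def vec_eq_iff Abs_wo_inverse)
lemma to_of_wo[simp]: "to_wo (of_wo y) = y" by (simp add: to_wo_def of_wo_def vec_eq_iff Rep_wo_inverse)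

lemma linear_to_wo: "linear to_wo" by (rule linearI) (auto simp: to_wo_def vec_eq_iff)
lemma linear_of_wo: "linear of_wo" by (rule linearI) (auto simp: of_wo_def vec_eq_iff)
lemma bounded_linear_to_wo: "bounded_linear to_wo" using linear_to_wo by (simp add: linear_conv_bounded_linear)
lemma bounded_linear_of_wo: "bounded_linear of_wo" using linear_of_wo by (simp add: linear_conv_bounded_linear)

lemma bij_to_wo: "bij to_wo" by (rule o_bij[of of_wo]) (auto simp: fun_eq_iff)

lemma to_wo_image: "to_wo ` S = of_wo -` S"
 by (auto simp: image_iff) (metis to_of_wo)
lemma to_wo_borel[measurable]: "to_wo \<in> borel_measurable borel"
 by (intro borel_measurable_continuous_onI linear_continuous_on bounded_linear_to_wo)
lemma of_wo_borel[measurable]: "of_wo \<in> borel_measurable borel"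
 by (intro borel_measurable_continuous_onI linear_continuous_on bounded_linear_of_wo)

text \<open>Relabelling coordinates maps boxes to boxes with the same side lengths, and these
  determine Lebesgue measure.\<close>

lemma distr_to_wo: "distr lborel borel (to_wo :: real^'n => real^('n::finite wo)) = lborel"
proof (rule lborel_eqI[symmetric])
 fix l u :: "real^('n::finite wo)" assume lu: "\<And>b. b \<in> Basis ==> l \<bullet> b <= u \<bullet> b"
 have lu': "l $ i <= u $ i" for i using lu[of "axis i 1"] by (simp add: inner_axis)
 have vi: "to_wo -` box l u = box (of_wo l) (of_wo u)"
 proof (rule Set.set_eqI)
  fix x :: "real^'n"
  have "(\<forall>i. l $ i < x $ Rep_wo i \<and> x $ Rep_wo i < u $ i) \<longleftrightarrow> (\<forall>i. l $ Abs_wo i < x $ i \<and> x $ i < u $ Abs_wo i)"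
   by (metis Abs_wo_inverse Rep_wo_inverse UNIV_I)
  then show "x \<in> to_wo -` box l u \<longleftrightarrow> x \<in> box (of_wo l) (of_wo u)"
   by (simp add: mem_box_cart to_wo_def of_wo_def)
 qed
 have b: "bij (Abs_wo :: 'n => 'n wo)" by (metis Abs_wo_inverse Rep_wo_inverse UNIV_I bijI')
 have pr: "(\<Prod>b\<in>Basis. (v :: real^'k) \<bullet> b) = (\<Prod>i\<in>UNIV. v $ i)" for v
 proof -
  have "(\<Prod>b\<in>Basis. v \<bullet> b) = (\<Prod>b\<in>range (%i::'k. axis i (1::real)). v \<bullet> b)"
   by (intro arg_cong2[where f = prod] refl) (auto simp: Basis_vec_def)
  also have "\<dots> = (\<Prod>i\<in>UNIV. v \<bullet> axis i 1)" by (rule prod.reindex_cong[OF _ refl]) (auto simp: inj_on_def axis_eq_axis)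
  finally show ?thesis by (simp add: inner_axis)
 qed
 have "emeasure (distr lborel borel to_wo) (box l u) = emeasure lborel (box (of_wo l) (of_wo u))"
  by (subst emeasure_distr) (auto simp: vi)
 also have "\<dots> = (\<Prod>b\<in>Basis. (of_wo u - of_wo l) \<bullet> b)"
  by (rule emeasure_lborel_box) (use lu' in \<open>auto simp: Basis_vec_def inner_axis of_wo_def\<close>)
 also have "(\<Prod>b\<in>Basis. (of_wo u - of_wo l) \<bullet> b) = (\<Prod>b\<in>Basis. (u - l) \<bullet> b)"
  unfolding pr using prod.reindex_bij_betw[OF b, of "%i. (u - l) $ i"] by (simp add: of_wo_def)
 finally show "emeasure (distr lborel borel to_wo) (box l u) = (\<Prod>b\<in>Basis. (u - l) \<bullet> b)" .
qed simp

lemma to_wo_lebesgue_sets: "S \<in> sets lebesgue ==> to_wo -` S \<in> sets lebesgue"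
 and to_wo_lebesgue_emeasure: "S \<in> sets lebesgue ==> emeasure lebesgue (to_wo -` S) = emeasure lebesgue S"
proof -
 assume S: "S \<in> sets lebesgue"
 obtain B N N' where SB: "S = B \<union> N" "N \<subseteq> N'" "N' \<in> null_sets lborel" "B \<in> sets lborel"
  using S by (rule sets_completionE)
 have d: "to_wo -` A \<in> sets lborel" "emeasure lborel (to_wo -` A) = emeasure lborel A" if "A \<in> sets lborel" for A
 proof -
  have "to_wo -` A \<inter> space lborel \<in> sets lborel" using that by (intro measurable_sets[of to_wo lborel borel]) auto
  then show "to_wo -` A \<in> sets lborel" by simp
  have "emeasure lborel A = emeasure (distr lborel borel to_wo) A" by (simp add: distr_to_wo)
  also have "\<dots> = emeasure lborel (to_wo -` A)" using that by (subst emeasure_distr) auto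
  finally show "emeasure lborel (to_wo -` A) = emeasure lborel A" by simp
 qed
 have n: "to_wo -` N' \<in> null_sets lborel" using SB(3) d[of N'] by (auto simp: null_sets_def)
 have eq: "to_wo -` S = to_wo -` B \<union> to_wo -` N" using SB(1) by auto
 have nn: "to_wo -` N \<in> null_sets lebesgue" "N \<in> null_sets lebesgue"
  by (rule null_sets_completion_subset[OF vimage_mono[OF SB(2)] null_sets_completionI[OF n]],
    rule null_sets_completion_subset[OF SB(2) null_sets_completionI[OF SB(3)]])
 show "to_wo -` S \<in> sets lebesgue"
  unfolding eq using d(1)[OF SB(4)] nn(1) by (auto simp: null_sets_def)
 have "emeasure lebesgue (to_wo -` S) = emeasure lebesgue (to_wo -` B)"
  unfolding eq using d(1)[OF SB(4)] by (intro emeasure_Un_null_set nn(1)) auto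
 also have "\<dots> = emeasure lebesgue B" using d[OF SB(4)] SB(4) by simp
 also have "\<dots> = emeasure lebesgue S" unfolding SB(1) using SB(4) by (intro emeasure_Un_null_set[symmetric] nn(2)) auto
 finally show "emeasure lebesgue (to_wo -` S) = emeasure lebesgue S" .
qed

lemma to_wo_lebesgue_measurable: "to_wo \<in> measurable lebesgue lebesgue"
 by (rule measurableI) (auto simp: to_wo_lebesgue_sets)

lemma distr_to_wo_lebesgue: "distr lebesgue lebesgue (to_wo :: real^'n => real^('n::finite wo)) = lebesgue"
 by (rule measure_eqI) (auto simp: emeasure_distr to_wo_lebesgue_measurable to_wo_lebesgue_emeasure)

lemma of_wo_lebesgue_sets: "S \<in> sets lebesgue ==> of_wo -` S \<in> sets lebesgue"
proof -
 assume S: "S \<in> sets lebesgue"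
 obtain B N N' where SB: "S = B \<union> N" "N \<subseteq> N'" "N' \<in> null_sets lborel" "B \<in> sets lborel"
  using S by (rule sets_completionE)
 have d: "of_wo -` A \<in> sets lborel" if "A \<in> sets lborel" for A
  using that measurable_sets[of of_wo lborel borel A] by auto
 have "emeasure lborel (of_wo -` N') = emeasure (distr lborel borel to_wo) (of_wo -` N')" by (simp add: distr_to_wo)
 also have "\<dots> = emeasure lborel (to_wo -` (of_wo -` N'))" using d[of N'] SB(3) by (subst emeasure_distr) auto
 also have "to_wo -` (of_wo -` N') = N'" by auto
 finally have "of_wo -` N' \<in> null_sets lborel" using SB(3) d[of N'] by (auto simp: null_sets_def)
 then have "of_wo -` N \<in> null_sets lebesgue"
  by (rule null_sets_completion_subset[OF vimage_mono[OF SB(2)] null_sets_completionI])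
 moreover have "of_wo -` S = of_wo -` B \<union> of_wo -` N" using SB(1) by auto
 ultimately show "of_wo -` S \<in> sets lebesgue" using d[OF SB(4)] by (auto simp: null_sets_def)
qed

lemma of_wo_lebesgue_measurable: "of_wo \<in> measurable lebesgue lebesgue"
 by (rule measurableI) (auto simp: of_wo_lebesgue_sets)

text \<open>An image measure computation for measurable \<open>h\<close>; for other \<open>h\<close>
  neither function is integrable and both integrals are 0 by convention.\<close>

lemma integrable_wo_iff:
 fixes h :: "real^('n::finite wo) => real"
 shows "integrable lebesgue (%x. h (to_wo x)) \<longleftrightarrow> integrable lebesgue h"
  and "(\<integral>x. h (to_wo x) \<partial>lebesgue) = (\<integral>x. h x \<partial>lebesgue)"
proof -
 have m: "h \<in> borel_measurable lebesgue" if "(%x. h (to_wo x)) \<in> borel_measurable lebesgue"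
  using measurable_compose[OF of_wo_lebesgue_measurable that] by simp
 have *: "integrable lebesgue (%x. h (to_wo x)) \<longleftrightarrow> integrable lebesgue h" if "h \<in> borel_measurable lebesgue"
  using integrable_distr_eq[OF to_wo_lebesgue_measurable that] by (simp add: distr_to_wo_lebesgue)
 then show 1: "integrable lebesgue (%x. h (to_wo x)) \<longleftrightarrow> integrable lebesgue h"
  using m borel_measurable_integrable by blast
 show "(\<integral>x. h (to_wo x) \<partial>lebesgue) = (\<integral>x. h x \<partial>lebesgue)"
 proof (cases "h \<in> borel_measurable lebesgue")
  case True
  then show ?thesis using integral_distr[OF to_wo_lebesgue_measurable True] by (simp add: distr_to_wo_lebesgue)
 next
  case False
  then have "\<not> integrable lebesgue h" by (meson borel_measurable_integrable)
  then show ?thesis using 1 by (simp add: not_integrable_integral_eq)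
 qed
qed

lemma negligible_wo: "negligible (to_wo ` S) \<longleftrightarrow> negligible S"
proof
 assume "negligible S"
 then show "negligible (to_wo ` S)"
  unfolding negligible_iff_null_sets to_wo_image
  using of_wo_lebesgue_sets[of S] to_wo_lebesgue_emeasure[of "of_wo -` S"] by (auto simp: null_sets_def vimage_def)
next
 assume "negligible (to_wo ` S)"
 then have n: "of_wo -` S \<in> null_sets lebesgue" by (simp add: negligible_iff_null_sets to_wo_image)
 have "to_wo -` (of_wo -` S) = S" by auto
 then show "negligible S"
  unfolding negligible_iff_null_sets
  using to_wo_lebesgue_sets[of "of_wo -` S"] to_wo_lebesgue_emeasure[of "of_wo -` S"] n by (auto simp: null_sets_def)
qed

text \<open>Conjugation along \<open>r\<close> matches the permutations of the two index types,
  keeps their signs and reorders the factors of each product.\<close>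

lemma det_reindex:
 fixes A :: "real^'n^'n" and r :: "'m::finite => 'n::finite"
 assumes r: "bij r"
 shows "det (\<chi> i j. A $ r i $ r j) = det A"
proof -
 let ?F = "%p x. if x \<in> UNIV then r (p (inv_into UNIV r x)) else x"
 have F: "bij_betw ?F {p. p permutes (UNIV :: 'm set)} {p. p permutes (UNIV :: 'n set)}"
  by (rule bij_betw_permutations[OF r])
 have Feq: "?F p = map_permutation UNIV r p" for p
  using r by (auto simp: map_permutation_def restrict_id_def fun_eq_iff bij_def)
 have "det A = (\<Sum>p\<in>{p. p permutes (UNIV :: 'm set)}. of_int (sign (?F p)) * (\<Prod>i\<in>UNIV. A $ i $ ?F p i))"
  unfolding det_def by (rule sum.reindex_bij_betw[OF F, symmetric])
 also have "\<dots> = (\<Sum>p\<in>{p. p permutes (UNIV :: 'm set)}. of_int (sign p) * (\<Prod>i\<in>UNIV. A $ r i $ r (p i)))"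
 proof (rule sum.cong[OF refl])
  fix p assume "p \<in> {p. p permutes (UNIV :: 'm set)}"
  then have "sign (?F p) = sign p" unfolding Feq using r by (intro sign_map_permutation) (auto simp: bij_def)
  moreover have "(\<Prod>i\<in>UNIV. A $ i $ ?F p i) = (\<Prod>i\<in>UNIV. A $ r i $ ?F p (r i))"
   by (rule prod.reindex_bij_betw[OF r, symmetric])
  moreover have "?F p (r i) = r (p i)" for i using r by (simp add: bij_def)
  ultimately show "of_int (sign (?F p)) * (\<Prod>i\<in>UNIV. A $ i $ ?F p i) = of_int (sign p) * (\<Prod>i\<in>UNIV. A $ r i $ r (p i))"
   by simp
 qed
 finally show ?thesis by (simp add: det_def)
qed

lemma det_matrix_wo: "det (matrix (%y. to_wo (f (of_wo y)))) = det (matrix f)"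
proof -
 have e: "of_wo (axis j 1) = axis (Rep_wo j) 1" for j :: "'a wo"
  by (auto simp: of_wo_def axis_def vec_eq_iff Rep_wo_inverse Abs_wo_inverse)
 then have "matrix (%y. to_wo (f (of_wo y))) = (\<chi> i j. matrix f $ Rep_wo i $ Rep_wo j)"
  unfolding matrix_def to_wo_def e by (simp add: vec_eq_iff)
 then show ?thesis by (simp add: det_reindex[OF bij_Rep_wo])
qed

lemma has_derivative_wo:
 assumes "(f has_derivative f') (at x within S)"
 shows "((%y. to_wo (f (of_wo y))) has_derivative (%y. to_wo (f' (of_wo y)))) (at (to_wo x) within to_wo ` S)"
proof -
 have "(of_wo has_derivative of_wo) (at (to_wo x) within to_wo ` S)"
  by (rule bounded_linear_imp_has_derivative[OF bounded_linear_of_wo])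
 then have "(f \<circ> of_wo has_derivative f' \<circ> of_wo) (at (to_wo x) within to_wo ` S)"
  by (rule diff_chain_within) (use assms in \<open>simp add: image_image\<close>)
 then show ?thesis
  using bounded_linear.has_derivative[OF bounded_linear_to_wo] by (fastforce simp: o_def)
qed

text \<open>Sard's lemma for the relabelled map, a vanishing determinant being a defect of
  rank.\<close>

lemma negligible_image_det_0:
 fixes f :: "real^'n => real^'n"
 assumes der: "\<And>x. x \<in> S ==> (f has_derivative f' x) (at x within S)"
  and det0: "\<And>x. x \<in> S ==> det (matrix (f' x)) = 0"
 shows "negligible (f ` S)"
proof -
 let ?g = "%y. to_wo (f (of_wo y))"
 have "negligible (?g ` to_wo ` S)"
 proof (rule baby_Sard[where f' = "%z y. to_wo (f' (of_wo z) (of_wo y))"])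
  fix z assume "z \<in> to_wo ` S"
  then obtain x where x: "x \<in> S" "z = to_wo x" by blast
  show "(?g has_derivative (%y. to_wo (f' (of_wo z) (of_wo y)))) (at z within to_wo ` S)"
   using has_derivative_wo[OF der[OF x(1)]] x(2) by simp
  have "det (matrix (%y. to_wo (f' (of_wo z) (of_wo y)))) = 0"
   unfolding det_matrix_wo using det0[OF x(1)] x(2) by simp
  then show "rank (matrix (%y. to_wo (f' (of_wo z) (of_wo y)))) < CARD('n wo)"
   by (simp add: det_eq_0_rank)
 qed simp
 moreover have "?g ` to_wo ` S = to_wo ` (f ` S)" by (auto simp: image_image)
 ultimately show ?thesis by (simp add: negligible_wo)
qed

lemma change_of_variables_nonneg:
 fixes f :: "real^'n => real^'n" and h :: "real^'n => real"
 assumes S: "S \<in> sets lebesgue"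
  and der: "\<And>x. x \<in> S ==> (f has_derivative f' x) (at x within S)"
  and inj: "inj_on f S"
  and h: "set_integrable lebesgue (f ` S) h"
 shows "set_integrable lebesgue S (%x. \<bar>det (matrix (f' x))\<bar> * h (f x))"
  and "(LINT x:S|lebesgue. \<bar>det (matrix (f' x))\<bar> * h (f x)) = (LINT y:f ` S|lebesgue. h y)"
proof -
 let ?g = "%y. to_wo (f (of_wo y))"
 let ?g' = "%z y. to_wo (f' (of_wo z) (of_wo y))"
 let ?W = "to_wo ` S"
 have S': "?W \<in> sets lebesgue" unfolding to_wo_image by (rule of_wo_lebesgue_sets[OF S])
 have der': "(?g has_derivative ?g' z) (at z within ?W)" if z: "z \<in> ?W" for z
 proof -
  obtain x where x: "x \<in> S" "z = to_wo x" using z by blast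
  show ?thesis using has_derivative_wo[OF der[OF x(1)]] x(2) by simp
 qed
 have inj': "inj_on ?g ?W"
  using inj bij_to_wo by (auto simp: inj_on_def bij_def)
 have im: "?g ` ?W = to_wo ` (f ` S)" by (auto simp: image_image)
 \<comment> \<open>The change of variables theorem takes vector-valued integrands, so
   \<open>h\<close> is packed into \<open>real^1\<close>.\<close>
 define H :: "real^('n::finite wo) => real^1" where "H y = (\<chi> i. h (of_wo y))" for y
 have comp: "K absolutely_integrable_on A \<longleftrightarrow> (%y. K y $ 1) absolutely_integrable_on A" for K :: "real^('n::finite wo) => real^1" and A
  by (subst absolutely_integrable_componentwise_iff) (auto simp: Basis_vec_def cart_eq_inner_axis[symmetric])
 have ind: "indicator (to_wo ` A) (to_wo x) = (indicator A x :: real)" for A and x :: "real^'n"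
  using bij_to_wo by (auto simp: indicator_def bij_def inj_def)
 have ab: "set_integrable lebesgue (to_wo ` A) k \<longleftrightarrow> set_integrable lebesgue A (%x. k (to_wo x))"
  "(LINT y:to_wo ` A|lebesgue. k y) = (LINT x:A|lebesgue. k (to_wo x))" for k :: "real^('n::finite wo) => real" and A
  using integrable_wo_iff[of "%y. indicator (to_wo ` A) y *\<^sub>R k y"]
  by (simp_all add: set_integrable_def set_lebesgue_integral_def ind)
 have "(%y. H y $ 1) absolutely_integrable_on ?g ` ?W"
  unfolding im ab(1) using h by (simp add: H_def)
 then have Hi: "H absolutely_integrable_on ?g ` ?W" by (subst comp)
 note cov = has_absolute_integral_change_of_variables[OF S' der' inj', of H "integral (?g ` ?W) H"]
 have cov1: "(%z. \<bar>det (matrix (?g' z))\<bar> *\<^sub>R H (?g z)) absolutely_integrable_on ?W"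
  and cov2: "integral ?W (%z. \<bar>det (matrix (?g' z))\<bar> *\<^sub>R H (?g z)) = integral (?g ` ?W) H"
  using cov Hi by blast+
 have i1: "(%z. \<bar>det (matrix (f' (of_wo z)))\<bar> * h (f (of_wo z))) absolutely_integrable_on ?W"
  using cov1 unfolding comp det_matrix_wo by (simp add: H_def)
 show I: "set_integrable lebesgue S (%x. \<bar>det (matrix (f' x))\<bar> * h (f x))"
  using i1 unfolding ab(1) by simp
 have int1: "integral A K $ 1 = integral A (%y. K y $ 1)" if "K absolutely_integrable_on A" for K :: "real^('n::finite wo) => real^1" and A
  by (rule integral_component_eq_cart[symmetric, OF set_lebesgue_integral_eq_integral(1)[OF that]])
 have "(LINT x:S|lebesgue. \<bar>det (matrix (f' x))\<bar> * h (f x)) = integral ?W (%z. \<bar>det (matrix (f' (of_wo z)))\<bar> * h (f (of_wo z)))"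
  using set_lebesgue_integral_eq_integral(2)[OF i1] ab(2)[of S "%z. \<bar>det (matrix (f' (of_wo z)))\<bar> * h (f (of_wo z))"] by simp
 also have "\<dots> = integral ?W (%z. \<bar>det (matrix (?g' z))\<bar> *\<^sub>R H (?g z)) $ 1"
  using int1[OF cov1] unfolding det_matrix_wo by (simp add: H_def)
 also have "\<dots> = integral (?g ` ?W) (%y. H y $ 1)" unfolding cov2 int1[OF Hi] ..
 also have "\<dots> = (LINT y:?g ` ?W|lebesgue. H y $ 1)"
  using set_lebesgue_integral_eq_integral(2)[of "?g ` ?W" "%y. H y $ 1"] Hi unfolding comp by simp
 also have "\<dots> = (LINT y:f ` S|lebesgue. h y)" unfolding im ab(2) by (simp add: H_def)
 finally show "(LINT x:S|lebesgue. \<bar>det (matrix (f' x))\<bar> * h (f x)) = (LINT y:f ` S|lebesgue. h y)" .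
qed

lemma borel_measurable_det_Jacobian_finite:
 fixes f :: "real^'n => real^'n"
 assumes S: "S \<in> sets lebesgue" and der: "\<And>x. x \<in> S ==> (f has_derivative f' x) (at x within S)"
 shows "(%x. det (matrix (f' x))) \<in> borel_measurable (lebesgue_on S)"
proof -
 let ?g = "%y. to_wo (f (of_wo y))"
 let ?g' = "%z y. to_wo (f' (of_wo z) (of_wo y))"
 let ?W = "to_wo ` S"
 have S': "?W \<in> sets lebesgue" unfolding to_wo_image by (rule of_wo_lebesgue_sets[OF S])
 have der': "(?g has_derivative ?g' z) (at z within ?W)" if z: "z \<in> ?W" for z
 proof -
  obtain x where x: "x \<in> S" "z = to_wo x" using z by blast
  show ?thesis using has_derivative_wo[OF der[OF x(1)]] x(2) by simp
 qed
 have "(%z. det (matrix (?g' z))) \<in> borel_measurable (lebesgue_on ?W)"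
  by (rule borel_measurable_det_Jacobian[OF S' der'])
 then have m: "(%z. det (matrix (f' (of_wo z)))) \<in> borel_measurable (lebesgue_on ?W)"
  unfolding det_matrix_wo .
 have "to_wo \<in> measurable (lebesgue_on S) (lebesgue_on ?W)"
  using to_wo_lebesgue_measurable by (intro measurable_restrict_space2 measurable_restrict_space1) (auto simp: space_restrict_space)
 from measurable_compose[OF this m] show ?thesis by simp
qed

section \<open>Smooth functions and mollification\<close>

lemma C_class_SucI:
 assumes "\<And>z. (g has_derivative G z) (at z)" "\<And>v. C_class k (%z. G z v)"
 shows "C_class (Suc k) g"
proof -
 have "frechet_derivative g (at z) = G z" for z
  using frechet_derivative_at[OF assms(1)] by simp
 then show ?thesis using assms by (auto simp: differentiable_def)
qed

lemma C_class_has_derivative: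
 "C_class (Suc k) g ==> (g has_derivative frechet_derivative g (at z)) (at z)"
 by (simp add: frechet_derivative_works)

lemma C_class_continuous: "C_class k g ==> continuous_on UNIV g"
proof (cases k)
 case (Suc j)
 assume "C_class k g"
 then have "g differentiable (at z)" for z using Suc by simp
 then show ?thesis
  by (intro continuous_at_imp_continuous_on ballI differentiable_imp_continuous_within)
qed simp

lemma C_class_SucD: "C_class (Suc k) g ==> C_class k g"
proof (induction k arbitrary: g)
 case 0
 then show ?case using C_class_continuous by fastforce
next
 case (Suc k)
 have d: "g differentiable (at z)" for z using Suc.prems by simp
 have "C_class k (%z. frechet_derivative g (at z) v)" for v
  by (rule Suc.IH) (use Suc.prems in simp)
 then show ?case using d by simp
qed

lemma C_class_const [simp]: "C_class k (%_. c)"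
proof (induction k arbitrary: c)
 case (Suc k)
 show ?case by (rule C_class_SucI[where G = "%_ _. 0"]) (auto simp: Suc.IH)
qed simp

lemma C_class_linear: "bounded_linear L ==> C_class k L"
proof (cases k)
 case 0
 assume "bounded_linear L"
 then show ?thesis using 0 by (simp add: linear_continuous_on)
next
 case (Suc j)
 assume "bounded_linear L"
 then show ?thesis unfolding Suc
  by (intro C_class_SucI[where G = "%_. L"]) (auto simp: bounded_linear_imp_has_derivative)
qed

lemma C_class_add: "C_class k f ==> C_class k g ==> C_class k (%z. f z + g z)"
proof (induction k arbitrary: f g)
 case 0
 then show ?case by (auto intro: continuous_on_add)
next
 case (Suc k)
 show ?case
  by (rule C_class_SucI[OF has_derivative_add[OF C_class_has_derivative[OF Suc.prems(1)] C_class_has_derivative[OF Suc.prems(2)]]])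
    (rule Suc.IH; use Suc.prems in simp)
qed

lemma C_class_mult: "C_class k f ==> C_class k g ==> C_class k (%z. f z * g z)"
proof (induction k arbitrary: f g)
 case 0
 then show ?case by (auto intro: continuous_on_mult)
next
 case (Suc k)
 show ?case
 proof (rule C_class_SucI[OF has_derivative_mult[OF C_class_has_derivative[OF Suc.prems(1)] C_class_has_derivative[OF Suc.prems(2)]]])
  fix v
  have "C_class k f" "C_class k g" using C_class_SucD Suc.prems by blast+
  moreover have "C_class k (%z. frechet_derivative f (at z) v)" "C_class k (%z. frechet_derivative g (at z) v)"
   using Suc.prems by simp_all
  ultimately show "C_class k (%z. f z * frechet_derivative g (at z) v + frechet_derivative f (at z) v * g z)"
   by (intro C_class_add Suc.IH)
 qed
qed

lemma C_class_cmult: "C_class k f ==> C_class k (%z. c * f z)"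
 by (rule C_class_mult[OF C_class_const])

lemma C_class_diff: "C_class k f ==> C_class k g ==> C_class k (%z. f z - g z)"
 using C_class_add[OF _ C_class_cmult[of k g "-1"], of f] by simp

lemma C_class_compose_affine:
 assumes L: "bounded_linear L"
 shows "C_class k g ==> C_class k (%z. g (L z + c))"
proof (induction k arbitrary: g)
 case 0
 have "continuous_on UNIV (%z. L z + c)" by (intro continuous_on_add linear_continuous_on L continuous_on_const)
 then show ?case using 0 by (auto intro: continuous_on_compose2)
next
 case (Suc k)
 have "((%z. g (L z + c)) has_derivative (%v. frechet_derivative g (at (L z + c)) (L v))) (at z)" for z
 proof -
  have "((%z. L z + c) has_derivative L) (at z)"
   using has_derivative_add[OF bounded_linear_imp_has_derivative[OF L] has_derivative_const[of c]] by simp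
  then show ?thesis
   by (rule has_derivative_compose[OF _ C_class_has_derivative[OF Suc.prems]])
 qed
 then show ?case
  by (rule C_class_SucI) (rule Suc.IH, use Suc.prems in simp)
qed

text \<open>The powers in the denominator close the family under differentiation up to linear
  combinations, so smoothness is an induction with \<open>j\<close> free.\<close>

definition smooth_exp :: "nat => real => real" where
 "smooth_exp j x = (if x > 0 then exp (- 1 / x) / x ^ j else 0)"

text \<open>From \<open>(1 + y / m) ^ m <= exp y\<close> with \<open>y = 1 / x\<close> and
  \<open>m = j + 2\<close>. This exponent leaves \<open>x\<^sup>2\<close> after division by
  \<open>x ^ j\<close>, which gives derivative 0 at the origin.\<close>

lemma smooth_exp_le:
 fixes x :: real
 assumes "0 < x"
 shows "smooth_exp j x <= real (j + 2) ^ (j + 2) * x\<^sup>2"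
proof -
 let ?m = "j + 2"
 have "(1 / (real ?m * x)) ^ ?m <= (1 + (1 / x) / real ?m) ^ ?m"
  using assms by (intro power_mono) (auto simp: field_simps)
 also have "\<dots> <= exp (1 / x)"
 proof (rule exp_ge_one_plus_x_over_n_power_n)
  have "0 <= 1 / x" using assms by simp
  then show "- real ?m <= 1 / x" by linarith
 qed simp
 finally have le: "1 / (real ?m * x) ^ ?m <= exp (1 / x)" by (simp only: power_one_over)
 define q where "q = (real ?m * x) ^ ?m"
 have q: "q > 0" unfolding q_def using assms by (intro zero_less_power mult_pos_pos) auto
 have "1 <= exp (1 / x) * q" using le q unfolding q_def[symmetric] by (simp add: divide_le_eq)
 then have "1 / exp (1 / x) <= q" by (simp add: divide_le_eq mult.commute)
 then have "exp (- 1 / x) <= (real ?m * x) ^ ?m" unfolding q_def by (simp only: exp_minus inverse_eq_divide minus_divide_left[symmetric])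
 then have "exp (- 1 / x) / x ^ j <= (real ?m * x) ^ ?m / x ^ j"
  using assms by (intro divide_right_mono) auto
 also have "\<dots> = real ?m ^ ?m * x\<^sup>2"
  using assms by (simp add: power_mult_distrib power_add power2_eq_square)
 finally show ?thesis using assms by (simp add: smooth_exp_def)
qed

lemma smooth_exp_nonneg: "0 <= smooth_exp j x"
 by (simp add: smooth_exp_def)

lemma smooth_exp_deriv:
 "(smooth_exp j has_real_derivative (smooth_exp (j + 2) x - real j * smooth_exp (j + 1) x)) (at x)"
proof -
 consider "x > 0" | "x < 0" | "x = 0" by linarith
 then show ?thesis
 proof cases
  case 1
  have "((%x. exp (- 1 / x) / x ^ j) has_real_derivative (smooth_exp (j + 2) x - real j * smooth_exp (j + 1) x)) (at x)"
  proof -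
   have "((%x. exp (- 1 / x) / x ^ j) has_real_derivative
     ((exp (- 1 / x) * (1 / x\<^sup>2)) * x ^ j - exp (- 1 / x) * (real j * x ^ (j - 1))) / (x ^ j * x ^ j)) (at x)"
    using 1 by (auto intro!: derivative_eq_intros simp: power2_eq_square)
   moreover have "((exp (- 1 / x) * (1 / x\<^sup>2)) * x ^ j - exp (- 1 / x) * (real j * x ^ (j - 1))) / (x ^ j * x ^ j)
     = smooth_exp (j + 2) x - real j * smooth_exp (j + 1) x"
    using 1 by (cases j) (auto simp: smooth_exp_def field_simps power2_eq_square)
   ultimately show ?thesis by simp
  qed
  then show ?thesis
   by (rule has_field_derivative_transform_within_open[of _ _ _ "{0<..}"]) (use 1 in \<open>auto simp: smooth_exp_def\<close>)
 next
  case 2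
  have "((%x. 0) has_real_derivative 0) (at x)" by simp
  then have "(smooth_exp j has_real_derivative 0) (at x)"
   by (rule has_field_derivative_transform_within_open[of _ _ _ "{..<0}"]) (use 2 in \<open>auto simp: smooth_exp_def\<close>)
  then show ?thesis using 2 by (simp add: smooth_exp_def)
 next
  case 3
  let ?C = "real (j + 2) ^ (j + 2)"
  have "((%y. (smooth_exp j y - smooth_exp j 0) / (y - 0)) \<longlongrightarrow> 0) (at 0)"
  proof (rule Lim_null_comparison[where g = "%y. ?C * \<bar>y\<bar>"])
   show "\<forall>\<^sub>F y in at 0. norm ((smooth_exp j y - smooth_exp j 0) / (y - 0)) <= ?C * \<bar>y\<bar>"
   proof (rule always_eventually, rule allI)
    fix y :: real
    show "norm ((smooth_exp j y - smooth_exp j 0) / (y - 0)) <= ?C * \<bar>y\<bar>"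
    proof (cases "y > 0")
     case True
     have "smooth_exp j y / y <= (?C * y\<^sup>2) / y"
      using smooth_exp_le[OF True, of j] True by (intro divide_right_mono) auto
     also have "\<dots> = ?C * y" using True by (simp add: power2_eq_square)
     finally show ?thesis using True smooth_exp_nonneg[of j y] by (simp add: smooth_exp_def[of _ 0])
    next
     case False
     then have z: "smooth_exp j y = 0" "smooth_exp j 0 = 0" by (auto simp: smooth_exp_def)
     have "0 <= ?C * \<bar>y\<bar>" by (rule mult_nonneg_nonneg) auto
     then show ?thesis using False by (simp add: z)
    qed
   qed
   show "((%y. ?C * \<bar>y\<bar>) \<longlongrightarrow> 0) (at 0)" by (auto intro!: tendsto_eq_intros)
  qed
  then have "(smooth_exp j has_real_derivative 0) (at 0)" by (simp add: has_field_derivative_iff)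
  then show ?thesis using 3 by (simp add: smooth_exp_def)
 qed
qed

lemma C_class_smooth_exp: "C_class k g ==> C_class k (%z. smooth_exp j (g z))"
proof (induction k arbitrary: j)
 case 0
 have "continuous_on UNIV (smooth_exp j)"
  by (intro continuous_at_imp_continuous_on ballI) (rule DERIV_isCont[OF smooth_exp_deriv])
 then show ?case using 0 by (auto intro: continuous_on_compose2)
next
 case (Suc k)
 let ?d = "%x. smooth_exp (j + 2) x - real j * smooth_exp (j + 1) x"
 have "((%z. smooth_exp j (g z)) has_derivative (%v. ?d (g z) * frechet_derivative g (at z) v)) (at z)" for z
  by (rule has_derivative_compose[OF C_class_has_derivative[OF Suc.prems] smooth_exp_deriv[unfolded has_field_derivative_def]])
 then show ?case
 proof (rule C_class_SucI)
  fix v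
  have g: "C_class k g" by (rule C_class_SucD[OF Suc.prems])
  have "C_class k (%z. frechet_derivative g (at z) v)" using Suc.prems by simp
  then show "C_class k (%z. ?d (g z) * frechet_derivative g (at z) v)"
   by (intro C_class_mult C_class_diff C_class_cmult Suc.IH g)
 qed
qed

section \<open>Bump functions, mollifiers and convolutions\<close>

definition bump :: "'a::euclidean_space => real" where
 "bump x = smooth_exp 0 (1 - x \<bullet> x)"

lemma bump_nonneg: "0 <= bump x" by (simp add: bump_def smooth_exp_nonneg)

lemma bump_eq_0: "norm x \<ge> 1 ==> bump x = 0"
proof -
 assume "norm x \<ge> 1"
 then have "1 <= (norm x)\<^sup>2" by simp
 then show ?thesis by (simp add: bump_def smooth_exp_def power2_norm_eq_inner)
qed

lemma bump_pos: "norm x < 1 ==> 0 < bump x"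
proof -
 assume "norm x < 1"
 then have "(norm x)\<^sup>2 < 1" by (simp add: power_less_one_iff)
 then show ?thesis by (simp add: bump_def smooth_exp_def power2_norm_eq_inner)
qed

lemma C_class_bump: "C_class k bump"
proof -
 have "C_class k (%x::'a. x \<bullet> x)"
 proof (cases k)
  case (Suc j)
  have "((%x::'a. x \<bullet> x) has_derivative (%v. 2 * (z \<bullet> v))) (at z)" for z
   by (rule has_derivative_eq_rhs[OF has_derivative_inner[OF has_derivative_ident has_derivative_ident]]) (auto simp: inner_commute)
  then show ?thesis unfolding Suc
   by (rule C_class_SucI) (intro C_class_cmult C_class_linear bounded_linear_inner_left)
 qed (auto intro!: continuous_intros)
 then show ?thesis unfolding bump_def
  by (intro C_class_smooth_exp C_class_diff C_class_const)
qed

text \<open>Dividing by the integral of the rescaled bump normalises without an explicit power of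
  \<open>\<epsilon>\<close>.\<close>

definition mollifier :: "real => 'a::euclidean_space => real" where
 "mollifier \<epsilon> x = bump (x /\<^sub>R \<epsilon>) / (\<integral>y. bump (y /\<^sub>R \<epsilon> :: 'a) \<partial>lborel)"

lemma bump_integrable: "0 < \<epsilon> ==> integrable lborel (%y. bump (y /\<^sub>R \<epsilon> :: 'a::euclidean_space))"
 and bump_integral_pos: "0 < \<epsilon> ==> 0 < (\<integral>y. bump (y /\<^sub>R \<epsilon> :: 'a::euclidean_space) \<partial>lborel)"
proof -
 assume e: "0 < \<epsilon>"
 let ?g = "%y::'a. bump (y /\<^sub>R \<epsilon>)"
 have c: "continuous_on UNIV ?g"
  by (intro continuous_on_compose2[OF C_class_continuous[OF C_class_bump[of 0]]] continuous_intros) auto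
 have z: "?g y = 0" if "y \<notin> cball 0 \<epsilon>" for y
  using that e by (intro bump_eq_0) (auto simp: field_simps)
 have "integrable lborel (%y. indicator (cball 0 \<epsilon>) y *\<^sub>R ?g y)"
  by (rule borel_integrable_compact) (auto intro: continuous_on_subset[OF c])
 moreover have "(%y. indicator (cball 0 \<epsilon>) y *\<^sub>R ?g y) = ?g" using z by (auto simp: indicator_def fun_eq_iff)
 ultimately show i: "integrable lborel ?g" by simp
 have "(\<integral>y. ?g y \<partial>lborel) ~= 0"
 proof
  assume "(\<integral>y. ?g y \<partial>lborel) = 0"
  then have ae: "AE y in lborel. ?g y = 0"
   using integral_nonneg_eq_0_iff_AE[OF i] bump_nonneg by auto
  have "ball (0::'a) \<epsilon> \<in> null_sets lborel"
  proof (subst AE_iff_null_sets)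
   show "AE y in lborel. y \<notin> ball (0::'a) \<epsilon>"
    using ae
   proof eventually_elim
    fix y :: 'a assume "?g y = 0"
    then have "\<not> norm (y /\<^sub>R \<epsilon>) < 1" using bump_pos by fastforce
    then show "y \<notin> ball 0 \<epsilon>" using e by (auto simp: field_simps)
   qed
  qed simp
  then have "negligible (ball (0::'a) \<epsilon>)"
   unfolding negligible_iff_null_sets by (rule null_sets_completionI)
  then show False using open_not_negligible[of "ball (0::'a) \<epsilon>"] e by simp
 qed
 moreover have "0 <= (\<integral>y. ?g y \<partial>lborel)" by (intro integral_nonneg_AE) (auto simp: bump_nonneg)
 ultimately show "0 < (\<integral>y. ?g y \<partial>lborel)" by simp
qed

lemma mollifier_nonneg: "0 < \<epsilon> ==> 0 <= mollifier \<epsilon> x"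
 using bump_integral_pos[of \<epsilon>] by (simp add: mollifier_def bump_nonneg less_imp_le)

lemma mollifier_eq_0: "0 < \<epsilon> ==> \<epsilon> <= norm x ==> mollifier \<epsilon> x = 0"
 by (simp add: mollifier_def bump_eq_0 field_simps)

lemma mollifier_integrable: "0 < \<epsilon> ==> integrable lborel (mollifier \<epsilon>)"
 unfolding mollifier_def[abs_def] by (intro integrable_divide bump_integrable)

lemma mollifier_integral: "0 < \<epsilon> ==> (\<integral>x. mollifier \<epsilon> (x::'a::euclidean_space) \<partial>lborel) = 1"
 unfolding mollifier_def using bump_integral_pos[of \<epsilon>, where 'a = 'a] by simp

lemma C_class_mollifier: "C_class k (mollifier \<epsilon> :: 'a::euclidean_space => real)"
proof -
 have "C_class k (%x::'a. bump (inverse \<epsilon> *\<^sub>R x + 0))"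
  by (rule C_class_compose_affine[OF bounded_linear_scaleR_right C_class_bump])
 from C_class_cmult[OF this, of "1 / (\<integral>y. bump (y /\<^sub>R \<epsilon> :: 'a) \<partial>lborel)"]
 show ?thesis unfolding mollifier_def[abs_def] by simp
qed

lemma frechet_derivative_eq_0:
 assumes "open U" "x \<in> U" "\<And>y. y \<in> U ==> g y = 0"
 shows "frechet_derivative g (at x) v = (0::real)"
proof -
 have "((%_. 0) has_derivative (%_. 0)) (at x)" by simp
 then have "(g has_derivative (%_. 0)) (at x)"
  by (rule has_derivative_transform_within_open[OF _ assms(1,2)]) (use assms(3) in auto)
 then show ?thesis using frechet_derivative_at by metis
qed

lemma C_class_derivative_zero_outside:
 assumes "\<And>x. norm x > R ==> g x = 0" "norm x > R"
 shows "frechet_derivative g (at x) v = (0::real)"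
proof (rule frechet_derivative_eq_0[of "- cball 0 R"])
 show "open (- cball 0 R)" by auto
qed (use assms in auto)

lemma C_class_bounded_derivative:
 assumes C: "C_class 1 g" and R: "\<And>x::'a::euclidean_space. norm x > R ==> g x = 0"
 obtains B where "\<And>x v. \<bar>frechet_derivative g (at x) v\<bar> <= B * norm v" "B \<ge> 0"
proof -
 have C': "C_class (Suc 0) g" using C by simp
 have "\<exists>B. \<forall>x. \<bar>frechet_derivative g (at x) i\<bar> <= B" for i
 proof -
  have "continuous_on UNIV (%x. frechet_derivative g (at x) i)" using C' by simp
  then have "bounded ((%x. frechet_derivative g (at x) i) ` cball 0 R)"
   by (meson compact_cball compact_continuous_image compact_imp_bounded continuous_on_subset subset_UNIV)
  then obtain B where B: "\<And>x. x \<in> cball 0 R ==> \<bar>frechet_derivative g (at x) i\<bar> <= B"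
   unfolding bounded_iff real_norm_def by blast
  have "\<bar>frechet_derivative g (at x) i\<bar> <= \<bar>B\<bar>" for x
  proof (cases "norm x > R")
   case True
   then show ?thesis using C_class_derivative_zero_outside[OF R True] by simp
  next
   case False
   then show ?thesis using B[of x] by simp
  qed
  then show ?thesis by blast
 qed
 then obtain B where B: "\<And>x i. \<bar>frechet_derivative g (at x) i\<bar> <= B i" by metis
 have B0: "B i \<ge> 0" for i using B[of undefined i] by linarith
 show ?thesis
 proof (rule that[of "\<Sum>i\<in>Basis. B i"])
  fix x v :: 'a
  have lin: "linear (frechet_derivative g (at x))"
   using C_class_has_derivative[OF C'] has_derivative_linear by blast
  have "frechet_derivative g (at x) v = frechet_derivative g (at x) (\<Sum>i\<in>Basis. (v \<bullet> i) *\<^sub>R i)"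
   by (simp add: euclidean_representation)
  also have "\<dots> = (\<Sum>i\<in>Basis. (v \<bullet> i) * frechet_derivative g (at x) i)"
   by (simp add: linear_sum[OF lin] linear_scale[OF lin])
  finally have "\<bar>frechet_derivative g (at x) v\<bar> <= (\<Sum>i\<in>Basis. \<bar>v \<bullet> i\<bar> * \<bar>frechet_derivative g (at x) i\<bar>)"
   by (simp add: sum_abs flip: abs_mult)
  also have "\<dots> <= (\<Sum>i\<in>Basis. norm v * B i)"
   by (intro sum_mono mult_mono Basis_le_norm B) auto
  finally show "\<bar>frechet_derivative g (at x) v\<bar> <= (\<Sum>i\<in>Basis. B i) * norm v"
   by (simp add: sum_distrib_left mult.commute)
 qed (auto intro: sum_nonneg B0)
qed

text \<open>Second derivatives are continuous and vanish outside a ball, so the first derivative is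
  Lipschitz; the mean value bound for \<open>g\<close> minus its linearisation then gives the
  quadratic remainder.\<close>

lemma C_class_Taylor2:
 assumes C: "C_class 2 g" and R: "\<And>x::'a::euclidean_space. norm x > R ==> g x = 0"
 obtains B where "\<And>x h. \<bar>g (x + h) - g x - frechet_derivative g (at x) h\<bar> <= B * (norm h)\<^sup>2" "B \<ge> 0"
proof -
 have C2: "C_class (Suc (Suc 0)) g" using C by (simp add: numeral_2_eq_2)
 have "\<exists>B. B \<ge> 0 \<and> (\<forall>x y. \<bar>frechet_derivative g (at x) i - frechet_derivative g (at y) i\<bar> <= B * norm (x - y))" for i
 proof -
  have Ci: "C_class 1 (%x. frechet_derivative g (at x) i)" using C2 by simp
  have z: "frechet_derivative g (at x) i = 0" if "norm x > R" for x
   by (rule C_class_derivative_zero_outside[OF R that])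
  obtain B where B: "\<And>x v. \<bar>frechet_derivative (%x. frechet_derivative g (at x) i) (at x) v\<bar> <= B * norm v" "B \<ge> 0"
   using C_class_bounded_derivative[OF Ci z] by blast
  have "norm (frechet_derivative g (at x) i - frechet_derivative g (at y) i) <= B * norm (x - y)" for x y
  proof (rule differentiable_bound[OF convex_UNIV])
   fix z
   show "((%x. frechet_derivative g (at x) i) has_derivative frechet_derivative (%x. frechet_derivative g (at x) i) (at z)) (at z within UNIV)"
    using C_class_has_derivative[of 0 "%x. frechet_derivative g (at x) i" z] Ci by simp
   show "onorm (frechet_derivative (%x. frechet_derivative g (at x) i) (at z)) <= B"
    by (rule onorm_bound[OF B(2)]) (use B(1) in simp)
  qed auto
  then show ?thesis using B(2) by auto
 qed
 then obtain B where B0: "\<And>i. B i \<ge> 0" and B: "\<And>i x y. \<bar>frechet_derivative g (at x) i - frechet_derivative g (at y) i\<bar> <= B i * norm (x - y)" by metis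
 define K where "K = (\<Sum>i\<in>Basis. B i)"
 have K0: "K \<ge> 0" by (simp add: K_def sum_nonneg B0)
 have lin: "linear (frechet_derivative g (at x))" for x
  using C_class_has_derivative[OF C2] has_derivative_linear by blast
 have DL: "\<bar>frechet_derivative g (at x) v - frechet_derivative g (at y) v\<bar> <= K * norm (x - y) * norm v" for x y v
 proof -
  have e: "frechet_derivative g (at z) v = (\<Sum>i\<in>Basis. (v \<bullet> i) * frechet_derivative g (at z) i)" for z
  proof -
   have "frechet_derivative g (at z) v = frechet_derivative g (at z) (\<Sum>i\<in>Basis. (v \<bullet> i) *\<^sub>R i)"
    by (simp add: euclidean_representation)
   then show ?thesis by (simp add: linear_sum[OF lin] linear_scale[OF lin])
  qed
  have "\<bar>frechet_derivative g (at x) v - frechet_derivative g (at y) v\<bar>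
    = \<bar>\<Sum>i\<in>Basis. (v \<bullet> i) * (frechet_derivative g (at x) i - frechet_derivative g (at y) i)\<bar>"
   unfolding e by (simp add: sum_subtractf right_diff_distrib)
  also have "\<dots> <= (\<Sum>i\<in>Basis. \<bar>v \<bullet> i\<bar> * \<bar>frechet_derivative g (at x) i - frechet_derivative g (at y) i\<bar>)"
   by (rule order_trans[OF sum_abs]) (simp add: abs_mult)
  also have "\<dots> <= (\<Sum>i\<in>Basis. norm v * (B i * norm (x - y)))"
   by (intro sum_mono mult_mono Basis_le_norm B) auto
  also have "\<dots> = K * norm (x - y) * norm v" by (simp add: K_def sum_distrib_left sum_distrib_right mult_ac)
  finally show ?thesis .
 qed
 show ?thesis
 proof (rule that[OF _ K0])
  fix x h :: 'a
  define p where "p y = g y - frechet_derivative g (at x) y" for y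
  have "norm (p (x + h) - p x) <= (K * norm h * 1) * norm (x + h - x)"
  proof (rule differentiable_bound[of "cball x (norm h)" p "%z v. frechet_derivative g (at z) v - frechet_derivative g (at x) v"])
   fix z assume z: "z \<in> cball x (norm h)"
   have "bounded_linear (frechet_derivative g (at x))" using lin by (simp add: linear_conv_bounded_linear)
   then have "(p has_derivative (%v. frechet_derivative g (at z) v - frechet_derivative g (at x) v)) (at z)"
    unfolding p_def by (intro has_derivative_diff C_class_has_derivative[OF C2] bounded_linear_imp_has_derivative)
   then show "(p has_derivative (%v. frechet_derivative g (at z) v - frechet_derivative g (at x) v)) (at z within cball x (norm h))"
    by (rule has_derivative_at_withinI)
   show "onorm (%v. frechet_derivative g (at z) v - frechet_derivative g (at x) v) <= K * norm h * 1"
   proof (rule onorm_bound)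
    fix v
    have "\<bar>frechet_derivative g (at z) v - frechet_derivative g (at x) v\<bar> <= K * norm (z - x) * norm v" by (rule DL)
    also have "\<dots> <= K * norm h * norm v"
     using z K0 by (intro mult_right_mono mult_left_mono) (auto simp: dist_norm norm_minus_commute)
    finally show "norm (frechet_derivative g (at z) v - frechet_derivative g (at x) v) <= K * norm h * 1 * norm v" by simp
   qed (use K0 in auto)
  qed (auto simp: dist_norm)
  then show "\<bar>g (x + h) - g x - frechet_derivative g (at x) h\<bar> <= K * (norm h)\<^sup>2"
   by (simp add: p_def linear_add[OF lin] power2_eq_square algebra_simps)
 qed
qed

definition mollify :: "real => ('a::euclidean_space => real) => 'a => real" where
 "mollify \<epsilon> u x = (\<integral>y. mollifier \<epsilon> (x - y) * u y \<partial>lborel)"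

lemma bounded_if_eq_0_outside:
 fixes g :: "'a::euclidean_space => real"
 assumes "continuous_on UNIV g" "\<And>x. norm x > R ==> g x = 0"
 shows "\<exists>M\<ge>0. \<forall>x. \<bar>g x\<bar> <= M"
proof -
 have "bounded (g ` cball 0 R)"
  using assms(1) by (intro compact_imp_bounded compact_continuous_image continuous_on_subset[OF assms(1)]) auto
 then obtain M where M: "\<And>x. x \<in> cball 0 R ==> \<bar>g x\<bar> <= M" unfolding bounded_iff real_norm_def by blast
 have "\<bar>g x\<bar> <= \<bar>M\<bar>" for x
  using M[of x] assms(2)[of x] by (cases "norm x > R") auto
 then show ?thesis by (intro exI[of _ "\<bar>M\<bar>"]) auto
qed

lemma integrable_convolution:
 fixes u g :: "'a::euclidean_space => real"
 assumes u: "integrable lborel u" and g: "continuous_on UNIV g" "\<And>x. norm x > R ==> g x = 0"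
 shows "integrable lborel (%y. g (x - y) * u y)"
proof -
 obtain M where M: "\<And>x. \<bar>g x\<bar> <= M" using bounded_if_eq_0_outside[OF g] by blast
 have [measurable]: "g \<in> borel_measurable borel" by (rule borel_measurable_continuous_onI[OF g(1)])
 have [measurable]: "u \<in> borel_measurable borel" using borel_measurable_integrable[OF u] by simp
 show ?thesis
 proof (rule Bochner_Integration.integrable_bound[OF integrable_mult_right[OF u, of M]])
  show "AE y in lborel. norm (g (x - y) * u y) <= norm (M * u y)"
   using M by (intro AE_I2) (auto simp: abs_mult intro!: mult_right_mono order_trans[OF M abs_ge_self])
 qed measurable
qed

text \<open>The quadratic Taylor bound of \<open>g\<close> passes under the integral and yields the
  derivative and its remainder at once. The order of the quantifiers matters: \<open>B\<close> is
  chosen before \<open>u\<close>, which enters only through its L^1 norm, so that later one constant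
  serves a whole family of functions.\<close>

lemma convolution_derivative:
 fixes g :: "'a::euclidean_space => real"
 assumes g: "\<And>j. C_class j g" "\<And>x. norm x > R ==> g x = 0"
 shows "\<exists>B\<ge>0. \<forall>u. integrable lborel u --> (\<forall>x.
   ((%x. \<integral>y. g (x - y) * u y \<partial>lborel) has_derivative
    (%v. \<integral>y. frechet_derivative g (at (x - y)) v * u y \<partial>lborel)) (at x)) \<and>
   (\<forall>x h. \<bar>(\<integral>y. g (x + h - y) * u y \<partial>lborel) - (\<integral>y. g (x - y) * u y \<partial>lborel)
    - (\<integral>y. frechet_derivative g (at (x - y)) h * u y \<partial>lborel)\<bar> <= B * (\<integral>y. \<bar>u y\<bar> \<partial>lborel) * (norm h)\<^sup>2) \<and>
   (\<forall>x v. \<bar>\<integral>y. frechet_derivative g (at (x - y)) v * u y \<partial>lborel\<bar> <= B * (\<integral>y. \<bar>u y\<bar> \<partial>lborel) * norm v)"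
proof -
 let ?D = "%z v. frechet_derivative g (at z) v"
 have CD: "C_class j (%z. ?D z v)" for j v using g(1)[of "Suc j"] by simp
 have D0: "?D x v = 0" if "norm x > R" for x v by (rule C_class_derivative_zero_outside[OF g(2) that])
 obtain B1 where B1: "\<And>x h. \<bar>g (x + h) - g x - ?D x h\<bar> <= B1 * (norm h)\<^sup>2" "B1 \<ge> 0"
  using C_class_Taylor2[OF g(1,2)] by blast
 obtain B2 where B2: "\<And>x v. \<bar>?D x v\<bar> <= B2 * norm v" "B2 \<ge> 0"
  using C_class_bounded_derivative[OF g(1,2)] by blast
 define B where "B = max B1 B2"
 have B: "\<bar>g (x + h) - g x - ?D x h\<bar> <= B * (norm h)\<^sup>2" "\<bar>?D x h\<bar> <= B * norm h" "B \<ge> 0" for x h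
  using order_trans[OF B1(1) mult_right_mono[of B1 B]] order_trans[OF B2(1) mult_right_mono[of B2 B]] B1(2) by (auto simp: B_def)
 have lin: "linear (?D z)" for z
  using C_class_has_derivative[OF g(1)[of "Suc 0"]] has_derivative_linear by blast
 have main: "(\<forall>x. ((%x. \<integral>y. g (x - y) * u y \<partial>lborel) has_derivative (%v. \<integral>y. ?D (x - y) v * u y \<partial>lborel)) (at x)) \<and>
   (\<forall>x h. \<bar>(\<integral>y. g (x + h - y) * u y \<partial>lborel) - (\<integral>y. g (x - y) * u y \<partial>lborel)
    - (\<integral>y. ?D (x - y) h * u y \<partial>lborel)\<bar> <= B * (\<integral>y. \<bar>u y\<bar> \<partial>lborel) * (norm h)\<^sup>2) \<and>
   (\<forall>x v. \<bar>\<integral>y. ?D (x - y) v * u y \<partial>lborel\<bar> <= B * (\<integral>y. \<bar>u y\<bar> \<partial>lborel) * norm v)"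
  if u: "integrable lborel u" for u :: "'a => real"
 proof -
  define I where "I = (\<integral>y. \<bar>u y\<bar> \<partial>lborel)"
  have I0: "I \<ge> 0" by (simp add: I_def)
  have iD: "integrable lborel (%y. ?D (x - y) v * u y)" for x v
   by (rule integrable_convolution[OF u C_class_continuous[OF CD] D0])
  have ig: "integrable lborel (%y. g (x - y) * u y)" for x
   by (rule integrable_convolution[OF u C_class_continuous[OF g(1)] g(2)])
  have bl: "bounded_linear (%v. \<integral>y. ?D (x - y) v * u y \<partial>lborel)" for x
  proof -
   have "linear (%v. \<integral>y. ?D (x - y) v * u y \<partial>lborel)"
    by (rule linearI)
      (simp_all add: linear_add[OF lin] linear_scale[OF lin] distrib_right mult.assoc iD)
   then show ?thesis by (simp add: linear_conv_bounded_linear)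
  qed
  have est: "\<bar>(\<integral>y. g (x + h - y) * u y \<partial>lborel) - (\<integral>y. g (x - y) * u y \<partial>lborel) - (\<integral>y. ?D (x - y) h * u y \<partial>lborel)\<bar>
    <= B * I * (norm h)\<^sup>2" for x h
  proof -
   have "(\<integral>y. g (x + h - y) * u y \<partial>lborel) - (\<integral>y. g (x - y) * u y \<partial>lborel) - (\<integral>y. ?D (x - y) h * u y \<partial>lborel)
     = (\<integral>y. (g (x + h - y) - g (x - y) - ?D (x - y) h) * u y \<partial>lborel)"
    by (simp add: left_diff_distrib ig iD)
   also have "\<bar>\<dots>\<bar> <= (\<integral>y. (B * (norm h)\<^sup>2) * \<bar>u y\<bar> \<partial>lborel)"
   proof (rule order_trans[OF integral_abs_bound], rule integral_mono_AE)
    have "integrable lborel (%y. g (x + h - y) * u y - g (x - y) * u y - ?D (x - y) h * u y)"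
     by (intro Bochner_Integration.integrable_diff ig iD)
    then show "integrable lborel (%y. \<bar>(g (x + h - y) - g (x - y) - ?D (x - y) h) * u y\<bar>)"
     by (intro integrable_abs) (simp add: left_diff_distrib)
    show "integrable lborel (%y. (B * (norm h)\<^sup>2) * \<bar>u y\<bar>)" using u by auto
    have "\<bar>g (x + h - y) - g (x - y) - ?D (x - y) h\<bar> <= B * (norm h)\<^sup>2" for y
     using B(1)[of "x - y" h] by (simp add: algebra_simps)
    then show "AE y in lborel. \<bar>(g (x + h - y) - g (x - y) - ?D (x - y) h) * u y\<bar> <= (B * (norm h)\<^sup>2) * \<bar>u y\<bar>"
     by (intro AE_I2) (simp add: abs_mult mult_right_mono)
   qed
   also have "\<dots> = B * I * (norm h)\<^sup>2" by (simp add: I_def)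
   finally show ?thesis .
  qed
  have bd: "\<bar>\<integral>y. ?D (x - y) v * u y \<partial>lborel\<bar> <= B * I * norm v" for x v
  proof -
   have "\<bar>\<integral>y. ?D (x - y) v * u y \<partial>lborel\<bar> <= (\<integral>y. (B * norm v) * \<bar>u y\<bar> \<partial>lborel)"
   proof (rule order_trans[OF integral_abs_bound], rule integral_mono_AE)
    show "integrable lborel (%y. \<bar>?D (x - y) v * u y\<bar>)" by (intro integrable_abs iD)
    show "integrable lborel (%y. (B * norm v) * \<bar>u y\<bar>)" using u by auto
    show "AE y in lborel. \<bar>?D (x - y) v * u y\<bar> <= (B * norm v) * \<bar>u y\<bar>"
     using B(2) by (intro AE_I2) (simp add: abs_mult mult_right_mono)
   qed
   then show ?thesis by (simp add: I_def mult_ac)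
  qed
  have der: "((%x. \<integral>y. g (x - y) * u y \<partial>lborel) has_derivative (%v. \<integral>y. ?D (x - y) v * u y \<partial>lborel)) (at x)" for x
   unfolding has_derivative_at_alt
  proof (intro conjI bl allI impI)
   fix e :: real assume e: "0 < e"
   define d where "d = e / (B * I + 1)"
   have BI: "B * I \<ge> 0" using B(3) I0 by simp
   have d: "d > 0" using e BI by (simp add: d_def add_nonneg_pos)
   show "\<exists>d>0. \<forall>y. norm (y - x) < d -->
     norm ((\<integral>ya. g (y - ya) * u ya \<partial>lborel) - (\<integral>y. g (x - y) * u y \<partial>lborel) - (\<integral>ya. ?D (x - ya) (y - x) * u ya \<partial>lborel)) <= e * norm (y - x)"
   proof (intro exI[of _ d] conjI d allI impI)
    fix z assume z: "norm (z - x) < d"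
    have "B * I * (norm (z - x))\<^sup>2 <= B * I * (d * norm (z - x))"
     using z BI by (intro mult_left_mono) (auto simp: power2_eq_square intro: mult_right_mono)
    also have "\<dots> <= e * norm (z - x)"
    proof -
     have "B * I * d <= e" using BI e by (simp add: d_def field_simps)
     then have "B * I * d * norm (z - x) <= e * norm (z - x)" by (intro mult_right_mono) auto
     then show ?thesis by (simp add: mult.assoc)
    qed
    finally show "norm ((\<integral>ya. g (z - ya) * u ya \<partial>lborel) - (\<integral>y. g (x - y) * u y \<partial>lborel) - (\<integral>ya. ?D (x - ya) (z - x) * u ya \<partial>lborel)) <= e * norm (z - x)"
     using est[of x "z - x"] by (simp add: real_norm_def)
   qed
  qed
  show ?thesis using der est bd unfolding I_def by blast
 qed
 show ?thesis by (rule exI[of _ B], rule conjI, rule B(3)) (use main in blast)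
qed

text \<open>Derivatives fall on \<open>g\<close>, and they vanish outside the same ball; hence the
  induction runs over \<open>g\<close> with \<open>u\<close> fixed.\<close>

lemma C_class_convolution:
 fixes u :: "'a::euclidean_space => real"
 assumes u: "integrable lborel u"
 shows "(\<And>j. C_class j g) ==> (\<And>x. norm x > R ==> g x = 0) ==> C_class k (%x. \<integral>y. g (x - y) * u y \<partial>lborel)"
proof (induction k arbitrary: g)
 case (Suc k)
 have CD: "C_class j (%z. frechet_derivative g (at z) v)" for j v using Suc.prems(1)[of "Suc j"] by simp
 have D0: "frechet_derivative g (at x) v = 0" if "norm x > R" for x v
  by (rule C_class_derivative_zero_outside[OF Suc.prems(2) that])
 show ?case
  by (rule C_class_SucI[where G = "%x v. \<integral>y. frechet_derivative g (at (x - y)) v * u y \<partial>lborel"])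
    (use convolution_derivative[OF Suc.prems] u in blast, rule Suc.IH[OF CD D0])
next
 case (0 g)
 have "((%x. \<integral>y. g (x - y) * u y \<partial>lborel) has_derivative
   (%v. \<integral>y. frechet_derivative g (at (x - y)) v * u y \<partial>lborel)) (at x)" for x
  using convolution_derivative[OF 0] u by blast
 then show ?case by (auto intro!: continuous_at_imp_continuous_on has_derivative_continuous)
qed

section \<open>Curves in local Lebesgue spaces\<close>

lemma Lp_norm_infinity_imp_L1:
 fixes g :: "'a::euclidean_space => real"
 assumes g: "g \<in> borel_measurable lebesgue" and K: "compact K"
 shows "(\<integral>\<^sup>+x. ennreal \<bar>g x\<bar> \<partial>lebesgue_on K) <= Lp_norm_on \<infinity> K g * emeasure lebesgue K"
proof -
 have Ks: "K \<in> sets lebesgue" using K by (simp add: compact_imp_closed borel_closed)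
 let ?N = "esssup (lebesgue_on K) (%x. ennreal \<bar>g x\<bar>)"
 have gm: "(%x. ennreal \<bar>g x\<bar>) \<in> borel_measurable (lebesgue_on K)"
  using g by (intro measurable_restrict_space1) measurable
 have "AE x in lebesgue_on K. ennreal \<bar>g x\<bar> <= ?N"
  by (rule esssup_AE[where f = "%x. ennreal \<bar>g x\<bar>"])
 then have "(\<integral>\<^sup>+x. ennreal \<bar>g x\<bar> \<partial>lebesgue_on K) <= (\<integral>\<^sup>+x. ?N \<partial>lebesgue_on K)"
  by (rule nn_integral_mono_AE)
 also have "\<dots> = ?N * emeasure lebesgue K"
  using Ks by (simp add: emeasure_restrict_space space_restrict_space)
 finally show ?thesis by (simp add: Lp_norm_on_def)
qed

text \<open>A substitute for Hoelder's inequality: integrated over a set of finite measure it bounds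
  the L^1 norm through the L^q norm, with \<open>l\<close> free for balancing.\<close>

lemma le_interpolate:
 fixes y q l :: real
 assumes "0 < l" "1 <= q" "0 <= y"
 shows "y <= l + l powr (1 - q) * y powr q"
proof (cases "y <= l")
 case True
 then show ?thesis by (simp add: add_increasing2)
next
 case False
 then have y: "0 < y" using assms by simp
 have "y = y powr (1 - q) * y powr q" using y by (simp flip: powr_add)
 also have "\<dots> <= l powr (1 - q) * y powr q"
  using False assms by (intro mult_right_mono powr_mono2') auto
 finally show ?thesis using assms by simp
qed

lemma Lp_norm_finite_imp_L1:
 fixes g :: "'a::euclidean_space => real"
 assumes g: "g \<in> borel_measurable lebesgue" and K: "compact K" and p: "1 <= p" "p ~= \<infinity>" and l: "0 < l" and d: "0 < d"
  and norm: "Lp_norm_on p K g < ennreal d"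
 shows "(\<integral>\<^sup>+x. ennreal \<bar>g x\<bar> \<partial>lebesgue_on K)
   <= ennreal (l * measure lebesgue K + l powr (1 - enn2real p) * d powr enn2real p)"
proof -
 define q where "q = enn2real p"
 have q: "1 <= q"
 proof -
  have "p = ennreal q" using p(2) by (simp add: q_def less_top)
  then show ?thesis using p(1) by (metis ennreal_ge_1)
 qed
 have Ks: "K \<in> sets lebesgue" using K by (simp add: compact_imp_closed borel_closed)
 have Kf: "emeasure lebesgue K = ennreal (measure lebesgue K)"
  using lmeasurable_compact[OF K] by (simp add: emeasure_eq_measure2)
 define I where "I = (\<integral>\<^sup>+x. ennreal (\<bar>g x\<bar> powr q) \<partial>lebesgue_on K)"
 have gm: "(%x. ennreal (\<bar>g x\<bar> powr q)) \<in> borel_measurable (lebesgue_on K)"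
  using g by (intro measurable_restrict_space1) measurable
 have Ifin: "I ~= \<infinity>"
 proof
  assume "I = \<infinity>"
  then have "Lp_norm_on p K g = \<infinity>" using p(2) by (simp add: Lp_norm_on_def I_def q_def Let_def)
  then show False using norm by simp
 qed
 then have "Lp_norm_on p K g = ennreal (enn2real I powr (1 / q))"
  using p(2) by (simp add: Lp_norm_on_def I_def q_def Let_def)
 then have "enn2real I powr (1 / q) < d" using norm d by (simp add: ennreal_less_iff)
 then have "(enn2real I powr (1 / q)) powr q <= d powr q" using q by (intro powr_mono2) auto
 then have Id: "enn2real I <= d powr q" using q by (simp add: powr_powr)
 have "(\<integral>\<^sup>+x. ennreal \<bar>g x\<bar> \<partial>lebesgue_on K) <= (\<integral>\<^sup>+x. ennreal l + ennreal (l powr (1 - q)) * ennreal (\<bar>g x\<bar> powr q) \<partial>lebesgue_on K)"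
 proof (rule nn_integral_mono)
  fix x
  have "ennreal \<bar>g x\<bar> <= ennreal (l + l powr (1 - q) * \<bar>g x\<bar> powr q)"
   by (intro ennreal_leI le_interpolate l q) simp
  also have "\<dots> = ennreal l + ennreal (l powr (1 - q)) * ennreal (\<bar>g x\<bar> powr q)"
   using l by (simp add: ennreal_plus ennreal_mult)
  finally show "ennreal \<bar>g x\<bar> <= ennreal l + ennreal (l powr (1 - q)) * ennreal (\<bar>g x\<bar> powr q)" .
 qed
 also have "\<dots> = ennreal l * emeasure lebesgue K + ennreal (l powr (1 - q)) * I"
  unfolding I_def using gm Ks
  by (subst nn_integral_add) (auto simp: nn_integral_cmult emeasure_restrict_space space_restrict_space)
 also have "\<dots> = ennreal (l * measure lebesgue K) + ennreal (l powr (1 - q)) * ennreal (enn2real I)"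
  using l Ifin by (simp add: Kf ennreal_mult less_top)
 also have "\<dots> = ennreal (l * measure lebesgue K + l powr (1 - q) * enn2real I)"
  using l by (simp add: ennreal_plus ennreal_mult)
 also have "\<dots> <= ennreal (l * measure lebesgue K + l powr (1 - q) * d powr q)"
  using Id by (intro ennreal_leI add_left_mono mult_left_mono) auto
 finally show ?thesis by (simp add: q_def)
qed

lemma set_integral_abs_le_if_nn_integral_le:
 fixes g :: "'a::euclidean_space => real"
 assumes g: "g \<in> borel_measurable lebesgue" and K: "compact K"
  and le: "(\<integral>\<^sup>+x. ennreal \<bar>g x\<bar> \<partial>lebesgue_on K) <= ennreal e" and e: "0 <= e"
 shows "set_integrable lebesgue K g" "(LINT x:K|lebesgue. \<bar>g x\<bar>) <= e"
proof -
 have Ks: "K \<in> sets lebesgue" using K by (simp add: compact_imp_closed borel_closed)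
 have gm: "g \<in> borel_measurable (lebesgue_on K)" using g by (rule measurable_restrict_space1)
 have i: "integrable (lebesgue_on K) g"
  using gm le by (intro integrableI_bounded) (auto intro: le_less_trans)
 then show "set_integrable lebesgue K g"
  using Ks by (simp add: integrable_restrict_space set_integrable_def)
 have "(\<integral>\<^sup>+x. ennreal \<bar>g x\<bar> \<partial>lebesgue_on K) = ennreal (\<integral>x. \<bar>g x\<bar> \<partial>lebesgue_on K)"
  using i by (intro nn_integral_eq_integral) auto
 then have "(\<integral>x. \<bar>g x\<bar> \<partial>lebesgue_on K) <= e" using le e by (simp add: ennreal_le_iff)
 moreover have "(\<integral>x. \<bar>g x\<bar> \<partial>lebesgue_on K) = (LINT x:K|lebesgue. \<bar>g x\<bar>)"
  using Ks by (simp add: integral_restrict_space set_lebesgue_integral_def)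
 ultimately show "(LINT x:K|lebesgue. \<bar>g x\<bar>) <= e" by simp
qed

lemma Lp_norm_imp_set_integrable:
 fixes g :: "'a::euclidean_space => real"
 assumes g: "g \<in> borel_measurable lebesgue" and K: "compact K" and p: "1 <= p" and fin: "Lp_norm_on p K g < \<infinity>"
 shows "set_integrable lebesgue K g"
proof -
 have "\<exists>e\<ge>0. (\<integral>\<^sup>+x. ennreal \<bar>g x\<bar> \<partial>lebesgue_on K) <= ennreal e"
 proof (cases "p = \<infinity>")
  case True
  have "Lp_norm_on \<infinity> K g * emeasure lebesgue K < \<infinity>"
  proof -
   have "emeasure lebesgue K < \<infinity>" using lmeasurable_compact[OF K] unfolding fmeasurable_def by blast
   then show ?thesis using fin True by (intro ennreal_mult_less_top[THEN iffD2, unfolded infinity_ennreal_def[symmetric]]) auto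
  qed
  then have "Lp_norm_on \<infinity> K g * emeasure lebesgue K = ennreal (enn2real (Lp_norm_on \<infinity> K g * emeasure lebesgue K))"
   by simp
  then show ?thesis using Lp_norm_infinity_imp_L1[OF g K] by (metis enn2real_nonneg)
 next
  case False
  define d where "d = enn2real (Lp_norm_on p K g) + 1"
  have d: "0 < d" by (simp add: d_def add_nonneg_pos)
  have "Lp_norm_on p K g = ennreal (enn2real (Lp_norm_on p K g))" using fin by simp
  then have "Lp_norm_on p K g < ennreal d" unfolding d_def
   by (metis enn2real_nonneg ennreal_lessI less_add_one add_nonneg_pos zero_less_one)
  from Lp_norm_finite_imp_L1[OF g K p False zero_less_one d this] show ?thesis
   by (intro exI[of _ "1 * measure lebesgue K + 1 powr (1 - enn2real p) * d powr enn2real p"]) auto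
 qed
 then show ?thesis using set_integral_abs_le_if_nn_integral_le(1)[OF g K] by blast
qed

lemma Lp_norm_small_imp_L1_small:
 assumes K: "compact (K :: 'a::euclidean_space set)" and p: "1 <= p" and e: "0 < e"
 shows "\<exists>d>0. \<forall>g\<in>borel_measurable lebesgue. Lp_norm_on p K g < ennreal d --> (LINT x:K|lebesgue. \<bar>g x\<bar>) <= e"
proof -
 define m where "m = measure lebesgue K"
 have m0: "m \<ge> 0" by (simp add: m_def)
 have Km: "emeasure lebesgue K = ennreal m"
  using lmeasurable_compact[OF K] by (simp add: emeasure_eq_measure2 m_def)
 show ?thesis
 proof (cases "p = \<infinity>")
  case True
  define d where "d = e / (m + 1)"
  have d: "d > 0" using e m0 by (simp add: d_def)
  have "(LINT x:K|lebesgue. \<bar>g x\<bar>) <= e" if g: "g \<in> borel_measurable lebesgue" "Lp_norm_on p K g < ennreal d" for g :: "'a => real"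
  proof (rule set_integral_abs_le_if_nn_integral_le(2)[OF g(1) K])
   have "(\<integral>\<^sup>+x. ennreal \<bar>g x\<bar> \<partial>lebesgue_on K) <= Lp_norm_on \<infinity> K g * emeasure lebesgue K"
    by (rule Lp_norm_infinity_imp_L1[OF g(1) K])
   also have "\<dots> <= ennreal d * ennreal m" using g(2) True by (simp add: Km mult_right_mono)
   also have "\<dots> = ennreal (d * m)" using d m0 by (simp add: ennreal_mult)
   also have "\<dots> <= ennreal e"
   proof (rule ennreal_leI)
    show "d * m <= e" using e m0 by (simp add: d_def field_simps)
   qed
   finally show "(\<integral>\<^sup>+x. ennreal \<bar>g x\<bar> \<partial>lebesgue_on K) <= ennreal e" .
  qed (use e in simp)
  then show ?thesis using d by blast
 next
  case False
  define q where "q = enn2real p"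
  have q: "1 <= q"
  proof -
   have "p = ennreal q" using False by (simp add: q_def less_top)
   then show ?thesis using p by (metis ennreal_ge_1)
  qed
  \<comment> \<open>\<open>l\<close> makes the first term of the interpolation at most
    \<open>e / 2\<close>; \<open>d\<close> then makes the second one equal to
    \<open>e / 2\<close>.\<close>
  define l where "l = e / (2 * (m + 1))"
  have l: "l > 0" using e m0 by (simp add: l_def)
  define d where "d = (e / 2 * l powr (q - 1)) powr (1 / q)"
  have d: "d > 0" using e l by (simp add: d_def)
  have dq: "d powr q = e / 2 * l powr (q - 1)" using q e l by (simp add: d_def powr_powr)
  have tot: "l * m + l powr (1 - q) * d powr q <= e"
  proof -
   have "l * m <= e / 2" using e m0 by (simp add: l_def field_simps)
   moreover have "l powr (1 - q) * d powr q = e / 2"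
    unfolding dq using l by (simp add: powr_diff field_simps)
   ultimately show ?thesis by simp
  qed
  have "(LINT x:K|lebesgue. \<bar>g x\<bar>) <= e" if g: "g \<in> borel_measurable lebesgue" "Lp_norm_on p K g < ennreal d" for g :: "'a => real"
  proof (rule set_integral_abs_le_if_nn_integral_le(2)[OF g(1) K])
   have "(\<integral>\<^sup>+x. ennreal \<bar>g x\<bar> \<partial>lebesgue_on K) <= ennreal (l * m + l powr (1 - q) * d powr q)"
    unfolding m_def q_def by (rule Lp_norm_finite_imp_L1[OF g(1) K p False l d g(2)])
   also have "\<dots> <= ennreal e" by (rule ennreal_leI[OF tot])
   finally show "(\<integral>\<^sup>+x. ennreal \<bar>g x\<bar> \<partial>lebesgue_on K) <= ennreal e" .
  qed (use e in simp)
  then show ?thesis using d by blast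
 qed
qed

locale Lp_curve =
 fixes T :: real and p :: ennreal and f :: "real => 'a::euclidean_space => real"
 assumes p_ge_1: "1 <= p" and cont_f: "continuous_into_Lp_loc T p f"
begin

lemma f_meas: "t \<in> {0..T} ==> f t \<in> borel_measurable lebesgue"
 using cont_f unfolding continuous_into_Lp_loc_def Lp_loc_def by auto

lemma f_int: "t \<in> {0..T} ==> compact K ==> set_integrable lebesgue K (f t)"
 using cont_f unfolding continuous_into_Lp_loc_def Lp_loc_def
 by (intro Lp_norm_imp_set_integrable[OF f_meas _ p_ge_1]) auto

definition L1d :: "'a set => real => real => real" where
 "L1d K s t = (LINT x:K|lebesgue. \<bar>f s x - f t x\<bar>)"

lemma L1d_int: "s \<in> {0..T} ==> t \<in> {0..T} ==> compact K ==> set_integrable lebesgue K (%x. \<bar>f s x - f t x\<bar>)"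
 by (intro set_integrable_abs set_integral_diff(1) f_int)

lemma L1d_commute: "L1d K s t = L1d K t s"
 unfolding L1d_def by (simp add: abs_minus_commute)

lemma L1d_triangle:
 assumes "r \<in> {0..T}" "s \<in> {0..T}" "t \<in> {0..T}" "compact K"
 shows "L1d K r t <= L1d K r s + L1d K s t"
proof -
 have "L1d K r t <= (LINT x:K|lebesgue. \<bar>f r x - f s x\<bar> + \<bar>f s x - f t x\<bar>)"
  unfolding L1d_def using assms
  by (intro set_integral_mono L1d_int set_integral_add(1)) auto
 also have "\<dots> = L1d K r s + L1d K s t"
  unfolding L1d_def using assms by (intro set_integral_add(2) L1d_int)
 finally show ?thesis .
qed

lemma f_cont_at:
 assumes t: "t \<in> {0..T}" and K: "compact K" and e: "0 < e"
 shows "\<exists>d>0. \<forall>s\<in>{0..T}. \<bar>s - t\<bar> < d --> L1d K s t <= e"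
proof -
 obtain d0 where d0: "d0 > 0" "\<And>g. g \<in> borel_measurable lebesgue ==> Lp_norm_on p K g < ennreal d0 ==> (LINT x:K|lebesgue. \<bar>g x\<bar>) <= e"
  using Lp_norm_small_imp_L1_small[OF K p_ge_1 e] by blast
 have "((%s. Lp_norm_on p K (%x. f s x - f t x)) \<longlongrightarrow> 0) (at t within {0..T})"
  using cont_f t K unfolding continuous_into_Lp_loc_def by blast
 then have "\<forall>\<^sub>F s in at t within {0..T}. Lp_norm_on p K (%x. f s x - f t x) < ennreal d0"
  by (rule order_tendstoD) (use d0 in simp)
 then obtain d where d: "d > 0" "\<And>s. s \<in> {0..T} ==> s ~= t ==> dist s t < d ==> Lp_norm_on p K (%x. f s x - f t x) < ennreal d0"
  unfolding eventually_at by blast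
 have "L1d K s t <= e" if s: "s \<in> {0..T}" "\<bar>s - t\<bar> < d" for s
 proof (cases "s = t")
  case True
  then show ?thesis using e by (simp add: L1d_def set_lebesgue_integral_def)
 next
  case False
  have "(%x. f s x - f t x) \<in> borel_measurable lebesgue" using f_meas[OF s(1)] f_meas[OF t] by measurable
  then show ?thesis unfolding L1d_def using d0(2) d(2)[OF s(1) False] s(2) by (simp add: dist_real_def)
 qed
 then show ?thesis using d by blast
qed

text \<open>A Lebesgue number for the cover of \<open>{0..T}\<close> by intervals in which the
  distance to the centre is at most \<open>e / 2\<close>.\<close>

lemma f_cont:
 assumes K: "compact K" and e: "0 < e"
 shows "\<exists>d>0. \<forall>s\<in>{0..T}. \<forall>t\<in>{0..T}. \<bar>s - t\<bar> < d --> L1d K s t <= e"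
proof -
 have e2: "0 < e / 2" using e by simp
 have "\<exists>d. t \<in> {0..T} --> d > 0 \<and> (\<forall>s\<in>{0..T}. \<bar>s - t\<bar> < d --> L1d K s t <= e / 2)" for t
  using f_cont_at[OF _ K e2] by blast
 then have "\<forall>t. \<exists>d. t \<in> {0..T} --> d > 0 \<and> (\<forall>s\<in>{0..T}. \<bar>s - t\<bar> < d --> L1d K s t <= e / 2)" by blast
 from choice[OF this] obtain d where d: "\<And>t. t \<in> {0..T} ==> d t > 0"
  "\<And>s t. t \<in> {0..T} ==> s \<in> {0..T} ==> \<bar>s - t\<bar> < d t ==> L1d K s t <= e / 2" by blast
 let ?G = "(%t. ball t (d t)) ` {0..T}"
 have sub: "{0..T} \<subseteq> \<Union>?G" using d(1) by auto
 have op: "open G" if "G \<in> ?G" for G using that by auto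
 obtain \<delta> where \<delta>: "\<delta> > 0" "\<And>x. x \<in> {0..T} ==> \<exists>G\<in>?G. ball x \<delta> \<subseteq> G"
  using Heine_Borel_lemma[OF compact_Icc sub op] by blast
 have "L1d K s t <= e" if st: "s \<in> {0..T}" "t \<in> {0..T}" "\<bar>s - t\<bar> < \<delta>" for s t
 proof -
  obtain r where r: "r \<in> {0..T}" "ball t \<delta> \<subseteq> ball r (d r)" using \<delta>(2)[OF st(2)] by blast
  have "s \<in> ball t \<delta>" "t \<in> ball t \<delta>" using st \<delta>(1) by (auto simp: dist_real_def)
  then have "s \<in> ball r (d r)" "t \<in> ball r (d r)" using r by blast+
  then have "\<bar>s - r\<bar> < d r" "\<bar>t - r\<bar> < d r" by (auto simp: dist_real_def abs_minus_commute)
  then have "L1d K s r <= e / 2" "L1d K t r <= e / 2" using d(2)[OF r(1)] st by auto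
  then show ?thesis using L1d_triangle[OF st(1) r(1) st(2) K] L1d_commute[of K r t] by linarith
 qed
 then show ?thesis using \<delta>(1) by blast
qed

text \<open>Expresses uniform integrability in time. Unlike the integral over the set where
  \<open>|f| > M\<close>, it is 1-Lipschitz in the L^1 norm of \<open>f\<close>.\<close>

definition excess :: "'a set => real => real => real" where
 "excess K M t = (LINT x:K|lebesgue. max 0 (\<bar>f t x\<bar> - M))"

lemma excess_int:
 assumes "t \<in> {0..T}" "compact K" "0 <= M"
 shows "set_integrable lebesgue K (%x. max 0 (\<bar>f t x\<bar> - M))"
proof (rule set_integrable_bound[OF set_integrable_abs[OF f_int[OF assms(1,2)]]])
 have "f t \<in> borel_measurable lebesgue" by (rule f_meas[OF assms(1)])
 moreover have "K \<in> sets lebesgue" using assms(2) by (simp add: compact_imp_closed borel_closed)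
 ultimately show "set_borel_measurable lebesgue K (%x. max 0 (\<bar>f t x\<bar> - M))"
  unfolding set_borel_measurable_def by measurable
qed (use assms in auto)

lemma excess_to_0:
 assumes t: "t \<in> {0..T}" and K: "compact K" and e: "0 < e"
 shows "\<exists>n::nat. excess K (real n) t <= e"
proof -
 have m: "f t \<in> borel_measurable lebesgue" by (rule f_meas[OF t])
 have Ks: "K \<in> sets lebesgue" using K by (simp add: compact_imp_closed borel_closed)
 have "(%n. LINT x|lebesgue. indicator K x *\<^sub>R max 0 (\<bar>f t x\<bar> - real n)) \<longlonglongrightarrow> (LINT x|(lebesgue :: 'a measure). 0)"
 proof (rule integral_dominated_convergence[where w = "%x. indicator K x * \<bar>f t x\<bar>"])
  show "integrable lebesgue (%x. indicator K x * \<bar>f t x\<bar>)"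
   using set_integrable_abs[OF f_int[OF t K]] by (simp add: set_integrable_def)
  show "AE x in lebesgue. (%n. indicator K x *\<^sub>R max 0 (\<bar>f t x\<bar> - real n)) \<longlonglongrightarrow> 0"
  proof (rule AE_I2)
   fix x
   obtain N :: nat where "\<bar>f t x\<bar> <= real N" using real_arch_simple by blast
   then have "\<forall>\<^sub>F n in sequentially. indicator K x *\<^sub>R max 0 (\<bar>f t x\<bar> - real n) = 0"
    unfolding eventually_sequentially by (intro exI[of _ N]) auto
   then show "(%n. indicator K x *\<^sub>R max 0 (\<bar>f t x\<bar> - real n)) \<longlonglongrightarrow> 0" by (rule tendsto_eventually)
  qed
  show "AE x in lebesgue. norm (indicator K x *\<^sub>R max 0 (\<bar>f t x\<bar> - real n)) <= indicator K x * \<bar>f t x\<bar>" for n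
   by (intro AE_I2) (auto simp: indicator_def)
 qed (use m Ks in measurable)
 then have "(%n. excess K (real n) t) \<longlonglongrightarrow> 0" by (simp add: excess_def set_lebesgue_integral_def)
 then have "\<forall>\<^sub>F n in sequentially. excess K (real n) t < e" by (rule order_tendstoD) (rule e)
 then show ?thesis by (auto simp: eventually_sequentially intro: less_imp_le)
qed

text \<open>A finite net of times that is dense in the L^1 sense controls all other times, so the
  largest of finitely many levels serves.\<close>

lemma f_unif_int:
 assumes K: "compact K" and e: "0 < e"
 shows "\<exists>M\<ge>0. \<forall>t\<in>{0..T}. excess K M t <= e"
proof -
 have e2: "0 < e / 2" using e by simp
 obtain d where d: "d > 0" "\<And>s t. s \<in> {0..T} ==> t \<in> {0..T} ==> \<bar>s - t\<bar> < d ==> L1d K s t <= e / 2"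
  using f_cont[OF K e2] by blast
 have cov: "{0..T} \<subseteq> (\<Union>t\<in>{0..T}. ball t d)" using d by auto
 obtain S where S: "S \<subseteq> {0..T}" "finite S" "{0..T} \<subseteq> (\<Union>t\<in>S. ball t d)"
  by (rule compactE_image[OF compact_Icc _ cov]) auto
 have "\<forall>t. \<exists>n::nat. t \<in> {0..T} --> excess K (real n) t <= e / 2" using excess_to_0[OF _ K e2] by blast
 from choice[OF this] obtain n where n: "\<And>t. t \<in> {0..T} ==> excess K (real (n t)) t <= e / 2" by blast
 define M where "M = real (Max (insert 0 (n ` S)))"
 have M: "real (n s) <= M" if "s \<in> S" for s using that S(2) by (simp add: M_def)
 have M0: "M \<ge> 0" by (simp add: M_def)
 have "excess K M t <= e" if t: "t \<in> {0..T}" for t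
 proof -
  obtain s where s: "s \<in> S" "t \<in> ball s d" using S(3) t by blast
  have sT: "s \<in> {0..T}" using s S by blast
  have "excess K M t <= (LINT x:K|lebesgue. max 0 (\<bar>f s x\<bar> - real (n s)) + \<bar>f t x - f s x\<bar>)"
   unfolding excess_def
  proof (rule set_integral_mono[OF excess_int[OF t K M0]])
   show "set_integrable lebesgue K (%x. max 0 (\<bar>f s x\<bar> - real (n s)) + \<bar>f t x - f s x\<bar>)"
    by (intro set_integral_add(1) excess_int L1d_int sT t K) simp
   show "max 0 (\<bar>f t x\<bar> - M) <= max 0 (\<bar>f s x\<bar> - real (n s)) + \<bar>f t x - f s x\<bar>" for x
    using M[OF s(1)] by (auto simp: max_def)
  qed
  also have "\<dots> = excess K (real (n s)) s + L1d K t s"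
   unfolding excess_def L1d_def by (intro set_integral_add(2) excess_int L1d_int sT t K) simp
  also have "\<dots> <= e / 2 + e / 2"
   using s by (intro add_mono n sT d(2) t) (auto simp: dist_real_def abs_minus_commute)
  finally show ?thesis by simp
 qed
 then show ?thesis using M0 by blast
qed

lemma f_bounded_L1:
 assumes K: "compact K"
 shows "\<exists>B\<ge>0. \<forall>t\<in>{0..T}. (LINT x:K|lebesgue. \<bar>f t x\<bar>) <= B"
proof -
 obtain M where M: "M \<ge> 0" "\<And>t. t \<in> {0..T} ==> excess K M t <= 1" using f_unif_int[OF K, of 1] by auto
 have iM: "set_integrable lebesgue K (%x. M)"
  using lmeasurable_compact[OF K] unfolding set_integrable_def fmeasurable_def
  by (auto intro!: integrable_scaleR_left integrable_real_indicator)
 have "(LINT x:K|lebesgue. \<bar>f t x\<bar>) <= 1 + (LINT x:K|lebesgue. M)" if t: "t \<in> {0..T}" for t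
 proof -
  have "(LINT x:K|lebesgue. \<bar>f t x\<bar>) <= (LINT x:K|lebesgue. max 0 (\<bar>f t x\<bar> - M) + M)"
   by (intro set_integral_mono set_integral_add(1) excess_int set_integrable_abs f_int t K M iM) auto
  also have "\<dots> = excess K M t + (LINT x:K|lebesgue. M)"
   unfolding excess_def by (intro set_integral_add(2) excess_int t K M iM)
  finally show ?thesis using M(2)[OF t] by linarith
 qed
 moreover have "0 <= (LINT x:K|lebesgue. M)" using M unfolding set_lebesgue_integral_def by (intro integral_nonneg_AE) auto
 ultimately show ?thesis by (intro exI[of _ "1 + (LINT x:K|lebesgue. M)"]) auto
qed

end

section \<open>Weak solutions at fixed times\<close>

lemma linear_eq_sum_Basis:
 fixes L :: "'a::euclidean_space => real"
 assumes "linear L"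
 shows "L v = (\<Sum>i\<in>Basis. (v \<bullet> i) * L i)"
proof -
 have "L v = L (\<Sum>i\<in>Basis. (v \<bullet> i) *\<^sub>R i)" by (simp add: euclidean_representation)
 also have "\<dots> = (\<Sum>i\<in>Basis. (v \<bullet> i) * L i)" by (simp add: linear_sum[OF assms] linear_scale[OF assms])
 finally show ?thesis .
qed

lemma integrable_mult_bounded:
 fixes u w :: "'a::euclidean_space => real"
 assumes u: "set_integrable lborel K u" and w: "w \<in> borel_measurable borel" "\<And>x. \<bar>w x\<bar> <= W" "\<And>x. x \<notin> K ==> w x = 0"
 shows "integrable lborel (%x. u x * w x)" "\<bar>\<integral>x. u x * w x \<partial>lborel\<bar> <= W * (LINT x:K|lborel. \<bar>u x\<bar>)"
proof -
 have eq: "u x * w x = w x * (indicator K x *\<^sub>R u x)" for x using w(3)[of x] by (cases "x \<in> K") auto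
 have iu: "integrable lborel (%x. indicator K x *\<^sub>R u x)" using u by (simp add: set_integrable_def)
 have b: "\<bar>u x * w x\<bar> <= W * \<bar>indicator K x *\<^sub>R u x\<bar>" for x
  unfolding eq abs_mult by (rule mult_right_mono[OF w(2)]) simp
 have iW: "integrable lborel (%x. W * \<bar>indicator K x *\<^sub>R u x\<bar>)"
  by (intro integrable_mult_right integrable_abs iu)
 show i: "integrable lborel (%x. u x * w x)"
 proof (rule Bochner_Integration.integrable_bound[OF iW])
  show "(%x. u x * w x) \<in> borel_measurable lborel"
   unfolding eq using w(1) by (intro borel_measurable_times borel_measurable_integrable[OF iu]) simp
  show "AE x in lborel. norm (u x * w x) <= norm (W * \<bar>indicator K x *\<^sub>R u x\<bar>)"
   by (intro AE_I2) (metis b abs_ge_self order_trans real_norm_def)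
 qed
 have "\<bar>\<integral>x. u x * w x \<partial>lborel\<bar> <= (\<integral>x. W * \<bar>indicator K x *\<^sub>R u x\<bar> \<partial>lborel)"
  by (rule order_trans[OF integral_abs_bound], rule integral_mono[OF integrable_abs[OF i] iW b])
 also have "\<dots> = W * (LINT x:K|lborel. \<bar>u x\<bar>)"
  by (simp add: set_lebesgue_integral_def abs_mult)
 finally show "\<bar>\<integral>x. u x * w x \<partial>lborel\<bar> <= W * (LINT x:K|lborel. \<bar>u x\<bar>)" .
qed

lemma frechet_derivative_real_eq:
 assumes "(g has_derivative frechet_derivative g (at z)) (at (z::real))"
 shows "frechet_derivative g (at z) v = v * (frechet_derivative g (at z) 1 :: real)"
 using linear_scale[OF has_derivative_linear[OF assms], of v 1] by simp

lemma tendsto_abs_diff_le: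
 fixes a g :: "'b => real"
 assumes "\<And>n. \<bar>a n - l\<bar> <= g n" "(g \<longlongrightarrow> 0) F"
 shows "(a \<longlongrightarrow> l) F"
proof -
 have "((%n. a n - l) \<longlongrightarrow> 0) F"
  by (rule Lim_null_comparison[OF _ assms(2)]) (simp add: assms(1))
 then show ?thesis by (rule Lim_null[THEN iffD2])
qed

lemma has_derivative_convolution:
 fixes g :: "'a::euclidean_space => real"
 assumes g: "\<And>j. C_class j g" "\<And>x. norm x > R ==> g x = 0" and u: "integrable lborel u"
 shows "((%x. \<integral>y. g (x - y) * u y \<partial>lborel) has_derivative
    (%v. \<integral>y. frechet_derivative g (at (x - y)) v * u y \<partial>lborel)) (at x)"
 by (rule exE[OF convolution_derivative[of g R]], rule g(1), erule g(2), elim conjE,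
   erule allE[of _ u], erule impE, rule u, elim conjE, erule spec)

text \<open>Borel versions of the data, defined for all real times and with bounds that hold
  everywhere, so that integrals can be exchanged. Of \<open>f\<close> only the sections at fixed
  times are measurable; continuity in L^1 makes up for the missing joint measurability. Instances
  come from \<open>ex_transport_solution\<close>.\<close>

locale weak_solution =
 fixes T :: real
  and bb :: "real => 'a::euclidean_space => 'a"
  and c0 :: "real => real"
  and f :: "real => 'a => real"
 assumes bb_meas: "(%z. bb (fst z) (snd z)) \<in> borel_measurable borel"
  and c0_meas: "c0 \<in> borel_measurable borel" and c0_nonneg: "\<And>r. 0 <= c0 r" and c0_int: "integrable lborel c0"
  and bb_growth: "\<And>r x. norm (bb r x) <= c0 r * (1 + norm x)"
  and f_borel: "\<And>t. f t \<in> borel_measurable borel"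
  and f_int: "\<And>t K. compact K ==> set_integrable lborel K (f t)"
  and f_bounded_L1: "\<And>K. compact K ==> \<exists>J\<ge>0. \<forall>t. (LINT x:K|lborel. \<bar>f t x\<bar>) <= J"
  and f_cont: "\<And>K e. compact K ==> 0 < e ==> \<exists>d>0. \<forall>s t. \<bar>s - t\<bar> < d --> (LINT x:K|lborel. \<bar>f s x - f t x\<bar>) <= e"
  and weak: "\<And>\<psi>. test_function ({0<..<T} \<times> UNIV) \<psi> ==>
    (LINT t:{0<..<T}|lebesgue. (LINT x|lborel.
      f t x * (frechet_derivative \<psi> (at (t, x)) (1, 0) + frechet_derivative \<psi> (at (t, x)) (0, bb t x)))) = 0"
begin

lemma f_diff_int: "compact K ==> set_integrable lborel K (%x. f s x - f t x)"
 by (intro set_integral_diff(1) f_int)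

lemma f_L1_tendsto:
 assumes K: "compact K" and g: "(g \<longlongrightarrow> r) F"
 shows "((%n. LINT x:K|lborel. \<bar>f (g n) x - f r x\<bar>) \<longlongrightarrow> 0) F"
proof (rule tendstoI)
 fix e :: real assume e: "0 < e"
 obtain d where d: "d > 0" "\<And>s t. \<bar>s - t\<bar> < d ==> (LINT x:K|lborel. \<bar>f s x - f t x\<bar>) <= e / 2"
  using f_cont[OF K, of "e / 2"] e by auto
 have nn: "0 <= (LINT x:K|lborel. \<bar>f s x - f t x\<bar>)" for s t
  unfolding set_lebesgue_integral_def by (intro integral_nonneg_AE) auto
 have "\<forall>\<^sub>F n in F. dist (g n) r < d" using g d(1) by (rule tendstoD)
 then show "\<forall>\<^sub>F n in F. dist (LINT x:K|lborel. \<bar>f (g n) x - f r x\<bar>) 0 < e"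
 proof eventually_elim
  case (elim n)
  then have "(LINT x:K|lborel. \<bar>f (g n) x - f r x\<bar>) <= e / 2" by (intro d(2)) (simp add: dist_real_def)
  then show ?case using nn[of "g n" r] e by simp
 qed
qed

context
 fixes \<Psi> :: "'a => real" and R :: real
 assumes \<Psi>: "\<And>k. C_class k \<Psi>" and \<Psi>0: "\<And>x. norm x > R ==> \<Psi> x = 0" and R: "0 <= R"
begin

lemma \<Psi>_linear: "linear (frechet_derivative \<Psi> (at x))"
 using C_class_has_derivative[OF \<Psi>[of "Suc 0"]] has_derivative_linear by blast

lemma \<Psi>_derivative_measurable:
 "(%z. frechet_derivative \<Psi> (at (snd z)) (bb (fst z) (snd z))) \<in> borel_measurable borel"
proof -
 have "(%z. frechet_derivative \<Psi> (at (snd z)) i) \<in> borel_measurable (borel :: (real \<times> 'a) measure)" for i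
 proof -
  have "C_class 0 (%x. frechet_derivative \<Psi> (at x) i)" using \<Psi>[of "Suc 0"] by simp
  then have "continuous_on UNIV (%x. frechet_derivative \<Psi> (at x) i)" by simp
  then have "continuous_on UNIV (%z::real \<times> 'a. frechet_derivative \<Psi> (at (snd z)) i)"
   by (rule continuous_on_compose2[OF _ continuous_on_snd[OF continuous_on_id]]) auto
  then show ?thesis by (rule borel_measurable_continuous_onI)
 qed
 note [measurable] = this bb_meas
 show ?thesis by (subst linear_eq_sum_Basis[OF \<Psi>_linear]) measurable
qed

lemma \<Psi>_derivative_section_measurable:
 "(%x. frechet_derivative \<Psi> (at x) (bb r x)) \<in> borel_measurable borel"
proof -
 have "(%x::'a. (r, x)) \<in> borel_measurable borel"
  by (intro borel_measurable_continuous_onI continuous_intros)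
 from measurable_compose[OF this \<Psi>_derivative_measurable] show ?thesis by simp
qed

lemma \<Psi>_derivative_bound:
 assumes L: "\<And>x v. \<bar>frechet_derivative \<Psi> (at x) v\<bar> <= L * norm v" "0 <= L"
 shows "\<bar>frechet_derivative \<Psi> (at x) (bb r x)\<bar> <= L * (1 + R) * c0 r"
  "x \<notin> cball 0 R ==> frechet_derivative \<Psi> (at x) (bb r x) = 0"
proof -
 show 0: "x \<notin> cball 0 R ==> frechet_derivative \<Psi> (at x) (bb r x) = 0"
  by (rule C_class_derivative_zero_outside[OF \<Psi>0]) auto
 show "\<bar>frechet_derivative \<Psi> (at x) (bb r x)\<bar> <= L * (1 + R) * c0 r"
 proof (cases "x \<in> cball 0 R")
  case True
  have "\<bar>frechet_derivative \<Psi> (at x) (bb r x)\<bar> <= L * norm (bb r x)" by (rule L(1))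
  also have "\<dots> <= L * (c0 r * (1 + R))"
   using True c0_nonneg[of r] by (intro mult_left_mono L(2) order_trans[OF bb_growth]) auto
  finally show ?thesis by (simp add: mult_ac)
 next
  case False
  then show ?thesis using 0 L(2) c0_nonneg[of r] R by simp
 qed
qed

text \<open>The density is frozen at time \<open>q\<close> while the field is taken at time
  \<open>r\<close>. With the times separated, measurability in \<open>r\<close> follows from Fubini;
  the diagonal is reached by approximation.\<close>

definition dens :: "real => real => real" where
 "dens q r = (\<integral>x. f q x * frechet_derivative \<Psi> (at x) (bb r x) \<partial>lborel)"

lemma dens_measurable: "dens q \<in> borel_measurable borel"
proof -
 have "(%z. f q (snd z)) \<in> borel_measurable (borel :: (real \<times> 'a) measure)"
  by (rule measurable_compose[OF _ f_borel]) (intro borel_measurable_continuous_onI continuous_intros)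
 then have "(%z. f q (snd z) * frechet_derivative \<Psi> (at (snd z)) (bb (fst z) (snd z))) \<in> borel_measurable borel"
  by (rule borel_measurable_times[OF _ \<Psi>_derivative_measurable])
 moreover have "sets (borel :: (real \<times> 'a) measure) = sets (borel \<Otimes>\<^sub>M lborel)"
  unfolding borel_prod[symmetric] by (intro sets_pair_measure_cong) auto
 ultimately have "(%(r, x). f q x * frechet_derivative \<Psi> (at x) (bb r x)) \<in> borel_measurable (borel \<Otimes>\<^sub>M lborel)"
  by (simp add: case_prod_unfold cong: measurable_cong_sets)
 then show ?thesis unfolding dens_def by (rule lborel.borel_measurable_lebesgue_integral)
qed

lemma dens_bounds:
 assumes L: "\<And>x v. \<bar>frechet_derivative \<Psi> (at x) v\<bar> <= L * norm v" "0 <= L"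
 shows "integrable lborel (%x. f q x * frechet_derivative \<Psi> (at x) (bb r x))"
  "\<bar>dens q r\<bar> <= L * (1 + R) * c0 r * (LINT x:cball 0 R|lborel. \<bar>f q x\<bar>)"
  "\<bar>dens q r - dens q' r\<bar> <= L * (1 + R) * c0 r * (LINT x:cball 0 R|lborel. \<bar>f q x - f q' x\<bar>)"
proof -
 have *: "integrable lborel (%x. u x * frechet_derivative \<Psi> (at x) (bb r x))"
   "\<bar>\<integral>x. u x * frechet_derivative \<Psi> (at x) (bb r x) \<partial>lborel\<bar> <= L * (1 + R) * c0 r * (LINT x:cball 0 R|lborel. \<bar>u x\<bar>)"
  if u: "set_integrable lborel (cball 0 R) u" for u
  using integrable_mult_bounded[OF u \<Psi>_derivative_section_measurable[of r], of "L * (1 + R) * c0 r"] \<Psi>_derivative_bound[OF L] by auto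
 have fi: "set_integrable lborel (cball 0 R) (f q)" for q by (rule f_int) simp
 show i: "integrable lborel (%x. f q x * frechet_derivative \<Psi> (at x) (bb r x))" for q
  by (rule *(1)[OF fi])
 show "\<bar>dens q r\<bar> <= L * (1 + R) * c0 r * (LINT x:cball 0 R|lborel. \<bar>f q x\<bar>)"
  unfolding dens_def by (rule *(2)[OF fi])
 have fd: "set_integrable lborel (cball 0 R) (%x. f q x - f q' x)" by (rule f_diff_int) simp
 have e: "dens q r - dens q' r = (\<integral>x. (f q x - f q' x) * frechet_derivative \<Psi> (at x) (bb r x) \<partial>lborel)"
  unfolding dens_def by (subst Bochner_Integration.integral_diff[OF i i, symmetric]) (simp add: left_diff_distrib)
 show "\<bar>dens q r - dens q' r\<bar> <= L * (1 + R) * c0 r * (LINT x:cball 0 R|lborel. \<bar>f q x - f q' x\<bar>)"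
  unfolding e by (rule *(2)[OF fd])
qed

lemma ex_derivative_bound:
 "\<exists>L\<ge>0. \<forall>x v. \<bar>frechet_derivative \<Psi> (at x) v\<bar> <= L * norm v"
 by (rule C_class_bounded_derivative[OF \<Psi> \<Psi>0]) auto

text \<open>Rounding the first argument to a grid leaves countably many functions, each measurable
  in \<open>r\<close>; continuity of \<open>f\<close> in L^1 allows the grid to be refined.\<close>

lemma dens_diagonal_measurable: "(%r. dens r r) \<in> borel_measurable borel"
proof -
 obtain L where L: "\<And>x v. \<bar>frechet_derivative \<Psi> (at x) v\<bar> <= L * norm v" "0 <= L" using ex_derivative_bound by blast
 define q where "q n r = real_of_int \<lfloor>r * real (Suc n)\<rfloor> / real (Suc n)" for n r
 have ql: "\<bar>q n r - r\<bar> <= inverse (real (Suc n))" for n r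
 proof -
  have "\<bar>real_of_int \<lfloor>r * real (Suc n)\<rfloor> - r * real (Suc n)\<bar> <= 1" by linarith
  moreover have "(q n r - r) * real (Suc n) = real_of_int \<lfloor>r * real (Suc n)\<rfloor> - r * real (Suc n)"
   by (simp add: q_def left_diff_distrib del: of_nat_Suc)
  ultimately have "\<bar>q n r - r\<bar> * real (Suc n) <= 1" by (metis abs_mult abs_of_nat)
  then show ?thesis by (simp add: inverse_eq_divide pos_le_divide_eq del: of_nat_Suc)
 qed
 have qlim: "(%n. q n r) \<longlonglongrightarrow> r" for r
  by (rule tendsto_abs_diff_le[OF ql LIMSEQ_inverse_real_of_nat])
 show ?thesis
 proof (rule borel_measurable_LIMSEQ_real)
  fix r
  have "(%n. L * (1 + R) * c0 r * (LINT x:cball 0 R|lborel. \<bar>f (q n r) x - f r x\<bar>)) \<longlonglongrightarrow> L * (1 + R) * c0 r * 0"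
   by (intro tendsto_intros f_L1_tendsto qlim) auto
  then have "(%n. L * (1 + R) * c0 r * (LINT x:cball 0 R|lborel. \<bar>f (q n r) x - f r x\<bar>)) \<longlonglongrightarrow> 0" by simp
  then show "(%n. dens (q n r) r) \<longlonglongrightarrow> dens r r"
   by (rule tendsto_abs_diff_le[OF dens_bounds(3)[OF L]])
 next
  fix n
  have "(%r. dens (real_of_int i / real (Suc n)) r) \<in> borel_measurable borel" for i by (rule dens_measurable)
  moreover have "(%r. \<lfloor>r * real (Suc n)\<rfloor>) \<in> measurable borel (count_space UNIV)"
   by (rule measurable_compose[OF _ measurable_real_floor]) simp
  ultimately show "(%r. dens (q n r) r) \<in> borel_measurable borel"
   unfolding q_def by (rule measurable_compose_countable[where f = "%i r. dens (real_of_int i / real (Suc n)) r" and g = "%r. \<lfloor>r * real (Suc n)\<rfloor>"])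
 qed
qed

lemma dens_diagonal_integrable: "integrable lborel (%r. dens r r)"
proof -
 obtain L where L: "\<And>x v. \<bar>frechet_derivative \<Psi> (at x) v\<bar> <= L * norm v" "0 <= L" using ex_derivative_bound by blast
 obtain J where J: "J \<ge> 0" "\<And>t. (LINT x:cball 0 R|lborel. \<bar>f t x\<bar>) <= J" using f_bounded_L1[OF compact_cball] by blast
 show ?thesis
 proof (rule Bochner_Integration.integrable_bound)
  show "integrable lborel (%r. (L * (1 + R) * J) * c0 r)" by (intro integrable_mult_right c0_int)
  show "(%r. dens r r) \<in> borel_measurable lborel" using dens_diagonal_measurable by simp
  show "AE r in lborel. norm (dens r r) <= norm ((L * (1 + R) * J) * c0 r)"
  proof (rule AE_I2)
   fix r
   have "\<bar>dens r r\<bar> <= L * (1 + R) * c0 r * (LINT x:cball 0 R|lborel. \<bar>f r x\<bar>)" by (rule dens_bounds[OF L])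
   also have "\<dots> <= L * (1 + R) * c0 r * J" using L R c0_nonneg by (intro mult_left_mono J) auto
   finally show "norm (dens r r) <= norm ((L * (1 + R) * J) * c0 r)" by (simp add: mult_ac)
  qed
 qed
qed

definition mean :: "real => real" where "mean t = (\<integral>x. f t x * \<Psi> x \<partial>lborel)"

lemma \<Psi>_measurable: "\<Psi> \<in> borel_measurable borel"
 by (intro borel_measurable_continuous_onI C_class_continuous \<Psi>)

lemma mean_facts:
 shows "integrable lborel (%x. f t x * \<Psi> x)" "isCont mean t"
proof -
 obtain W where W: "\<And>x. \<bar>\<Psi> x\<bar> <= W" using bounded_if_eq_0_outside[OF C_class_continuous[OF \<Psi>] \<Psi>0] by blast
 have 0: "x \<notin> cball 0 R ==> \<Psi> x = 0" for x using \<Psi>0[of x] by auto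
 show i: "integrable lborel (%x. f t x * \<Psi> x)" for t
  by (rule integrable_mult_bounded(1)[where K = "cball 0 R", OF f_int \<Psi>_measurable W 0]) auto
 have b: "\<bar>mean s - mean t\<bar> <= W * (LINT x:cball 0 R|lborel. \<bar>f s x - f t x\<bar>)" for s
 proof -
  have "mean s - mean t = (\<integral>x. (f s x - f t x) * \<Psi> x \<partial>lborel)"
   unfolding mean_def by (simp add: left_diff_distrib i)
  also have "\<bar>\<dots>\<bar> <= W * (LINT x:cball 0 R|lborel. \<bar>f s x - f t x\<bar>)"
   by (rule integrable_mult_bounded(2)[where K = "cball 0 R", OF f_diff_int \<Psi>_measurable W 0]) auto
  finally show ?thesis .
 qed
 have "((%s. W * (LINT x:cball 0 R|lborel. \<bar>f s x - f t x\<bar>)) \<longlongrightarrow> W * 0) (at t)"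
  by (intro tendsto_intros f_L1_tendsto) auto
 then have "((%s. W * (LINT x:cball 0 R|lborel. \<bar>f s x - f t x\<bar>)) \<longlongrightarrow> 0) (at t)" by simp
 then show "isCont mean t" unfolding isCont_def by (rule tendsto_abs_diff_le[OF b])
qed

lemma mean_continuous: "continuous_on S mean"
 by (intro continuous_at_imp_continuous_on ballI mean_facts)

text \<open>The weak equation for the product of \<open>\<eta>\<close> in time and
  \<open>\<Psi>\<close> in space, with the space integral carried out.\<close>

lemma weak_time_derivative:
 assumes \<eta>: "\<And>k. C_class k \<eta>" and st: "0 < s" "t < T" and \<eta>0: "\<And>r. r \<notin> {s..t} ==> \<eta> r = 0"
 shows "(\<integral>r. frechet_derivative \<eta> (at r) 1 * mean r + \<eta> r * dens r r \<partial>lborel) = 0"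
proof -
 obtain L where L: "\<And>x v. \<bar>frechet_derivative \<Psi> (at x) v\<bar> <= L * norm v" "0 <= L" using ex_derivative_bound by blast
 define \<psi> where "\<psi> z = \<eta> (fst z) * \<Psi> (snd z)" for z
 have C: "C_class k \<psi>" for k
  using C_class_mult[OF C_class_compose_affine[OF bounded_linear_fst \<eta>, of k 0] C_class_compose_affine[OF bounded_linear_snd \<Psi>, of k 0]]
  by (simp add: \<psi>_def[abs_def])
 have supp: "closure {z. \<psi> z ~= 0} \<subseteq> {s..t} \<times> cball 0 R"
 proof (rule closure_minimal)
  show "{z. \<psi> z ~= 0} \<subseteq> {s..t} \<times> cball 0 R"
  proof
   fix z assume "z \<in> {z. \<psi> z ~= 0}"
   then have "\<eta> (fst z) ~= 0" "\<Psi> (snd z) ~= 0" by (auto simp: \<psi>_def)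
   then have "fst z \<in> {s..t}" "snd z \<in> cball 0 R" using \<eta>0[of "fst z"] \<Psi>0[of "snd z"] by (blast, force)
   then show "z \<in> {s..t} \<times> cball 0 R" by (simp add: mem_Times_iff)
  qed
 qed (intro closed_Times closed_atLeastAtMost closed_cball)
 have tf: "test_function ({0<..<T} \<times> UNIV) \<psi>"
  unfolding test_function_def
 proof (intro conjI allI C)
  show "compact (closure {z. \<psi> z ~= 0})"
   using supp compact_Times[OF compact_Icc compact_cball] by (metis bounded_subset compact_eq_bounded_closed closed_closure)
  show "closure {z. \<psi> z ~= 0} \<subseteq> {0<..<T} \<times> UNIV" using supp st by auto
 qed
 have d\<eta>: "(\<eta> has_derivative frechet_derivative \<eta> (at r)) (at r)" for r by (rule C_class_has_derivative[OF \<eta>])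
 have d\<Psi>: "(\<Psi> has_derivative frechet_derivative \<Psi> (at x)) (at x)" for x by (rule C_class_has_derivative[OF \<Psi>])
 have fd: "frechet_derivative \<psi> (at (r, x)) h = \<eta> r * frechet_derivative \<Psi> (at x) (snd h) + frechet_derivative \<eta> (at r) (fst h) * \<Psi> x" for r x h
 proof -
  have 1: "((%z. \<eta> (fst z)) has_derivative (%h. frechet_derivative \<eta> (at r) (fst h))) (at (r, x))"
   by (rule has_derivative_compose[OF has_derivative_fst[OF has_derivative_ident]]) (simp add: d\<eta>)
  have 2: "((%z. \<Psi> (snd z)) has_derivative (%h. frechet_derivative \<Psi> (at x) (snd h))) (at (r, x))"
   by (rule has_derivative_compose[OF has_derivative_snd[OF has_derivative_ident]]) (simp add: d\<Psi>)
  have "(\<psi> has_derivative (%h. \<eta> r * frechet_derivative \<Psi> (at x) (snd h) + frechet_derivative \<eta> (at r) (fst h) * \<Psi> x)) (at (r, x))"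
   unfolding \<psi>_def[abs_def] using has_derivative_mult[OF 1 2] by simp
  from fun_cong[OF frechet_derivative_at[OF this], of h] show ?thesis by (rule sym)
 qed
 have z1: "frechet_derivative \<eta> (at r) 0 = 0" "frechet_derivative \<Psi> (at x) 0 = 0" for r x
  using linear_0[OF has_derivative_linear[OF d\<eta>]] linear_0[OF \<Psi>_linear] by auto
 define G where "G r = frechet_derivative \<eta> (at r) 1 * mean r + \<eta> r * dens r r" for r
 have inner: "(LINT x|lborel. f r x * (frechet_derivative \<psi> (at (r, x)) (1, 0) + frechet_derivative \<psi> (at (r, x)) (0, bb r x))) = G r" for r
 proof -
  have "f r x * (frechet_derivative \<psi> (at (r, x)) (1, 0) + frechet_derivative \<psi> (at (r, x)) (0, bb r x))
    = frechet_derivative \<eta> (at r) 1 * (f r x * \<Psi> x) + \<eta> r * (f r x * frechet_derivative \<Psi> (at x) (bb r x))" for x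
   unfolding fd by (simp add: z1 algebra_simps)
  then show ?thesis
   unfolding G_def mean_def dens_def using mean_facts(1)[of r] dens_bounds(1)[OF L, of r r] by simp
 qed
 have G0: "G r = 0" if "r \<notin> {0<..<T}" for r
 proof -
  have "r \<in> - {s..t}" using that st by auto
  then have "frechet_derivative \<eta> (at r) 1 = 0"
   by (rule frechet_derivative_eq_0[rotated]) (use \<eta>0 in \<open>auto intro: open_Compl\<close>)
  moreover have "\<eta> r = 0" using that st by (intro \<eta>0) auto
  ultimately show ?thesis by (simp add: G_def)
 qed
 have Gm: "G \<in> borel_measurable borel"
 proof -
  have "C_class 0 (%r. frechet_derivative \<eta> (at r) 1)" using \<eta>[of "Suc 0"] by simp
  then have "(%r. frechet_derivative \<eta> (at r) 1) \<in> borel_measurable borel"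
   by (intro borel_measurable_continuous_onI) simp
  moreover have "\<eta> \<in> borel_measurable borel" by (intro borel_measurable_continuous_onI C_class_continuous \<eta>)
  moreover have "mean \<in> borel_measurable borel" by (intro borel_measurable_continuous_onI mean_continuous)
  ultimately show ?thesis unfolding G_def[abs_def]
   by (intro borel_measurable_add borel_measurable_times dens_diagonal_measurable)
 qed
 have "0 = (LINT t:{0<..<T}|lebesgue. G t)" using weak[OF tf] by (simp add: inner)
 also have "\<dots> = (LINT t|lebesgue. G t)"
  unfolding set_lebesgue_integral_def by (rule Bochner_Integration.integral_cong) (use G0 in \<open>auto simp: indicator_def\<close>)
 also have "\<dots> = (\<integral>t. G t \<partial>lborel)" using Gm by (simp add: integral_completion)
 finally show ?thesis by (simp add: G_def)
qed

text \<open>The cutoff \<open>\<eta>\<close> is a mollified indicator of \<open>{s..t}\<close>. Its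
  derivative is a mollifier at \<open>s\<close> minus one at \<open>t\<close>, which in the limit
  evaluate the continuous function \<open>mean\<close> at these times.\<close>

lemma mean_increment_interior:
 assumes st: "0 < s" "s < t" "t < T"
 shows "mean t - mean s = (LINT r:{s..t}|lborel. dens r r)"
proof -
 \<comment> \<open>Half the distance to the ends, so that the mollified indicators are supported
   inside \<open>(0, T)\<close>.\<close>
 define \<sigma>0 where "\<sigma>0 = min s (T - t) / 2"
 define \<sigma> where "\<sigma> n = \<sigma>0 * inverse (real (Suc n))" for n
 have \<sigma>0: "\<sigma>0 > 0" "\<sigma>0 < s" "\<sigma>0 < T - t" using st by (auto simp: \<sigma>0_def min_def)
 have \<sigma>: "\<sigma> n > 0" "\<sigma> n <= \<sigma>0" for n
  using \<sigma>0 mult_left_mono[of "inverse (real (Suc n))" 1 \<sigma>0] by (auto simp: \<sigma>_def inverse_eq_divide simp del: of_nat_Suc)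
 have \<sigma>lim: "\<sigma> \<longlonglongrightarrow> 0"
  unfolding \<sigma>_def[abs_def] using tendsto_mult[OF tendsto_const LIMSEQ_inverse_real_of_nat, of \<sigma>0] by simp
 define \<rho> :: "nat => real => real" where "\<rho> n = mollifier (\<sigma> n)" for n
 have \<rho>C: "C_class k (\<rho> n)" for k n unfolding \<rho>_def by (rule C_class_mollifier)
 have \<rho>0: "\<rho> n x = 0" if "\<sigma> n <= \<bar>x\<bar>" for n x using that \<sigma> by (simp add: \<rho>_def mollifier_eq_0)
 have \<rho>0': "\<rho> n x = 0" if "norm x > \<sigma> n" for n x using that by (intro \<rho>0) simp
 have \<rho>nn: "0 <= \<rho> n x" for n x unfolding \<rho>_def by (rule mollifier_nonneg[OF \<sigma>(1)])
 have \<rho>i: "integrable lborel (\<rho> n)" "(\<integral>x. \<rho> n x \<partial>lborel) = 1" for n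
  unfolding \<rho>_def by (rule mollifier_integrable[OF \<sigma>(1)], rule mollifier_integral[OF \<sigma>(1)])
 have \<rho>r: "integrable lborel (%y. \<rho> n (r - y))" "(\<integral>y. \<rho> n (r - y) \<partial>lborel) = 1" for n r
  using lborel_integrable_real_affine[OF \<rho>i(1)[of n], of "-1" r] lborel_integral_real_affine[of "-1" "\<rho> n" r] \<rho>i(2)[of n] by auto
 have \<rho>s: "integrable lborel (%y. \<rho> n (y - r))" "(\<integral>y. \<rho> n (y - r) \<partial>lborel) = 1" for n r
  using lborel_integrable_real_affine[OF \<rho>i(1)[of n], of "1" "-r"] lborel_integral_real_affine[of "1" "\<rho> n" "-r"] \<rho>i(2)[of n] by auto
 have u: "integrable lborel (indicator {s..t} :: real => real)"
  by (intro integrable_real_indicator) (auto simp: emeasure_lborel_Icc_eq)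
 define \<eta> where "\<eta> n r = (\<integral>y. \<rho> n (r - y) * indicator {s..t} y \<partial>lborel)" for n r
 have \<eta>C: "C_class k (\<eta> n)" for k n
  unfolding \<eta>_def[abs_def] by (rule C_class_convolution[where g = "\<rho> n" and R = "\<sigma> n", OF u]) (rule \<rho>C, rule \<rho>0')
 have D\<rho>: "(\<rho> n has_derivative frechet_derivative (\<rho> n) (at z)) (at z)" for n z by (rule C_class_has_derivative[OF \<rho>C])
 have \<eta>': "frechet_derivative (\<eta> n) (at r) 1 = \<rho> n (r - s) - \<rho> n (r - t)" for n r
 proof -
  have "(\<eta> n has_derivative (%v. \<integral>y. frechet_derivative (\<rho> n) (at (r - y)) v * indicator {s..t} y \<partial>lborel)) (at r)"
   unfolding \<eta>_def[abs_def] by (rule has_derivative_convolution[where g = "\<rho> n" and R = "\<sigma> n", OF _ _ u]) (rule \<rho>C, rule \<rho>0')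
  from fun_cong[OF frechet_derivative_at[OF this], of 1]
  have "frechet_derivative (\<eta> n) (at r) 1 = (\<integral>y. frechet_derivative (\<rho> n) (at (r - y)) 1 * indicator {s..t} y \<partial>lborel)" by (rule sym)
  also have "\<dots> = - \<rho> n (r - t) - (- \<rho> n (r - s))"
  proof (rule integral_FTC_Icc_real)
   show "s <= t" using st by simp
   fix y
   have "(\<rho> n has_field_derivative frechet_derivative (\<rho> n) (at (r - y)) 1) (at (r - y))"
    unfolding has_field_derivative_def
    by (rule has_derivative_eq_rhs[OF D\<rho>], rule ext, subst frechet_derivative_real_eq[OF D\<rho>], rule mult.commute)
   moreover have "((%y. r - y) has_real_derivative -1) (at y)" by (auto intro!: derivative_eq_intros)
   ultimately have "((%y. \<rho> n (r - y)) has_real_derivative frechet_derivative (\<rho> n) (at (r - y)) 1 * -1) (at y)"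
    by (rule DERIV_chain2[where f = "\<rho> n" and g = "%y. r - y" and x = y and Db = "-1" and s = UNIV])
   from DERIV_minus[OF this] show "((%y. - \<rho> n (r - y)) has_real_derivative frechet_derivative (\<rho> n) (at (r - y)) 1) (at y)" by simp
   have "continuous_on UNIV (%z. frechet_derivative (\<rho> n) (at z) 1)" using \<rho>C[of "Suc 0"] by simp
   then have "continuous_on UNIV (%y. frechet_derivative (\<rho> n) (at (r - y)) 1)"
    by (rule continuous_on_compose2) (auto intro!: continuous_intros)
   then show "isCont (%y. frechet_derivative (\<rho> n) (at (r - y)) 1) y" by (simp add: continuous_on_eq_continuous_at)
  qed
  finally show ?thesis by simp
 qed
 have \<eta>_bounds: "0 <= \<eta> n r" "\<eta> n r <= 1" for n r
 proof -
  show "0 <= \<eta> n r" unfolding \<eta>_def by (intro integral_nonneg_AE AE_I2) (simp add: \<rho>nn)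
  have "\<eta> n r <= (\<integral>y. \<rho> n (r - y) \<partial>lborel)"
   unfolding \<eta>_def
  proof (rule integral_mono[OF _ \<rho>r(1)])
   show "integrable lborel (%y. \<rho> n (r - y) * indicator {s..t} y)"
    by (rule integrable_convolution[where g = "\<rho> n" and R = "\<sigma> n", OF u C_class_continuous[OF \<rho>C]]) (rule \<rho>0')
   show "\<rho> n (r - y) * indicator {s..t} y <= \<rho> n (r - y)" for y
    using \<rho>nn[of n "r - y"] by (auto simp: indicator_def)
  qed
  then show "\<eta> n r <= 1" by (simp add: \<rho>r)
 qed
 have \<eta>_out: "\<eta> n r = 0" if "r <= s - \<sigma> n \<or> t + \<sigma> n <= r" for n r
 proof -
  have "\<rho> n (r - y) * indicator {s..t} y = 0" for y
  proof (cases "y \<in> {s..t}")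
   case True
   then have "s <= y" "y <= t" by auto
   then have "\<sigma> n <= \<bar>r - y\<bar>" using that by (elim disjE) linarith+
   then show ?thesis by (simp add: \<rho>0)
  qed simp
  then show ?thesis unfolding \<eta>_def by (simp only: Bochner_Integration.integral_zero)
 qed
 have \<eta>_in: "\<eta> n r = 1" if "s + \<sigma> n <= r" "r <= t - \<sigma> n" for n r
 proof -
  have "\<rho> n (r - y) * indicator {s..t} y = \<rho> n (r - y)" for y
  proof (cases "y \<in> {s..t}")
   case False
   then have "y < s \<or> t < y" by auto
   then have "\<sigma> n <= \<bar>r - y\<bar>" using that by (elim disjE) linarith+
   then show ?thesis by (simp add: \<rho>0)
  qed simp
  then show ?thesis unfolding \<eta>_def by (simp only: \<rho>r)
 qed
 have mi: "integrable lborel (%r. \<rho> n (r - a) * mean r)" for n a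
 proof -
  have c: "continuous_on UNIV (%r. \<rho> n (r - a) * mean r)"
   by (intro continuous_on_mult mean_continuous continuous_on_compose2[where f = "%r. r - a" and t = UNIV, OF C_class_continuous[OF \<rho>C[of 0]]] continuous_on_diff continuous_on_id continuous_on_const) auto
  have "integrable lborel (%r. indicator {a - \<sigma> n..a + \<sigma> n} r *\<^sub>R (\<rho> n (r - a) * mean r))"
   by (intro borel_integrable_compact compact_Icc continuous_on_subset[OF c]) auto
  moreover have "indicator {a - \<sigma> n..a + \<sigma> n} r *\<^sub>R (\<rho> n (r - a) * mean r) = \<rho> n (r - a) * mean r" for r
  proof (cases "r \<in> {a - \<sigma> n..a + \<sigma> n}")
   case False
   then have "r < a - \<sigma> n \<or> a + \<sigma> n < r" by auto
   then have "\<sigma> n <= \<bar>r - a\<bar>" by linarith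
   then show ?thesis by (simp add: \<rho>0)
  qed simp
  ultimately show ?thesis by (simp only:)
 qed
 have mlim: "(%n. \<integral>r. \<rho> n (r - a) * mean r \<partial>lborel) \<longlonglongrightarrow> mean a" for a
 proof (rule tendstoI)
  fix e :: real assume e: "0 < e"
  have "isCont mean a" by (rule mean_facts)
  then obtain d where d: "d > 0" "\<And>r. \<bar>r - a\<bar> < d ==> \<bar>mean r - mean a\<bar> < e / 2"
   unfolding continuous_at_eps_delta dist_real_def using e by (metis half_gt_zero)
  have "\<forall>\<^sub>F n in sequentially. \<sigma> n < d" using \<sigma>lim d(1) by (rule order_tendstoD)
  then show "\<forall>\<^sub>F n in sequentially. dist (\<integral>r. \<rho> n (r - a) * mean r \<partial>lborel) (mean a) < e"
  proof (rule eventually_mono)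
   fix n assume elim: "\<sigma> n < d"
   have ic: "integrable lborel (%r. \<rho> n (r - a) * mean a)" by (rule integrable_mult_left[OF \<rho>s(1)])
   have "(\<integral>r. \<rho> n (r - a) * mean a \<partial>lborel) = mean a" by (simp add: \<rho>s)
   then have "(\<integral>r. \<rho> n (r - a) * mean r \<partial>lborel) - mean a = (\<integral>r. \<rho> n (r - a) * mean r \<partial>lborel) - (\<integral>r. \<rho> n (r - a) * mean a \<partial>lborel)" by simp
   also have "\<dots> = (\<integral>r. \<rho> n (r - a) * mean r - \<rho> n (r - a) * mean a \<partial>lborel)"
    by (rule Bochner_Integration.integral_diff[symmetric, OF mi ic])
   also have "\<bar>\<dots>\<bar> <= (\<integral>r. \<rho> n (r - a) * (e / 2) \<partial>lborel)"
   proof (rule order_trans[OF integral_abs_bound], rule integral_mono)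
    show "integrable lborel (%r. \<bar>\<rho> n (r - a) * mean r - \<rho> n (r - a) * mean a\<bar>)"
     by (intro integrable_abs Bochner_Integration.integrable_diff mi ic)
    show "integrable lborel (%r. \<rho> n (r - a) * (e / 2))" by (rule integrable_mult_left[OF \<rho>s(1)])
    fix r
    show "\<bar>\<rho> n (r - a) * mean r - \<rho> n (r - a) * mean a\<bar> <= \<rho> n (r - a) * (e / 2)"
    proof (cases "\<sigma> n <= \<bar>r - a\<bar>")
     case False
     then have "\<bar>mean r - mean a\<bar> <= e / 2" using elim d(2)[of r] by simp
     from mult_left_mono[OF this \<rho>nn[of n "r - a"]] show ?thesis
      using \<rho>nn[of n "r - a"] by (simp add: abs_mult flip: right_diff_distrib)
    qed (simp add: \<rho>0)
   qed
   also have "\<dots> = e / 2" using \<rho>s(2)[of n a] by simp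
   finally show "dist (\<integral>r. \<rho> n (r - a) * mean r \<partial>lborel) (mean a) < e" using e by (simp add: dist_real_def)
  qed
 qed
 have \<eta>m: "\<eta> n \<in> borel_measurable borel" for n by (intro borel_measurable_continuous_onI C_class_continuous \<eta>C)
 have di: "integrable lborel (%r. \<eta> n r * dens r r)" for n
 proof (rule Bochner_Integration.integrable_bound[OF dens_diagonal_integrable])
  show "(%r. \<eta> n r * dens r r) \<in> borel_measurable lborel"
   using \<eta>m dens_diagonal_measurable by simp
  show "AE r in lborel. norm (\<eta> n r * dens r r) <= norm (dens r r)"
   using \<eta>_bounds by (intro AE_I2) (simp add: abs_mult mult_left_le_one_le)
 qed
 have dlim: "(%n. \<integral>r. \<eta> n r * dens r r \<partial>lborel) \<longlonglongrightarrow> (\<integral>r. indicator {s..t} r * dens r r \<partial>lborel)"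
 proof (rule integral_dominated_convergence[where w = "%r. \<bar>dens r r\<bar>"])
  show "(%r. indicator {s..t} r * dens r r) \<in> borel_measurable lborel"
   using dens_diagonal_measurable by simp
  show "(%r. \<eta> n r * dens r r) \<in> borel_measurable lborel" for n using di by auto
  show "integrable lborel (%r. \<bar>dens r r\<bar>)" by (rule integrable_abs[OF dens_diagonal_integrable])
  show "AE r in lborel. norm (\<eta> n r * dens r r) <= \<bar>dens r r\<bar>" for n
   using \<eta>_bounds by (intro AE_I2) (simp add: abs_mult mult_left_le_one_le)
  \<comment> \<open>Apart from the two end points, \<open>\<eta> n r\<close> eventually equals the
    indicator.\<close>
  have "AE r in lborel. r ~= s" "AE r in lborel. r ~= t" by (rule AE_lborel_singleton)+
  then have "AE r in lborel. r ~= s \<and> r ~= t" by simp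
  then show "AE r in lborel. (%n. \<eta> n r * dens r r) \<longlonglongrightarrow> indicator {s..t} r * dens r r"
  proof (rule eventually_mono)
   fix r assume elim: "r ~= s \<and> r ~= t"
   define d where "d = min \<bar>r - s\<bar> \<bar>r - t\<bar>"
   have d: "d > 0" using elim by (simp add: d_def)
   have "\<forall>\<^sub>F n in sequentially. \<sigma> n < d" using \<sigma>lim d by (rule order_tendstoD)
   then have "\<forall>\<^sub>F n in sequentially. \<eta> n r * dens r r = indicator {s..t} r * dens r r"
   proof (rule eventually_mono)
    fix n assume elim: "\<sigma> n < d"
    have "\<eta> n r = indicator {s..t} r"
    proof (cases "r \<in> {s..t}")
     case True
     then have "\<eta> n r = 1" using elim by (intro \<eta>_in) (auto simp: d_def)
     then show ?thesis using True by simp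
    next
     case False
     then have "\<eta> n r = 0" using elim by (intro \<eta>_out) (auto simp: d_def)
     then show ?thesis using False by simp
    qed
    then show "\<eta> n r * dens r r = indicator {s..t} r * dens r r" by simp
   qed
   then show "(%n. \<eta> n r * dens r r) \<longlonglongrightarrow> indicator {s..t} r * dens r r" by (rule tendsto_eventually)
  qed
 qed
 have eq: "(\<integral>r. \<rho> n (r - s) * mean r \<partial>lborel) - (\<integral>r. \<rho> n (r - t) * mean r \<partial>lborel) + (\<integral>r. \<eta> n r * dens r r \<partial>lborel) = 0" for n
 proof -
  have "(\<integral>r. frechet_derivative (\<eta> n) (at r) 1 * mean r + \<eta> n r * dens r r \<partial>lborel) = 0"
  proof (rule weak_time_derivative[OF \<eta>C])
   show "0 < s - \<sigma> n" "t + \<sigma> n < T" using \<sigma>(2)[of n] \<sigma>0 by linarith+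
   show "\<eta> n r = 0" if "r \<notin> {s - \<sigma> n..t + \<sigma> n}" for r using that by (intro \<eta>_out) auto
  qed
  then have "(\<integral>r. (\<rho> n (r - s) * mean r - \<rho> n (r - t) * mean r) + \<eta> n r * dens r r \<partial>lborel) = 0"
   unfolding \<eta>' by (simp only: left_diff_distrib)
  then show ?thesis
   unfolding Bochner_Integration.integral_add[OF Bochner_Integration.integrable_diff[OF mi mi] di] Bochner_Integration.integral_diff[OF mi mi] .
 qed
 have "(%n. (\<integral>r. \<rho> n (r - s) * mean r \<partial>lborel) - (\<integral>r. \<rho> n (r - t) * mean r \<partial>lborel) + (\<integral>r. \<eta> n r * dens r r \<partial>lborel))
   \<longlonglongrightarrow> mean s - mean t + (\<integral>r. indicator {s..t} r * dens r r \<partial>lborel)"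
  by (rule tendsto_add[OF tendsto_diff[OF mlim mlim] dlim])
 then have lim0: "(%n::nat. 0) \<longlonglongrightarrow> mean s - mean t + (\<integral>r. indicator {s..t} r * dens r r \<partial>lborel)"
  by (simp only: eq)
 have "mean s - mean t + (\<integral>r. indicator {s..t} r * dens r r \<partial>lborel) = 0"
  by (rule LIMSEQ_unique[OF lim0 tendsto_const])
 then have e: "mean t - mean s = (\<integral>r. indicator {s..t} r * dens r r \<partial>lborel)" by linarith
 show ?thesis unfolding set_lebesgue_integral_def real_scaleR_def by (rule e)
qed

text \<open>\<open>mean\<close> minus the integral of the density is constant on the open interval,
  and by continuity on its closure; this brings in the times 0 and \<open>T\<close>.\<close>

lemma mean_increment:
 assumes st: "0 <= s" "s <= t" "t <= T"
 shows "mean t - mean s = (LINT r:{s..t}|lborel. dens r r)"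
proof (cases "0 < T")
 case T: True
 have si: "set_integrable lborel {a..b} (%r. dens r r)" for a b
  using integrable_mult_indicator[OF _ dens_diagonal_integrable, of "{a..b}"] by (simp add: set_integrable_def)
 have hk: "(%r. dens r r) integrable_on {a..b}" "(LINT r:{a..b}|lborel. dens r r) = integral {a..b} (%r. dens r r)" for a b
  using set_borel_integral_eq_integral[OF si] by auto
 define G where "G q = mean q - integral {0..q} (%r. dens r r)" for q
 have cG: "continuous_on {0..T} G"
  unfolding G_def[abs_def] by (intro continuous_on_diff mean_continuous indefinite_integral_continuous_1 hk)
 have comb: "integral {0..b} (%r. dens r r) - integral {0..a} (%r. dens r r) = integral {a..b} (%r. dens r r)" if "0 <= a" "a <= b" for a b
  using Henstock_Kurzweil_Integration.integral_combine[OF that hk(1)] by linarith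
 have less: "G b = G a" if "0 < a" "a < b" "b < T" for a b
  using mean_increment_interior[OF that] comb[of a b] that by (simp add: G_def hk)
 have const: "G q = G (T / 2)" if "q \<in> {0<..<T}" for q
  using less[of q "T / 2"] less[of "T / 2" q] that by (cases q "T / 2" rule: linorder_cases) auto
 have cl: "closure {0<..<T} = {0..T}" using T by simp
 have all: "G q = G (T / 2)" if "q \<in> {0..T}" for q
  by (rule continuous_constant_on_closure[where S = "{0<..<T}" and f = G and a = "G (T / 2)"],
    unfold cl, rule cG, rule const, assumption, rule that)
 have "G t = G (T / 2)" "G s = G (T / 2)" by (rule all, use st in simp)+
 then have "G t = G s" by (rule trans[OF _ sym])
 then show ?thesis using comb[OF st(1,2)] by (simp add: G_def hk)
next
 case False
 then have "s = 0" "t = 0" using st by auto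
 moreover have "(LINT r:{0..0}|lborel. dens r r) = 0"
  unfolding set_lebesgue_integral_def
  by (rule integral_eq_zero_AE, rule AE_mp[OF AE_lborel_singleton[of "0::real"]]) (auto simp: indicator_def)
 ultimately show ?thesis by simp
qed

end

end

section \<open>Transport along the flow\<close>

text \<open>In \<open>bb_eq\<close> the point is quantified first, since trajectories are compared
  with the field at a fixed point during a whole time interval.\<close>

locale transport_solution = backward_flow T b C0 C1 \<phi> + weak_solution T bb c0 f
 for T and b :: "real => real^'n => real^'n" and C0 C1 and \<phi> and bb :: "real => real^'n => real^'n"
  and c0 and f :: "real => real^'n => real" +
 assumes c0_eq: "AE r in lborel. r \<in> {0..T} --> c0 r = C0 r"
  and bb_eq: "AE x in lborel. AE r in lborel. r \<in> {0..T} --> bb r x = b r x"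
  and f_unif_int: "\<And>K e. compact K ==> 0 < e ==> \<exists>M\<ge>0. \<forall>t. (LINT x:K|lborel. max 0 (\<bar>f t x\<bar> - M)) <= e"
begin

lemma bb_section_measurable: "(%r. bb r x) \<in> borel_measurable borel"
proof -
 have "(%r::real. (r, x)) \<in> borel_measurable borel"
  by (intro borel_measurable_continuous_onI continuous_intros)
 from measurable_compose[OF this bb_meas] show ?thesis by simp
qed

lemma c0_set_integrable: "set_integrable lborel {s..t} c0"
 using integrable_mult_indicator[OF _ c0_int, of "{s..t}"] by (simp add: set_integrable_def)

lemma c0_integral_eq:
 assumes st: "0 <= s" "t <= T"
 shows "(LINT r:{s..t}|lborel. c0 r) = integral {s..t} C0"
proof -
 have "(LINT r:{s..t}|lborel. c0 r) = integral {s..t} c0"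
  by (rule set_borel_integral_eq_integral(2)[OF c0_set_integrable])
 also have "\<dots> = integral {s..t} C0"
 proof -
  have "AE r in lebesgue. r \<in> {0..T} --> c0 r = C0 r" using c0_eq by (rule AE_completion)
  then have n: "negligible {r. \<not> (r \<in> {0..T} --> c0 r = C0 r)}" by (simp only: AE_lebesgue_iff_negligible)
  show ?thesis
  proof (rule integral_spike[OF n])
   fix r assume "r \<in> {s..t} - {r. \<not> (r \<in> {0..T} --> c0 r = C0 r)}"
   then show "C0 r = c0 r" using st by auto
  qed
 qed
 finally show ?thesis .
qed

text \<open>The displacement during a step when the position is frozen at \<open>x\<close>.\<close>

definition drift :: "real => real => real^'n => real^'n" where
 "drift s t x = (LINT r:{s..t}|lborel. bb r x)"

lemma bb_set_integrable: "set_integrable lborel {s..t} (%r. bb r x)"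
proof (rule set_integrable_bound[OF set_integrable_mult_left[of "1 + norm x", OF c0_set_integrable]])
 show "set_borel_measurable lborel {s..t} (%r. bb r x)"
  unfolding set_borel_measurable_def using bb_section_measurable[of x] by (intro borel_measurable_scaleR) auto
 show "AE r in lborel. r \<in> {s..t} --> norm (bb r x) <= norm (c0 r * (1 + norm x))"
  by (rule AE_I2, rule impI, rule order_trans[OF bb_growth]) simp
qed

lemma norm_drift_le: "norm (drift s t x) <= (LINT r:{s..t}|lborel. c0 r) * (1 + norm x)"
proof -
 have "norm (drift s t x) <= (LINT r:{s..t}|lborel. norm (bb r x))"
  unfolding drift_def by (rule set_integral_norm_bound[OF bb_set_integrable])
 also have "\<dots> <= (LINT r:{s..t}|lborel. c0 r * (1 + norm x))"
  by (rule set_integral_mono[OF set_integrable_norm[OF bb_set_integrable] set_integrable_mult_left[OF c0_set_integrable]])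
    (rule bb_growth)
 also have "\<dots> = (LINT r:{s..t}|lborel. c0 r) * (1 + norm x)" by (rule set_integral_mult_left)
 finally show ?thesis .
qed

lemma bb_swap_measurable: "(%(x, r). bb r x) \<in> borel_measurable (borel \<Otimes>\<^sub>M lborel)"
proof -
 have "(%z. (snd z, fst z)) \<in> borel_measurable (borel :: ((real^'n) \<times> real) measure)"
  by (intro borel_measurable_continuous_onI continuous_intros)
 from measurable_compose[OF this bb_meas]
 have "(%z. bb (snd z) (fst z)) \<in> borel_measurable (borel :: ((real^'n) \<times> real) measure)" by simp
 moreover have "sets (borel :: ((real^'n) \<times> real) measure) = sets (borel \<Otimes>\<^sub>M lborel)"
  unfolding borel_prod[symmetric] by (intro sets_pair_measure_cong) auto
 ultimately show ?thesis by (simp add: case_prod_unfold cong: measurable_cong_sets)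
qed

lemma drift_measurable: "drift s t \<in> borel_measurable borel"
proof -
 have "(%(x, r). indicator {s..t} r *\<^sub>R bb r x) \<in> borel_measurable (borel \<Otimes>\<^sub>M lborel)"
  using bb_swap_measurable by (simp add: case_prod_unfold)
 then have "(%x. \<integral>r. indicator {s..t} r *\<^sub>R bb r x \<partial>lborel) \<in> borel_measurable borel"
  by (rule lborel.borel_measurable_lebesgue_integral)
 then show ?thesis unfolding drift_def[abs_def] set_lebesgue_integral_def .
qed

text \<open>With the density frozen, the field enters linearly, and Fubini allows its time integral
  to be taken first.\<close>

lemma integral_dens_eq_drift:
 assumes \<Psi>: "\<And>k. C_class k \<Psi>" "\<And>x. norm x > R ==> \<Psi> x = 0" "0 <= R"
 shows "(LINT r:{s..t}|lborel. dens \<Psi> q r) = (\<integral>x. f q x * frechet_derivative \<Psi> (at x) (drift s t x) \<partial>lborel)"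
proof -
 let ?D = "%x v. frechet_derivative \<Psi> (at x) v"
 obtain L where L: "\<And>x v. \<bar>?D x v\<bar> <= L * norm v" "0 <= L" using ex_derivative_bound[of \<Psi> R] \<Psi> by auto
 define F where "F r x = indicator {s..t} r * (f q x * ?D x (bb r x))" for r x
 have Fm: "(%(r, x). F r x) \<in> borel_measurable (lborel \<Otimes>\<^sub>M lborel)"
 proof -
  have "(%z. f q (snd z)) \<in> borel_measurable (borel :: (real \<times> (real^'n)) measure)"
   by (rule measurable_compose[OF _ f_borel]) (intro borel_measurable_continuous_onI continuous_intros)
  moreover have "(%z. indicator {s..t} (fst z) :: real) \<in> borel_measurable (borel :: (real \<times> (real^'n)) measure)"
   by (rule measurable_compose[of fst _ borel]) (intro borel_measurable_continuous_onI continuous_intros, simp)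
  moreover have "(%z. ?D (snd z) (bb (fst z) (snd z))) \<in> borel_measurable borel"
   by (rule \<Psi>_derivative_measurable[of \<Psi> R]) (use \<Psi> in auto)
  ultimately have "(%z. F (fst z) (snd z)) \<in> borel_measurable borel"
   unfolding F_def by (intro borel_measurable_times)
  then show ?thesis by (simp add: case_prod_unfold lborel_prod)
 qed
 have bnd: "integrable lborel (F r)" "(\<integral>x. F r x \<partial>lborel) = indicator {s..t} r * dens \<Psi> q r" for r
 proof -
  have i: "integrable lborel (%x. f q x * ?D x (bb r x))"
   by (rule dens_bounds(1)[of \<Psi> R L]) (use \<Psi> L in auto)
  then show "integrable lborel (F r)" unfolding F_def[abs_def] by (rule integrable_mult_right)
  have "dens \<Psi> q r = (\<integral>x. f q x * ?D x (bb r x) \<partial>lborel)" by (rule dens_def[of \<Psi> R]) (use \<Psi> in auto)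
  then show "(\<integral>x. F r x \<partial>lborel) = indicator {s..t} r * dens \<Psi> q r" unfolding F_def by simp
 qed
 define W where "W = (LINT x:cball 0 R|lborel. \<bar>f q x\<bar>)"
 have nb: "(\<integral>x. norm (F r x) \<partial>lborel) <= L * (1 + R) * W * c0 r" for r
 proof -
  have i: "set_integrable lborel (cball 0 R) (%x. \<bar>f q x\<bar>)" by (intro set_integrable_abs f_int) simp
  have m: "(%x. \<bar>?D x (bb r x)\<bar>) \<in> borel_measurable borel"
   using \<Psi>_derivative_section_measurable[of \<Psi> R r] \<Psi> by auto
  have w: "\<bar>\<bar>?D x (bb r x)\<bar>\<bar> <= L * (1 + R) * c0 r" for x
   using \<Psi>_derivative_bound(1)[of \<Psi> R L x r] \<Psi> L by auto
  have z: "\<bar>?D x (bb r x)\<bar> = 0" if "x \<notin> cball 0 R" for x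
   using \<Psi>_derivative_bound(2)[of \<Psi> R L x r] \<Psi> L that by auto
  have "(\<integral>x. norm (F r x) \<partial>lborel) = indicator {s..t} r * (\<integral>x. \<bar>f q x\<bar> * \<bar>?D x (bb r x)\<bar> \<partial>lborel)"
   by (simp add: F_def abs_mult)
  also have "\<dots> <= 1 * \<bar>\<integral>x. \<bar>f q x\<bar> * \<bar>?D x (bb r x)\<bar> \<partial>lborel\<bar>"
   by (intro mult_mono) (auto simp: indicator_def)
  also have "\<dots> <= L * (1 + R) * c0 r * (LINT x:cball 0 R|lborel. \<bar>\<bar>f q x\<bar>\<bar>)"
   using integrable_mult_bounded(2)[OF i m w z] by simp
  finally show ?thesis by (simp add: W_def mult_ac)
 qed
 have Fi: "integrable (lborel \<Otimes>\<^sub>M lborel) (%(r, x). F r x)"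
 proof (rule lborel_pair.Fubini_integrable)
  show "(%(r, x). F r x) \<in> borel_measurable (lborel \<Otimes>\<^sub>M lborel)" by (rule Fm)
  show "AE r in lborel. integrable lborel (%x. case (r, x) of (r, x) => F r x)" using bnd(1) by simp
  show "integrable lborel (%r. \<integral>x. norm (case (r, x) of (r, x) => F r x) \<partial>lborel)"
  proof (rule Bochner_Integration.integrable_bound[OF integrable_mult_right[OF c0_int, of "L * (1 + R) * W"]])
   have "(%(r, x). norm (F r x)) \<in> borel_measurable (lborel \<Otimes>\<^sub>M lborel)"
    using measurable_compose[OF Fm borel_measurable_norm] by (simp add: case_prod_unfold)
   then show "(%r. \<integral>x. norm (case (r, x) of (r, x) => F r x) \<partial>lborel) \<in> borel_measurable lborel"
    unfolding prod.case by (rule lborel.borel_measurable_lebesgue_integral)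
   show "AE r in lborel. norm (\<integral>x. norm (case (r, x) of (r, x) => F r x) \<partial>lborel) <= norm (L * (1 + R) * W * c0 r)"
   proof (rule AE_I2)
    fix r
    have "0 <= (\<integral>x. norm (F r x) \<partial>lborel)" by (intro integral_nonneg_AE) auto
    then show "norm (\<integral>x. norm (case (r, x) of (r, x) => F r x) \<partial>lborel) <= norm (L * (1 + R) * W * c0 r)"
     using nb[of r] by simp
   qed
  qed
 qed
 have lin: "bounded_linear (?D x)" for x
  using C_class_has_derivative[OF \<Psi>(1)[of "Suc 0"]] has_derivative_bounded_linear by blast
 have inner: "(\<integral>r. F r x \<partial>lborel) = f q x * ?D x (drift s t x)" for x
 proof -
  have "?D x (drift s t x) = (LINT r|lborel. ?D x (indicator {s..t} r *\<^sub>R bb r x))"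
   unfolding drift_def set_lebesgue_integral_def
   by (rule integral_bounded_linear[OF lin, symmetric]) (use bb_set_integrable[of s t x] in \<open>simp add: set_integrable_def\<close>)
  also have "\<dots> = (LINT r|lborel. indicator {s..t} r * ?D x (bb r x))"
   using linear_scale[OF bounded_linear.linear[OF lin]] by simp
  finally have "f q x * ?D x (drift s t x) = (LINT r|lborel. f q x * (indicator {s..t} r * ?D x (bb r x)))" by simp
  also have "\<dots> = (\<integral>r. F r x \<partial>lborel)" unfolding F_def by (simp only: mult.left_commute)
  finally show ?thesis by (rule sym)
 qed
 have "(LINT r:{s..t}|lborel. dens \<Psi> q r) = (\<integral>r. (\<integral>x. F r x \<partial>lborel) \<partial>lborel)"
  unfolding bnd set_lebesgue_integral_def by simp
 also have "\<dots> = (\<integral>x. (\<integral>r. F r x \<partial>lborel) \<partial>lborel)"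
  by (rule lborel_pair.Fubini_integral[OF Fi, symmetric])
 also have "\<dots> = (\<integral>x. f q x * ?D x (drift s t x) \<partial>lborel)" by (simp only: inner)
 finally show ?thesis .
qed

text \<open>Freezing the density at the end time \<open>t\<close> leaves only the drift in the weak
  equation; the price is the oscillation \<open>\<omega>\<close> of \<open>f\<close> in L^1 during
  the step.\<close>

lemma mean_increment_drift:
 assumes \<Psi>: "\<And>k. C_class k \<Psi>" "\<And>x. norm x > R ==> \<Psi> x = 0" "0 <= R"
  and L: "\<And>x v. \<bar>frechet_derivative \<Psi> (at x) v\<bar> <= L * norm v" "0 <= L"
  and st: "0 <= s" "s <= t" "t <= T"
  and \<omega>: "\<And>r. r \<in> {s..t} ==> (LINT x:cball 0 R|lborel. \<bar>f r x - f t x\<bar>) <= \<omega>"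
 shows "\<bar>(\<integral>x. f t x * \<Psi> x \<partial>lborel) - (\<integral>x. f s x * \<Psi> x \<partial>lborel)
   - (\<integral>x. f t x * frechet_derivative \<Psi> (at x) (drift s t x) \<partial>lborel)\<bar> <= L * (1 + R) * \<omega> * (LINT r:{s..t}|lborel. c0 r)"
proof -
 have inc: "(\<integral>x. f t x * \<Psi> x \<partial>lborel) - (\<integral>x. f s x * \<Psi> x \<partial>lborel) = (LINT r:{s..t}|lborel. dens \<Psi> r r)"
 proof -
  have m: "mean \<Psi> q = (\<integral>x. f q x * \<Psi> x \<partial>lborel)" for q by (rule mean_def[of \<Psi> R]) (use \<Psi> in auto)
  show ?thesis unfolding m[symmetric] by (rule mean_increment[of \<Psi> R]) (use \<Psi> st in auto)
 qed
 have i1: "set_integrable lborel {s..t} (%r. dens \<Psi> r r)"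
  using integrable_mult_indicator[OF _ dens_diagonal_integrable[of \<Psi> R], of "{s..t}"] \<Psi> by (auto simp: set_integrable_def)
 have bdd: "\<bar>dens \<Psi> r r - dens \<Psi> t r\<bar> <= L * (1 + R) * \<omega> * c0 r" if "r \<in> {s..t}" for r
 proof -
  have "\<bar>dens \<Psi> r r - dens \<Psi> t r\<bar> <= L * (1 + R) * c0 r * (LINT x:cball 0 R|lborel. \<bar>f r x - f t x\<bar>)"
   by (rule dens_bounds(3)[of \<Psi> R L]) (use \<Psi> L in auto)
  also have "\<dots> <= L * (1 + R) * c0 r * \<omega>"
   using L(2) \<Psi>(3) c0_nonneg by (intro mult_left_mono \<omega> that) auto
  finally show ?thesis by (simp add: mult_ac)
 qed
 have ic: "set_integrable lborel {s..t} (%r. L * (1 + R) * \<omega> * c0 r)" by (rule set_integrable_mult_right[OF c0_set_integrable])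
 have id: "set_integrable lborel {s..t} (%r. dens \<Psi> r r - dens \<Psi> t r)"
 proof (rule set_integrable_bound[OF ic])
  show "set_borel_measurable lborel {s..t} (%r. dens \<Psi> r r - dens \<Psi> t r)"
   unfolding set_borel_measurable_def
   using dens_diagonal_measurable[of \<Psi> R] dens_measurable[of \<Psi> R t] \<Psi> by (intro borel_measurable_scaleR borel_measurable_diff) auto
  show "AE r in lborel. r \<in> {s..t} --> norm (dens \<Psi> r r - dens \<Psi> t r) <= norm (L * (1 + R) * \<omega> * c0 r)"
   by (rule AE_I2, rule impI) (use bdd in \<open>force simp: real_norm_def\<close>)
 qed
 have i2: "set_integrable lborel {s..t} (%r. dens \<Psi> t r)"
  using set_integral_diff(1)[OF i1 id] by simp
 have "(\<integral>x. f t x * \<Psi> x \<partial>lborel) - (\<integral>x. f s x * \<Psi> x \<partial>lborel) - (\<integral>x. f t x * frechet_derivative \<Psi> (at x) (drift s t x) \<partial>lborel)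
   = (LINT r:{s..t}|lborel. dens \<Psi> r r) - (LINT r:{s..t}|lborel. dens \<Psi> t r)"
  unfolding inc using integral_dens_eq_drift[of \<Psi> R s t t] \<Psi> by auto
 also have "\<dots> = (LINT r:{s..t}|lborel. dens \<Psi> r r - dens \<Psi> t r)"
  by (rule set_integral_diff(2)[OF i1 i2, symmetric])
 finally have eq: "(\<integral>x. f t x * \<Psi> x \<partial>lborel) - (\<integral>x. f s x * \<Psi> x \<partial>lborel) - (\<integral>x. f t x * frechet_derivative \<Psi> (at x) (drift s t x) \<partial>lborel)
   = (LINT r:{s..t}|lborel. dens \<Psi> r r - dens \<Psi> t r)" .
 have "norm (LINT r:{s..t}|lborel. dens \<Psi> r r - dens \<Psi> t r) <= (LINT r:{s..t}|lborel. norm (dens \<Psi> r r - dens \<Psi> t r))"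
  by (rule set_integral_norm_bound[OF id])
 also have "\<dots> <= (LINT r:{s..t}|lborel. L * (1 + R) * \<omega> * c0 r)"
  by (rule set_integral_mono[OF set_integrable_norm[OF id] ic]) (simp add: bdd)
 also have "\<dots> = L * (1 + R) * \<omega> * (LINT r:{s..t}|lborel. c0 r)" by (rule set_integral_mult_right)
 finally show ?thesis unfolding eq real_norm_def .
qed

end



lemma integral_le_AE:
 fixes f g :: "'a::euclidean_space => real"
 assumes f: "f integrable_on S" and g: "g integrable_on S" and le: "AE x in lebesgue. x \<in> S --> f x <= g x"
 shows "integral S f <= integral S g"
proof -
 define N where "N = {x. \<not> (x \<in> S --> f x <= g x)}"
 have n: "negligible N" using le unfolding N_def by (simp only: AE_lebesgue_iff_negligible)
 define h where "h x = (if x \<in> N then f x else g x)" for x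
 have h: "h x = g x" if "x \<in> S - N" for x using that by (simp add: h_def)
 have "integral S f <= integral S h"
  by (rule integral_le[OF f integrable_spike[OF g n h]]) (auto simp: h_def N_def)
 also have "\<dots> = integral S g" by (rule integral_spike[OF n]) (simp add: h)
 finally show ?thesis .
qed

lemma integrable_bounded_support:
 fixes w :: "'a::euclidean_space => real"
 assumes w: "w \<in> borel_measurable borel" "\<And>x. \<bar>w x\<bar> <= W" "\<And>x. norm x > R ==> w x = 0"
 shows "integrable lborel w" "\<bar>\<integral>x. w x \<partial>lborel\<bar> <= W * measure lborel (cball (0::'a) R)"
proof -
 have fin: "emeasure lborel (cball (0::'a) R) < \<infinity>" by (rule emeasure_lborel_cball_finite)
 have 1: "set_integrable lborel (cball (0::'a) R) (%x. 1 :: real)"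
  unfolding set_integrable_def using fin by (auto intro!: integrable_real_indicator)
 have 0: "w x = 0" if "x \<notin> cball 0 R" for x using w(3)[of x] that by auto
 show "integrable lborel w" using integrable_mult_bounded(1)[OF 1 w(1,2) 0] by simp
 have "(LINT x:cball (0::'a) R|lborel. \<bar>1::real\<bar>) = measure lborel (cball (0::'a) R)"
  by (simp add: set_lebesgue_integral_def)
 then show "\<bar>\<integral>x. w x \<partial>lborel\<bar> <= W * measure lborel (cball (0::'a) R)"
  using integrable_mult_bounded(2)[OF 1 w(1,2) 0] by simp
qed

context transport_solution
begin

abbreviation "A0 s t \<equiv> integral {s..t} C0"
abbreviation "A1 s t \<equiv> integral {s..t} C1"

text \<open>Error of comparing a trajectory within distance \<open>\<kappa>\<close> of
  \<open>x\<close> with the field at distance \<open>\<tau>\<close>: the first term is the integral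
  of \<open>C1\<close> times \<open>(2 * \<tau>)\<^sup>2 / \<tau>\<close>, the second is the growth
  bound times \<open>\<kappa> / \<tau>\<close>.\<close>

definition slack :: "real => real => real => real => real => real" where
 "slack s t \<tau> \<kappa> R = 4 * \<tau> * A1 s t + 2 * (1 + R) * (\<kappa> / \<tau>) * A0 s t"

lemma drift_inner_eq:
 "drift s t x \<bullet> e = integral {s..t} (%r. bb r x \<bullet> e)" "(%r. bb r x \<bullet> e) integrable_on {s..t}"
proof -
 have i: "set_integrable lborel {s..t} (%r. bb r x \<bullet> e)"
  using integrable_inner_left[of e, OF bb_set_integrable[of s t x, unfolded set_integrable_def]]
  by (simp add: set_integrable_def)
 have "drift s t x \<bullet> e = (LINT r:{s..t}|lborel. bb r x \<bullet> e)"
  unfolding drift_def set_lebesgue_integral_def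
  using integral_inner_left[of e lborel "%r. indicator {s..t} r *\<^sub>R bb r x"] bb_set_integrable[of s t x] by (simp add: set_integrable_def)
 then show "drift s t x \<bullet> e = integral {s..t} (%r. bb r x \<bullet> e)"
  using set_borel_integral_eq_integral(2)[OF i] by simp
 show "(%r. bb r x \<bullet> e) integrable_on {s..t}" using set_borel_integral_eq_integral(1)[OF i] .
qed

definition regular :: "real^'n => bool" where
 "regular x \<longleftrightarrow> (AE r in lborel. r \<in> {0..T} --> bb r x = b r x)"

text \<open>The one-sided Lipschitz condition between the trajectory and the shifted point \<open>x + \<tau> e\<close> controls
 the velocity of the trajectory in direction \<open>e\<close> by the values of \<open>b\<close> at that point.\<close>

lemma trajectory_component_le:
 assumes st: "0 <= s" "s <= t" "t <= T" and e: "norm e = 1" and \<tau>: "0 < \<tau>" "\<tau> <= 1"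
  and \<kappa>: "0 <= \<kappa>" "\<kappa> <= \<tau>" and near: "\<And>r. r \<in> {s..t} ==> norm (x - \<phi> r t y) <= \<kappa>"
  and R: "norm x + 1 <= R" and reg: "regular (x + \<tau> *\<^sub>R e)"
 shows "(y - \<phi> s t y) \<bullet> e <= drift s t (x + \<tau> *\<^sub>R e) \<bullet> e + slack s t \<tau> \<kappa> R"
proof -
 let ?y = "%r. \<phi> r t y" and ?z = "x + \<tau> *\<^sub>R e"
 define h where "h r = bb r ?z \<bullet> e + (4 * \<tau> * C1 r + 2 * (1 + R) * (\<kappa> / \<tau>) * C0 r)" for r
 have tr: "is_traj s t ?y" by (rule is_traj_flow[OF st])
 have iC0: "C0 integrable_on {s..t}" and iC1: "C1 integrable_on {s..t}"
  using integral_C_subinterval(3)[OF C0_int C0_nonneg st(1,3)] integral_C_subinterval(3)[OF C1_int C1_nonneg st(1,3)] by auto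
 have i1: "(%r. 4 * \<tau> * C1 r) integrable_on {s..t}" "(%r. 2 * (1 + R) * (\<kappa> / \<tau>) * C0 r) integrable_on {s..t}"
  by (rule integrable_on_mult_right[OF iC1], rule integrable_on_mult_right[OF iC0])
 have hi: "h integrable_on {s..t}" unfolding h_def[abs_def]
  by (rule integrable_add[OF drift_inner_eq(2) integrable_add[OF i1]])
 have hint: "integral {s..t} h = drift s t ?z \<bullet> e + slack s t \<tau> \<kappa> R"
  unfolding h_def[abs_def] slack_def drift_inner_eq(1)
  by (simp only: Henstock_Kurzweil_Integration.integral_add[OF drift_inner_eq(2) integrable_add[OF i1]]
    Henstock_Kurzweil_Integration.integral_add[OF i1] integral_mult_right)
 have "?y t \<bullet> e - ?y s \<bullet> e <= integral {s..t} h"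
 proof (rule abs_continuous_on_increment_le[OF st(2) _ _ hi])
  show "abs_continuous_on s t (%r. ?y r \<bullet> e)"
   by (rule abs_continuous_on_dominated[where M = 1 and g = ?y])
    (use tr Cauchy_Schwarz_ineq2[of _ e] e in \<open>auto simp: is_traj_def inner_diff_left[symmetric]\<close>)
  define P where "P r \<longleftrightarrow> (\<exists>v\<in>filippov_hull b r (?y r). (?y has_vector_derivative v) (at r within {s..t}))" for r
  define P' where "P' r \<longleftrightarrow> (r \<in> {0..T} --> bb r ?z = b r ?z)" for r
  define Q where "Q r \<longleftrightarrow> (\<exists>v. ((%r. ?y r \<bullet> e) has_vector_derivative v) (at r within {s..t}) \<and> v <= h r)" for r
  have 1: "AE r in lebesgue_on {s..t}. P r"
   using tr unfolding is_traj_def P_def by auto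
  have "AE r in lebesgue. P' r" using reg unfolding regular_def P'_def[symmetric] by (rule AE_completion)
  then have 2: "AE r in lebesgue_on {s..t}. P' r" by (subst AE_restrict_space_iff) auto
  have "AE r in lebesgue_on {s..t}. P r \<and> P' r" using 1 2 by (rule AE_conjI)
  moreover have "Q r" if r: "r \<in> {s..t}" and H: "P r \<and> P' r" for r
  proof -
   from H obtain v where v: "v \<in> filippov_hull b r (?y r)" "(?y has_vector_derivative v) (at r within {s..t})"
    unfolding P_def by blast
   have rT: "r \<in> {0..T}" using r st by auto
   have bz: "bb r ?z = b r ?z" using H rT unfolding P'_def by blast
   have d: "((%r. ?y r \<bullet> e) has_vector_derivative (v \<bullet> e)) (at r within {s..t})"
    using bounded_linear.has_vector_derivative[OF bounded_linear_inner_left v(2)] .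
   define w where "w = x - ?y r"
   have w: "norm w <= \<kappa>" unfolding w_def by (rule near[OF r])
   have zy: "?z - ?y r = \<tau> *\<^sub>R e + w" by (simp add: w_def)
   \<comment> \<open>\<open>\<kappa> <= \<tau>\<close> keeps the separation below
     \<open>2 * \<tau>\<close>, whence the 4 in \<open>slack\<close>.\<close>
   have nz: "norm (\<tau> *\<^sub>R e + w) <= 2 * \<tau>"
    using norm_triangle_ineq[of "\<tau> *\<^sub>R e" w] w \<kappa> \<tau> e by simp
   have C: "0 <= C0 r" "0 <= C1 r" using C0_nonneg[OF rT] C1_nonneg[OF rT] by auto
   have "- C1 r * (norm (\<tau> *\<^sub>R e + w))\<^sup>2 <= (b r ?z - v) \<bullet> (\<tau> *\<^sub>R e + w)"
    using filippov_hull_one_sided[OF rT v(1), of ?z] unfolding zy .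
   moreover have "C1 r * (norm (\<tau> *\<^sub>R e + w))\<^sup>2 <= C1 r * (2 * \<tau>)\<^sup>2"
    by (intro mult_left_mono power_mono nz C) simp
   \<comment> \<open>The component along \<open>w\<close> has no useful sign and is bounded by
     growth alone; divided by \<open>\<tau>\<close> it gives the second term of
     \<open>slack\<close>.\<close>
   moreover have "(b r ?z - v) \<bullet> w <= 2 * (C0 r * (1 + R)) * \<kappa>"
   proof -
    have "norm ?z <= R" using norm_triangle_ineq[of x "\<tau> *\<^sub>R e"] R \<tau> e by simp
    then have n1: "norm (b r ?z) <= C0 r * (1 + R)"
     using C by (intro order_trans[OF growth[OF rT]] mult_left_mono) auto
    have "norm (?y r) <= norm x + norm w" using norm_triangle_ineq4[of x w] by (simp add: w_def)
    then have "norm (?y r) <= R" using w \<kappa> \<tau> R by linarith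
    then have n2: "norm v <= C0 r * (1 + R)"
     using C by (intro order_trans[OF filippov_hull_growth[OF rT v(1)]] mult_left_mono) auto
    have "(b r ?z - v) \<bullet> w <= norm (b r ?z - v) * norm w" by (rule norm_cauchy_schwarz)
    also have "\<dots> <= (norm (b r ?z) + norm v) * \<kappa>"
     by (intro mult_mono norm_triangle_ineq4 w) auto
    also have "\<dots> <= 2 * (C0 r * (1 + R)) * \<kappa>" using n1 n2 \<kappa> by (intro mult_right_mono) auto
    finally show ?thesis .
   qed
   ultimately have "- (C1 r * (2 * \<tau>)\<^sup>2) - 2 * (C0 r * (1 + R)) * \<kappa> <= (b r ?z - v) \<bullet> (\<tau> *\<^sub>R e)"
    unfolding inner_add_right by linarith
   then have "\<tau> * (v \<bullet> e) <= \<tau> * (b r ?z \<bullet> e) + C1 r * (2 * \<tau>)\<^sup>2 + 2 * (C0 r * (1 + R)) * \<kappa>"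
    by (simp add: inner_diff_left right_diff_distrib)
   also have "\<dots> = \<tau> * h r"
    using \<tau> by (simp add: h_def bz power2_eq_square field_simps)
   finally have le: "v \<bullet> e <= h r" using \<tau> by simp
   show ?thesis unfolding Q_def by (rule exI, rule conjI, rule d, rule le)
  qed
  ultimately have "AE r in lebesgue_on {s..t}. Q r" by (rule AE_interval_mp)
  then show "AE r in lebesgue_on {s..t}. \<exists>v. ((%r. ?y r \<bullet> e) has_vector_derivative v) (at r within {s..t}) \<and> v <= h r"
   unfolding Q_def .
 qed
 then show ?thesis using flow_self[of t y] st by (simp add: hint inner_diff_left)
qed

text \<open>The one-sided condition between the two regular points, divided by \<open>\<tau>\<close>
  and integrated in time.\<close>

lemma drift_difference_ge:
 assumes st: "0 <= s" "s <= t" "t <= T" and e: "norm e = 1" and \<tau>: "0 < \<tau>"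
  and reg: "regular x" "regular (x + \<tau> *\<^sub>R e)"
 shows "- (\<tau> * A1 s t) <= (drift s t (x + \<tau> *\<^sub>R e) - drift s t x) \<bullet> e"
proof -
 let ?z = "x + \<tau> *\<^sub>R e"
 have iC1: "C1 integrable_on {s..t}" by (rule integral_C_subinterval(3)[OF C1_int C1_nonneg st(1,3)])
 have i1: "(%r. - \<tau> * C1 r) integrable_on {s..t}" by (rule integrable_on_mult_right[OF iC1])
 have i2: "(%r. bb r ?z \<bullet> e - bb r x \<bullet> e) integrable_on {s..t}"
  by (rule integrable_diff[OF drift_inner_eq(2) drift_inner_eq(2)])
 have a: "AE r in lebesgue. r \<in> {0..T} --> bb r x = b r x" "AE r in lebesgue. r \<in> {0..T} --> bb r ?z = b r ?z"
  using reg[unfolded regular_def, THEN AE_completion] by auto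
 have "- (\<tau> * A1 s t) = integral {s..t} (%r. - \<tau> * C1 r)" by simp
 also have "\<dots> <= integral {s..t} (%r. bb r ?z \<bullet> e - bb r x \<bullet> e)"
 proof (rule integral_le_AE[OF i1 i2])
  show "AE r in lebesgue. r \<in> {s..t} --> - \<tau> * C1 r <= bb r ?z \<bullet> e - bb r x \<bullet> e"
   using a
  proof eventually_elim
   case (elim r)
   show ?case
   proof
    assume "r \<in> {s..t}"
    then have rT: "r \<in> {0..T}" using st by auto
    have "- C1 r * (norm (?z - x))\<^sup>2 <= (b r ?z - b r x) \<bullet> (?z - x)" by (rule one_sided[OF rT])
    then have "\<tau> * (- \<tau> * C1 r) <= \<tau> * ((b r ?z - b r x) \<bullet> e)"
     using e by (simp add: power2_eq_square mult_ac)
    then have "- \<tau> * C1 r <= (b r ?z - b r x) \<bullet> e" by (rule mult_left_le_imp_le[OF _ \<tau>])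
    then show "- \<tau> * C1 r <= bb r ?z \<bullet> e - bb r x \<bullet> e" using elim rT by (simp add: inner_diff_left)
   qed
  qed
 qed
 also have "\<dots> = (drift s t ?z - drift s t x) \<bullet> e"
  unfolding inner_diff_left drift_inner_eq(1)
  by (rule Henstock_Kurzweil_Integration.integral_diff[OF drift_inner_eq(2) drift_inner_eq(2)])
 finally show ?thesis .
qed

text \<open>Raising the difference by \<open>q\<close> makes it nonnegative at regular points once
  \<open>q\<close> is at least \<open>\<tau> * A1 s t\<close>. It bounds how far the flow deviates
  from the drift in direction \<open>e\<close>.\<close>

definition overshoot :: "real => real => real => real => real^'n => real^'n => real" where
 "overshoot s t \<tau> q e x = (drift s t (x + \<tau> *\<^sub>R e) - drift s t x) \<bullet> e + q"

lemma A_nonneg: assumes "0 <= s" "t <= T" shows "0 <= A0 s t" "0 <= A1 s t"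
 using integral_C_subinterval(4)[OF C0_int C0_nonneg assms] integral_C_subinterval(4)[OF C1_int C1_nonneg assms] by auto

lemma norm_drift_le':
 assumes "0 <= s" "t <= T" "norm x <= R"
 shows "norm (drift s t x) <= A0 s t * (1 + R)"
 using norm_drift_le[of s t x] A_nonneg[OF assms(1,2)] assms(3) mult_left_mono[of "1 + norm x" "1 + R" "A0 s t"]
 unfolding c0_integral_eq[OF assms(1,2)] by linarith

lemma slack_nonneg:
 assumes "0 <= s" "t <= T" "0 < \<tau>" "0 <= \<kappa>" "0 <= R"
 shows "0 <= slack s t \<tau> \<kappa> R" "\<tau> * A1 s t <= slack s t \<tau> \<kappa> R"
proof -
 have 1: "0 <= \<tau> * A1 s t" "0 <= 2 * (1 + R) * (\<kappa> / \<tau>) * A0 s t"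
  using assms A_nonneg[OF assms(1,2)] by auto
 have "slack s t \<tau> \<kappa> R = 4 * (\<tau> * A1 s t) + 2 * (1 + R) * (\<kappa> / \<tau>) * A0 s t" by (simp add: slack_def)
 then show "0 <= slack s t \<tau> \<kappa> R" "\<tau> * A1 s t <= slack s t \<tau> \<kappa> R" using 1 by linarith+
qed

lemma overshoot_le:
 assumes "0 <= s" "t <= T" "norm e = 1" "0 < \<tau>" "\<tau> <= 1" "norm x + 1 <= R"
 shows "\<bar>overshoot s t \<tau> q e x - q\<bar> <= 2 * (1 + R) * A0 s t"
proof -
 have "norm (x + \<tau> *\<^sub>R e) <= R" using norm_triangle_ineq[of x "\<tau> *\<^sub>R e"] assms by simp
 then have "norm (drift s t (x + \<tau> *\<^sub>R e)) <= A0 s t * (1 + R)" by (rule norm_drift_le'[OF assms(1,2)])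
 moreover have "norm (drift s t x) <= A0 s t * (1 + R)" by (rule norm_drift_le'[OF assms(1,2)]) (use assms in simp)
 moreover have "\<bar>(drift s t (x + \<tau> *\<^sub>R e) - drift s t x) \<bullet> e\<bar> <= norm (drift s t (x + \<tau> *\<^sub>R e)) + norm (drift s t x)"
  using Cauchy_Schwarz_ineq2[of "drift s t (x + \<tau> *\<^sub>R e) - drift s t x" e] norm_triangle_ineq4[of "drift s t (x + \<tau> *\<^sub>R e)" "drift s t x"] assms(3) by simp
 ultimately show ?thesis by (simp add: overshoot_def algebra_simps)
qed

text \<open>Summation by parts: a translation lets the difference act on the 1-Lipschitz cutoff
  \<open>\<psi>\<close>, which gains a factor \<open>\<tau>\<close> over the pointwise bound
  \<open>overshoot_le\<close>. The cutoff and its translate vanish outside the ball of radius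
  \<open>R + 2\<close>, where the drift is at most \<open>(3 + R) * A0 s t\<close>.\<close>

lemma integral_overshoot_le:
 assumes st: "0 <= s" "t <= T" and e: "norm e = 1" and \<tau>: "0 < \<tau>" "\<tau> <= 1" and q: "0 <= q" and R: "0 <= R"
 defines "\<psi> \<equiv> %x::real^'n. max 0 (min 1 (R + 1 - norm x))"
 shows "integrable lborel (%x. \<psi> x * overshoot s t \<tau> q e x)"
  "(\<integral>x. \<psi> x * overshoot s t \<tau> q e x \<partial>lborel) <= (\<tau> * ((3 + R) * A0 s t) + q) * measure lborel (cball (0::real^'n) (R + 2))"
proof -
 let ?S = "%x. drift s t x \<bullet> e" and ?a = "(3 + R) * A0 s t" and ?V = "measure lborel (cball (0::real^'n) (R + 2))"
 have a0: "0 <= ?a" using A_nonneg[OF st] R by simp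
 have \<psi>01: "0 <= \<psi> x" "\<psi> x <= 1" for x by (auto simp: \<psi>_def)
 have \<psi>L: "\<bar>\<psi> x - \<psi> y\<bar> <= norm (x - y)" for x y
  using norm_triangle_ineq3[of x y] by (auto simp: \<psi>_def max_def min_def abs_if split: if_splits)
 have \<psi>0: "\<psi> x = 0" if "norm x \<ge> R + 1" for x using that by (simp add: \<psi>_def)
 have \<psi>m: "\<psi> \<in> borel_measurable borel" unfolding \<psi>_def
  by (intro borel_measurable_continuous_onI continuous_intros)
 have Sm: "?S \<in> borel_measurable borel" using drift_measurable[of s t] by measurable
 have S: "\<bar>?S x\<bar> <= ?a" if "norm x <= R + 2" for x
  using Cauchy_Schwarz_ineq2[of "drift s t x" e] norm_drift_le'[OF st that] e by (simp add: algebra_simps)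
 have shift: "norm x \<ge> R + 1" if "norm (x + - (\<tau> *\<^sub>R e)) > R + 2 \<or> norm x > R + 2" for x
  using that norm_triangle_ineq4[of x "\<tau> *\<^sub>R e"] e \<tau> by auto
 have shift2: "\<psi> (x + - (\<tau> *\<^sub>R e)) = 0" if "norm x > R + 2" for x
 proof (rule \<psi>0)
  have "norm x <= norm (x + - (\<tau> *\<^sub>R e)) + norm (\<tau> *\<^sub>R e)" using norm_triangle_ineq[of "x + - (\<tau> *\<^sub>R e)" "\<tau> *\<^sub>R e"] by simp
  then show "R + 1 <= norm (x + - (\<tau> *\<^sub>R e))" using that e \<tau> by simp
 qed
 define g1 where "g1 x = \<psi> x * ?S x" for x
 define g2 where "g2 x = \<psi> (x + - (\<tau> *\<^sub>R e)) * ?S x" for x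
 have \<psi>s: "(%x. \<psi> (x + - (\<tau> *\<^sub>R e))) \<in> borel_measurable borel"
  using \<psi>m by measurable
 have g1m: "g1 \<in> borel_measurable borel" unfolding g1_def[abs_def] by (rule borel_measurable_times[OF \<psi>m Sm])
 have g2m: "g2 \<in> borel_measurable borel" unfolding g2_def[abs_def] by (rule borel_measurable_times[OF \<psi>s Sm])
 have prod: "\<bar>u * ?S x\<bar> <= c * ?a" if "\<bar>u\<bar> <= c" "norm x > R + 2 ==> u = 0" for u c x
 proof (cases "norm x <= R + 2")
  case True
  then show ?thesis unfolding abs_mult using that(1) by (intro mult_mono S) auto
 next
  case False
  have "0 <= c" using that(1) by linarith
  then show ?thesis using that(2) False a0 by simp
 qed
 have i1: "integrable lborel g1"
  by (rule integrable_bounded_support(1)[OF g1m, of "1 * ?a" "R + 2"])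
    (unfold g1_def, rule prod, use \<psi>01 \<psi>0 in \<open>auto simp: abs_le_iff intro: order_trans\<close>)
 have i2: "integrable lborel g2"
  by (rule integrable_bounded_support(1)[OF g2m, of "1 * ?a" "R + 2"])
    (unfold g2_def, rule prod, use \<psi>01 shift2 in \<open>auto simp: abs_le_iff intro: order_trans\<close>)
 have i3: "integrable lborel \<psi>" "\<bar>\<integral>x. \<psi> x \<partial>lborel\<bar> <= 1 * ?V"
  using integrable_bounded_support[OF \<psi>m, of 1 "R + 2"] \<psi>01 \<psi>0 by auto
 have sh: "(\<integral>x. g2 (x + \<tau> *\<^sub>R e) \<partial>lborel) = (\<integral>x. g2 x \<partial>lborel)" by (rule integral_lborel_shift[OF g2m])
 have i2': "integrable lborel (%x. g2 (x + \<tau> *\<^sub>R e))"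
 proof (rule integrable_bounded_support(1)[of _ "1 * ?a" "R + 1"])
  show "(%x. g2 (x + \<tau> *\<^sub>R e)) \<in> borel_measurable borel" using g2m by measurable
  show "\<bar>g2 (x + \<tau> *\<^sub>R e)\<bar> <= 1 * ?a" for x
   unfolding g2_def by (rule prod) (use \<psi>01 shift2[of "x + \<tau> *\<^sub>R e"] in auto)
  show "g2 (x + \<tau> *\<^sub>R e) = 0" if "norm x > R + 1" for x using that \<psi>0[of x] by (simp add: g2_def)
 qed
 have split: "\<psi> x * overshoot s t \<tau> q e x = (g2 (x + \<tau> *\<^sub>R e) - g1 x) + q * \<psi> x" for x
  by (simp add: overshoot_def g1_def g2_def inner_diff_left algebra_simps)
 show "integrable lborel (%x. \<psi> x * overshoot s t \<tau> q e x)"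
  unfolding split by (intro Bochner_Integration.integrable_add Bochner_Integration.integrable_diff i1 i2' integrable_mult_right i3)
 have "(\<integral>x. \<psi> x * overshoot s t \<tau> q e x \<partial>lborel) = (\<integral>x. g2 x \<partial>lborel) - (\<integral>x. g1 x \<partial>lborel) + q * (\<integral>x. \<psi> x \<partial>lborel)"
  unfolding split Bochner_Integration.integral_add[OF Bochner_Integration.integrable_diff[OF i2' i1] integrable_mult_right[OF i3(1)]]
   Bochner_Integration.integral_diff[OF i2' i1] sh by simp
 also have "(\<integral>x. g2 x \<partial>lborel) - (\<integral>x. g1 x \<partial>lborel) = (\<integral>x. g2 x - g1 x \<partial>lborel)"
  by (rule Bochner_Integration.integral_diff[OF i2 i1, symmetric])
 also have "(\<integral>x. g2 x - g1 x \<partial>lborel) <= \<tau> * ?a * ?V"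
 proof -
  have d: "\<bar>g2 x - g1 x\<bar> <= \<tau> * ?a" for x
  proof -
   have "\<bar>(\<psi> (x + - (\<tau> *\<^sub>R e)) - \<psi> x) * ?S x\<bar> <= \<tau> * ?a"
   proof (rule prod)
    show "\<bar>\<psi> (x + - (\<tau> *\<^sub>R e)) - \<psi> x\<bar> <= \<tau>" using \<psi>L[of "x + - (\<tau> *\<^sub>R e)" x] e \<tau> by simp
    show "\<psi> (x + - (\<tau> *\<^sub>R e)) - \<psi> x = 0" if "norm x > R + 2" using shift2[OF that] \<psi>0[of x] that by simp
   qed
   then show ?thesis by (simp add: g1_def g2_def left_diff_distrib)
  qed
  have z: "g2 x - g1 x = 0" if "norm x > R + 2" for x using shift2[OF that] \<psi>0[of x] that by (simp add: g1_def g2_def)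
  have "\<bar>\<integral>x. g2 x - g1 x \<partial>lborel\<bar> <= \<tau> * ?a * ?V"
   by (rule integrable_bounded_support(2)[OF borel_measurable_diff[OF g2m g1m] d z])
  then show ?thesis by linarith
 qed
 also have "q * (\<integral>x. \<psi> x \<partial>lborel) <= q * ?V" using i3 q by (intro mult_left_mono) auto
 finally show "(\<integral>x. \<psi> x * overshoot s t \<tau> q e x \<partial>lborel) <= (\<tau> * ?a + q) * ?V"
  by (simp add: algebra_simps)
qed

end

section \<open>Mollified functions during one time step\<close>

lemma AE_lborel_shift:
 assumes "AE x in lborel. P x"
 shows "AE x in (lborel :: 'a::euclidean_space measure). P (x + c)"
proof -
 have "(lborel :: 'a measure) = distr lborel borel ((+) c)" by (rule lborel_distr_plus[symmetric])
 then have "AE x in distr lborel borel ((+) c). P x" using assms by metis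
 then have "AE x in (lborel :: 'a measure). P (c + x)" by (rule AE_distrD[rotated]) simp
 then show ?thesis by (simp add: add.commute)
qed

lemma mollifier_measurable: "mollifier \<epsilon> \<in> borel_measurable borel"
 by (intro borel_measurable_continuous_onI C_class_continuous C_class_mollifier)

lemma mollifier_reflected:
 assumes "0 < \<epsilon>"
 shows "integrable lborel (%y::'a::euclidean_space. mollifier \<epsilon> (x - y))" "(\<integral>y. mollifier \<epsilon> (x - y) \<partial>lborel) = 1"
proof -
 have m: "mollifier \<epsilon> (x - y) = mollifier \<epsilon> (y + - x)" for y :: 'a
 proof -
  have "x - y = - (y + - x)" by simp
  then show ?thesis by (simp only: mollifier_def bump_def scaleR_minus_right inner_minus_left inner_minus_right minus_minus)
 qed
 show 2: "(\<integral>y. mollifier \<epsilon> (x - y) \<partial>lborel) = 1"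
  unfolding m integral_lborel_shift[OF mollifier_measurable] by (rule mollifier_integral[OF assms])
 show "integrable lborel (%y::'a. mollifier \<epsilon> (x - y))"
 proof (rule ccontr)
  assume "\<not> integrable lborel (%y::'a. mollifier \<epsilon> (x - y))"
  from not_integrable_integral_eq[OF this] 2 show False by simp
 qed
qed

lemma integrable_mollifier_mult:
 fixes u :: "'a::euclidean_space => real"
 assumes "0 < \<epsilon>" "u \<in> borel_measurable borel" "\<And>y. \<bar>u y\<bar> <= U"
 shows "integrable lborel (%y. mollifier \<epsilon> (x - y) * u y)"
proof (rule Bochner_Integration.integrable_bound[OF integrable_mult_right[OF mollifier_reflected(1)[OF assms(1), of x], of U]])
 have "(%y. mollifier \<epsilon> (x - y)) \<in> borel_measurable borel"
  by (rule measurable_compose[OF _ mollifier_measurable]) simp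
 then show "(%y. mollifier \<epsilon> (x - y) * u y) \<in> borel_measurable lborel" using assms(2) by simp
 show "AE y in lborel. norm (mollifier \<epsilon> (x - y) * u y) <= norm (U * mollifier \<epsilon> (x - y))"
 proof (rule AE_I2)
  fix y
  have "\<bar>u y\<bar> * mollifier \<epsilon> (x - y) <= \<bar>U\<bar> * mollifier \<epsilon> (x - y)"
   using assms(3)[of y] by (intro mult_right_mono mollifier_nonneg assms(1)) auto
  then show "norm (mollifier \<epsilon> (x - y) * u y) <= norm (U * mollifier \<epsilon> (x - y))"
   using mollifier_nonneg[OF assms(1), of "x - y"] by (simp add: abs_mult mult.commute)
 qed
qed

text \<open>The kernel is a probability density supported in the ball of radius
  \<open>\<epsilon>\<close>, so the bound \<open>c\<close> survives averaging.\<close>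

lemma mollify_diff_le:
 fixes u v :: "'a::euclidean_space => real"
 assumes \<epsilon>: "0 < \<epsilon>" and u: "u \<in> borel_measurable borel" "\<And>y. \<bar>u y\<bar> <= U" and v: "v \<in> borel_measurable borel" "\<And>y. \<bar>v y\<bar> <= V"
  and c: "\<And>y. norm (x - y) < \<epsilon> ==> \<bar>u y - v y\<bar> <= c"
 shows "\<bar>mollify \<epsilon> u x - mollify \<epsilon> v x\<bar> <= c"
proof -
 have i: "integrable lborel (%y. mollifier \<epsilon> (x - y) * u y)" "integrable lborel (%y. mollifier \<epsilon> (x - y) * v y)"
  by (rule integrable_mollifier_mult[OF \<epsilon> u], rule integrable_mollifier_mult[OF \<epsilon> v])
 have "mollify \<epsilon> u x - mollify \<epsilon> v x = (\<integral>y. mollifier \<epsilon> (x - y) * u y - mollifier \<epsilon> (x - y) * v y \<partial>lborel)"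
  unfolding mollify_def by (rule Bochner_Integration.integral_diff[OF i, symmetric])
 then have "\<bar>mollify \<epsilon> u x - mollify \<epsilon> v x\<bar> <= (\<integral>y. \<bar>mollifier \<epsilon> (x - y) * u y - mollifier \<epsilon> (x - y) * v y\<bar> \<partial>lborel)"
  by (simp only: integral_abs_bound)
 also have "\<dots> <= (\<integral>y. mollifier \<epsilon> (x - y) * c \<partial>lborel)"
 proof (rule integral_mono)
  show "integrable lborel (%y. \<bar>mollifier \<epsilon> (x - y) * u y - mollifier \<epsilon> (x - y) * v y\<bar>)"
   by (intro integrable_abs Bochner_Integration.integrable_diff i)
  show "integrable lborel (%y. mollifier \<epsilon> (x - y) * c)" by (rule integrable_mult_left[OF mollifier_reflected(1)[OF \<epsilon>]])
  fix y
  show "\<bar>mollifier \<epsilon> (x - y) * u y - mollifier \<epsilon> (x - y) * v y\<bar> <= mollifier \<epsilon> (x - y) * c"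
  proof (cases "norm (x - y) < \<epsilon>")
   case True
   from mult_left_mono[OF c[OF this] mollifier_nonneg[OF \<epsilon>, of "x - y"]] show ?thesis
    using mollifier_nonneg[OF \<epsilon>, of "x - y"] by (simp add: abs_mult flip: right_diff_distrib)
  qed (simp add: mollifier_eq_0 \<epsilon>)
 qed
 also have "\<dots> = c" using mollifier_reflected(2)[OF \<epsilon>, of x] by simp
 finally show ?thesis .
qed

lemma mollify_const: "0 < \<epsilon> ==> mollify \<epsilon> (%_. k) x = k"
 using mollifier_reflected(2)[of \<epsilon> x] by (simp add: mollify_def)

lemma mollify_shift:
 fixes u :: "'a::euclidean_space => real"
 assumes u: "u \<in> borel_measurable borel"
 shows "mollify \<epsilon> u (x - d) = mollify \<epsilon> (%y. u (y - d)) x"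
proof -
 have "(%y. mollifier \<epsilon> (x - d - y)) \<in> borel_measurable borel"
  by (rule measurable_compose[OF _ mollifier_measurable]) simp
 then have m: "(%y. mollifier \<epsilon> (x - d - y) * u y) \<in> borel_measurable borel" using u by simp
 show ?thesis using integral_lborel_shift[OF m, of "- d"] by (simp add: mollify_def)
qed

lemma mollify_eq_0:
 assumes "0 < \<epsilon>" "\<And>y. norm y > R ==> u y = 0" "norm x > R + \<epsilon>"
 shows "mollify \<epsilon> u x = 0"
proof -
 have "mollifier \<epsilon> (x - y) * u y = 0" for y
 proof (cases "norm y > R")
  case False
  then have "\<epsilon> <= norm (x - y)" using norm_triangle_ineq2[of x y] assms(3) by linarith
  then show ?thesis using assms(1) by (simp add: mollifier_eq_0)
 qed (simp add: assms(2))
 then show ?thesis unfolding mollify_def by (simp only: Bochner_Integration.integral_zero)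
qed

text \<open>Telescoping over steps of length at most \<open>d / 2\<close>, by induction on their
  number.\<close>

lemma increment_le_of_local:
 fixes F H :: "real => real"
 assumes d: "0 < d" and loc: "\<And>s t. 0 <= s ==> s <= t ==> t <= T ==> t - s < d ==> \<bar>F t - F s\<bar> <= H t - H s"
  and t: "0 <= t" "t <= T"
 shows "\<bar>F t - F 0\<bar> <= H t - H 0"
proof -
 have "0 <= t ==> t <= T ==> t <= real N * (d / 2) ==> \<bar>F t - F 0\<bar> <= H t - H 0" for N t
 proof (induction N arbitrary: t)
  case 0
  then have "t = 0" by simp
  then show ?case by simp
 next
  case (Suc N)
  define s where "s = max 0 (t - d / 2)"
  have s: "0 <= s" "s <= t" "s <= T" "t - s < d" using Suc.prems d by (auto simp: s_def)
  have "t - d / 2 <= real N * (d / 2)" using Suc.prems(3) by (simp add: algebra_simps)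
  then have "s <= real N * (d / 2)" unfolding s_def using d by (intro max.boundedI) auto
  then have "\<bar>F s - F 0\<bar> <= H s - H 0" by (rule Suc.IH[OF s(1,3)])
  then show ?case using loc[OF s(1,2) Suc.prems(2) s(4)] by linarith
 qed
 moreover obtain N :: nat where "t / (d / 2) <= real N" using real_arch_simple by blast
 moreover have "t <= real N * (d / 2)" using calculation(2) d by (simp add: field_simps)
 ultimately show ?thesis using t by blast
qed

context transport_solution
begin

lemma AE_regular_shifts:
 "AE x in lborel. regular x \<and> (\<forall>i\<in>Basis. regular (x + \<tau> *\<^sub>R i) \<and> regular (x + \<tau> *\<^sub>R (- i)))"
proof -
 have r: "AE x in lborel. regular x" unfolding regular_def by (rule bb_eq)
 have "AE x in lborel. \<forall>i\<in>Basis. regular (x + \<tau> *\<^sub>R i) \<and> regular (x + \<tau> *\<^sub>R (- i))"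
  by (rule AE_finite_allI[OF finite_Basis], rule AE_conjI; rule AE_lborel_shift[OF r])
 with r show ?thesis by (rule AE_conjI)
qed

text \<open>The two opposite shifts bound each coordinate of the deviation from above and from
  below.\<close>

definition total_overshoot :: "real => real => real => real => real^'n => real" where
 "total_overshoot s t \<tau> q x = (\<Sum>i\<in>Basis. overshoot s t \<tau> q i x + overshoot s t \<tau> q (- i) x)"

lemma overshoot_nonneg:
 assumes st: "0 <= s" "s <= t" "t <= T" and e: "norm e = 1" and \<tau>: "0 < \<tau>" and q: "\<tau> * A1 s t <= q"
  and reg: "regular x" "regular (x + \<tau> *\<^sub>R e)"
 shows "0 <= overshoot s t \<tau> q e x"
 using drift_difference_ge[OF st e \<tau> reg] q unfolding overshoot_def by linarith

text \<open>A point \<open>y\<close> within \<open>\<epsilon>\<close> of \<open>x\<close> remains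
  within \<open>\<epsilon> + \<delta>\<close> of \<open>x\<close> along its trajectory, so in each
  coordinate direction and its opposite its displacement exceeds the drift at \<open>x\<close> by at
  most the overshoot. Hence near \<open>x\<close> the function \<open>v\<close> is close to
  \<open>u\<close> shifted by a constant vector, and averaging preserves this.\<close>

lemma mollify_transported_le:
 assumes st: "0 <= s" "s <= t" "t <= T" and \<tau>: "0 < \<tau>" "\<tau> <= 1" and \<epsilon>: "0 < \<epsilon>" "0 <= \<delta>" "\<epsilon> + \<delta> <= \<tau>"
  and disp: "\<And>r y. r \<in> {s..t} ==> norm y <= R + 1 ==> norm (\<phi> r t y - y) <= \<delta>"
  and x: "norm x <= R" "regular x" "\<And>i. i \<in> Basis ==> regular (x + \<tau> *\<^sub>R i)" "\<And>i. i \<in> Basis ==> regular (x + \<tau> *\<^sub>R (- i))"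
  and u: "\<And>x y. \<bar>u x - u y\<bar> <= L * norm (x - y)" "0 <= L" "u \<in> borel_measurable borel" "\<And>y. \<bar>u y\<bar> <= 1"
  and v: "v \<in> borel_measurable borel" "\<And>y. v y = u (\<phi> s t y)"
 shows "\<bar>mollify \<epsilon> v x - mollify \<epsilon> u (x - drift s t x)\<bar> <= L * total_overshoot s t \<tau> (slack s t \<tau> (\<epsilon> + \<delta>) (R + 1)) x"
proof -
 define q where "q = slack s t \<tau> (\<epsilon> + \<delta>) (R + 1)"
 have R0: "0 <= R" using x(1) norm_ge_zero[of x] by linarith
 have q1: "\<tau> * A1 s t <= q" unfolding q_def by (rule slack_nonneg(2)) (use st \<tau> \<epsilon> R0 in auto)
 have um: "(%y. u (y - drift s t x)) \<in> borel_measurable borel"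
  by (rule measurable_compose[OF _ u(3)]) simp
 have "\<bar>mollify \<epsilon> v x - mollify \<epsilon> (%y. u (y - drift s t x)) x\<bar> <= L * total_overshoot s t \<tau> q x"
 proof (rule mollify_diff_le[OF \<epsilon>(1) v(1) _ um u(4)])
  show "\<bar>v y\<bar> <= 1" for y using u(4) v(2) by simp
  fix y assume y: "norm (x - y) < \<epsilon>"
  have ny: "norm y <= R + 1" using norm_triangle_ineq2[of y x] y x(1) \<epsilon> \<tau> by (simp add: norm_minus_commute)
  have near: "norm (x - \<phi> r t y) <= \<epsilon> + \<delta>" if "r \<in> {s..t}" for r
   using norm_triangle_ineq[of "x - y" "y - \<phi> r t y"] y disp[OF that ny] by (simp add: norm_minus_commute)
  define w where "w = y - \<phi> s t y - drift s t x"
  have comp: "w \<bullet> e <= overshoot s t \<tau> q e x" if e: "norm e = 1" "regular (x + \<tau> *\<^sub>R e)" for e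
  proof -
   have "(y - \<phi> s t y) \<bullet> e <= drift s t (x + \<tau> *\<^sub>R e) \<bullet> e + q"
    unfolding q_def by (rule trajectory_component_le[OF st e(1) \<tau> _ _ near _ e(2)]) (use \<epsilon> x(1) in auto)
   then show ?thesis by (simp add: w_def overshoot_def inner_diff_left)
  qed
  have "norm w <= (\<Sum>i\<in>Basis. \<bar>w \<bullet> i\<bar>)" by (rule norm_le_l1)
  also have "\<dots> <= total_overshoot s t \<tau> q x"
   unfolding total_overshoot_def
  proof (rule sum_mono)
   fix i :: "real^'n" assume i: "i \<in> Basis"
   have "0 <= overshoot s t \<tau> q i x" "0 <= overshoot s t \<tau> q (- i) x"
    by (rule overshoot_nonneg[OF st _ \<tau>(1) q1 x(2)], use i x in simp, use i x in blast)+
   moreover have "w \<bullet> i <= overshoot s t \<tau> q i x" "w \<bullet> (- i) <= overshoot s t \<tau> q (- i) x"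
    by (rule comp, use i x in simp, use i x in blast)+
   ultimately show "\<bar>w \<bullet> i\<bar> <= overshoot s t \<tau> q i x + overshoot s t \<tau> q (- i) x"
    by (simp add: abs_le_iff)
  qed
  finally have nw: "norm w <= total_overshoot s t \<tau> q x" .
  have "\<bar>v y - u (y - drift s t x)\<bar> <= L * norm (\<phi> s t y - (y - drift s t x))" unfolding v(2) by (rule u(1))
  also have "norm (\<phi> s t y - (y - drift s t x)) = norm w"
  proof -
   have "\<phi> s t y - (y - drift s t x) = - w" by (simp add: w_def)
   then show ?thesis by (simp only: norm_minus_cancel)
  qed
  also have "L * norm w <= L * total_overshoot s t \<tau> q x" by (rule mult_left_mono[OF nw u(2)])
  finally show "\<bar>v y - u (y - drift s t x)\<bar> <= L * total_overshoot s t \<tau> q x" .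
 qed
 then show ?thesis unfolding mollify_shift[OF u(3)] q_def .
qed

text \<open>There are four errors. The overshoot is paired with \<open>f\<close> split at level
  \<open>M\<close>: the part below \<open>M\<close> profits from the factor \<open>\<tau>\<close> in
  the integral of the overshoot, the part above pays the pointwise bound times
  \<open>\<eta>\<close>. The other two are the Taylor remainder along the drift and the freezing of
  \<open>f\<close> at time \<open>t\<close>.\<close>

lemma step_estimate:
 assumes st: "0 <= s" "s <= t" "t <= T" and \<tau>: "0 < \<tau>" "\<tau> <= 1" and \<epsilon>: "0 < \<epsilon>" "0 <= \<delta>" "\<epsilon> + \<delta> <= \<tau>"
  and R: "1 <= R"
  and disp: "\<And>r y. r \<in> {s..t} ==> norm y <= R + 1 ==> norm (\<phi> r t y - y) <= \<delta>"
  and u: "\<And>x y. \<bar>u x - u y\<bar> <= L * norm (x - y)" "0 <= L" "u \<in> borel_measurable borel" "\<And>y. \<bar>u y\<bar> <= 1"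
   "\<And>x. norm x > R - 1 ==> u x = 0" "integrable lborel u"
  and v: "v \<in> borel_measurable borel" "\<And>y. v y = u (\<phi> s t y)" "\<And>x. norm x > R - 1 ==> v x = 0" "integrable lborel v"
  and E: "0 <= E" "\<And>x h. \<bar>frechet_derivative (mollify \<epsilon> u) (at x) h\<bar> <= E * norm h"
   "\<And>x h. \<bar>mollify \<epsilon> u (x + h) - mollify \<epsilon> u x - frechet_derivative (mollify \<epsilon> u) (at x) h\<bar> <= E * (norm h)\<^sup>2"
  and \<omega>: "\<And>r. r \<in> {s..t} ==> (LINT x:cball 0 R|lborel. \<bar>f r x - f t x\<bar>) <= \<omega>"
  and M: "0 <= M" "(LINT x:cball 0 R|lborel. max 0 (\<bar>f t x\<bar> - M)) <= \<eta>"
  and J: "(LINT x:cball 0 R|lborel. \<bar>f t x\<bar>) <= J"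
  and q: "q = slack s t \<tau> (\<epsilon> + \<delta>) (R + 1)"
 shows "\<bar>(\<integral>x. f t x * mollify \<epsilon> v x \<partial>lborel) - (\<integral>x. f s x * mollify \<epsilon> u x \<partial>lborel)\<bar>
  <= L * (M * (2 * CARD('n) * ((\<tau> * ((3 + R) * A0 s t) + q) * measure lborel (cball (0::real^'n) (R + 2))))
    + 2 * CARD('n) * (2 * (2 + R) * A0 s t + q) * \<eta>)
   + E * (A0 s t * (1 + R))\<^sup>2 * J + E * (1 + R) * \<omega> * A0 s t"
proof -
 let ?B = "cball (0::real^'n) R" and ?D = "%x h. frechet_derivative (mollify \<epsilon> u) (at x) h" and ?d = "drift s t"
 let ?V = "measure lborel (cball (0::real^'n) (R + 2))"
 have mC: "C_class k (mollify \<epsilon> u)" "C_class k (mollify \<epsilon> v)" for k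
 proof -
  have 0: "norm x > \<epsilon> ==> mollifier \<epsilon> x = 0" for x :: "real^'n" by (rule mollifier_eq_0[OF \<epsilon>(1)]) simp
  show "C_class k (mollify \<epsilon> u)" unfolding mollify_def[abs_def]
   by (rule C_class_convolution[where g = "mollifier \<epsilon>" and R = \<epsilon>, OF u(6) C_class_mollifier]) (rule 0)
  show "C_class k (mollify \<epsilon> v)" unfolding mollify_def[abs_def]
   by (rule C_class_convolution[where g = "mollifier \<epsilon>" and R = \<epsilon>, OF v(4) C_class_mollifier]) (rule 0)
 qed
 have e1: "\<epsilon> <= 1" using \<epsilon> \<tau> by linarith
 have u0: "mollify \<epsilon> u x = 0" "mollify \<epsilon> v x = 0" if "norm x > R" for x
  using mollify_eq_0[of \<epsilon> "R - 1" u x] mollify_eq_0[of \<epsilon> "R - 1" v x] \<epsilon>(1) e1 that u(5) v(3) by auto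
 have R0: "0 <= R" using R by simp
 have D0: "?D x h = 0" if "norm x > R" for x h by (rule C_class_derivative_zero_outside[OF u0(1) that])
 have q0: "0 <= q" and q1: "\<tau> * A1 s t <= q"
  unfolding q by (rule slack_nonneg; use st \<tau> \<epsilon> R0 in simp)+
 have A0: "0 <= A0 s t" by (rule A_nonneg(1)[OF st(1,3)])
 define Z where "Z = (\<integral>x. f t x * ?D x (?d x) \<partial>lborel)"
 have inc: "\<bar>(\<integral>x. f t x * mollify \<epsilon> u x \<partial>lborel) - (\<integral>x. f s x * mollify \<epsilon> u x \<partial>lborel) - Z\<bar> <= E * (1 + R) * \<omega> * A0 s t"
  unfolding Z_def c0_integral_eq[OF st(1,3), symmetric]
  by (rule mean_increment_drift[OF mC(1) u0(1) R0 E(2,1) st \<omega>])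
 \<comment> \<open>What the weak equation leaves unexplained: to first order
   \<open>mollify \<epsilon> v\<close> is \<open>mollify \<epsilon> u\<close> moved along the
   drift.\<close>
 define w where "w x = mollify \<epsilon> v x - mollify \<epsilon> u x + ?D x (?d x)" for x
 have Dm: "(%x. ?D x (?d x)) \<in> borel_measurable borel"
 proof -
  have "(%x. ?D x i) \<in> borel_measurable borel" for i
   using mC(1)[of "Suc 0"] by (intro borel_measurable_continuous_onI) simp
  moreover have "linear (?D x)" for x
   using C_class_has_derivative[OF mC(1)[of "Suc 0"]] has_derivative_linear by blast
  ultimately show ?thesis
   using drift_measurable[of s t] by (subst linear_eq_sum_Basis) (auto intro!: borel_measurable_sum borel_measurable_times)
 qed
 have mm: "mollify \<epsilon> u \<in> borel_measurable borel" "mollify \<epsilon> v \<in> borel_measurable borel"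
  by (intro borel_measurable_continuous_onI C_class_continuous mC)+
 have nd: "norm (?d x) <= A0 s t * (1 + R)" if "norm x <= R" for x by (rule norm_drift_le'[OF st(1,3) that])
 have Db: "\<bar>?D x (?d x)\<bar> <= E * (A0 s t * (1 + R))" for x
 proof (cases "norm x <= R")
  case True
  show ?thesis by (rule order_trans[OF E(2) mult_left_mono[OF nd[OF True] E(1)]])
 next
  case False
  then show ?thesis using D0[of x] E A0 R0 by simp
 qed
 have fB: "set_integrable lborel ?B (f t)" by (rule f_int) simp
 have mb: "\<bar>mollify \<epsilon> u x\<bar> <= 1" "\<bar>mollify \<epsilon> v x\<bar> <= 1" for x
 proof -
  have v1: "\<bar>v y\<bar> <= 1" for y using u(4) v(2) by simp
  have z: "mollify \<epsilon> (%_. 0) x = 0" by (rule mollify_const[OF \<epsilon>(1)])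
  show "\<bar>mollify \<epsilon> u x\<bar> <= 1" using mollify_diff_le[OF \<epsilon>(1) u(3,4), of "%_. 0" 0 x 1] u(4) by (simp add: z)
  show "\<bar>mollify \<epsilon> v x\<bar> <= 1" using mollify_diff_le[OF \<epsilon>(1) v(1) v1, of "%_. 0" 0 x 1] v1 by (simp add: z)
 qed
 have nB: "norm x > R" if "x \<notin> ?B" for x :: "real^'n" using that by simp
 have i_u: "integrable lborel (%x. f t x * mollify \<epsilon> u x)"
  by (rule integrable_mult_bounded(1)[OF fB mm(1) mb(1)]) (rule u0(1), erule nB)
 have i_v: "integrable lborel (%x. f t x * mollify \<epsilon> v x)"
  by (rule integrable_mult_bounded(1)[OF fB mm(2) mb(2)]) (rule u0(2), erule nB)
 have i_D: "integrable lborel (%x. f t x * ?D x (?d x))"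
  by (rule integrable_mult_bounded(1)[OF fB Dm Db]) (rule D0, erule nB)
 have i_w: "integrable lborel (%x. f t x * w x)" and w_eq: "(\<integral>x. f t x * w x \<partial>lborel) =
   (\<integral>x. f t x * mollify \<epsilon> v x \<partial>lborel) - (\<integral>x. f t x * mollify \<epsilon> u x \<partial>lborel) + Z"
 proof -
  have e: "f t x * w x = f t x * mollify \<epsilon> v x - f t x * mollify \<epsilon> u x + f t x * ?D x (?d x)" for x
   by (simp add: w_def algebra_simps)
  show "integrable lborel (%x. f t x * w x)" unfolding e
   by (rule Bochner_Integration.integrable_add[OF Bochner_Integration.integrable_diff[OF i_v i_u] i_D])
  show "(\<integral>x. f t x * w x \<partial>lborel) = (\<integral>x. f t x * mollify \<epsilon> v x \<partial>lborel) - (\<integral>x. f t x * mollify \<epsilon> u x \<partial>lborel) + Z"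
   unfolding e Z_def Bochner_Integration.integral_add[OF Bochner_Integration.integrable_diff[OF i_v i_u] i_D]
    Bochner_Integration.integral_diff[OF i_v i_u] ..
 qed
 define \<psi> where "\<psi> = (%x::real^'n. max 0 (min 1 (R + 1 - norm x)))"
 define G where "G = total_overshoot s t \<tau> q"
 \<comment> \<open>\<open>c1\<close> bounds the total overshoot pointwise on the ball of radius
   \<open>R\<close>, \<open>c2\<close> the Taylor remainder there.\<close>
 define c1 where "c1 = CARD('n) * (2 * (2 * (2 + R) * A0 s t + q))"
 define c2 where "c2 = E * (A0 s t * (1 + R))\<^sup>2"
 have c2: "0 <= c2" using E by (simp add: c2_def)
 have ov: "integrable lborel (%x. \<psi> x * overshoot s t \<tau> q e x)"
  "(\<integral>x. \<psi> x * overshoot s t \<tau> q e x \<partial>lborel) <= (\<tau> * ((3 + R) * A0 s t) + q) * ?V" if "norm e = 1" for e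
  using integral_overshoot_le[OF st(1,3) that \<tau> q0 R0] unfolding \<psi>_def by auto
 have \<psi>G: "\<psi> x * G x = (\<Sum>i\<in>Basis. \<psi> x * overshoot s t \<tau> q i x + \<psi> x * overshoot s t \<tau> q (- i) x)" for x
  by (simp add: G_def total_overshoot_def sum_distrib_left distrib_left)
 have iG: "integrable lborel (%x. \<psi> x * G x)"
  unfolding \<psi>G by (intro Bochner_Integration.integrable_sum Bochner_Integration.integrable_add ov(1)) auto
 have IG: "(\<integral>x. \<psi> x * G x \<partial>lborel) <= CARD('n) * (2 * ((\<tau> * ((3 + R) * A0 s t) + q) * ?V))"
 proof -
  have "(\<integral>x. \<psi> x * G x \<partial>lborel) = (\<Sum>i\<in>Basis. \<integral>x. \<psi> x * overshoot s t \<tau> q i x + \<psi> x * overshoot s t \<tau> q (- i) x \<partial>lborel)"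
   unfolding \<psi>G by (intro Bochner_Integration.integral_sum Bochner_Integration.integrable_add ov(1)) auto
  also have "\<dots> <= (\<Sum>i\<in>(Basis :: (real^'n) set). 2 * ((\<tau> * ((3 + R) * A0 s t) + q) * ?V))"
  proof (rule sum_mono)
   fix i :: "real^'n" assume i: "i \<in> Basis"
   have n: "norm i = 1" "norm (- i) = 1" using i by auto
   show "(\<integral>x. \<psi> x * overshoot s t \<tau> q i x + \<psi> x * overshoot s t \<tau> q (- i) x \<partial>lborel) <= 2 * ((\<tau> * ((3 + R) * A0 s t) + q) * ?V)"
    unfolding Bochner_Integration.integral_add[OF ov(1)[OF n(1)] ov(1)[OF n(2)]] using ov(2)[OF n(1)] ov(2)[OF n(2)] by linarith
  qed
  also have "\<dots> = CARD('n) * (2 * ((\<tau> * ((3 + R) * A0 s t) + q) * ?V))" by simp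
  finally show ?thesis .
 qed
 define ex where "ex x = indicator ?B x *\<^sub>R max 0 (\<bar>f t x\<bar> - M)" for x
 define fb where "fb x = indicator ?B x *\<^sub>R \<bar>f t x\<bar>" for x
 have i_fb: "integrable lborel fb" using set_integrable_abs[OF fB] unfolding fb_def[abs_def] set_integrable_def .
 have i_ex: "integrable lborel ex"
 proof (rule Bochner_Integration.integrable_bound[OF i_fb])
  have fm: "f t \<in> borel_measurable lborel" using f_borel[of t] by simp
  show "ex \<in> borel_measurable lborel" unfolding ex_def[abs_def]
   by (intro borel_measurable_scaleR borel_measurable_indicator borel_measurable_max borel_measurable_diff borel_measurable_abs borel_measurable_const fm) auto
  show "AE x in lborel. norm (ex x) <= norm (fb x)" using M(1) by (intro AE_I2) (auto simp: ex_def fb_def indicator_def)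
 qed
 define h where "h x = L * (M * (\<psi> x * G x) + c1 * ex x) + c2 * fb x" for x
 have i_h: "integrable lborel h" unfolding h_def[abs_def]
  by (intro Bochner_Integration.integrable_add integrable_mult_right iG i_ex i_fb)
 have point: "\<bar>f t x * w x\<bar> <= h x" if reg: "regular x \<and> (\<forall>i\<in>Basis. regular (x + \<tau> *\<^sub>R i) \<and> regular (x + \<tau> *\<^sub>R (- i)))" for x
 proof -
  have ovn: "0 <= overshoot s t \<tau> q i x \<and> 0 <= overshoot s t \<tau> q (- i) x" if i: "i \<in> Basis" for i
   by (rule conjI; rule overshoot_nonneg[OF st _ \<tau>(1) q1]; use reg i in simp)
  have G0: "0 <= G x" unfolding G_def total_overshoot_def by (rule sum_nonneg) (use ovn in force)
  have \<psi>n: "0 <= \<psi> x" by (simp add: \<psi>_def)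
  show ?thesis
  proof (cases "norm x <= R")
   case True
   have ind: "ex x = max 0 (\<bar>f t x\<bar> - M)" "fb x = \<bar>f t x\<bar>" "\<psi> x = 1" using True by (auto simp: ex_def fb_def \<psi>_def)
   have "G x <= (\<Sum>i\<in>(Basis :: (real^'n) set). 2 * (2 * (2 + R) * A0 s t + q))" unfolding G_def total_overshoot_def
   proof (rule sum_mono)
    fix i :: "real^'n" assume i: "i \<in> Basis"
    have n: "norm i = 1" "norm (- i) = 1" using i by auto
    have x1: "norm x + 1 <= R + 1" using True by simp
    show "overshoot s t \<tau> q i x + overshoot s t \<tau> q (- i) x <= 2 * (2 * (2 + R) * A0 s t + q)"
     using overshoot_le[OF st(1,3) n(1) \<tau> x1, of q] overshoot_le[OF st(1,3) n(2) \<tau> x1, of q] by (simp add: abs_le_iff algebra_simps)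
   qed
   then have Gc: "G x <= c1" by (simp add: c1_def)
   have "\<bar>mollify \<epsilon> v x - mollify \<epsilon> u (x - ?d x)\<bar> <= L * G x"
    unfolding G_def q by (rule mollify_transported_le[OF st \<tau> \<epsilon> disp True _ _ _ u(1-4) v(1,2)]) (use reg in auto)
   moreover have "\<bar>mollify \<epsilon> u (x - ?d x) - mollify \<epsilon> u x + ?D x (?d x)\<bar> <= c2"
   proof -
    have lin: "linear (?D x)" using C_class_has_derivative[OF mC(1)[of "Suc 0"]] has_derivative_linear by blast
    have "\<bar>mollify \<epsilon> u (x + - ?d x) - mollify \<epsilon> u x - ?D x (- ?d x)\<bar> <= E * (norm (- ?d x))\<^sup>2" by (rule E(3))
    also have "\<dots> <= c2" unfolding c2_def norm_minus_cancel by (intro mult_left_mono power_mono nd True E(1)) simp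
    finally show ?thesis by (simp add: linear_neg[OF lin])
   qed
   ultimately have wb: "\<bar>w x\<bar> <= L * G x + c2" unfolding w_def by linarith
   have "\<bar>f t x * w x\<bar> <= \<bar>f t x\<bar> * (L * G x + c2)" unfolding abs_mult by (rule mult_left_mono[OF wb]) simp
   also have "\<dots> = L * (\<bar>f t x\<bar> * G x) + c2 * \<bar>f t x\<bar>" by (simp add: algebra_simps)
   also have "L * (\<bar>f t x\<bar> * G x) <= L * (M * G x + c1 * max 0 (\<bar>f t x\<bar> - M))"
   proof (rule mult_left_mono[OF _ u(2)])
    have "\<bar>f t x\<bar> * G x <= (M + max 0 (\<bar>f t x\<bar> - M)) * G x" by (rule mult_right_mono[OF _ G0]) simp
    also have "\<dots> <= M * G x + max 0 (\<bar>f t x\<bar> - M) * c1"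
     unfolding distrib_right by (intro add_left_mono mult_left_mono Gc) simp
    finally show "\<bar>f t x\<bar> * G x <= M * G x + c1 * max 0 (\<bar>f t x\<bar> - M)" by (simp add: mult.commute)
   qed
   finally show ?thesis by (simp add: h_def ind)
  next
   case False
   then have "w x = 0" "ex x = 0" "fb x = 0" using u0[of x] D0[of x] by (auto simp: w_def ex_def fb_def)
   then show ?thesis using G0 \<psi>n u(2) M(1) by (simp add: h_def)
  qed
 qed
 have "\<bar>\<integral>x. f t x * w x \<partial>lborel\<bar> <= (\<integral>x. h x \<partial>lborel)"
 proof (rule order_trans[OF integral_abs_bound], rule integral_mono_AE[OF integrable_abs[OF i_w] i_h])
  show "AE x in lborel. \<bar>f t x * w x\<bar> <= h x" by (rule eventually_mono[OF AE_regular_shifts[of \<tau>]]) (rule point)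
 qed
 also have "(\<integral>x. h x \<partial>lborel) = L * (M * (\<integral>x. \<psi> x * G x \<partial>lborel) + c1 * (\<integral>x. ex x \<partial>lborel)) + c2 * (\<integral>x. fb x \<partial>lborel)"
  unfolding h_def using iG i_ex i_fb by simp
 also have "\<dots> <= L * (M * (CARD('n) * (2 * ((\<tau> * ((3 + R) * A0 s t) + q) * ?V))) + c1 * \<eta>) + c2 * J"
 proof (intro add_mono mult_left_mono IG u(2) M(1) c2)
  show "0 <= c1" using R0 A0 q0 by (simp add: c1_def)
  show "(\<integral>x. ex x \<partial>lborel) <= \<eta>" using M(2) by (simp add: ex_def set_lebesgue_integral_def)
  show "(\<integral>x. fb x \<partial>lborel) <= J" using J by (simp add: fb_def set_lebesgue_integral_def)
 qed
 finally have "\<bar>\<integral>x. f t x * w x \<partial>lborel\<bar> <= L * (M * (CARD('n) * (2 * ((\<tau> * ((3 + R) * A0 s t) + q) * ?V))) + c1 * \<eta>) + c2 * J" .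
 moreover have "(\<integral>x. f t x * mollify \<epsilon> v x \<partial>lborel) - (\<integral>x. f s x * mollify \<epsilon> u x \<partial>lborel)
   = (\<integral>x. f t x * w x \<partial>lborel) + ((\<integral>x. f t x * mollify \<epsilon> u x \<partial>lborel) - (\<integral>x. f s x * mollify \<epsilon> u x \<partial>lborel) - Z)"
  unfolding w_eq by simp
 ultimately show ?thesis using inc unfolding c1_def c2_def by (simp add: mult_ac)
qed

end

section \<open>Summation over the time steps\<close>

definition second_order_bound :: "real => ('a::euclidean_space => real) => bool" where
 "second_order_bound E w \<longleftrightarrow> (\<forall>x h. \<bar>frechet_derivative w (at x) h\<bar> <= E * norm h \<and>
   \<bar>w (x + h) - w x - frechet_derivative w (at x) h\<bar> <= E * (norm h)\<^sup>2)"

lemma second_order_boundD: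
 assumes "second_order_bound E w" "E <= E'"
 shows "\<bar>frechet_derivative w (at x) h\<bar> <= E' * norm h"
  "\<bar>w (x + h) - w x - frechet_derivative w (at x) h\<bar> <= E' * (norm h)\<^sup>2"
proof -
 have "\<bar>frechet_derivative w (at x) h\<bar> <= E * norm h" "\<bar>w (x + h) - w x - frechet_derivative w (at x) h\<bar> <= E * (norm h)\<^sup>2"
  using assms(1) unfolding second_order_bound_def by auto
 moreover have "E * norm h <= E' * norm h" "E * (norm h)\<^sup>2 <= E' * (norm h)\<^sup>2"
  by (rule mult_right_mono[OF assms(2)], simp)+
 ultimately show "\<bar>frechet_derivative w (at x) h\<bar> <= E' * norm h"
  "\<bar>w (x + h) - w x - frechet_derivative w (at x) h\<bar> <= E' * (norm h)\<^sup>2" by linarith+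
qed

text \<open>\<open>B\<close> depends on \<open>\<epsilon>\<close> but not on \<open>u\<close>, so
  functions with bounded L^1 norm share one second order bound.\<close>

lemma mollify_second_order_bound:
 assumes \<epsilon>: "0 < \<epsilon>"
 shows "\<exists>B\<ge>0. \<forall>u :: 'a::euclidean_space => real. integrable lborel u --> second_order_bound (B * (\<integral>y. \<bar>u y\<bar> \<partial>lborel)) (mollify \<epsilon> u)"
proof -
 let ?g = "mollifier \<epsilon> :: 'a => real"
 have z: "norm x > \<epsilon> ==> ?g x = 0" for x by (rule mollifier_eq_0[OF \<epsilon>]) simp
 define D where "D u x v = (\<integral>y. frechet_derivative ?g (at (x - y)) v * u y \<partial>lborel)" for u x v
 define Q where "Q B u \<longleftrightarrow> (\<forall>x. ((%x. \<integral>y. ?g (x - y) * u y \<partial>lborel) has_derivative (%v. D u x v)) (at x)) \<and>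
   (\<forall>x h. \<bar>(\<integral>y. ?g (x + h - y) * u y \<partial>lborel) - (\<integral>y. ?g (x - y) * u y \<partial>lborel)
    - D u x h\<bar> <= B * (\<integral>y. \<bar>u y\<bar> \<partial>lborel) * (norm h)\<^sup>2) \<and>
   (\<forall>x v. \<bar>D u x v\<bar> <= B * (\<integral>y. \<bar>u y\<bar> \<partial>lborel) * norm v)" for B u
 have "\<exists>B\<ge>0. \<forall>u. integrable lborel u --> Q B u"
  unfolding Q_def D_def by (rule convolution_derivative[where g = ?g and R = \<epsilon>]) (rule C_class_mollifier, erule z)
 then obtain B where B: "B \<ge> 0" "\<And>u. integrable lborel u ==> Q B u" by blast
 have "second_order_bound (B * (\<integral>y. \<bar>u y\<bar> \<partial>lborel)) (mollify \<epsilon> u)"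
  if u: "integrable lborel u" for u :: "'a => real"
 proof -
  have "(mollify \<epsilon> u has_derivative (%v. D u x v)) (at x)" for x
   using B(2)[OF u] unfolding Q_def mollify_def[abs_def] by blast
  then have d: "frechet_derivative (mollify \<epsilon> u) (at x) = (%v. D u x v)" for x
   by (rule frechet_derivative_at[symmetric])
  show ?thesis using B(2)[OF u] unfolding second_order_bound_def d Q_def mollify_def by auto
 qed
 then show ?thesis using B(1) by blast
qed

context transport_solution
begin

text \<open>The parameters are fixed in the order \<open>\<eta>\<close>, \<open>M\<close>,
  \<open>\<tau>\<close>, \<open>\<epsilon>\<close>, \<open>E\<close>, then \<open>\<omega>\<close>
  and \<open>\<alpha>\<close>, and finally the step length; each may depend on its predecessors.
  There is no control of \<open>E\<close> as \<open>\<epsilon>\<close> shrinks, so the terms with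
  \<open>E\<close> are left to \<open>\<omega>\<close> and \<open>\<alpha>\<close>, that is, to
  shorter time steps.\<close>

lemma pushforward_lipschitz:
 assumes g: "\<And>x y. \<bar>g x - g y\<bar> <= Lg * norm (x - y)" "0 <= Lg" "\<And>x. 0 <= g x" "\<And>x. g x <= 1"
   "\<And>x. g x ~= 0 ==> norm x <= Rg"
  and T': "0 <= T'" "T' <= T"
 shows "(\<integral>x. f T' x * g (\<phi> 0 T' x) \<partial>lborel) = (\<integral>x. f 0 x * g x \<partial>lborel)"
proof -
 \<comment> \<open>By the second growth bound every \<open>u r\<close> vanishes outside the ball of
   radius \<open>R1\<close>; the larger \<open>R\<close> leaves room for mollification.\<close>
 define R1 where "R1 = KR * (1 + Rg\<^sup>2)"
 define R where "R = R1 + 1"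
 define Lu where "Lu = Lg * KL"
 define u where "u r x = g (\<phi> 0 r x)" for r x
 have R1: "0 <= R1" using KR_ge_1 by (simp add: R1_def)
 then have R: "1 <= R" by (simp add: R_def)
 have Lu: "0 <= Lu" using g(2) KL_ge_1 by (simp add: Lu_def)
 have uL: "\<bar>u r x - u r y\<bar> <= Lu * norm (x - y)" if "0 <= r" "r <= T" for r x y
 proof -
  have "\<bar>u r x - u r y\<bar> <= Lg * norm (\<phi> 0 r x - \<phi> 0 r y)" unfolding u_def by (rule g(1))
  also have "\<dots> <= Lg * (KL * norm (x - y))" using that by (intro mult_left_mono g(2) flow_lipschitz) auto
  finally show ?thesis by (simp add: Lu_def)
 qed
 have ub: "\<bar>u r x\<bar> <= 1" for r x using g(3)[of "\<phi> 0 r x"] g(4)[of "\<phi> 0 r x"] by (simp add: u_def)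
 have u0: "u r x = 0" if "0 <= r" "r <= T" "norm x > R1" for r x
 proof (rule ccontr)
  assume "u r x ~= 0"
  then have n: "norm (\<phi> 0 r x) <= Rg" unfolding u_def by (rule g(5))
  have "norm x <= 1 + (norm x)\<^sup>2" by (rule norm_le_1_plus_power2)
  also have "\<dots> <= KR * (1 + (norm (\<phi> 0 r x))\<^sup>2)" by (rule flow_growth(2)) (use that in auto)
  also have "\<dots> <= R1" unfolding R1_def using KR_ge_1 n by (intro mult_left_mono add_left_mono power_mono) auto
  finally show False using that by simp
 qed
 have um: "u r \<in> borel_measurable borel" if "0 <= r" "r <= T" for r
 proof -
  have "Lu-lipschitz_on UNIV (u r)" by (rule lipschitz_onI) (use uL[OF that] Lu in \<open>auto simp: dist_norm\<close>)
  then show ?thesis by (intro borel_measurable_continuous_onI lipschitz_on_continuous_on)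
 qed
 define V1 where "V1 = measure lborel (cball (0::real^'n) R1)"
 have ui: "integrable lborel (u r)" "(\<integral>y. \<bar>u r y\<bar> \<partial>lborel) <= V1" if "0 <= r" "r <= T" for r
 proof -
  show "integrable lborel (u r)" by (rule integrable_bounded_support(1)[OF um[OF that] ub u0[OF that]])
  have m: "(%y. \<bar>u r y\<bar>) \<in> borel_measurable borel" using um[OF that] by simp
  have "\<bar>\<integral>y. \<bar>u r y\<bar> \<partial>lborel\<bar> <= 1 * V1"
   unfolding V1_def by (rule integrable_bounded_support(2)[OF m]) (use ub u0[OF that] in auto)
  then show "(\<integral>y. \<bar>u r y\<bar> \<partial>lborel) <= V1" by simp
 qed
 have V1: "0 <= V1" by (simp add: V1_def)
 obtain J where J: "J \<ge> 0" "\<And>t. (LINT x:cball 0 R|lborel. \<bar>f t x\<bar>) <= J"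
  using f_bounded_L1[OF compact_cball[of "0::real^'n" R]] by blast
 define V where "V = measure lborel (cball (0::real^'n) (R + 2))"
 have V: "0 <= V" by (simp add: V_def)
 define n where "n = real CARD('n)"
 have n: "0 <= n" by (simp add: n_def)
 \<comment> \<open>The constant of \<open>flow_displacement\<close> on the ball of radius
   \<open>R + 1\<close>; the 1 makes it positive.\<close>
 define Kd where "Kd = n * (2 * KR * (1 + (R + 1)\<^sup>2)) + 1"
 have Kd: "0 < Kd" using n KR_ge_1 by (simp add: Kd_def add_nonneg_pos)
 have disp: "norm (\<phi> r t y - y) <= Kd * A0 s t" if "0 <= s" "s <= r" "r <= t" "t <= T" "norm y <= R + 1" for s r t y
 proof -
  have a: "0 <= A0 r t" by (rule A_nonneg) (use that in auto)
  have "norm (\<phi> r t y - y) <= CARD('n) * ((2 * KR * (1 + (norm y)\<^sup>2)) * A0 r t)" by (rule flow_displacement) (use that in auto)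
  also have "\<dots> <= CARD('n) * ((2 * KR * (1 + (R + 1)\<^sup>2)) * A0 r t)"
   using KR_ge_1 that(5) a by (intro mult_left_mono mult_right_mono add_left_mono power_mono) auto
  also have "\<dots> = (Kd - 1) * A0 r t" by (simp add: Kd_def n_def)
  also have "\<dots> <= Kd * A0 r t" using a by (intro mult_right_mono) auto
  also have "A0 r t <= A0 s t"
  proof (rule integral_subset_le)
   show "{r..t} \<subseteq> {s..t}" using that by auto
   show "C0 integrable_on {r..t}" "C0 integrable_on {s..t}"
    by (rule integral_C_subinterval(3)[OF C0_int C0_nonneg]; use that in simp)+
   show "\<forall>x\<in>{s..t}. 0 <= C0 x" using that by (intro ballI C0_nonneg) auto
  qed
  finally show ?thesis using Kd by (simp add: mult_left_mono)
 qed
 define a where "a = A0 0 T + A1 0 T"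
 have main: "\<bar>(\<integral>x. f T' x * u T' x \<partial>lborel) - (\<integral>x. f 0 x * u 0 x \<partial>lborel)\<bar> <= e * (4 * a + 1)" if e: "0 < e" for e
 proof -
  define c1 where "c1 = Lu * (2 * n * (5 * (3 + R) * V))"
  define c2 where "c2 = Lu * (2 * n * (6 * (2 + R)))"
  have c12: "0 <= c1" "0 <= c2" using Lu n R V by (auto simp: c1_def c2_def)
  \<comment> \<open>Makes the part of \<open>f\<close> above level \<open>M\<close> contribute at
    most \<open>e\<close> times the mass of \<open>C0 + C1\<close>.\<close>
  define \<eta> where "\<eta> = e / (c2 + 1)"
  have \<eta>: "0 < \<eta>" "c2 * \<eta> <= e" using e c12 by (auto simp: \<eta>_def field_simps)
  obtain M where M: "0 <= M" "\<And>t. (LINT x:cball 0 R|lborel. max 0 (\<bar>f t x\<bar> - M)) <= \<eta>"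
   using f_unif_int[OF compact_cball[of "0::real^'n" R] \<eta>(1)] by blast
  define cc where "cc = c1 * M + 2 * (Lu * J) + 1"
  have cc: "1 <= cc" "0 <= c1 * M" "0 <= Lu * J" using c12 M(1) Lu J(1) by (auto simp: cc_def)
  \<comment> \<open>The bound 1/2 gives \<open>2 * \<tau>\<^sup>2 <= \<tau>\<close>;
    \<open>cc\<close> collects the overshoot below level \<open>M\<close> and the final
    mollification error.\<close>
  define \<tau> where "\<tau> = min (1 / 2) (e / cc)"
  have "0 < e / cc" using e cc(1) by simp
  then have \<tau>1: "0 < \<tau>" "\<tau> <= 1 / 2" "\<tau> <= e / cc" unfolding \<tau>_def by (simp_all only: min_less_iff_conj min.cobounded1 min.cobounded2) simp
  then have \<tau>: "0 < \<tau>" "\<tau> <= 1" "\<tau> <= 1 / 2" by linarith+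
  have "\<tau> * cc <= e" using \<tau>1(3) cc(1) by (simp add: field_simps)
  then have "c1 * M * \<tau> + 2 * (Lu * J) * \<tau> + \<tau> <= e" by (simp add: cc_def algebra_simps)
  moreover have "0 <= c1 * M * \<tau>" "0 <= 2 * (Lu * J) * \<tau>"
   using mult_nonneg_nonneg[OF cc(2) less_imp_le[OF \<tau>(1)]] mult_nonneg_nonneg[OF cc(3) less_imp_le[OF \<tau>(1)]] by linarith+
  ultimately have c1\<tau>: "c1 * M * \<tau> <= e" and J\<tau>: "2 * (Lu * J) * \<tau> <= e" using \<tau>(1) by linarith+
  \<comment> \<open>With radius and displacement both at most \<open>\<tau>\<^sup>2\<close>, the
    ratio \<open>\<kappa> / \<tau>\<close> in \<open>slack\<close> becomes
    \<open>2 * \<tau>\<close>.\<close>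
  define \<epsilon> where "\<epsilon> = \<tau>\<^sup>2"
  have \<epsilon>: "0 < \<epsilon>" "0 <= \<epsilon>" "\<epsilon> <= \<tau>" "\<epsilon> + \<epsilon> <= \<tau>"
  proof -
   have "\<tau> * \<tau> <= (1 / 2) * \<tau>" using \<tau> by (intro mult_right_mono) auto
   then show "\<epsilon> + \<epsilon> <= \<tau>" by (simp add: \<epsilon>_def power2_eq_square)
   then show "\<epsilon> <= \<tau>" using zero_le_power2[of \<tau>] unfolding \<epsilon>_def by linarith
  qed (use \<tau> in \<open>auto simp: \<epsilon>_def\<close>)
  obtain B where B: "B \<ge> 0" "\<And>u :: real^'n => real. integrable lborel u ==> second_order_bound (B * (\<integral>y. \<bar>u y\<bar> \<partial>lborel)) (mollify \<epsilon> u)"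
   using mollify_second_order_bound[OF \<epsilon>(1), where 'a = "real^'n"] by auto
  define E where "E = B * V1"
  have E: "0 <= E" using B(1) V1 by (simp add: E_def)
  have E2: "\<bar>frechet_derivative (mollify \<epsilon> (u r)) (at x) h\<bar> <= E * norm h"
   and E3: "\<bar>mollify \<epsilon> (u r) (x + h) - mollify \<epsilon> (u r) x - frechet_derivative (mollify \<epsilon> (u r)) (at x) h\<bar> <= E * (norm h)\<^sup>2"
   if "0 <= r" "r <= T" for r x h
  proof -
   have le: "B * (\<integral>y. \<bar>u r y\<bar> \<partial>lborel) <= E" unfolding E_def by (rule mult_left_mono[OF ui(2)[OF that] B(1)])
   show "\<bar>frechet_derivative (mollify \<epsilon> (u r)) (at x) h\<bar> <= E * norm h"
    by (rule second_order_boundD(1)[OF B(2)[OF ui(1)[OF that]] le])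
   show "\<bar>mollify \<epsilon> (u r) (x + h) - mollify \<epsilon> (u r) x - frechet_derivative (mollify \<epsilon> (u r)) (at x) h\<bar> <= E * (norm h)\<^sup>2"
    by (rule second_order_boundD(2)[OF B(2)[OF ui(1)[OF that]] le])
  qed
  define c3 where "c3 = E * (1 + R)\<^sup>2 * J"
  define c4 where "c4 = E * (1 + R)"
  have c34: "0 <= c3" "0 <= c4" using E R J(1) by (auto simp: c3_def c4_def)
  define \<omega> where "\<omega> = e / (c4 + 1)"
  have \<omega>: "0 < \<omega>" "c4 * \<omega> <= e" using e c34 by (auto simp: \<omega>_def field_simps)
  \<comment> \<open>A bound on the mass of \<open>C0\<close> per step: the first entry absorbs the
    quadratic Taylor term, the second keeps the displacement below
    \<open>\<epsilon>\<close>.\<close>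
  define \<alpha> where "\<alpha> = min (e / (c3 + 1)) (\<epsilon> / Kd)"
  have \<alpha>: "0 < \<alpha>" using e c34 \<epsilon> Kd by (simp add: \<alpha>_def)
  have \<alpha>2: "Kd * \<alpha> <= \<epsilon>"
  proof -
   have "\<alpha> <= \<epsilon> / Kd" by (simp add: \<alpha>_def)
   then show ?thesis using Kd by (simp add: field_simps)
  qed
  have \<alpha>3: "c3 * \<alpha> <= e"
  proof -
   have "\<alpha> <= e / (c3 + 1)" by (simp add: \<alpha>_def)
   then have "\<alpha> * (c3 + 1) <= e" using c34 by (simp add: field_simps)
   then show ?thesis using \<alpha> by (simp add: algebra_simps)
  qed
  obtain d1 where d1: "d1 > 0" "\<And>s t. \<bar>s - t\<bar> < d1 ==> (LINT x:cball 0 R|lborel. \<bar>f s x - f t x\<bar>) <= \<omega>"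
   using f_cont[OF compact_cball[of "0::real^'n" R] \<omega>(1)] by blast
  have iC: "C0 integrable_on {0..T}" "C1 integrable_on {0..T}"
   by (rule set_lebesgue_integral_eq_integral(1)[OF C0_int], rule set_lebesgue_integral_eq_integral(1)[OF C1_int])
  have "uniformly_continuous_on {0..T} (%r. A0 0 r)"
   by (rule compact_uniformly_continuous[OF indefinite_integral_continuous_1[OF iC(1)] compact_Icc])
  then obtain d2 where d2: "d2 > 0" "\<And>s t. s \<in> {0..T} ==> t \<in> {0..T} ==> dist t s < d2 ==> dist (A0 0 t) (A0 0 s) < \<alpha>"
   unfolding uniformly_continuous_on_def using \<alpha> by meson
  have comb: "A0 0 t - A0 0 s = A0 s t" "A1 0 t - A1 0 s = A1 s t" if "0 <= s" "s <= t" "t <= T" for s t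
  proof -
   have "C0 integrable_on {0..t}" "C1 integrable_on {0..t}"
    using integrable_on_subinterval[OF iC(1)] integrable_on_subinterval[OF iC(2)] that by auto
   from this[THEN Henstock_Kurzweil_Integration.integral_combine[OF that(1,2)]]
   show "A0 0 t - A0 0 s = A0 s t" "A1 0 t - A1 0 s = A1 s t" by linarith+
  qed
  define F where "F r = (\<integral>x. f r x * mollify \<epsilon> (u r) x \<partial>lborel)" for r
  \<comment> \<open>The error budget, additive over the steps, with one \<open>e\<close> for each of
    the four errors of \<open>step_estimate\<close>.\<close>
  define H where "H r = 4 * e * (A0 0 r + A1 0 r)" for r
  have loc: "\<bar>F t - F s\<bar> <= H t - H s" if st: "0 <= s" "s <= t" "t <= T" "t - s < min d1 d2" for s t
  proof -
   have rT: "s <= T" "0 <= t" using st by auto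
   define A where "A = A0 s t + A1 s t"
   have An: "0 <= A0 s t" "0 <= A1 s t" using A_nonneg[OF st(1,3)] by auto
   then have AA: "A0 s t <= A" "0 <= A" by (auto simp: A_def)
   have "dist (A0 0 t) (A0 0 s) < \<alpha>" by (rule d2(2)) (use st in \<open>auto simp: dist_real_def\<close>)
   then have A\<alpha>: "A0 s t <= \<alpha>" unfolding comb(1)[OF st(1-3), symmetric] dist_real_def by linarith
   define q where "q = slack s t \<tau> (\<epsilon> + \<epsilon>) (R + 1)"
   have q: "q <= 4 * (2 + R) * \<tau> * A"
   proof -
    have "(\<epsilon> + \<epsilon>) / \<tau> = 2 * \<tau>" using \<tau> by (simp add: \<epsilon>_def power2_eq_square)
    then have "q = 4 * \<tau> * A1 s t + 4 * (2 + R) * \<tau> * A0 s t" by (simp add: q_def slack_def algebra_simps)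
    moreover have "4 * \<tau> * A1 s t <= 4 * (2 + R) * \<tau> * A1 s t"
     using \<tau> R An by (intro mult_right_mono) auto
    ultimately show ?thesis by (simp add: A_def algebra_simps)
   qed
   have n_eq: "2 * n = real (2 * CARD('n))" by (simp add: n_def)
   have "\<bar>F t - F s\<bar> <= Lu * (M * (2 * n * ((\<tau> * ((3 + R) * A0 s t) + q) * V)) + 2 * n * (2 * (2 + R) * A0 s t + q) * \<eta>)
    + E * (A0 s t * (1 + R))\<^sup>2 * J + E * (1 + R) * \<omega> * A0 s t"
    unfolding F_def n_eq V_def
   proof (rule step_estimate[where \<delta> = \<epsilon>, OF st(1-3) \<tau>(1,2) \<epsilon>(1,2,4) R _ uL[OF st(1) rT(1)] Lu um[OF st(1) rT(1)] ub _ ui(1)[OF st(1) rT(1)]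
      um[OF rT(2) st(3)] _ _ ui(1)[OF rT(2) st(3)] E E2[OF st(1) rT(1)] E3[OF st(1) rT(1)] _ M(1) M(2) J(2) q_def])
    show "norm (\<phi> r t y - y) <= \<epsilon>" if "r \<in> {s..t}" "norm y <= R + 1" for r y
    proof -
     have "norm (\<phi> r t y - y) <= Kd * A0 s t" by (rule disp) (use that st in auto)
     also have "\<dots> <= Kd * \<alpha>" using A\<alpha> Kd by (intro mult_left_mono) auto
     finally show ?thesis using \<alpha>2 by linarith
    qed
    show "u s x = 0" if "R - 1 < norm x" for x by (rule u0[OF st(1) rT(1)]) (use that in \<open>simp add: R_def\<close>)
    show "u t x = 0" if "R - 1 < norm x" for x by (rule u0[OF rT(2) st(3)]) (use that in \<open>simp add: R_def\<close>)
    show "u t y = u s (\<phi> s t y)" for y unfolding u_def using flow_compose[of 0 s t y] st by simp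
    show "(LINT x:cball 0 R|lborel. \<bar>f r x - f t x\<bar>) <= \<omega>" if "r \<in> {s..t}" for r
     by (rule d1(2)) (use that st in auto)
   qed
   also have "\<dots> <= Lu * (M * (2 * n * ((5 * (3 + R) * \<tau> * A) * V)) + 2 * n * (6 * (2 + R) * A) * \<eta>) + c3 * \<alpha> * A + c4 * \<omega> * A"
   proof -
    have t1: "\<tau> * ((3 + R) * A0 s t) <= \<tau> * ((3 + R) * A)" using \<tau> R AA by (intro mult_left_mono) auto
    have t2: "4 * (2 + R) * \<tau> * A <= 4 * (3 + R) * \<tau> * A" using \<tau> R AA by (intro mult_right_mono) auto
    have b1: "\<tau> * ((3 + R) * A0 s t) + q <= 5 * (3 + R) * \<tau> * A"
     using t1 t2 q by (simp add: algebra_simps)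
    have t3: "2 * (2 + R) * A0 s t <= 2 * (2 + R) * A" using R AA by (intro mult_left_mono) auto
    have t4: "4 * (2 + R) * \<tau> * A <= 4 * (2 + R) * 1 * A" using \<tau> R AA by (intro mult_right_mono mult_left_mono) auto
    have b2: "2 * (2 + R) * A0 s t + q <= 6 * (2 + R) * A"
     using t3 t4 q by (simp add: algebra_simps)
    have "A0 s t * A0 s t <= \<alpha> * A" using A\<alpha> AA An \<alpha> by (intro mult_mono) auto
    then have "c3 * (A0 s t * A0 s t) <= c3 * (\<alpha> * A)" by (rule mult_left_mono[OF _ c34(1)])
    then have b3: "E * (A0 s t * (1 + R))\<^sup>2 * J <= c3 * \<alpha> * A" by (simp add: c3_def power2_eq_square mult_ac)
    have "c4 * \<omega> * A0 s t <= c4 * \<omega> * A" using AA c34 \<omega> by (intro mult_left_mono) auto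
    then have b4: "E * (1 + R) * \<omega> * A0 s t <= c4 * \<omega> * A" by (simp add: c4_def)
    have n2: "0 <= 2 * n" using n by simp
    note p1 = mult_left_mono[OF mult_left_mono[OF mult_right_mono[OF b1 V] n2] M(1)]
    note p2 = mult_right_mono[OF mult_left_mono[OF b2 n2] less_imp_le[OF \<eta>(1)]]
    show ?thesis
     by (rule add_mono[OF add_mono[OF mult_left_mono[OF add_mono[OF p1 p2] Lu] b3] b4])
   qed
   also have "\<dots> = (c1 * M * \<tau> + c2 * \<eta> + c3 * \<alpha> + c4 * \<omega>) * A"
    unfolding c1_def c2_def by (simp add: algebra_simps)
   also have "\<dots> <= (4 * e) * A"
    using c1\<tau> \<eta>(2) \<alpha>3 \<omega>(2) AA(2) by (intro mult_right_mono) auto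
   also have "\<dots> = H t - H s"
    unfolding H_def A_def comb[OF st(1-3), symmetric] by (simp add: algebra_simps)
   finally show ?thesis .
  qed
  have "\<bar>F T' - F 0\<bar> <= H T' - H 0"
   by (rule increment_le_of_local[of "min d1 d2" T F H]) (use d1(1) d2(1) loc T' in auto)
  also have "\<dots> <= 4 * e * a"
  proof -
   have "A0 0 T' <= A0 0 T" "A1 0 T' <= A1 0 T"
    using integral_C_subinterval(2)[OF C0_int C0_nonneg order_refl T'(2)] integral_C_subinterval(2)[OF C1_int C1_nonneg order_refl T'(2)] by auto
   then have "4 * e * (A0 0 T' + A1 0 T') <= 4 * e * a" unfolding a_def using e by (intro mult_left_mono) auto
   then show ?thesis by (simp add: H_def)
  qed
  finally have FF: "\<bar>F T' - F 0\<bar> <= 4 * e * a" .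
  \<comment> \<open>Replacing \<open>u r\<close> by its mollification is paid for once at each end
    of the time interval and not in every step.\<close>
  have err: "\<bar>F r - (\<integral>x. f r x * u r x \<partial>lborel)\<bar> <= Lu * J * \<tau>" if r: "0 <= r" "r <= T" for r
  proof -
   have fB: "set_integrable lborel (cball 0 R) (f r)" by (rule f_int) simp
   have mm: "mollify \<epsilon> (u r) \<in> borel_measurable borel"
   proof -
    have "norm x > \<epsilon> ==> mollifier \<epsilon> x = 0" for x :: "real^'n" by (rule mollifier_eq_0[OF \<epsilon>(1)]) simp
    then have "C_class 0 (mollify \<epsilon> (u r))" unfolding mollify_def[abs_def]
     by (intro C_class_convolution[where g = "mollifier \<epsilon>" and R = \<epsilon>, OF ui(1)[OF r] C_class_mollifier])
    then show ?thesis by (intro borel_measurable_continuous_onI) simp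
   qed
   have d: "\<bar>mollify \<epsilon> (u r) x - u r x\<bar> <= Lu * \<epsilon>" for x
   proof -
    have "\<bar>mollify \<epsilon> (u r) x - mollify \<epsilon> (%_. u r x) x\<bar> <= Lu * \<epsilon>"
    proof (rule mollify_diff_le[OF \<epsilon>(1) um[OF r] ub])
     show "(%_. u r x) \<in> borel_measurable borel" by simp
     show "\<bar>u r x\<bar> <= 1" by (rule ub)
     fix y assume "norm (x - y) < \<epsilon>"
     then have "Lu * norm (y - x) <= Lu * \<epsilon>" by (intro mult_left_mono Lu) (simp add: norm_minus_commute)
     then show "\<bar>u r y - u r x\<bar> <= Lu * \<epsilon>" using uL[OF r, of y x] by linarith
    qed
    then show ?thesis by (simp add: mollify_const[OF \<epsilon>(1)])
   qed
   have z: "u r x = 0" "mollify \<epsilon> (u r) x = 0" if "x \<notin> cball 0 R" for x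
   proof -
    have nx: "norm x > R" using that by simp
    show "u r x = 0" by (rule u0[OF r]) (use nx in \<open>simp add: R_def\<close>)
    show "mollify \<epsilon> (u r) x = 0"
     by (rule mollify_eq_0[of \<epsilon> R1, OF \<epsilon>(1)]) (use u0[OF r] nx \<epsilon> \<tau> in \<open>auto simp: R_def\<close>)
   qed
   have dm: "(%x. mollify \<epsilon> (u r) x - u r x) \<in> borel_measurable borel" by (rule borel_measurable_diff[OF mm um[OF r]])
   have i1: "integrable lborel (%x. f r x * (mollify \<epsilon> (u r) x - u r x))"
    and b: "\<bar>\<integral>x. f r x * (mollify \<epsilon> (u r) x - u r x) \<partial>lborel\<bar> <= Lu * \<epsilon> * (LINT x:cball 0 R|lborel. \<bar>f r x\<bar>)"
    by (rule integrable_mult_bounded[OF fB dm d], use z in simp)+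
   have i2: "integrable lborel (%x. f r x * u r x)" by (rule integrable_mult_bounded(1)[OF fB um[OF r] ub z(1)])
   have "F r = (\<integral>x. f r x * (mollify \<epsilon> (u r) x - u r x) + f r x * u r x \<partial>lborel)" unfolding F_def by (simp add: algebra_simps)
   also have "\<dots> = (\<integral>x. f r x * (mollify \<epsilon> (u r) x - u r x) \<partial>lborel) + (\<integral>x. f r x * u r x \<partial>lborel)"
    by (rule Bochner_Integration.integral_add[OF i1 i2])
   finally have "\<bar>F r - (\<integral>x. f r x * u r x \<partial>lborel)\<bar> <= Lu * \<epsilon> * (LINT x:cball 0 R|lborel. \<bar>f r x\<bar>)" using b by simp
   also have "\<dots> <= (Lu * \<tau>) * J" using Lu \<epsilon> J by (intro mult_mono mult_left_mono) (auto simp: set_lebesgue_integral_def)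
   finally show ?thesis by (simp add: mult_ac)
  qed
  have "\<bar>F T' - (\<integral>x. f T' x * u T' x \<partial>lborel)\<bar> <= Lu * J * \<tau>" by (rule err[OF T'])
  moreover have "\<bar>F 0 - (\<integral>x. f 0 x * u 0 x \<partial>lborel)\<bar> <= Lu * J * \<tau>" by (rule err) (use T' in auto)
  ultimately have "\<bar>(\<integral>x. f T' x * u T' x \<partial>lborel) - (\<integral>x. f 0 x * u 0 x \<partial>lborel)\<bar> <= 4 * e * a + 2 * (Lu * J) * \<tau>"
   using FF by (simp add: abs_le_iff)
  then show ?thesis using J\<tau> by (simp add: algebra_simps)
 qed
 have a0: "0 <= a" unfolding a_def using A_nonneg[of 0 T] by simp
 have "\<bar>(\<integral>x. f T' x * u T' x \<partial>lborel) - (\<integral>x. f 0 x * u 0 x \<partial>lborel)\<bar> <= 0"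
 proof (rule field_le_epsilon)
  fix e :: real assume e: "0 < e"
  have "0 < e / (4 * a + 1)" using e a0 by simp
  from main[OF this] show "\<bar>(\<integral>x. f T' x * u T' x \<partial>lborel) - (\<integral>x. f 0 x * u 0 x \<partial>lborel)\<bar> <= 0 + e" using a0 by simp
 qed
 then show ?thesis using flow_self[of 0] T' by (simp add: u_def)
qed

end

section \<open>From push-forward to densities\<close>

lemma negligible_subset_borel_null:
 fixes S :: "'a::euclidean_space set"
 assumes "negligible S"
 obtains N where "N \<in> sets borel" "emeasure lborel N = 0" "S \<subseteq> N" "negligible N"
proof -
 have "S \<in> null_sets lebesgue" using assms by (simp add: negligible_iff_null_sets)
 then obtain N where N: "N \<in> null_sets lborel" "S \<subseteq> N" by (auto simp: null_sets_completion_iff2)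
 show ?thesis
 proof (rule that)
  show "N \<in> sets borel" "emeasure lborel N = 0" using N(1) by auto
  show "negligible N" using N(1) null_sets_completionI[of N lborel] by (simp add: negligible_iff_null_sets)
 qed (rule N(2))
qed

text \<open>Inner approximation by closed subsets of the bounded pieces of \<open>P\<close>, which
  are compact.\<close>

lemma negligible_if_compact_subsets_negligible:
 fixes P :: "'a::euclidean_space set"
 assumes P: "P \<in> sets lebesgue" and sub: "\<And>S. compact S ==> S \<subseteq> P ==> negligible S"
 shows "negligible P"
proof -
 have "negligible (P \<inter> cball 0 (real k))" for k :: nat
 proof -
  have Q: "P \<inter> cball 0 (real k) \<in> sets lebesgue" using P by (intro sets.Int) auto
  have le: "emeasure lebesgue (P \<inter> cball 0 (real k)) <= 0 + ennreal e" if e: "0 < e" for e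
  proof -
   obtain C where C: "closed C" "C \<subseteq> P \<inter> cball 0 (real k)" "P \<inter> cball 0 (real k) - C \<in> lmeasurable"
     "emeasure lebesgue (P \<inter> cball 0 (real k) - C) < ennreal e"
    by (rule sets_lebesgue_inner_closed[OF Q e])
   have cC: "compact C" using C(1,2) bounded_subset[OF bounded_cball] by (auto simp: compact_eq_bounded_closed)
   have "negligible C" by (rule sub[OF cC]) (use C in auto)
   then have "emeasure lebesgue C = 0" "C \<in> sets lebesgue" by (auto simp: negligible_iff_null_sets)
   moreover have "emeasure lebesgue (P \<inter> cball 0 (real k)) <= emeasure lebesgue C + emeasure lebesgue (P \<inter> cball 0 (real k) - C)"
   proof (rule order_trans[OF emeasure_mono emeasure_subadditive])
    show "P \<inter> cball 0 (real k) \<subseteq> C \<union> (P \<inter> cball 0 (real k) - C)" by auto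
   qed (use Q calculation in auto)
   ultimately show ?thesis using C(4) by simp
  qed
  have "emeasure lebesgue (P \<inter> cball 0 (real k)) <= 0"
   by (rule ennreal_le_epsilon) (rule le)
  then show ?thesis using Q by (simp add: negligible_iff_null_sets null_sets_def)
 qed
 then have "negligible (\<Union>k::nat. P \<inter> cball 0 (real k))" by (intro negligible_countable_Union) auto
 moreover have "P \<subseteq> (\<Union>k::nat. P \<inter> cball 0 (real k))"
 proof
  fix x assume "x \<in> P"
  moreover obtain k :: nat where "norm x <= real k" using real_arch_simple by blast
  ultimately show "x \<in> (\<Union>k::nat. P \<inter> cball 0 (real k))" by auto
 qed
 ultimately show ?thesis by (rule negligible_subset)
qed

lemma set_integrable_lebesgue_iff_lborel:
 fixes u :: "'a::euclidean_space => real"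
 assumes "u \<in> borel_measurable borel" "K \<in> sets borel"
 shows "set_integrable lebesgue K u \<longleftrightarrow> set_integrable lborel K u" "(LINT x:K|lebesgue. u x) = (LINT x:K|lborel. u x)"
proof -
 have "(%x. indicator K x *\<^sub>R u x) \<in> borel_measurable lborel"
  using assms by (intro borel_measurable_scaleR borel_measurable_indicator) auto
 then show "set_integrable lebesgue K u \<longleftrightarrow> set_integrable lborel K u" "(LINT x:K|lebesgue. u x) = (LINT x:K|lborel. u x)"
  unfolding set_integrable_def set_lebesgue_integral_def by (rule integrable_completion, rule integral_completion)
qed

lemma negligible_if_integral_0:
 fixes w :: "'a::euclidean_space => real"
 assumes i: "set_integrable lebesgue S w" and 0: "(LINT x:S|lebesgue. w x) = 0" and pos: "\<And>x. x \<in> S ==> 0 < w x"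
 shows "negligible S"
proof -
 have "AE x in lebesgue. indicator S x *\<^sub>R w x = 0"
  using i 0 pos unfolding set_integrable_def set_lebesgue_integral_def
  by (subst integral_nonneg_eq_0_iff_AE[symmetric]) (auto simp: indicator_def intro!: AE_I2 less_imp_le)
 then have "negligible {x. \<not> indicator S x *\<^sub>R w x = 0}" by (simp only: AE_lebesgue_iff_negligible)
 then show ?thesis by (rule negligible_subset) (use pos in \<open>force simp: indicator_def\<close>)
qed

text \<open>\<open>F\<close> and \<open>h\<close> are Borel versions of \<open>F'\<close> and
  \<open>h'\<close>. In the region \<open>J ~= 0\<close> integrals are compared over compact sets,
  whose images are compact, hence Borel, and on which both densities are integrable. Replacing
  \<open>h'\<close> by \<open>h\<close> after composition with \<open>\<Phi>\<close> is harmless: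
  where \<open>J ~= 0\<close> preimages of null sets are null, and where \<open>J = 0\<close> the
  value is multiplied by 0.\<close>

lemma density_transform:
 fixes \<Phi> :: "real^'n => real^'n" and F h F' h' :: "real^'n => real"
 assumes Lip: "\<And>x y. norm (\<Phi> x - \<Phi> y) <= L * norm (x - y)"
  and fib: "\<And>x A. (\<Phi> has_derivative A) (at x) ==> det (matrix A) ~= 0 ==> 0 < det (matrix A)"
   "\<And>x A y. (\<Phi> has_derivative A) (at x) ==> det (matrix A) ~= 0 ==> \<Phi> y = \<Phi> x ==> y = x"
  and F: "F \<in> borel_measurable borel" "\<And>K. compact K ==> set_integrable lborel K F" "AE x in lborel. 0 <= F x"
  and h: "h \<in> borel_measurable borel" "\<And>K. compact K ==> set_integrable lborel K h" "AE x in lborel. 0 <= h x"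
  and push: "\<And>E. E \<in> sets borel ==> (\<integral>\<^sup>+x. ennreal (F x) * indicator E (\<Phi> x) \<partial>lborel) = (\<integral>\<^sup>+x. ennreal (h x) * indicator E x \<partial>lborel)"
  and F': "AE x in lebesgue. F' x = F x" and h': "AE x in lebesgue. h' x = h x"
 shows "AE x in lebesgue. F' x = h' (\<Phi> x) * det (jacobian \<Phi> (at x))"
proof -
 have L0: "0 <= \<bar>L\<bar>" by simp
 have "\<bar>L\<bar>-lipschitz_on UNIV \<Phi>"
 proof (rule lipschitz_onI[OF _ L0])
  fix x y
  have "norm (\<Phi> x - \<Phi> y) <= \<bar>L\<bar> * norm (x - y)"
   by (rule order_trans[OF Lip mult_right_mono]) auto
  then show "dist (\<Phi> x) (\<Phi> y) <= \<bar>L\<bar> * dist x y" by (simp add: dist_norm)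
 qed
 then have cont: "continuous_on UNIV \<Phi>" by (rule lipschitz_on_continuous_on)
 have \<Phi>m: "\<Phi> \<in> borel_measurable borel" by (rule borel_measurable_continuous_onI[OF cont])
 have negD: "negligible {x. \<not> \<Phi> differentiable (at x)}" by (rule rademacher[OF Lip])
 define Dn where "Dn = {x. \<Phi> differentiable (at x)}"
 have Dn: "Dn \<in> sets lebesgue"
 proof -
  have "- {x. \<not> \<Phi> differentiable (at x)} \<in> sets lebesgue"
   by (rule Compl_in_sets_lebesgue[THEN iffD2]) (rule negligible_imp_sets[OF negD])
  moreover have "- {x. \<not> \<Phi> differentiable (at x)} = Dn" by (auto simp: Dn_def)
  ultimately show ?thesis by simp
 qed
 let ?D = "%x. frechet_derivative \<Phi> (at x)"
 have der: "(\<Phi> has_derivative ?D x) (at x)" if "x \<in> Dn" for x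
  using that by (simp add: Dn_def frechet_derivative_works)
 define J where "J x = (if x \<in> Dn then det (matrix (?D x)) else 0)" for x
 have "(%x. det (matrix (?D x))) \<in> borel_measurable (lebesgue_on Dn)"
  by (rule borel_measurable_det_Jacobian_finite[OF Dn]) (rule has_derivative_at_withinI, erule der)
 then have Jm: "J \<in> borel_measurable lebesgue" unfolding J_def[abs_def]
  by (rule borel_measurable_if_I[OF _ Dn])
 have J_ne: "{x. J x ~= 0} \<in> sets lebesgue"
 proof -
  have "J -` (- {0}) \<inter> space lebesgue \<in> sets lebesgue" by (rule measurable_sets[OF Jm]) simp
  moreover have "J -` (- {0}) \<inter> space lebesgue = {x. J x ~= 0}" by auto
  ultimately show ?thesis by simp
 qed
 have J_D: "x \<in> Dn" "J x = det (matrix (?D x))" if "J x ~= 0" for x using that by (auto simp: J_def split: if_splits)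
 have J_pos: "0 < J x" if "J x ~= 0" for x using fib(1)[OF der[OF J_D(1)[OF that]]] J_D(2)[OF that] that by simp
 have inj: "y = x" if "J x ~= 0" "\<Phi> y = \<Phi> x" for x y
  using fib(2)[OF der[OF J_D(1)[OF that(1)]] _ that(2)] J_D(2)[OF that(1)] that(1) by simp
 have cov: "set_integrable lebesgue S (%x. J x * k (\<Phi> x))" "(LINT x:S|lebesgue. J x * k (\<Phi> x)) = (LINT y:\<Phi> ` S|lebesgue. k y)"
  if S: "S \<in> sets lebesgue" "\<And>x. x \<in> S ==> J x ~= 0" and k: "set_integrable lebesgue (\<Phi> ` S) k" for S k
 proof -
  have d: "(\<Phi> has_derivative ?D x) (at x within S)" if "x \<in> S" for x
   by (rule has_derivative_at_withinI[OF der[OF J_D(1)[OF S(2)[OF that]]]])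
  have i: "inj_on \<Phi> S" by (rule inj_onI) (use inj S(2) in blast)
  have e: "indicator S x *\<^sub>R (\<bar>det (matrix (?D x))\<bar> * k (\<Phi> x)) = indicator S x *\<^sub>R (J x * k (\<Phi> x))" for x
  proof (cases "x \<in> S")
   case True
   from S(2)[OF this] show ?thesis using J_D(2) J_pos by fastforce
  qed simp
  from change_of_variables_nonneg[OF S(1) d i k]
  show "set_integrable lebesgue S (%x. J x * k (\<Phi> x))" "(LINT x:S|lebesgue. J x * k (\<Phi> x)) = (LINT y:\<Phi> ` S|lebesgue. k y)"
   unfolding set_integrable_def set_lebesgue_integral_def e by auto
 qed
 \<comment> \<open>Change of variables with integrand 1 gives \<open>J\<close> integral 0 over the
   preimage, although \<open>J\<close> is positive there.\<close>
 have null_preimage: "negligible {x. J x ~= 0 \<and> \<Phi> x \<in> N}" if N: "N \<in> sets borel" "negligible N" for N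
 proof -
  let ?S = "{x. J x ~= 0 \<and> \<Phi> x \<in> N}"
  have 1: "{x. J x ~= 0} \<in> sets lebesgue" by (rule J_ne)
  have "\<Phi> -` N \<inter> space borel \<in> sets borel" by (rule measurable_sets[OF \<Phi>m N(1)])
  then have 2: "\<Phi> -` N \<in> sets lebesgue" by simp
  have S: "?S \<in> sets lebesgue" using sets.Int[OF 1 2] by (simp add: Int_def vimage_def)
  have n: "negligible (\<Phi> ` ?S)" by (rule negligible_subset[OF N(2)]) auto
  then have ae: "AE y in lebesgue. indicator (\<Phi> ` ?S) y *\<^sub>R (1::real) = 0"
   unfolding AE_lebesgue_iff_negligible by (rule negligible_subset) (auto simp: indicator_def)
  have m: "(%y. indicator (\<Phi> ` ?S) y *\<^sub>R (1::real)) \<in> borel_measurable lebesgue"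
   using negligible_imp_sets[OF n] by (intro borel_measurable_scaleR borel_measurable_indicator) auto
  have k: "set_integrable lebesgue (\<Phi> ` ?S) (%_. 1 :: real)"
   unfolding set_integrable_def by (rule integrable_cong_AE[THEN iffD2, OF m _ ae]) auto
  have z: "(LINT y:\<Phi> ` ?S|lebesgue. (1::real)) = 0"
   unfolding set_lebesgue_integral_def by (rule integral_eq_zero_AE[OF ae])
  show ?thesis
   by (rule negligible_if_integral_0[of ?S "%x. J x * 1"]) (use cov[OF S _ k] z J_pos in auto)
 qed
 have F_lb: "AE x in lebesgue. 0 <= F x" and h_lb: "AE x in lebesgue. 0 <= h x"
  using F(3) h(3) by (auto intro: AE_completion)
 \<comment> \<open>The push-forward identity is tested with a Borel null set that contains the
   critical values. It yields only \<open>F x <= 0\<close>, because \<open>ennreal\<close> sends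
   negative numbers to 0.\<close>
 have crit: "AE x in lebesgue. x \<in> Dn \<and> J x = 0 --> F x <= 0"
 proof -
  let ?Z = "{x \<in> Dn. J x = 0}"
  have "negligible (\<Phi> ` ?Z)"
   by (rule negligible_image_det_0[where f' = ?D]) (auto simp: J_def intro: has_derivative_at_withinI der)
  then obtain N where N: "N \<in> sets borel" "emeasure lborel N = 0" "\<Phi> ` ?Z \<subseteq> N" by (rule negligible_subset_borel_null)
  have "(\<integral>\<^sup>+x. ennreal (h x) * indicator N x \<partial>lborel) = 0"
   using N by (intro nn_integral_null_set) (simp add: null_sets_def)
  then have "(\<integral>\<^sup>+x. ennreal (F x) * indicator N (\<Phi> x) \<partial>lborel) = 0" using push[OF N(1)] by simp
  moreover have "(%x. ennreal (F x) * indicator N (\<Phi> x)) \<in> borel_measurable lborel"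
  proof -
   have [measurable]: "(%x. indicator N (\<Phi> x) :: ennreal) \<in> borel_measurable borel"
    by (rule measurable_compose[OF \<Phi>m borel_measurable_indicator[OF N(1)]])
   have [measurable]: "F \<in> borel_measurable borel" by (rule F(1))
   have "(%x. ennreal (F x) * indicator N (\<Phi> x)) \<in> borel_measurable borel" by measurable
   then show ?thesis by simp
  qed
  ultimately have "AE x in lborel. ennreal (F x) * indicator N (\<Phi> x) = 0"
   by (simp add: nn_integral_0_iff_AE)
  then have "AE x in lebesgue. ennreal (F x) * indicator N (\<Phi> x) = 0" by (rule AE_completion)
  then show ?thesis
  proof (rule eventually_mono)
   fix x assume a: "ennreal (F x) * indicator N (\<Phi> x) = 0"
   show "x \<in> Dn \<and> J x = 0 --> F x <= 0"
   proof
    assume "x \<in> Dn \<and> J x = 0"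
    then have "\<Phi> x \<in> N" using N(3) by blast
    then show "F x <= 0" using a by (simp add: ennreal_eq_0_iff)
   qed
  qed
 qed
 have comp: "set_integrable lebesgue S (%x. J x * h (\<Phi> x))" "set_integrable lebesgue S F"
   "(LINT x:S|lebesgue. J x * h (\<Phi> x)) = (LINT x:S|lebesgue. F x)"
  if S: "compact S" "\<And>x. x \<in> S ==> J x ~= 0" for S
 proof -
  have Sb: "S \<in> sets borel" by (rule borel_compact[OF S(1)])
  have c\<Phi>: "compact (\<Phi> ` S)" by (rule compact_continuous_image[OF continuous_on_subset[OF cont] S(1)]) simp
  have \<Phi>b: "\<Phi> ` S \<in> sets borel" by (rule borel_compact[OF c\<Phi>])
  have hi: "set_integrable lborel (\<Phi> ` S) h" by (rule h(2)[OF c\<Phi>])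
  have Fi: "set_integrable lborel S F" by (rule F(2)[OF S(1)])
  have hl: "set_integrable lebesgue (\<Phi> ` S) h" using set_integrable_lebesgue_iff_lborel(1)[OF h(1) \<Phi>b] hi by simp
  have Sl: "S \<in> sets lebesgue" using Sb by simp
  show "set_integrable lebesgue S (%x. J x * h (\<Phi> x))" by (rule cov(1)[OF Sl S(2) hl])
  show "set_integrable lebesgue S F" using set_integrable_lebesgue_iff_lborel(1)[OF F(1) Sb] Fi by simp
  \<comment> \<open>Full fibres are singletons; injectivity on \<open>S\<close> alone would not
    prevent points outside \<open>S\<close> from being mapped into the image of
    \<open>S\<close>.\<close>
  have ind: "indicator (\<Phi> ` S) (\<Phi> x) = (indicator S x :: ennreal)" for x
   using inj S(2) by (auto simp: indicator_def)
  have nn: "(\<integral>\<^sup>+x. ennreal (w x) * indicator K x \<partial>lborel) = ennreal (LINT x:K|lborel. w x) \<and> 0 <= (LINT x:K|lborel. w x)"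
   if "set_integrable lborel K w" "AE x in lborel. 0 <= w x" for K and w :: "real^'n => real"
  proof -
   have ae: "AE x in lborel. 0 <= indicator K x *\<^sub>R w x" using that(2) by (rule eventually_mono) simp
   have "(\<integral>\<^sup>+x. ennreal (w x) * indicator K x \<partial>lborel) = (\<integral>\<^sup>+x. ennreal (indicator K x *\<^sub>R w x) \<partial>lborel)"
    by (rule nn_integral_cong) (simp add: indicator_def)
   also have "\<dots> = ennreal (LINT x:K|lborel. w x)"
    unfolding set_lebesgue_integral_def by (rule nn_integral_eq_integral[OF that(1)[unfolded set_integrable_def] ae])
   finally show ?thesis unfolding set_lebesgue_integral_def using integral_nonneg_AE[OF ae] by simp
  qed
  have "(\<integral>\<^sup>+x. ennreal (F x) * indicator S x \<partial>lborel) = (\<integral>\<^sup>+x. ennreal (h x) * indicator (\<Phi> ` S) x \<partial>lborel)"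
   using push[OF \<Phi>b] unfolding ind .
  then have eq: "(LINT x:S|lborel. F x) = (LINT x:\<Phi> ` S|lborel. h x)"
   using nn[OF Fi F(3)] nn[OF hi h(3)] by simp
  have "(LINT x:S|lebesgue. J x * h (\<Phi> x)) = (LINT x:\<Phi> ` S|lebesgue. h x)" by (rule cov(2)[OF Sl S(2) hl])
  also have "\<dots> = (LINT x:\<Phi> ` S|lborel. h x)" by (rule set_integrable_lebesgue_iff_lborel(2)[OF h(1) \<Phi>b])
  also have "\<dots> = (LINT x:S|lborel. F x)" by (rule eq[symmetric])
  also have "\<dots> = (LINT x:S|lebesgue. F x)" by (rule set_integrable_lebesgue_iff_lborel(2)[OF F(1) Sb, symmetric])
  finally show "(LINT x:S|lebesgue. J x * h (\<Phi> x)) = (LINT x:S|lebesgue. F x)" .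
 qed
 define G where "G x = J x * h (\<Phi> x)" for x
 have Gm: "G \<in> borel_measurable lebesgue"
 proof -
  have "(%x. h (\<Phi> x)) \<in> borel_measurable lborel" using measurable_compose[OF \<Phi>m h(1)] by simp
  then have "(%x. h (\<Phi> x)) \<in> borel_measurable lebesgue" by (rule measurable_completion)
  then show ?thesis unfolding G_def[abs_def] by (rule borel_measurable_times[OF Jm])
 qed
 have Fm: "F \<in> borel_measurable lebesgue" using F(1) by (intro measurable_completion) simp
 \<comment> \<open>If the integrals over all compact subsets of the region \<open>J ~= 0\<close>
   agree, neither function exceeds the other on a set of positive measure; this is used in both
   orders.\<close>
 have neg: "negligible {x. J x ~= 0 \<and> w x < v x}"
  if m: "w \<in> borel_measurable lebesgue" "v \<in> borel_measurable lebesgue"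
   and i: "\<And>S. compact S ==> (\<And>x. x \<in> S ==> J x ~= 0) ==> set_integrable lebesgue S v \<and> set_integrable lebesgue S w \<and>
    (LINT x:S|lebesgue. v x) = (LINT x:S|lebesgue. w x)" for v w :: "real^'n => real"
 proof (rule negligible_if_compact_subsets_negligible)
  have "{x \<in> space lebesgue. w x < v x} \<in> sets lebesgue" by (rule borel_measurable_less[OF m])
  from sets.Int[OF J_ne this] show "{x. J x ~= 0 \<and> w x < v x} \<in> sets lebesgue" by (simp add: Int_def)
  fix S assume S: "compact S" "S \<subseteq> {x. J x ~= 0 \<and> w x < v x}"
  have iv: "set_integrable lebesgue S v" and iw: "set_integrable lebesgue S w" and eq: "(LINT x:S|lebesgue. v x) = (LINT x:S|lebesgue. w x)"
   using i[OF S(1)] S(2) by auto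
  show "negligible S"
   by (rule negligible_if_integral_0[OF set_integral_diff(1)[OF iv iw]])
     (use S(2) eq set_integral_diff(2)[OF iv iw] in auto)
 qed
 have n1: "negligible {x. J x ~= 0 \<and> G x < F x}" by (rule neg[OF Gm Fm]) (use comp in \<open>simp add: G_def[abs_def]\<close>)
 have n2: "negligible {x. J x ~= 0 \<and> F x < G x}" by (rule neg[OF Fm Gm]) (use comp in \<open>simp add: G_def[abs_def]\<close>)
 have "negligible {x. \<not> h' x = h x}" using h' by (simp only: AE_lebesgue_iff_negligible)
 then obtain N where N: "N \<in> sets borel" "emeasure lborel N = 0" "{x. \<not> h' x = h x} \<subseteq> N" "negligible N"
  by (rule negligible_subset_borel_null)
 have n3: "negligible {x. J x ~= 0 \<and> \<Phi> x \<in> N}" by (rule null_preimage[OF N(1,4)])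
 have "AE x in lebesgue. \<not> \<not> \<Phi> differentiable (at x)" "AE x in lebesgue. \<not> (J x ~= 0 \<and> G x < F x)"
  "AE x in lebesgue. \<not> (J x ~= 0 \<and> F x < G x)" "AE x in lebesgue. \<not> (J x ~= 0 \<and> \<Phi> x \<in> N)"
  unfolding AE_lebesgue_iff_negligible not_not using negD n1 n2 n3 by auto
 with F' F_lb crit show ?thesis
 proof eventually_elim
  case (elim x)
  have xD: "x \<in> Dn" using elim by (simp add: Dn_def)
  then have Jx: "det (jacobian \<Phi> (at x)) = J x" by (simp add: J_def jacobian_def)
  show ?case
  proof (cases "J x = 0")
   case True
   then show ?thesis using elim xD by (simp add: Jx)
  next
   case False
   then have "\<Phi> x \<notin> N" "F x = G x" using elim by auto
   then have "h' (\<Phi> x) = h (\<Phi> x)" using N(3) by blast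
   then show ?thesis using elim \<open>F x = G x\<close> by (simp add: Jx G_def)
  qed
 qed
qed

context transport_solution
begin

text \<open>\<open>pushforward_lipschitz\<close> equates two measures on Lipschitz functions of
  bounded support, and such functions determine them. The growth bound ensures that
  \<open>g (\<phi> 0 t x)\<close> has bounded support in \<open>x\<close> as well.\<close>

lemma pushforward_measure:
 assumes t: "0 <= t" "t <= T" and nonneg: "AE x in lborel. 0 <= f t x" "AE x in lborel. 0 <= f 0 x" and E: "E \<in> sets borel"
 shows "(\<integral>\<^sup>+x. ennreal (f t x) * indicator E (\<phi> 0 t x) \<partial>lborel) = (\<integral>\<^sup>+x. ennreal (f 0 x) * indicator E x \<partial>lborel)"
proof -
 define M where "M = density lborel (%x. ennreal (f 0 x))"
 define N where "N = distr (density lborel (%x. ennreal (f t x))) borel (\<phi> 0 t)"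
 have "KL-lipschitz_on UNIV (\<phi> 0 t)"
  by (rule lipschitz_onI) (use flow_lipschitz[of 0 t] t KL_ge_1 in \<open>auto simp: dist_norm\<close>)
 then have \<phi>m: "\<phi> 0 t \<in> borel_measurable borel" by (intro borel_measurable_continuous_onI lipschitz_on_continuous_on)
 have fm: "(%x. ennreal (f q x)) \<in> borel_measurable lborel" for q using f_borel[of q] by simp
 have \<phi>m': "\<phi> 0 t \<in> measurable (density lborel (%x. ennreal (f t x))) borel" using \<phi>m by simp
 have nn: "(\<integral>\<^sup>+x. ennreal (f q x) * ennreal (w x) \<partial>lborel) = ennreal (\<integral>x. f q x * w x \<partial>lborel)"
  if q: "AE x in lborel. 0 <= f q x" and w: "w \<in> borel_measurable borel" "\<And>x. 0 <= w x \<and> w x <= 1" "\<And>x. w x ~= 0 ==> norm x <= R" for q w R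
 proof -
  have fi: "set_integrable lborel (cball 0 R) (f q)" by (rule f_int) simp
  have 1: "\<bar>w x\<bar> <= 1" for x using w(2)[of x] by simp
  have 0: "w x = 0" if "x \<notin> cball 0 R" for x using w(3)[of x] that by auto
  have i: "integrable lborel (%x. f q x * w x)" by (rule integrable_mult_bounded(1)[OF fi w(1) 1 0])
  have "(\<integral>\<^sup>+x. ennreal (f q x) * ennreal (w x) \<partial>lborel) = (\<integral>\<^sup>+x. ennreal (f q x * w x) \<partial>lborel)"
   using w(2) by (intro nn_integral_cong) (simp add: ennreal_mult'')
  also have "\<dots> = ennreal (\<integral>x. f q x * w x \<partial>lborel)"
   by (rule nn_integral_eq_integral[OF i], rule eventually_mono[OF q]) (use w(2) in simp)
  finally show ?thesis .
 qed
 have "M = N"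
 proof (rule measure_eqI_lipschitz)
  show "sets M = sets borel" "sets N = sets borel" by (auto simp: M_def N_def)
  show "emeasure M (ball 0 R) < \<infinity>" for R
  proof -
   have fi: "set_integrable lborel (cball 0 R) (f 0)" by (rule f_int) simp
   have "emeasure M (ball 0 R) <= emeasure M (cball 0 R)" by (rule emeasure_mono) (auto simp: M_def)
   also have "\<dots> = (\<integral>\<^sup>+x. ennreal (f 0 x) * indicator (cball 0 R) x \<partial>lborel)"
    unfolding M_def by (rule emeasure_density[OF fm]) simp
   also have "\<dots> <= (\<integral>\<^sup>+x. ennreal (norm (indicator (cball 0 R) x *\<^sub>R f 0 x)) \<partial>lborel)"
    by (rule nn_integral_mono) (auto simp: indicator_def intro: ennreal_leI)
   also have "\<dots> < \<infinity>" using fi unfolding set_integrable_def integrable_iff_bounded by blast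
   finally show ?thesis .
  qed
  fix g :: "real^'n => real" and L R assume g: "\<And>x. 0 <= g x \<and> g x <= 1" "L-lipschitz_on UNIV g" "\<And>x. g x ~= 0 ==> norm x <= R"
  have gm: "g \<in> borel_measurable borel" by (intro borel_measurable_continuous_onI lipschitz_on_continuous_on[OF g(2)])
  have gb: "norm x <= KR * (1 + R\<^sup>2)" if "g (\<phi> 0 t x) ~= 0" for x
  proof -
   have "norm x <= 1 + (norm x)\<^sup>2" by (rule norm_le_1_plus_power2)
   also have "\<dots> <= KR * (1 + (norm (\<phi> 0 t x))\<^sup>2)" by (rule flow_growth(2)) (use t in auto)
   also have "\<dots> <= KR * (1 + R\<^sup>2)" using KR_ge_1 g(3)[OF that] by (intro mult_left_mono add_left_mono power_mono) auto
   finally show ?thesis .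
  qed
  have "(\<integral>\<^sup>+x. ennreal (g x) \<partial>M) = (\<integral>\<^sup>+x. ennreal (f 0 x) * ennreal (g x) \<partial>lborel)"
   unfolding M_def using gm by (intro nn_integral_density fm) simp
  also have "\<dots> = ennreal (\<integral>x. f 0 x * g x \<partial>lborel)" by (rule nn[OF nonneg(2) gm g(1) g(3)])
  also have "(\<integral>x. f 0 x * g x \<partial>lborel) = (\<integral>x. f t x * g (\<phi> 0 t x) \<partial>lborel)"
  proof (rule pushforward_lipschitz[symmetric, of g L R t])
   show "\<bar>g x - g y\<bar> <= L * norm (x - y)" for x y using lipschitz_onD[OF g(2), of x y] by (simp add: dist_norm)
  qed (use g t lipschitz_on_nonneg[OF g(2)] in auto)
  also have "ennreal (\<integral>x. f t x * g (\<phi> 0 t x) \<partial>lborel) = (\<integral>\<^sup>+x. ennreal (f t x) * ennreal (g (\<phi> 0 t x)) \<partial>lborel)"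
   by (rule nn[OF nonneg(1) measurable_compose[OF \<phi>m gm] g(1) gb, symmetric])
  also have "\<dots> = (\<integral>\<^sup>+x. ennreal (g (\<phi> 0 t x)) \<partial>density lborel (%x. ennreal (f t x)))"
   using measurable_compose[OF \<phi>m gm] by (intro nn_integral_density[symmetric] fm) simp
  also have "\<dots> = (\<integral>\<^sup>+x. ennreal (g x) \<partial>N)"
   unfolding N_def using gm by (intro nn_integral_distr[symmetric] \<phi>m') simp
  finally show "(\<integral>\<^sup>+x. ennreal (g x) \<partial>M) = (\<integral>\<^sup>+x. ennreal (g x) \<partial>N)" .
 qed
 have v: "\<phi> 0 t -` E \<in> sets lborel" using measurable_sets[OF \<phi>m E] by simp
 have "(\<integral>\<^sup>+x. ennreal (f t x) * indicator E (\<phi> 0 t x) \<partial>lborel) = (\<integral>\<^sup>+x. ennreal (f t x) * indicator (\<phi> 0 t -` E) x \<partial>lborel)"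
  by (simp add: indicator_vimage)
 also have "\<dots> = emeasure (density lborel (%x. ennreal (f t x))) (\<phi> 0 t -` E)" by (rule emeasure_density[OF fm v, symmetric])
 also have "\<dots> = emeasure N E" unfolding N_def by (subst emeasure_distr[OF \<phi>m' E]) simp
 also have "\<dots> = emeasure M E" by (simp add: \<open>M = N\<close>)
 also have "\<dots> = (\<integral>\<^sup>+x. ennreal (f 0 x) * indicator E x \<partial>lborel)"
  unfolding M_def by (rule emeasure_density[OF fm]) (simp add: E)
 finally show ?thesis .
qed

end

section \<open>Borel representatives of the data\<close>

lemma measurable_lebesgue_AE:
 fixes u v :: "'a::euclidean_space => real"
 assumes ae: "AE x in lebesgue. u x = v x" and v: "v \<in> borel_measurable lebesgue"
 shows "u \<in> borel_measurable lebesgue"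
proof (rule measurableI)
 fix A :: "real set" assume A: "A \<in> sets borel"
 have 1: "v -` A \<inter> space lebesgue \<in> sets lebesgue" by (rule measurable_sets[OF v A])
 have 2: "AE x in lebesgue. x \<in> v -` A \<inter> space lebesgue \<longleftrightarrow> x \<in> u -` A \<inter> space lebesgue"
  by (rule eventually_mono[OF ae]) simp
 show "u -` A \<inter> space lebesgue \<in> sets lebesgue"
  by (rule completion.in_sets_AE[OF 2 1]) simp
qed simp

text \<open>By completeness of Lebesgue measure the two functions are measurable together; if they
  are not, both integrals are 0 by convention.\<close>

lemma integral_lebesgue_cong_AE:
 fixes u v :: "'a::euclidean_space => real"
 assumes ae: "AE x in lebesgue. u x = v x"
 shows "(LINT x|lebesgue. u x) = (LINT x|lebesgue. v x)"
proof (cases "v \<in> borel_measurable lebesgue")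
 case True
 then show ?thesis using measurable_lebesgue_AE[OF ae True] ae by (intro integral_cong_AE) auto
next
 case False
 have ae': "AE x in lebesgue. v x = u x" using ae by (rule eventually_mono) simp
 have "u \<notin> borel_measurable lebesgue" using measurable_lebesgue_AE[OF ae'] False by blast
 then show ?thesis using False not_integrable_integral_eq[of lebesgue u] not_integrable_integral_eq[of lebesgue v]
  borel_measurable_integrable[of lebesgue u] borel_measurable_integrable[of lebesgue v] by metis
qed

lemma set_integral_lebesgue_eq_lborel:
 fixes u v :: "'a::euclidean_space => real"
 assumes ae: "AE x in lborel. u x = v x" and v: "v \<in> borel_measurable borel" and K: "K \<in> sets borel"
 shows "(LINT x:K|lebesgue. u x) = (LINT x:K|lborel. v x)" "set_integrable lebesgue K u ==> set_integrable lborel K v"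
proof -
 have m: "(%x. indicator K x *\<^sub>R v x) \<in> borel_measurable lborel"
  using v K by (intro borel_measurable_scaleR borel_measurable_indicator) auto
 have ae': "AE x in lebesgue. indicator K x *\<^sub>R u x = indicator K x *\<^sub>R v x"
  by (rule eventually_mono[OF AE_completion[OF ae]]) simp
 show "(LINT x:K|lebesgue. u x) = (LINT x:K|lborel. v x)"
  unfolding set_lebesgue_integral_def integral_lebesgue_cong_AE[OF ae'] by (rule integral_completion[OF m])
 assume "set_integrable lebesgue K u"
 then have i: "integrable lebesgue (%x. indicator K x *\<^sub>R u x)" unfolding set_integrable_def .
 have "integrable lebesgue (%x. indicator K x *\<^sub>R v x)"
  by (rule integrable_cong_AE_imp[OF i measurable_completion[OF m] ae'])
 then show "set_integrable lborel K v" unfolding set_integrable_def integrable_completion[OF m] .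
qed

text \<open>The exceptional set is enclosed in a measurable null set, so Fubini applies even where
  \<open>P\<close> itself is not measurable.\<close>

lemma AE_lborel_swap:
 assumes "AE z in (lborel :: ('a::euclidean_space \<times> 'b::euclidean_space) measure). P z"
 shows "AE x in lborel. AE y in lborel. P (x, y)" "AE y in lborel. AE x in lborel. P (x, y)"
proof -
 have e: "(lborel :: 'a measure) \<Otimes>\<^sub>M (lborel :: 'b measure) = lborel" by (rule lborel_prod)
 have "AE z in (lborel :: 'a measure) \<Otimes>\<^sub>M (lborel :: 'b measure). P z" unfolding e by (rule assms)
 then obtain N where N: "{z \<in> space ((lborel :: 'a measure) \<Otimes>\<^sub>M (lborel :: 'b measure)). \<not> P z} \<subseteq> N"
   "emeasure (lborel \<Otimes>\<^sub>M lborel) N = 0" "N \<in> sets (lborel \<Otimes>\<^sub>M lborel)"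
  by (rule AE_E)
 have sub: "P z" if "z \<notin> N" for z using N(1) that by (auto simp: space_pair_measure)
 have "AE z in (lborel :: 'a measure) \<Otimes>\<^sub>M (lborel :: 'b measure). z \<notin> N"
  by (rule AE_not_in) (use N in \<open>simp add: null_sets_def\<close>)
 then have 1: "AE x in lborel. AE y in lborel. (x, y) \<notin> N" by (rule lborel_pair.AE_pair)
 have "{z \<in> space (lborel \<Otimes>\<^sub>M lborel). (fst z, snd z) \<notin> N} = space (lborel \<Otimes>\<^sub>M lborel) - N" by auto
 moreover have "space (lborel \<Otimes>\<^sub>M lborel) - N \<in> sets (lborel \<Otimes>\<^sub>M lborel)" by (rule sets.compl_sets[OF N(3)])
 ultimately have "{z \<in> space (lborel \<Otimes>\<^sub>M lborel). (fst z, snd z) \<notin> N} \<in> sets (lborel \<Otimes>\<^sub>M lborel)" by simp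
 from lborel_pair.AE_commute[of "%x y. (x, y) \<notin> N", OF this] 1
 have 2: "AE y in lborel. AE x in lborel. (x, y) \<notin> N" by simp
 show "AE x in lborel. AE y in lborel. P (x, y)"
  by (rule eventually_mono[OF 1], erule eventually_mono, rule sub)
 show "AE y in lborel. AE x in lborel. P (x, y)"
  by (rule eventually_mono[OF 2], erule eventually_mono, rule sub)
qed

text \<open>Both orders of the almost everywhere quantifiers are recorded: the point comes first for
  the comparison with trajectories, the time comes first for exchanging the field in the weak
  equation.\<close>

lemma (in one_sided_field) ex_borel_field:
 "\<exists>bb c0. (%z. bb (fst z) (snd z)) \<in> borel_measurable borel \<and> c0 \<in> borel_measurable borel \<and> (\<forall>r. 0 <= c0 r) \<and>
  integrable lborel c0 \<and> (\<forall>r x. norm (bb r x) <= c0 r * (1 + norm x)) \<and> (AE r in lborel. r \<in> {0..T} --> c0 r = C0 r) \<and>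
  (AE x in lborel. AE r in lborel. r \<in> {0..T} --> bb r x = b r x) \<and> (AE r in lborel. AE x in lborel. r \<in> {0..T} --> bb r x = b r x)"
proof -
 let ?S = "{0..T} \<times> (UNIV :: (real^'n) set)"
 have S: "?S \<in> sets lebesgue" by (rule sets_completionI_sets) (simp add: borel_closed closed_Times)
 define B where "B z = (if z \<in> ?S then b (fst z) (snd z) else 0)" for z
 have Bm: "B \<in> borel_measurable lebesgue"
 proof -
  have "B = (%z. if z \<in> ?S then (case z of (t, x) => b t x) else 0)"
   by (rule ext) (auto simp: B_def split: prod.split)
  then show ?thesis using borel_measurable_if_I[OF b_meas S] by metis
 qed
 have "\<exists>g\<in>borel_measurable lborel. AE z in lborel. B z $ i = g z" for i
  by (rule completion_ex_borel_measurable_real) (rule measurable_compose[OF Bm], rule borel_measurable_continuous_onI, intro continuous_intros)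
 then have "\<forall>i. \<exists>g. g \<in> borel_measurable lborel \<and> (AE z in lborel. B z $ i = g z)" by blast
 from choice[OF this] obtain g where g: "\<And>i. g i \<in> borel_measurable lborel" "\<And>i. AE z in lborel. B z $ i = g i z" by blast
 define b1 where "b1 z = (\<chi> i. g i z)" for z
 have b1m: "b1 \<in> borel_measurable borel"
  using g(1) by (subst borel_measurable_euclidean_space) (auto simp: b1_def Basis_vec_def inner_axis)
 have "AE z in lborel. \<forall>i\<in>UNIV. B z $ i = g i z" by (rule AE_finite_allI[OF finite]) (rule g(2))
 then have Bb1: "AE z in lborel. B z = b1 z" by (rule eventually_mono) (simp add: b1_def vec_eq_iff)
 have Ci: "integrable lebesgue (%r. indicator {0..T} r *\<^sub>R C0 r)" using C0_int unfolding set_integrable_def .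
 then have "(%r. indicator {0..T} r *\<^sub>R C0 r) \<in> borel_measurable lebesgue" by (rule borel_measurable_integrable)
 then obtain c1 where c1: "c1 \<in> borel_measurable lborel" "AE r in lborel. indicator {0..T} r *\<^sub>R C0 r = c1 r"
  using completion_ex_borel_measurable_real by blast
 define c0 where "c0 r = max 0 (c1 r)" for r
 have c0m: "c0 \<in> borel_measurable borel" using c1(1) unfolding c0_def[abs_def] by simp
 have c0e: "AE r in lborel. indicator {0..T} r *\<^sub>R C0 r = c0 r"
  using c1(2)
 proof (rule eventually_mono)
  fix r assume "indicator {0..T} r *\<^sub>R C0 r = c1 r"
  moreover have "0 <= indicator {0..T} r *\<^sub>R C0 r" using C0_nonneg[of r] by (auto simp: indicator_def)
  ultimately show "indicator {0..T} r *\<^sub>R C0 r = c0 r" by (simp add: c0_def)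
 qed
 have c0_T: "AE r in lborel. r \<in> {0..T} --> c0 r = C0 r" using c0e by (rule eventually_mono) auto
 have c0m': "c0 \<in> borel_measurable lborel" using c0m by simp
 have "integrable lebesgue c0" by (rule integrable_cong_AE_imp[OF Ci measurable_completion[OF c0m'] AE_completion[OF c0e]])
 then have c0i: "integrable lborel c0" using integrable_completion[OF c0m'] by simp
 \<comment> \<open>Setting the representative to 0 where it violates the growth bound makes the
   bound hold everywhere and changes it only on a null set.\<close>
 define bb where "bb r x = (if norm (b1 (r, x)) <= c0 r * (1 + norm x) then b1 (r, x) else 0)" for r x
 have bbm: "(%z. bb (fst z) (snd z)) \<in> borel_measurable borel"
 proof -
  have f: "fst \<in> borel_measurable (borel :: (real \<times> (real^'n)) measure)" "snd \<in> borel_measurable (borel :: (real \<times> (real^'n)) measure)"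
   by (intro borel_measurable_continuous_onI continuous_intros)+
  have 1: "(%z. norm (b1 z)) \<in> borel_measurable borel" using b1m by simp
  have 2: "(%z. c0 (fst z) * (1 + norm (snd z :: real^'n))) \<in> borel_measurable borel"
  proof (rule borel_measurable_times[OF measurable_compose[OF f(1) c0m]])
   show "(%z. 1 + norm (snd z :: real^'n)) \<in> borel_measurable (borel :: (real \<times> (real^'n)) measure)"
    by (intro borel_measurable_continuous_onI continuous_intros)
  qed
  have l: "{z \<in> space borel. norm (b1 z) <= c0 (fst z) * (1 + norm (snd z))} \<in> sets borel" by (rule borel_measurable_le[OF 1 2])
  define A where "A = {z. norm (b1 z) <= c0 (fst z) * (1 + norm (snd z))}"
  have "A \<in> sets borel" using l by (simp add: A_def)
  then have "(%z. indicator A z *\<^sub>R b1 z) \<in> borel_measurable borel"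
   by (rule borel_measurable_scaleR[OF borel_measurable_indicator b1m])
  moreover have "(%z. bb (fst z) (snd z)) = (%z. indicator A z *\<^sub>R b1 z)"
   by (rule ext) (simp add: bb_def A_def)
  ultimately show ?thesis by simp
 qed
 have ev: "r \<in> {0..T} --> bb r x = b r x" if "B (r, x) = b1 (r, x)" "r \<in> {0..T} --> c0 r = C0 r" for r x
  using that growth[of r x] by (auto simp: B_def bb_def)
 have a1: "AE x in lborel. AE r in lborel. r \<in> {0..T} --> bb r x = b r x"
  using AE_lborel_swap(2)[OF Bb1]
 proof (rule eventually_mono)
  fix x assume "AE r in lborel. B (r, x) = b1 (r, x)"
  then show "AE r in lborel. r \<in> {0..T} --> bb r x = b r x"
   using c0_T by eventually_elim (rule ev)
 qed
 have a2: "AE r in lborel. AE x in lborel. r \<in> {0..T} --> bb r x = b r x"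
  using AE_lborel_swap(1)[OF Bb1] c0_T
 proof eventually_elim
  case (elim r)
  show ?case by (rule eventually_mono[OF elim(1)]) (rule ev[OF _ elim(2)])
 qed
 have n: "\<forall>r x. norm (bb r x) <= c0 r * (1 + norm x)" by (auto simp: bb_def c0_def)
 have c0n: "\<forall>r. 0 <= c0 r" by (simp add: c0_def)
 show ?thesis by (rule exI[of _ bb], rule exI[of _ c0]) (intro conjI bbm c0m c0n c0i n c0_T a1 a2)
qed

lemma ex_transport_solution:
 fixes b :: "real => real^'n => real^'n" and f :: "real => real^'n => real"
 assumes "backward_flow T b C0 C1 \<phi>" and "Lp_curve T p f" and dist: "distributional_solution T b f"
 shows "\<exists>bb c0 f'. transport_solution T b C0 C1 \<phi> bb c0 f' \<and> (\<forall>t\<in>{0..T}. AE x in lborel. f t x = f' t x)"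
proof -
 interpret bf: backward_flow T b C0 C1 \<phi> by fact
 interpret Lc: Lp_curve T p f by fact
 obtain bb c0 where bb: "(%z. bb (fst z) (snd z)) \<in> borel_measurable borel" "c0 \<in> borel_measurable borel" "\<forall>r. 0 <= c0 r"
   "integrable lborel c0" "\<forall>r x. norm (bb r x) <= c0 r * (1 + norm x)" "AE r in lborel. r \<in> {0..T} --> c0 r = C0 r"
   "AE x in lborel. AE r in lborel. r \<in> {0..T} --> bb r x = b r x" "AE r in lborel. AE x in lborel. r \<in> {0..T} --> bb r x = b r x"
  using bf.ex_borel_field by (elim exE conjE) (rule that)
 \<comment> \<open>Clamping time to \<open>{0..T}\<close> is 1-Lipschitz, so bounds and moduli of
   continuity carry over to all real times.\<close>
 define cl where "cl t = max 0 (min T t)" for t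
 have cl: "cl t \<in> {0..T}" for t using bf.T_pos by (auto simp: cl_def)
 have cl_id: "cl t = t" if "t \<in> {0..T}" for t using that by (auto simp: cl_def)
 have cl_dist: "\<bar>cl s - cl t\<bar> <= \<bar>s - t\<bar>" for s t by (auto simp: cl_def max_def min_def abs_if)
 have "\<exists>g\<in>borel_measurable lborel. AE x in lborel. f (cl t) x = g x" for t
  by (rule completion_ex_borel_measurable_real[OF Lc.f_meas[OF cl]])
 then have "\<forall>t. \<exists>g. g \<in> borel_measurable lborel \<and> (AE x in lborel. f (cl t) x = g x)" by blast
 from choice[OF this] obtain f' where f': "\<And>t. f' t \<in> borel_measurable lborel" "\<And>t. AE x in lborel. f (cl t) x = f' t x" by blast
 have f'm: "f' t \<in> borel_measurable borel" for t using f'(1)[of t] by simp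
 have Kb: "K \<in> sets borel" if "compact K" for K :: "(real^'n) set" by (rule borel_compact[OF that])
 have conv: "(LINT x:K|lborel. \<bar>f' s x - f' t x\<bar>) = Lc.L1d K (cl s) (cl t)" if K: "compact K" for K s t
 proof -
  have "AE x in lborel. \<bar>f (cl s) x - f (cl t) x\<bar> = \<bar>f' s x - f' t x\<bar>"
   using f'(2)[of s] f'(2)[of t] by eventually_elim simp
  from set_integral_lebesgue_eq_lborel(1)[OF this _ Kb[OF K]] show ?thesis
   unfolding Lc.L1d_def using f'm by simp
 qed
 have "transport_solution T b C0 C1 \<phi> bb c0 f'"
 proof
  show "(%z. bb (fst z) (snd z)) \<in> borel_measurable borel" "c0 \<in> borel_measurable borel" "integrable lborel c0"
   "AE r in lborel. r \<in> {0..T} --> c0 r = C0 r" "AE x in lborel. AE r in lborel. r \<in> {0..T} --> bb r x = b r x"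
   by (fact bb)+
  show "0 <= c0 r" "norm (bb r x) <= c0 r * (1 + norm x)" for r x using bb(3,5) by auto
  show "f' t \<in> borel_measurable borel" for t by (rule f'm)
  fix K :: "(real^'n) set" assume K: "compact K"
  show "set_integrable lborel K (f' t)" for t
   by (rule set_integral_lebesgue_eq_lborel(2)[OF f'(2) f'm Kb[OF K] Lc.f_int[OF cl K]])
  obtain J where J: "J \<ge> 0" "\<And>t. t \<in> {0..T} ==> (LINT x:K|lebesgue. \<bar>f t x\<bar>) <= J" using Lc.f_bounded_L1[OF K] by blast
  have "(LINT x:K|lborel. \<bar>f' t x\<bar>) <= J" for t
  proof -
   have "AE x in lborel. \<bar>f (cl t) x\<bar> = \<bar>f' t x\<bar>" using f'(2)[of t] by (rule eventually_mono) simp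
   from set_integral_lebesgue_eq_lborel(1)[OF this _ Kb[OF K]] show ?thesis using J(2)[OF cl, of t] f'm by simp
  qed
  then show "\<exists>J\<ge>0. \<forall>t. (LINT x:K|lborel. \<bar>f' t x\<bar>) <= J" using J(1) by blast
  fix e :: real assume e: "0 < e"
  obtain d where d: "d > 0" "\<And>s t. s \<in> {0..T} ==> t \<in> {0..T} ==> \<bar>s - t\<bar> < d ==> Lc.L1d K s t <= e" using Lc.f_cont[OF K e] by blast
  have "(LINT x:K|lborel. \<bar>f' s x - f' t x\<bar>) <= e" if "\<bar>s - t\<bar> < d" for s t
   unfolding conv[OF K] using that cl_dist[of s t] by (intro d(2) cl) linarith
  then show "\<exists>d>0. \<forall>s t. \<bar>s - t\<bar> < d --> (LINT x:K|lborel. \<bar>f' s x - f' t x\<bar>) <= e" using d(1) by blast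
  obtain M where M: "M \<ge> 0" "\<And>t. t \<in> {0..T} ==> Lc.excess K M t <= e" using Lc.f_unif_int[OF K e] by blast
  have "(LINT x:K|lborel. max 0 (\<bar>f' t x\<bar> - M)) <= e" for t
  proof -
   have "AE x in lborel. max 0 (\<bar>f (cl t) x\<bar> - M) = max 0 (\<bar>f' t x\<bar> - M)" using f'(2)[of t] by (rule eventually_mono) simp
   from set_integral_lebesgue_eq_lborel(1)[OF this _ Kb[OF K]] show ?thesis using M(2)[OF cl, of t] f'm unfolding Lc.excess_def by simp
  qed
  then show "\<exists>M\<ge>0. \<forall>t. (LINT x:K|lborel. max 0 (\<bar>f' t x\<bar> - M)) <= e" using M(1) by blast
 next
  fix \<psi> :: "real \<times> (real^'n) => real" assume \<psi>: "test_function ({0<..<T} \<times> UNIV) \<psi>"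
  then have C: "C_class (Suc 0) \<psi>" unfolding test_function_def by blast
  define D where "D r x = frechet_derivative \<psi> (at (r, x)) (1, 0) + frechet_derivative \<psi> (at (r, x)) (0, bb r x)" for r x
  have Dm: "(%x. D r x) \<in> borel_measurable borel" for r
  proof -
   have c: "(%x. frechet_derivative \<psi> (at (r, x)) v) \<in> borel_measurable borel" for v
   proof -
    have "continuous_on UNIV (%z. frechet_derivative \<psi> (at z) v)" using C by (cases v) simp
    then have "continuous_on UNIV (%x. frechet_derivative \<psi> (at (r, x)) v)"
     by (rule continuous_on_compose2) (auto intro!: continuous_intros)
    then show ?thesis by (rule borel_measurable_continuous_onI)
   qed
   have l: "linear (frechet_derivative \<psi> (at z))" for z
    using C_class_has_derivative[OF C] has_derivative_linear by blast
   have "(%x::real^'n. (r, x)) \<in> borel_measurable borel" by (intro borel_measurable_continuous_onI continuous_intros)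
   from measurable_compose[OF this bb(1)] have m: "bb r \<in> borel_measurable borel" by simp
   have p: "(%x. (0::real, bb r x) \<bullet> i) \<in> borel_measurable borel" for i
    using m by (cases i) (simp add: inner_prod_def)
   have e: "D r x = frechet_derivative \<psi> (at (r, x)) (1, 0)
     + (\<Sum>i\<in>Basis. ((0, bb r x) \<bullet> i) * frechet_derivative \<psi> (at (r, x)) i)" for x
   proof -
    have "frechet_derivative \<psi> (at (r, x)) (0, bb r x) = (\<Sum>i\<in>Basis. ((0, bb r x) \<bullet> i) * frechet_derivative \<psi> (at (r, x)) i)"
     by (rule linear_eq_sum_Basis[OF l])
    then show ?thesis unfolding D_def by (simp only:)
   qed
   show ?thesis unfolding e
    by (intro borel_measurable_add c borel_measurable_sum borel_measurable_times p)
  qed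
  \<comment> \<open>The inner integrals agree for almost every time. This suffices for the iterated
    integral and asks no joint measurability of the original \<open>f\<close>.\<close>
  have "AE r in lebesgue. indicator {0<..<T} r *\<^sub>R (LINT x|lborel. f' r x * D r x)
    = indicator {0<..<T} r *\<^sub>R (LINT x|lebesgue. f r x * (frechet_derivative \<psi> (at (r, x)) (1, 0) + frechet_derivative \<psi> (at (r, x)) (0, b r x)))"
   using AE_completion[OF bb(8)]
  proof (rule eventually_mono)
   fix r assume r: "AE x in lborel. r \<in> {0..T} --> bb r x = b r x"
   show "indicator {0<..<T} r *\<^sub>R (LINT x|lborel. f' r x * D r x)
    = indicator {0<..<T} r *\<^sub>R (LINT x|lebesgue. f r x * (frechet_derivative \<psi> (at (r, x)) (1, 0) + frechet_derivative \<psi> (at (r, x)) (0, b r x)))"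
   proof (cases "r \<in> {0<..<T}")
    case True
    then have rT: "r \<in> {0..T}" by auto
    have "AE x in lborel. f' r x * D r x = f r x * (frechet_derivative \<psi> (at (r, x)) (1, 0) + frechet_derivative \<psi> (at (r, x)) (0, b r x))"
     using r f'(2)[of r] by eventually_elim (use rT in \<open>simp add: D_def cl_id[OF rT]\<close>)
    from integral_lebesgue_cong_AE[OF AE_completion[OF this]]
    have "(LINT x|lebesgue. f' r x * D r x) = (LINT x|lebesgue. f r x * (frechet_derivative \<psi> (at (r, x)) (1, 0) + frechet_derivative \<psi> (at (r, x)) (0, b r x)))" .
    moreover have "(LINT x|lebesgue. f' r x * D r x) = (LINT x|lborel. f' r x * D r x)"
     by (rule integral_completion) (use f'm Dm in simp)
    ultimately show ?thesis by simp
   qed simp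
  qed
  from integral_lebesgue_cong_AE[OF this]
  show "(LINT t:{0<..<T}|lebesgue. (LINT x|lborel.
      f' t x * (frechet_derivative \<psi> (at (t, x)) (1, 0) + frechet_derivative \<psi> (at (t, x)) (0, bb t x)))) = 0"
   using dist \<psi> unfolding distributional_solution_def set_lebesgue_integral_def D_def by simp
 qed
 moreover have "AE x in lborel. f t x = f' t x" if "t \<in> {0..T}" for t using f'(2)[of t] unfolding cl_id[OF that] .
 ultimately show ?thesis by blast
qed

theorem theorem4p11:
  fixes T :: real
    and b :: "real \<Rightarrow> real^'n \<Rightarrow> real^'n"
    and C0 C1 :: "real \<Rightarrow> real"
    and p :: ennreal
    and f :: "real \<Rightarrow> real^'n \<Rightarrow> real"
    and \<phi> :: "real \<Rightarrow> real \<Rightarrow> real^'n \<Rightarrow> real^'n"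
  assumes "T > 0"
    and "(\<lambda>(t, x). b t x) \<in> borel_measurable (lebesgue_on ({0..T} \<times> UNIV))"
    and "C0 absolutely_integrable_on {0..T}" and "\<And>t. t \<in> {0..T} \<Longrightarrow> C0 t \<ge> 0"
    and "C1 absolutely_integrable_on {0..T}" and "\<And>t. t \<in> {0..T} \<Longrightarrow> C1 t \<ge> 0"
    and "\<And>t x. t \<in> {0..T} \<Longrightarrow> norm (b t x) \<le> C0 t * (1 + norm x)"
    and "\<And>t x y. t \<in> {0..T} \<Longrightarrow>
           (b t x - b t y) \<bullet> (x - y) \<ge> - C1 t * (norm (x - y))\<^sup>2"
    and "backward_filippov_flow T b \<phi>"
    and "1 \<le> p"
    and "continuous_into_Lp_loc T p f"
    and "distributional_solution T b f"
    and "\<And>t. t \<in> {0..T} \<Longrightarrow> AE x in lebesgue. f t x \<ge> 0"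
  shows "\<forall>t\<in>{0..T}. AE x in lebesgue. f t x = f 0 (\<phi> 0 t x) * flow_jacobian \<phi> 0 t x"
proof
  fix t assume t: "t \<in> {0..T}"
  have bf: "backward_flow T b C0 C1 \<phi>" by unfold_locales (rule assms; assumption)+
  have lc: "Lp_curve T p f" by unfold_locales (rule assms)+
  obtain bb c0 f' where ts: "transport_solution T b C0 C1 \<phi> bb c0 f'"
    and f': "\<And>t. t \<in> {0..T} \<Longrightarrow> AE x in lborel. f t x = f' t x"
    using ex_transport_solution[OF bf lc assms(12)] by blast
  interpret transport_solution T b C0 C1 \<phi> bb c0 f' by (rule ts)
  have zT: "0 \<in> {0..T}" using assms(1) by simp
  have t': "0 \<le> t" "t \<le> T" using t by auto
  have nonneg: "AE x in lborel. 0 \<le> f' r x" if r: "r \<in> {0..T}" for r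
  proof -
    have "AE x in lebesgue. 0 \<le> f' r x"
      using assms(13)[OF r] AE_completion[OF f'[OF r]] by eventually_elim simp
    moreover have "{x \<in> space lborel. 0 \<le> f' r x} \<in> sets lborel"
      using borel_measurable_le[OF borel_measurable_const f_borel[of r], of 0] by simp
    ultimately show ?thesis by (simp add: AE_completion_iff)
  qed
  have eq: "AE x in lebesgue. f r x = f' r x" if "r \<in> {0..T}" for r
    by (rule AE_completion[OF f'[OF that]])
  show "AE x in lebesgue. f t x = f 0 (\<phi> 0 t x) * flow_jacobian \<phi> 0 t x"
    unfolding flow_jacobian_def
  proof (rule density_transform[where F = "f' t" and h = "f' 0" and L = KL])
    show "norm (\<phi> 0 t x - \<phi> 0 t y) \<le> KL * norm (x - y)" for x y by (rule flow_lipschitz[OF order_refl t'])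
    show "0 < det (matrix A)" if "(\<phi> 0 t has_derivative A) (at x)" "det (matrix A) \<noteq> 0" for x A
      by (rule regular_fibre(2)[OF t' that])
    show "y = x" if "(\<phi> 0 t has_derivative A) (at x)" "det (matrix A) \<noteq> 0" "\<phi> 0 t y = \<phi> 0 t x" for x A y
      by (rule regular_fibre(1)[OF t' that])
    show "(\<integral>\<^sup>+x. ennreal (f' t x) * indicator E (\<phi> 0 t x) \<partial>lborel) = (\<integral>\<^sup>+x. ennreal (f' 0 x) * indicator E x \<partial>lborel)"
      if "E \<in> sets borel" for E
      by (rule pushforward_measure[OF t' nonneg[OF t] nonneg[OF zT] that])
  qed (rule f_borel f_int nonneg t zT eq | assumption)+
qed

end
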